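(* Let $n\ge2$, let $X_1,\dots,X_n$ be Banach spaces, $Y_{n+1}$ a $\mathrm{UMD}$ space and $X_{n+1}:=Y_{n+1}^*$. Let $f_m\in L^\infty_c(X_m)$ for $m=1,\dots,n+1$. Let $\mathcal D$ be a dyadic grid in $\mathbb R^d$ and $\eta\in(0,1)$. Then there exists an $\eta$-sparse collection $\mathcal S=\mathcal S((f_m),\eta)\subset\mathcal D$ so that the following holds. Suppose $a=(a_Q)_{Q\in\mathcal D}$, $a_Q\in\mathcal L(\prod_{m=1}^nX_m,Y_{n+1})$, satisfies the $\mathrm{UMD}$ subspace condition with $\mathrm{UMD}$ subspaces $\mathcal T_k\subset\mathcal L(\prod_{m=1}^kX_m,Y_{n+1})$, $k=1,\dots,n$. Then the paraproduct $\pi:=\pi_{\mathcal D,a}$ satisfies, for all $r\in(0,\infty)$, $$|\langle\pi(f_1,\dots,f_n),f_{n+1}\rangle|\lesssim_\eta\|a\|_{\mathrm{BMO}_{\mathcal D,r}(\mathcal T_n)}\sum_{Q\in\mathcal S}|Q|\prod_{m=1}^{n+1}\big\langle|f_m|_{X_m}\big\rangle_Q.$$ In particular, if $p_1,\dots,p_n\in(1,\infty]$, $q_{n+1}\in(1/n,\infty)$ and $\sum_{m=1}^n1/p_m=1/q_{n+1}$, then $$\|\pi(f_1,\dots,f_n)\|_{L^{q_{n+1}}(Y_{n+1})}\lesssim\|a\|_{\mathrm{BMO}_{\mathcal D,r}(\mathcal T_n)}\prod_{m=1}^n\|f_m\|_{L^{p_m}(X_m)}.$$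
   Context: **Conventions.** $L^p(X)=L^p(\mathbb R^d;X)$ (Bochner); $L^\infty_c(X)$: functions in $L^\infty(X)$ with compact support. $\langle\cdot,\cdot\rangle$ is the natural duality pairing; $\langle f\rangle_Q=|Q|^{-1}\int_Qf$. $A\lesssim B$ means $A\le CB$ with $C$ depending only on $d$, $n$, $r$, the exponents and the Banach spaces involved, including $\mathcal T_1,\dots,\mathcal T_n$ (and $\eta$ for $\lesssim_\eta$), not on the functions or on $a$. $\mathcal L(\prod_{m=1}^kX_m,Y)$: bounded $k$-linear operators, with the operator norm. A collection $\mathcal S$ of cubes is $\eta$-sparse if there are pairwise disjoint $E_Q\subset Q$, $Q\in\mathcal S$, with $|E_Q|>\eta|Q|$. **Dyadic grids, Haar functions.** $\mathcal D_0=\{2^{-k}([0,1)^d+m):k\in\mathbb Z,m\in\mathbb Z^d\}$; a dyadic grid is $\mathcal D_\omega=\{Q+\omega:Q\in\mathcal D_0\}$, $\omega\in(\{0,1\}^d)^{\mathbb Z}$, $Q+\omega:=Q+\sum_{k:2^{-k}<\ell(Q)}\omega_k2^{-k}$. For an interval $I$ with halves $I_l,I_r$: $h^0_I=|I|^{-1/2}1_I$, $h^1_I=|I|^{-1/2}(1_{I_l}-1_{I_r})$; for $Q=I_1\times\dots\times I_d$, $h_Q^{\theta}=\otimes_ih_{I_i}^{\theta_i}$, $\theta\in\{0,1\}^d$. $h_Q$ denotes a cancellative Haar function $h_Q^\theta$ for some $\theta\ne0$. **Paraproduct.** $\pi_{\mathcal D,a}(f_1,\dots,f_n)=\sum_{Q\in\mathcal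 D}a_Q[\langle f_1\rangle_Q,\dots,\langle f_n\rangle_Q]h_Q$, $f_m\in L^1_{\mathrm{loc}}(X_m)$; only finitely many $a_Q$ are nonzero, so that this is well defined. **UMD subspace condition.** For $B\in\mathcal L(\prod_{m=1}^nX_m,Y_{n+1})$, $1\le k<n$ and $e_m\in X_m$, let $B[e_{k+1},\dots,e_n]\in\mathcal L(\prod_{m=1}^kX_m,Y_{n+1})$ be $(e_1,\dots,e_k)\mapsto B[e_1,\dots,e_n]$. The sequence $a=(a_Q)$ satisfies the UMD subspace condition if for every $k\in\{1,\dots,n\}$ there is a UMD subspace $\mathcal T_k\subset\mathcal L(\prod_{m=1}^kX_m,Y_{n+1})$ such that $a_Q\in\mathcal T_n$ for all $Q$, and for $k<n$, $a_Q[e_{k+1},\dots,e_n]\in\mathcal T_k$ for all $Q$ and all $e_{k+1}\in X_{k+1},\dots,e_n\in X_n$. **BMO.** For a Banach space $X$, $a=(a_Q)_{Q\in\mathcal D}\subset X$ and $p\in(0,\infty)$, $$\|a\|_{\mathrm{BMO}_{\mathcal D,p}(X)}=\sup_{\mathcal D'}\sup_{Q_0\in\mathcal D}\Big(\frac1{|Q_0|}\mathbb E\Big\|\sum_{Q\in\mathcal D',\,Q\subset Q_0}\varepsilon_Qa_Q\frac{1_Q}{|Q|^{1/2}}\Big\|^p_{L^p(X)}\Big)^{1/p},$$ where $\mathcal D'$ ranges over finite subcollections of $\mathcal D$ and $\varepsilon_Q$ are independent random signs. *)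

theory Defs
  imports "HOL-Probability.Probability"
begin

section \<open>Strong measurability, Bochner integral and Lebesgue-Bochner norms\<close>

text \<open>
  The Bochner integral of \<open>HOL-Analysis\<close> is restricted to second countable target spaces. Spaces of
  operators are in general not separable, so the notions are restated here for arbitrary
  Banach spaces, with the same simple functions and the same approximation as in the library.
\<close>

definition strongly_measurable :: "'w measure \<Rightarrow> ('w \<Rightarrow> 'a::real_normed_vector) \<Rightarrow> bool" where
  "strongly_measurable M f \<longleftrightarrow>
    (\<exists>s. (\<forall>i. simple_function M (s i)) \<and> (AE x in M. (\<lambda>i::nat. s i x) \<longlonglongrightarrow> f x))"

definition has_strong_integral ::
    "'w measure \<Rightarrow> ('w \<Rightarrow> 'a::real_normed_vector) \<Rightarrow> 'a \<Rightarrow> bool" where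
  "has_strong_integral M f v \<longleftrightarrow> strongly_measurable M f \<and>
    (\<exists>s. (\<forall>i::nat. Bochner_Integration.simple_bochner_integrable M (s i)) \<and>
      (\<lambda>i. \<integral>\<^sup>+x. ennreal (norm (f x - s i x)) \<partial>M) \<longlonglongrightarrow> 0 \<and>
      (\<lambda>i. Bochner_Integration.simple_bochner_integral M (s i)) \<longlonglongrightarrow> v)"

definition strong_integral :: "'w measure \<Rightarrow> ('w \<Rightarrow> 'a::real_normed_vector) \<Rightarrow> 'a" where
  "strong_integral M f = (THE v. has_strong_integral M f v)"

lemma has_bochner_integral_imp_has_strong_integral:
  fixes f :: "'w \<Rightarrow> 'a::{real_normed_vector, second_countable_topology}"
  assumes "has_bochner_integral M f v"
  shows "has_strong_integral M f v"
proof -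
  have f: "f \<in> borel_measurable M"
    using assms by (auto elim: has_bochner_integral.cases)
  obtain F where "\<And>i::nat. simple_function M (F i)" "\<And>x. x \<in> space M \<Longrightarrow> (\<lambda>i. F i x) \<longlonglongrightarrow> f x"
    using borel_measurable_implies_sequence_metric[OF f, of 0] by metis
  then have "strongly_measurable M f"
    unfolding strongly_measurable_def by (intro exI[of _ F]) auto
  then show ?thesis
    using assms unfolding has_strong_integral_def
    by (auto elim!: has_bochner_integral.cases)
qed

text \<open>\<open>x\<close> to the power \<open>s\<close>, for \<open>s > 0\<close>\<close>

definition ennreal_pow :: "ennreal \<Rightarrow> real \<Rightarrow> ennreal" where
  "ennreal_pow x s = (if x = \<infinity> then \<infinity> else ennreal (enn2real x powr s))"

definition Lp_norm :: "'w measure \<Rightarrow> ennreal \<Rightarrow> ('w \<Rightarrow> 'a::real_normed_vector) \<Rightarrow> ennreal" where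
  "Lp_norm M p f =
    (if p = \<infinity> then esssup M (\<lambda>x. ennreal (norm (f x)))
     else ennreal_pow (\<integral>\<^sup>+x. ennreal (norm (f x) powr enn2real p) \<partial>M) (1 / enn2real p))"

text \<open>Bounded functions with compact support and values in a (closed) subspace \<open>X\<close>\<close>

definition Linfc :: "'a::real_normed_vector set \<Rightarrow> (real^'d \<Rightarrow> 'a) \<Rightarrow> bool" where
  "Linfc X f \<longleftrightarrow> strongly_measurable lebesgue f \<and> (AE x in lebesgue. f x \<in> X) \<and>
    (\<exists>B. AE x in lebesgue. norm (f x) \<le> B) \<and>
    (\<exists>K. compact K \<and> (AE x in lebesgue. x \<notin> K \<longrightarrow> f x = 0))"

section \<open>UMD spaces\<close>

text \<open>\<open>d 1, \<dots>, d N\<close> is a martingale difference sequence for the filtration \<open>F 0, \<dots>, F N\<close>;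
  the last condition says that the conditional expectation of \<open>d i\<close> given \<open>F (i - 1)\<close> is zero.\<close>

definition martingale_differences ::
    "'w measure \<Rightarrow> (nat \<Rightarrow> 'w measure) \<Rightarrow> nat \<Rightarrow> (nat \<Rightarrow> 'w \<Rightarrow> 'a::real_normed_vector) \<Rightarrow> bool" where
  "martingale_differences M F N d \<longleftrightarrow>
    (\<forall>i\<le>N. subalgebra M (F i)) \<and>
    (\<forall>i<N. sets (F i) \<subseteq> sets (F (Suc i))) \<and>
    (\<forall>i\<in>{1..N}. strongly_measurable (restr_to_subalg M (F i)) (d i) \<and>
      (\<forall>A\<in>sets (F (i - 1)). has_strong_integral M (\<lambda>x. indicator A x *\<^sub>R d i x) 0))"

text \<open>
  A closed subspace \<open>V\<close> of a Banach space that is a UMD space. A definition cannot quantify over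
  the type of the sample space. The sample space is \<open>\<real>\<close>, with an arbitrary \<open>\<sigma>\<close>-algebra and
  probability measure; this loses nothing, since a finite martingale of strongly measurable
  functions has its joint law on a Polish space.
\<close>

definition UMD_space :: "'a::banach set \<Rightarrow> bool" where
  "UMD_space V \<longleftrightarrow> subspace V \<and> closed V \<and>
    (\<forall>p>1. \<exists>\<beta>::real. \<forall>(M::real measure) F N d \<epsilon>.
      prob_space M \<and> martingale_differences M F N d \<and>
      (\<forall>i\<in>{1..N}. (AE x in M. d i x \<in> V) \<and> Lp_norm M (ennreal p) (d i) < \<infinity>) \<and>
      (\<forall>i\<in>{1..N}. \<epsilon> i \<in> {-1, 1::real}) \<longrightarrow>
      Lp_norm M (ennreal p) (\<lambda>x. \<Sum>i=1..N. \<epsilon> i *\<^sub>R d i x)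
        \<le> ennreal \<beta> * Lp_norm M (ennreal p) (\<lambda>x. \<Sum>i=1..N. d i x))"

section \<open>Bounded multilinear operators\<close>

text \<open>
  A Banach space type that contains all the spaces of bounded \<open>k\<close>-linear operators isometrically:
  functions on argument lists, of any length, that are bounded by a multiple of the product of
  the norms of the arguments. On \<open>k\<close>-linear operators the norm is the operator norm.
\<close>

typedef (overloaded) ('x, 'y) multop =
  "{F :: 'x::real_normed_vector list \<Rightarrow> 'y::real_normed_vector.
     \<exists>C. \<forall>xs. norm (F xs) \<le> C * prod_list (map norm xs)}"
  morphisms multop_apply Multop
  by (rule exI[of _ "\<lambda>_. 0"]) (auto intro!: exI[of _ 0])

setup_lifting type_definition_multop

lemma multop_eqI: "(\<And>xs. multop_apply F xs = multop_apply G xs) \<Longrightarrow> F = G"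
  by transfer auto

lemma prod_list_norm_nonneg: "0 \<le> prod_list (map norm xs)"
  by (induction xs) auto

instantiation multop :: (real_normed_vector, real_normed_vector) real_normed_vector
begin

lift_definition norm_multop :: "('a, 'b) multop \<Rightarrow> real"
  is "\<lambda>F. SUP xs. norm (F xs) / prod_list (map norm xs)" .

lift_definition zero_multop :: "('a, 'b) multop" is "\<lambda>xs. 0"
  by (auto intro!: exI[of _ 0])

lift_definition plus_multop :: "('a, 'b) multop \<Rightarrow> ('a, 'b) multop \<Rightarrow> ('a, 'b) multop"
  is "\<lambda>F G xs. F xs + G xs"
proof -
  fix F G :: "'a list \<Rightarrow> 'b"
  assume "\<exists>C. \<forall>xs. norm (F xs) \<le> C * prod_list (map norm xs)"
    and "\<exists>C. \<forall>xs. norm (G xs) \<le> C * prod_list (map norm xs)"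
  then obtain C D where "\<And>xs. norm (F xs) \<le> C * prod_list (map norm xs)"
    and "\<And>xs. norm (G xs) \<le> D * prod_list (map norm xs)" by blast
  then have "norm (F xs + G xs) \<le> (C + D) * prod_list (map norm xs)" for xs
    by (metis add_mono distrib_right norm_triangle_le)
  then show "\<exists>C. \<forall>xs. norm (F xs + G xs) \<le> C * prod_list (map norm xs)" by blast
qed

lift_definition scaleR_multop :: "real \<Rightarrow> ('a, 'b) multop \<Rightarrow> ('a, 'b) multop"
  is "\<lambda>c F xs. c *\<^sub>R F xs"
proof -
  fix c and F :: "'a list \<Rightarrow> 'b"
  assume "\<exists>C. \<forall>xs. norm (F xs) \<le> C * prod_list (map norm xs)"
  then obtain C where "\<And>xs. norm (F xs) \<le> C * prod_list (map norm xs)" by blast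
  then have "norm (c *\<^sub>R F xs) \<le> (\<bar>c\<bar> * C) * prod_list (map norm xs)" for xs
    by (simp add: mult.assoc mult_left_mono)
  then show "\<exists>C. \<forall>xs. norm (c *\<^sub>R F xs) \<le> C * prod_list (map norm xs)" by blast
qed

lift_definition uminus_multop :: "('a, 'b) multop \<Rightarrow> ('a, 'b) multop" is "\<lambda>F xs. - F xs"
  by simp

definition minus_multop :: "('a, 'b) multop \<Rightarrow> ('a, 'b) multop \<Rightarrow> ('a, 'b) multop"
  where "minus_multop F G = F + - G"

definition dist_multop :: "('a, 'b) multop \<Rightarrow> ('a, 'b) multop \<Rightarrow> real"
  where "dist_multop F G = norm (F - G)"

definition uniformity_multop :: "(('a, 'b) multop \<times> ('a, 'b) multop) filter"
  where "uniformity_multop = (INF e\<in>{0 <..}. principal {(x, y). dist x y < e})"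

definition open_multop :: "('a, 'b) multop set \<Rightarrow> bool"
  where "open_multop S = (\<forall>x\<in>S. \<forall>\<^sub>F (x', y) in uniformity. x' = x \<longrightarrow> y \<in> S)"

definition sgn_multop :: "('a, 'b) multop \<Rightarrow> ('a, 'b) multop"
  where "sgn_multop F = inverse (norm F) *\<^sub>R F"

lemma bdd_above_multop:
  "bdd_above (range (\<lambda>xs. norm (multop_apply F xs) / prod_list (map norm xs)))"
proof -
  obtain C where C: "\<And>xs. norm (multop_apply F xs) \<le> C * prod_list (map norm xs)"
    using multop_apply[of F] by blast
  have "norm (multop_apply F xs) / prod_list (map norm xs) \<le> max C 0" for xs
  proof (cases "prod_list (map norm xs) = 0")
    case False
    then have "prod_list (map norm xs) > 0" using prod_list_norm_nonneg[of xs] by simp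
    then have "norm (multop_apply F xs) / prod_list (map norm xs) \<le> C"
      using C[of xs] by (simp add: pos_divide_le_eq)
    then show ?thesis by simp
  qed simp
  then show ?thesis by (intro bdd_aboveI2)
qed

lemma norm_multop_apply: "norm (multop_apply F xs) \<le> norm F * prod_list (map norm xs)"
proof (cases "prod_list (map norm xs) = 0")
  case True
  obtain C where "\<And>xs. norm (multop_apply F xs) \<le> C * prod_list (map norm xs)"
    using multop_apply[of F] by blast
  from this[of xs] show ?thesis using True by simp
next
  case False
  have "norm (multop_apply F xs) / prod_list (map norm xs) \<le> norm F"
    unfolding norm_multop.rep_eq by (rule cSUP_upper[OF _ bdd_above_multop]) simp
  then show ?thesis
    using False prod_list_norm_nonneg[of xs] by (simp add: pos_divide_le_eq)
qed

lemma norm_multop_bound: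
  assumes "0 \<le> b" "\<And>xs. norm (multop_apply F xs) \<le> b * prod_list (map norm xs)"
  shows "norm F \<le> b"
  unfolding norm_multop.rep_eq
proof (rule cSUP_least)
  fix xs :: "'a list"
  show "norm (multop_apply F xs) / prod_list (map norm xs) \<le> b"
    using assms(1) assms(2)[of xs] prod_list_norm_nonneg[of xs]
    by (cases "prod_list (map norm xs) = 0") (auto simp: divide_simps)
qed simp

lemma norm_multop_nonneg: "0 \<le> norm (F :: ('a, 'b) multop)"
  using order_trans[OF norm_ge_zero norm_multop_apply[of F "[]"]] by simp

instance
proof
  fix F G H :: "('a, 'b) multop" and c e :: real
  show "F + G + H = F + (G + H)" "F + G = G + F" "0 + F = F" "- F + F = 0" "F - G = F + - G"
    by (auto intro!: multop_eqI simp: plus_multop.rep_eq zero_multop.rep_eq uminus_multop.rep_eq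
        minus_multop_def algebra_simps)
  show "c *\<^sub>R (F + G) = c *\<^sub>R F + c *\<^sub>R G" "(c + e) *\<^sub>R F = c *\<^sub>R F + e *\<^sub>R F"
    "c *\<^sub>R e *\<^sub>R F = (c * e) *\<^sub>R F" "1 *\<^sub>R F = F"
    by (auto intro!: multop_eqI simp: plus_multop.rep_eq scaleR_multop.rep_eq algebra_simps)
  show "(norm F = 0) = (F = 0)"
  proof
    assume "norm F = 0"
    then have "multop_apply F xs = 0" for xs
      using norm_multop_apply[of F xs] by simp
    then show "F = 0" by (auto intro!: multop_eqI simp: zero_multop.rep_eq)
  next
    assume "F = 0"
    then show "norm F = 0"
      by (intro antisym norm_multop_nonneg norm_multop_bound) (auto simp: zero_multop.rep_eq)
  qed
  show "norm (F + G) \<le> norm F + norm G"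
  proof (rule norm_multop_bound)
    fix xs
    show "norm (multop_apply (F + G) xs) \<le> (norm F + norm G) * prod_list (map norm xs)"
      using norm_triangle_ineq[of "multop_apply F xs" "multop_apply G xs"]
        norm_multop_apply[of F xs] norm_multop_apply[of G xs]
      by (simp add: plus_multop.rep_eq distrib_right)
  qed (intro add_nonneg_nonneg norm_multop_nonneg)
  have le: "norm (c *\<^sub>R F) \<le> \<bar>c\<bar> * norm F" for c and F :: "('a, 'b) multop"
    by (rule norm_multop_bound)
      (auto simp: scaleR_multop.rep_eq norm_multop_nonneg mult.assoc
        intro!: mult_left_mono norm_multop_apply)
  show "norm (c *\<^sub>R F) = \<bar>c\<bar> * norm F"
  proof (cases "c = 0")
    case True
    then show ?thesis using le[of c F] norm_multop_nonneg[of "c *\<^sub>R F"] by simp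
  next
    case False
    have "inverse c *\<^sub>R c *\<^sub>R F = F"
      using False by (auto intro!: multop_eqI simp: scaleR_multop.rep_eq)
    then have "norm F \<le> \<bar>inverse c\<bar> * norm (c *\<^sub>R F)"
      using le[of "inverse c" "c *\<^sub>R F"] by simp
    then have "\<bar>c\<bar> * norm F \<le> norm (c *\<^sub>R F)"
      using False by (simp add: field_simps)
    then show ?thesis using le[of c F] by simp
  qed
qed (rule dist_multop_def uniformity_multop_def open_multop_def sgn_multop_def)+

end

lemma multop_apply_diff: "multop_apply (F - G) xs = multop_apply F xs - multop_apply G xs"
  unfolding minus_multop_def plus_multop.rep_eq uminus_multop.rep_eq by simp

instance multop :: (real_normed_vector, banach) banach
proof
  fix S :: "nat \<Rightarrow> ('a, 'b) multop"
  assume S: "Cauchy S"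
  have bound: "norm (multop_apply (S m) xs - multop_apply (S k) xs)
      \<le> norm (S m - S k) * prod_list (map norm xs)" for m k xs
    using norm_multop_apply[of "S m - S k" xs]
    by (simp add: multop_apply_diff)
  have "Cauchy (\<lambda>m. multop_apply (S m) xs)" for xs
  proof (rule CauchyI)
    fix e :: real assume "0 < e"
    define P where "P = prod_list (map norm xs) + 1"
    have P: "P > 0" unfolding P_def using prod_list_norm_nonneg[of xs] by linarith
    obtain M where M: "\<And>m k. m \<ge> M \<Longrightarrow> k \<ge> M \<Longrightarrow> norm (S m - S k) < e / P"
      using CauchyD[OF S, of "e / P"] \<open>0 < e\<close> P by auto
    have "norm (multop_apply (S m) xs - multop_apply (S k) xs) < e" if "m \<ge> M" "k \<ge> M" for m k
    proof -
      have "norm (multop_apply (S m) xs - multop_apply (S k) xs) \<le> norm (S m - S k) * P"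
        using bound[of m xs k] norm_multop_nonneg[of "S m - S k"]
        unfolding P_def distrib_left mult_1_right by linarith
      also have "\<dots> < e" using M[OF that] P by (simp add: pos_less_divide_eq)
      finally show ?thesis .
    qed
    then show "\<exists>M. \<forall>m\<ge>M. \<forall>k\<ge>M. norm (multop_apply (S m) xs - multop_apply (S k) xs) < e"
      by blast
  qed
  then have "(\<lambda>m. multop_apply (S m) xs) \<longlonglongrightarrow> lim (\<lambda>m. multop_apply (S m) xs)" for xs
    by (simp add: Cauchy_convergent_iff convergent_LIMSEQ_iff)
  then obtain L where L: "\<And>xs. (\<lambda>m. multop_apply (S m) xs) \<longlonglongrightarrow> L xs"
    by (rule that)
  have close: "norm (multop_apply (S m) xs - L xs) \<le> e * prod_list (map norm xs)"
    if M: "\<forall>m\<ge>M. \<forall>k\<ge>M. norm (S m - S k) < e" and "m \<ge> M" for M m e xs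
  proof (rule tendsto_upperbound[where F = sequentially])
    show "(\<lambda>k. norm (multop_apply (S m) xs - multop_apply (S k) xs))
        \<longlonglongrightarrow> norm (multop_apply (S m) xs - L xs)"
      by (intro tendsto_intros L)
    show "\<forall>\<^sub>F k in sequentially. norm (multop_apply (S m) xs - multop_apply (S k) xs)
        \<le> e * prod_list (map norm xs)"
      using eventually_ge_at_top[of M]
    proof eventually_elim
      case (elim k)
      show ?case
        using bound[of m xs k] M[rule_format, OF \<open>m \<ge> M\<close> elim]
          mult_right_mono[OF less_imp_le prod_list_norm_nonneg, of "norm (S m - S k)" e xs]
        by linarith
    qed
  qed simp
  obtain M1 where M1: "\<forall>m\<ge>M1. \<forall>k\<ge>M1. norm (S m - S k) < 1"
    using CauchyD[OF S zero_less_one] by blast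
  have L_bound: "norm (L xs) \<le> (norm (S M1) + 1) * prod_list (map norm xs)" for xs
  proof -
    have "norm (L xs) - norm (multop_apply (S M1) xs) \<le> norm (multop_apply (S M1) xs - L xs)"
      by (metis norm_minus_commute norm_triangle_ineq2)
    also have "\<dots> \<le> 1 * prod_list (map norm xs)"
      by (rule close[OF M1 order_refl])
    finally show ?thesis
      using norm_multop_apply[of "S M1" xs] unfolding distrib_right by linarith
  qed
  have "\<exists>C. \<forall>xs. norm (L xs) \<le> C * prod_list (map norm xs)"
    by (rule exI[of _ "norm (S M1) + 1"], rule allI, rule L_bound)
  then have Lm: "multop_apply (Multop L) = L"
    using Multop_inverse[of L] by blast
  have "S \<longlonglongrightarrow> Multop L"
  proof (rule LIMSEQ_I)
    fix e :: real assume "0 < e"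
    then have e: "0 < e / 2" by simp
    obtain M where M: "\<forall>m\<ge>M. \<forall>k\<ge>M. norm (S m - S k) < e / 2"
      using CauchyD[OF S e] by blast
    have "norm (S m - Multop L) < e" if "m \<ge> M" for m
    proof -
      have "norm (S m - Multop L) \<le> e / 2"
      proof (rule norm_multop_bound)
        show "norm (multop_apply (S m - Multop L) xs) \<le> e / 2 * prod_list (map norm xs)" for xs
          unfolding multop_apply_diff Lm by (rule close[OF M that])
      qed (use e in simp)
      then show ?thesis using \<open>0 < e\<close> by linarith
    qed
    then show "\<exists>M. \<forall>m\<ge>M. norm (S m - Multop L) < e" by blast
  qed
  then show "convergent S" by (rule convergentI)
qed

text \<open>
  The bounded \<open>k\<close>-linear operators on \<open>X 1 \<times> \<dots> \<times> X k\<close>, extended by zero outside of this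
  domain. Entry \<open>i\<close> of the argument list, counted from \<open>0\<close>, is in \<open>X (Suc i)\<close>. The spaces \<open>X m\<close>
  are meant to be closed subspaces of one Banach space; every finite family of Banach spaces
  is of this form up to isometry, via its direct sum.
\<close>

definition multilinear_ops ::
    "(nat \<Rightarrow> 'x::real_normed_vector set) \<Rightarrow> nat \<Rightarrow> ('x, 'y::real_normed_vector) multop set" where
  "multilinear_ops X k =
    {B. (\<forall>xs. \<not> (length xs = k \<and> (\<forall>i<k. xs ! i \<in> X (Suc i))) \<longrightarrow> multop_apply B xs = 0) \<and>
        (\<forall>xs i u v c. length xs = k \<and> (\<forall>j<k. xs ! j \<in> X (Suc j)) \<and>
            i < k \<and> u \<in> X (Suc i) \<and> v \<in> X (Suc i) \<longrightarrow>
          multop_apply B (xs[i := u + c *\<^sub>R v]) =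
            multop_apply B (xs[i := u]) + c *\<^sub>R multop_apply B (xs[i := v]))}"

text \<open>\<open>B[e\<^sub>k\<^sub>+\<^sub>1, \<dots>, e\<^sub>n]\<close>: the last arguments are fixed\<close>

lift_definition freeze ::
    "('x::real_normed_vector, 'y::real_normed_vector) multop \<Rightarrow> 'x list \<Rightarrow> ('x, 'y) multop"
  is "\<lambda>B es xs. B (xs @ es)"
proof -
  fix B :: "'x list \<Rightarrow> 'y" and es :: "'x list"
  assume "\<exists>C. \<forall>xs. norm (B xs) \<le> C * prod_list (map norm xs)"
  then obtain C where C: "\<And>xs. norm (B xs) \<le> C * prod_list (map norm xs)" by blast
  then have "norm (B (xs @ es)) \<le> (C * prod_list (map norm es)) * prod_list (map norm xs)" for xs
    using C[of "xs @ es"] by (simp add: ac_simps)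
  then show "\<exists>C. \<forall>xs. norm (B (xs @ es)) \<le> C * prod_list (map norm xs)" by blast
qed

section \<open>Dyadic cubes, Haar functions, paraproducts\<close>

definition dyadic_cube :: "int \<Rightarrow> int^'d \<Rightarrow> (real^'d) set" where
  "dyadic_cube k m =
    (\<lambda>x. (2 powi (-k)) *\<^sub>R (x + (\<chi> i. real_of_int (m $ i)))) ` {x. \<forall>i. 0 \<le> x $ i \<and> x $ i < 1}"

definition dyadic_shifts :: "(int \<Rightarrow> real^'d) set" where
  "dyadic_shifts = {\<omega>. \<forall>k i. \<omega> k $ i \<in> {0, 1}}"

definition dyadic_grid :: "(int \<Rightarrow> real^'d) \<Rightarrow> (real^'d) set set" where
  "dyadic_grid \<omega> =
    {(\<lambda>x. x + (\<Sum>\<^sub>\<infinity>j\<in>{j. 2 powi (-j) < (2 powi (-k) :: real)}. (2 powi (-j)) *\<^sub>R \<omega> j)) ` dyadic_cube k m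
      | k m. True}"

text \<open>\<open>h\<^sup>0\<^sub>I\<close> (for \<open>False\<close>) and \<open>h\<^sup>1\<^sub>I\<close> (for \<open>True\<close>), for a half-open interval \<open>I\<close>\<close>

definition haar1 :: "bool \<Rightarrow> real set \<Rightarrow> real \<Rightarrow> real" where
  "haar1 b I t = measure lebesgue I powr (-1/2) *
    (if b then indicator {s\<in>I. s < (Inf I + Sup I) / 2} t - indicator {s\<in>I. (Inf I + Sup I) / 2 \<le> s} t
     else indicator I t)"

definition haar :: "('d \<Rightarrow> bool) \<Rightarrow> (real^'d) set \<Rightarrow> real^'d \<Rightarrow> real" where
  "haar \<theta> Q x = (\<Prod>i\<in>UNIV. haar1 (\<theta> i) ((\<lambda>y. y $ i) ` Q) (x $ i))"

definition cancellative :: "('d \<Rightarrow> bool) \<Rightarrow> bool" where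
  "cancellative \<theta> \<longleftrightarrow> (\<exists>i. \<theta> i)"

definition avg :: "(real^'d \<Rightarrow> 'a::banach) \<Rightarrow> (real^'d) set \<Rightarrow> 'a" where
  "avg f Q = (1 / measure lebesgue Q) *\<^sub>R strong_integral lebesgue (\<lambda>x. indicator Q x *\<^sub>R f x)"

definition norm_avg :: "(real^'d \<Rightarrow> 'a::banach) \<Rightarrow> (real^'d) set \<Rightarrow> ennreal" where
  "norm_avg f Q = (\<integral>\<^sup>+x. ennreal (norm (f x)) * indicator Q x \<partial>lebesgue) / emeasure lebesgue Q"

text \<open>\<open>\<theta>\<close> selects the Haar function \<open>h\<^sub>Q\<close> of each cube \<open>Q\<close>. The sum is the full sum over \<open>D\<close> when
  only finitely many \<open>a Q\<close> are nonzero.\<close>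

definition paraproduct ::
    "(real^'d) set set \<Rightarrow> ((real^'d) set \<Rightarrow> ('d \<Rightarrow> bool)) \<Rightarrow> nat \<Rightarrow>
      ((real^'d) set \<Rightarrow> ('x::banach, 'y::banach) multop) \<Rightarrow> (nat \<Rightarrow> real^'d \<Rightarrow> 'x) \<Rightarrow> real^'d \<Rightarrow> 'y" where
  "paraproduct D \<theta> n a f x =
    (\<Sum>Q\<in>{Q\<in>D. a Q \<noteq> 0}. haar (\<theta> Q) Q x *\<^sub>R multop_apply (a Q) (map (\<lambda>m. avg (f m) Q) [1..<n+1]))"

section \<open>Sparse collections, BMO and the UMD subspace condition\<close>

definition sparse_collection :: "real \<Rightarrow> (real^'d) set set \<Rightarrow> bool" where
  "sparse_collection \<eta> S \<longleftrightarrow>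
    (\<exists>E. disjoint_family_on E S \<and>
      (\<forall>Q\<in>S. E Q \<in> sets lebesgue \<and> E Q \<subseteq> Q \<and> measure lebesgue (E Q) > \<eta> * measure lebesgue Q))"

definition random_signs :: "'q set \<Rightarrow> ('q \<Rightarrow> real) pmf" where
  "random_signs A = Pi_pmf A 1 (\<lambda>_. pmf_of_set {-1, 1})"

definition BMO_norm :: "(real^'d) set set \<Rightarrow> real \<Rightarrow> ((real^'d) set \<Rightarrow> 'a::banach) \<Rightarrow> ennreal" where
  "BMO_norm D p a =
    (SUP D'\<in>{D'. finite D' \<and> D' \<subseteq> D}. SUP Q0\<in>D.
      ennreal_pow
        ((\<integral>\<^sup>+\<epsilon>. (\<integral>\<^sup>+x. ennreal (norm (\<Sum>Q\<in>{Q\<in>D'. Q \<subseteq> Q0}.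
            (\<epsilon> Q * indicator Q x / sqrt (measure lebesgue Q)) *\<^sub>R a Q) powr p) \<partial>lebesgue)
          \<partial>measure_pmf (random_signs D')) / emeasure lebesgue Q0)
        (1 / p))"

definition UMD_subspace_condition ::
    "(real^'d) set set \<Rightarrow> nat \<Rightarrow> (nat \<Rightarrow> 'x::banach set) \<Rightarrow> (nat \<Rightarrow> ('x, 'y::banach) multop set) \<Rightarrow>
      ((real^'d) set \<Rightarrow> ('x, 'y) multop) \<Rightarrow> bool" where
  "UMD_subspace_condition D n X T a \<longleftrightarrow>
    (\<forall>k\<in>{1..n}. T k \<subseteq> multilinear_ops X k \<and> UMD_space (T k)) \<and>
    (\<forall>Q\<in>D. a Q \<in> T n) \<and>
    (\<forall>k\<in>{1..<n}. \<forall>Q\<in>D. \<forall>e. (\<forall>m\<in>{k+1..n}. e m \<in> X m) \<longrightarrow> freeze (a Q) (map e [k+1..<n+1]) \<in> T k)"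

end

theory Submission
  imports Defs
begin

text \<open>
  The sparse collection is built from the functions alone. Below a cube \<open>R\<close> of the collection, the next
  members are the maximal cubes on which the average of some \<open>|f\<^sub>m|\<close> exceeds a fixed multiple of its
  average on \<open>R\<close>. In the part \<open>\<pi>\<^sub>R\<close> of the paraproduct over the cubes with stopping parent \<open>R\<close>, the
  averages of \<open>f\<^sub>m\<close> agree with a martingale that is bounded by a multiple of \<open>\<langle>|f\<^sub>m|\<rangle>\<^sub>R\<close>, and
  everything is constant on the atoms of a finite probability space. There the UMD property of \<open>Y\<close>
  replaces the Haar functions by random signs. The averages are conditional expectations, so Stein's
  inequality in \<open>T\<^sub>1, \<dots>, T\<^sub>n\<^sub>-\<^sub>1\<close> moves them out of the operators one argument at a time. What remains is
  a random sum of the operators \<open>a\<^sub>Q\<close> themselves, whose \<open>L\<^sup>p\<close> norm is controlled by \<open>BMO\<^sub>r\<close> by the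
  John-Nirenberg inequality. Since \<open>f\<^sub>n\<^sub>+\<^sub>1\<close> has bounded averages on the atoms as well, summation over \<open>R\<close>
  gives the sparse form. The top cubes are so large that their ancestors contain no new part of the
  supports; the ancestors therefore contribute a geometric series.

  For the \<open>L\<^sup>q\<close> bound the pieces \<open>\<pi>\<^sub>R\<close> satisfy an \<open>L\<^sup>s\<close> bound with \<open>s > q\<close>. If \<open>q \<le> 1\<close> the powers are
  subadditive. If \<open>q > 1\<close>, the norm of \<open>F = |\<pi>|\<close> is estimated by pairing the pieces with \<open>F\<^sup>q\<^sup>-\<^sup>1\<close>;
  Young's inequality and the Carleson embedding theorem allow to absorb the resulting norm of \<open>F\<close>.
\<close>

section \<open>UMD spaces on finite probability spaces\<close>

text \<open>Three obstacles shape the argument. Spaces of operators need not be separable, so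
  measurability is always drawn from simple functions and real-valued norms; on a finite probability
  space the problem disappears. \<open>BMO\<close> with an exponent r, possibly below 1, says
  nothing directly about the exponents p > 1 for which UMD is available, so a John-Nirenberg
  inequality for randomized sums has to come between. And below a stopping cube the averages are
  controlled only as long as cubes of the current family lie underneath: hence they are replaced by
  a martingale that is frozen on the first cell after the controlled ones, at the price of one
  factor \<open>2 ^ CARD('d)\<close> per function. The L^q bound is not read off from the sparse
  form, since duality fails for q \<le> 1. Both follow from the same estimate of a single piece,
  with exponent 2 for the form and an exponent above q for the norm. As only finitely many
  coefficients are nonzero, the norm that is absorbed is finite from the start.\<close>

definition UMD_bound :: "'a::banach set \<Rightarrow> real \<Rightarrow> real \<Rightarrow> bool" where
  "UMD_bound V p \<beta> \<longleftrightarrow> subspace V \<and> 1 < p \<and> 0 \<le> \<beta> \<and>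
    (\<forall>(M::real measure) F N d \<epsilon>.
      prob_space M \<and> martingale_differences M F N d \<and>
      (\<forall>i\<in>{1..N}. (AE x in M. d i x \<in> V) \<and> Lp_norm M (ennreal p) (d i) < \<infinity>) \<and>
      (\<forall>i\<in>{1..N}. \<epsilon> i \<in> {-1, 1::real}) \<longrightarrow>
      Lp_norm M (ennreal p) (\<lambda>x. \<Sum>i=1..N. \<epsilon> i *\<^sub>R d i x)
        \<le> ennreal \<beta> * Lp_norm M (ennreal p) (\<lambda>x. \<Sum>i=1..N. d i x))"

lemma UMD_space_imp_bound:
  assumes "UMD_space V" "1 < p"
  shows "\<exists>\<beta>. UMD_bound V p \<beta>"
proof -
  obtain \<beta> :: real where \<beta>: "\<forall>(M::real measure) F N d \<epsilon>.
      prob_space M \<and> martingale_differences M F N d \<and>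
      (\<forall>i\<in>{1..N}. (AE x in M. d i x \<in> V) \<and> Lp_norm M (ennreal p) (d i) < \<infinity>) \<and>
      (\<forall>i\<in>{1..N}. \<epsilon> i \<in> {-1, 1::real}) \<longrightarrow>
      Lp_norm M (ennreal p) (\<lambda>x. \<Sum>i=1..N. \<epsilon> i *\<^sub>R d i x)
        \<le> ennreal \<beta> * Lp_norm M (ennreal p) (\<lambda>x. \<Sum>i=1..N. d i x)"
    using assms unfolding UMD_space_def by blast
  \<comment> \<open>\<open>ennreal\<close> sends negative numbers to 0, so the constant may be taken
    nonnegative; raising the inequality to the power p will need this.\<close>
  have "ennreal (max \<beta> 0) = ennreal \<beta>"
    by (metis ennreal_max_0')
  then have "UMD_bound V p (max \<beta> 0)"
    using \<beta> assms unfolding UMD_bound_def UMD_space_def by simp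
  then show ?thesis ..
qed

lemma sum_saturated_eq_0:
  fixes g :: "'w \<Rightarrow> 'a::comm_monoid_add"
  assumes "finite A"
    and "\<And>w. w \<in> A \<Longrightarrow> (\<Sum>w'\<in>{w'\<in>A. \<kappa> w' = \<kappa> w}. g w') = 0"
  shows "sum g A = 0"
proof -
  have "sum g A = (\<Sum>c\<in>\<kappa> ` A. \<Sum>w\<in>{w\<in>A. \<kappa> w = c}. g w)"
    by (rule sum.image_gen[OF assms(1)])
  also have "\<dots> = 0"
    using assms(2) by (intro sum.neutral) auto
  finally show ?thesis .
qed

lemma Lp_norm_uniform_count_measure:
  fixes f :: "'w \<Rightarrow> 'a::real_normed_vector"
  assumes "finite A" "A \<noteq> {}" "0 < p"
  shows "Lp_norm (uniform_count_measure A) (ennreal p) f =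
    ennreal (((\<Sum>x\<in>A. norm (f x) powr p) / card A) powr (1 / p))"
proof -
  have "(\<integral>\<^sup>+x. ennreal (norm (f x) powr p) \<partial>uniform_count_measure A) =
      (\<Sum>x\<in>A. ennreal (1 / card A) * ennreal (norm (f x) powr p))"
    unfolding uniform_count_measure_def using assms(1)
    by (subst nn_integral_point_measure_finite) auto
  also have "\<dots> = ennreal ((\<Sum>x\<in>A. norm (f x) powr p) / card A)"
    by (simp add: ennreal_mult''[symmetric] sum_ennreal sum_divide_distrib)
  finally have *: "(\<integral>\<^sup>+x. ennreal (norm (f x) powr p) \<partial>uniform_count_measure A) =
     ennreal ((\<Sum>x\<in>A. norm (f x) powr p) / card A)" .
  have "0 \<le> (\<Sum>x\<in>A. norm (f x) powr p) / card A"
    by (intro divide_nonneg_nonneg sum_nonneg) auto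
  then show ?thesis
    using assms(3) unfolding Lp_norm_def by (simp add: * ennreal_pow_def)
qed

text \<open>Every subset of A is measurable, so f is simple and the constant sequence f approximates
  it with error 0; the integral is the plain mean.\<close>

lemma has_strong_integral_uniform_count_measure:
  fixes f :: "'w \<Rightarrow> 'a::real_normed_vector"
  assumes "finite A" "A \<noteq> {}"
  shows "has_strong_integral (uniform_count_measure A) f ((1 / card A) *\<^sub>R (\<Sum>x\<in>A. f x))"
proof -
  let ?M = "uniform_count_measure A"
  have sf: "simple_function ?M f"
    using assms by (auto simp: simple_function_def space_uniform_count_measure sets_uniform_count_measure)
  have fm: "finite_measure ?M"
    using prob_space_uniform_count_measure[OF assms] by (simp add: prob_space.finite_measure)
  have "Bochner_Integration.simple_bochner_integral ?M f = (1 / card A) *\<^sub>R (\<Sum>x\<in>A. f x)"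
  proof -
    have "Bochner_Integration.simple_bochner_integral ?M f = (\<Sum>y\<in>f ` A. (card {x\<in>A. f x = y} / card A) *\<^sub>R y)"
      unfolding simple_bochner_integral_def space_uniform_count_measure
      by (intro sum.cong refl) (subst measure_uniform_count_measure, use assms in auto)
    also have "\<dots> = (\<Sum>y\<in>f ` A. \<Sum>x\<in>{x\<in>A. f x = y}. (1 / card A) *\<^sub>R f x)"
    proof (intro sum.cong refl)
      fix y assume "y \<in> f ` A"
      have "(\<Sum>x\<in>{x\<in>A. f x = y}. (1 / card A) *\<^sub>R f x) = (\<Sum>x\<in>{x\<in>A. f x = y}. (1 / card A) *\<^sub>R y)"
        by (intro sum.cong) auto
      then show "(card {x\<in>A. f x = y} / card A) *\<^sub>R y = (\<Sum>x\<in>{x\<in>A. f x = y}. (1 / card A) *\<^sub>R f x)"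
        by (simp add: sum_constant_scaleR)
    qed
    also have "\<dots> = (\<Sum>x\<in>A. (1 / card A) *\<^sub>R f x)"
      by (rule sum.image_gen[OF assms(1), symmetric])
    finally show ?thesis by (simp add: scaleR_sum_right)
  qed
  moreover have "Bochner_Integration.simple_bochner_integrable ?M f"
    using sf finite_measure.emeasure_finite[OF fm] by (auto intro!: simple_bochner_integrable.intros)
  moreover have "strongly_measurable ?M f"
    unfolding strongly_measurable_def using sf by (intro exI[of _ "\<lambda>_. f"]) auto
  ultimately show ?thesis
    unfolding has_strong_integral_def by (auto intro!: exI[of _ "\<lambda>_. f"])
qed

text \<open>A filtration on a finite set is a sequence of refining partitions, given here by the
  fibres of \<open>q i\<close>. Its \<sigma>-algebras consist of the saturated sets, and a saturated
  set is a disjoint union of cells, so \<open>mean\<close>, which concerns single cells, gives the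
  vanishing integral over every set.\<close>

lemma martingale_differences_uniform:
  fixes q :: "nat \<Rightarrow> 'w \<Rightarrow> 'c" and d :: "nat \<Rightarrow> 'w \<Rightarrow> 'a::real_normed_vector"
  assumes W: "finite W" "W \<noteq> {}"
    and refine: "\<And>i w w'. i < N \<Longrightarrow> w \<in> W \<Longrightarrow> w' \<in> W \<Longrightarrow> q (Suc i) w = q (Suc i) w' \<Longrightarrow> q i w = q i w'"
    and const: "\<And>i w w'. i \<in> {1..N} \<Longrightarrow> w \<in> W \<Longrightarrow> w' \<in> W \<Longrightarrow> q i w = q i w' \<Longrightarrow> d i w = d i w'"
    and mean: "\<And>i w. i < N \<Longrightarrow> w \<in> W \<Longrightarrow> (\<Sum>w'\<in>{w'\<in>W. q i w' = q i w}. d (Suc i) w') = 0"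
  shows "martingale_differences (uniform_count_measure W)
    (\<lambda>i. sigma W {A. A \<subseteq> W \<and> (\<forall>x\<in>A. \<forall>y\<in>W. q i x = q i y \<longrightarrow> y \<in> A)}) N d"
proof -
  let ?M = "uniform_count_measure W"
  define G where "G i = {A. A \<subseteq> W \<and> (\<forall>x\<in>A. \<forall>y\<in>W. q i x = q i y \<longrightarrow> y \<in> A)}" for i
  define F where "F i = sigma W (G i)" for i
  \<comment> \<open>The saturated sets already form a \<sigma>-algebra, so \<open>sigma\<close> adds
    nothing and membership in \<open>F i\<close> can be read off.\<close>
  have sa: "sigma_algebra W (G i)" for i
    unfolding sigma_algebra_iff2
  proof (intro conjI ballI allI impI)
    fix A assume "A \<in> G i" then show "W - A \<in> G i" unfolding G_def by force
  qed (auto simp: G_def, blast)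
  have sets_F: "sets (F i) = G i" for i
    unfolding F_def using sigma_algebra.sets_measure_of_eq[OF sa] by simp
  have space_F: "space (F i) = W" for i
    unfolding F_def by (simp add: space_measure_of_conv)
  have sub: "subalgebra ?M (F i)" for i
    unfolding subalgebra_def sets_F space_F
    by (auto simp: G_def space_uniform_count_measure sets_uniform_count_measure)
  have sets_R: "sets (restr_to_subalg ?M (F i)) = G i" for i
    using sets_restr_to_subalg[OF sub] sets_F by simp
  have space_R: "space (restr_to_subalg ?M (F i)) = W" for i
    by (simp add: space_restr_to_subalg space_uniform_count_measure)
  have mono: "sets (F i) \<subseteq> sets (F (Suc i))" if "i < N" for i
  proof
    fix A assume "A \<in> sets (F i)"
    then have A: "A \<subseteq> W" "\<And>x y. x \<in> A \<Longrightarrow> y \<in> W \<Longrightarrow> q i x = q i y \<Longrightarrow> y \<in> A"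
      unfolding sets_F G_def by auto
    have "y \<in> A" if "x \<in> A" "y \<in> W" "q (Suc i) x = q (Suc i) y" for x y
      using A(1) that by (intro A(2)[OF that(1,2)] refine[OF \<open>i < N\<close>]) auto
    then have "A \<in> G (Suc i)"
      unfolding G_def using A(1) by simp
    then show "A \<in> sets (F (Suc i))"
      unfolding sets_F .
  qed
  have meas: "strongly_measurable (restr_to_subalg ?M (F i)) (d i)" if i: "i \<in> {1..N}" for i
  proof -
    have "simple_function (restr_to_subalg ?M (F i)) (d i)"
      unfolding simple_function_def sets_R space_R
    proof (intro conjI ballI)
      fix y assume "y \<in> d i ` W"
      have "d i w' = y" if "w \<in> W" "d i w = y" "w' \<in> W" "q i w = q i w'" for w w'
        using const[OF i that(1,3,4)] that(2) by simp
      then show "d i -` {y} \<inter> W \<in> G i"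
        unfolding G_def by blast
    qed (use W in simp)
    then show ?thesis
      unfolding strongly_measurable_def by (intro exI[of _ "\<lambda>_. d i"]) auto
  qed
  have zero: "has_strong_integral ?M (\<lambda>x. indicator A x *\<^sub>R d i x) 0"
    if i: "i \<in> {1..N}" and A: "A \<in> sets (F (i - 1))" for i A
  proof -
    obtain j where j: "i = Suc j" "j < N" using i by (cases i) auto
    have A': "A \<subseteq> W" "\<And>x y. x \<in> A \<Longrightarrow> y \<in> W \<Longrightarrow> q j x = q j y \<Longrightarrow> y \<in> A"
      using A j unfolding sets_F G_def by auto
    have "(\<Sum>x\<in>W. indicator A x *\<^sub>R d i x) = (\<Sum>x\<in>A. d i x)"
      using W A'(1) by (intro sum.mono_neutral_cong_right) auto
    also have "\<dots> = 0"
    proof (rule sum_saturated_eq_0[where \<kappa> = "q j"])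
      show "finite A" using A' W finite_subset by blast
      fix w assume w: "w \<in> A"
      have "{w'\<in>A. q j w' = q j w} = {w'\<in>W. q j w' = q j w}"
        using A'(1) A'(2)[OF w _ sym] by blast
      then show "(\<Sum>w'\<in>{w'\<in>A. q j w' = q j w}. d i w') = 0"
        using mean[OF j(2)] A'(1) w j(1) by auto
    qed
    finally have s0: "(\<Sum>x\<in>W. indicator A x *\<^sub>R d i x) = 0" .
    show ?thesis
      using has_strong_integral_uniform_count_measure[OF W, of "\<lambda>x. indicator A x *\<^sub>R d i x"]
      unfolding s0 by simp
  qed
  show ?thesis
    unfolding martingale_differences_def F_def[symmetric] G_def[symmetric]
    using sub mono meas zero by blast
qed

text \<open>The UMD inequality for p-th powers, with points of an arbitrary type. The normalization
  by \<open>card W\<close> cancels from both sides, which is why plain sums appear.\<close>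

lemma umd_finite:
  fixes q :: "nat \<Rightarrow> 'w \<Rightarrow> 'c" and d :: "nat \<Rightarrow> 'w \<Rightarrow> 'a::banach"
  assumes umd: "UMD_bound V p \<beta>" and W: "finite W"
    and refine: "\<And>i w w'. i < N \<Longrightarrow> w \<in> W \<Longrightarrow> w' \<in> W \<Longrightarrow> q (Suc i) w = q (Suc i) w' \<Longrightarrow> q i w = q i w'"
    and dV: "\<And>i w. i \<in> {1..N} \<Longrightarrow> w \<in> W \<Longrightarrow> d i w \<in> V"
    and const: "\<And>i w w'. i \<in> {1..N} \<Longrightarrow> w \<in> W \<Longrightarrow> w' \<in> W \<Longrightarrow> q i w = q i w' \<Longrightarrow> d i w = d i w'"
    and mean: "\<And>i w. i < N \<Longrightarrow> w \<in> W \<Longrightarrow> (\<Sum>w'\<in>{w'\<in>W. q i w' = q i w}. d (Suc i) w') = 0"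
    and sign: "\<And>i. i \<in> {1..N} \<Longrightarrow> \<epsilon> i \<in> {-1, 1::real}"
  shows "(\<Sum>w\<in>W. norm (\<Sum>i=1..N. \<epsilon> i *\<^sub>R d i w) powr p) \<le>
    \<beta> powr p * (\<Sum>w\<in>W. norm (\<Sum>i=1..N. d i w) powr p)"
proof (cases "W = {}")
  case False
  have p: "1 < p" and \<beta>: "0 \<le> \<beta>" using umd by (auto simp: UMD_bound_def)
  define K where "K = card W"
  have K: "K > 0" using False W by (simp add: K_def card_gt_0_iff)
  \<comment> \<open>UMD is stated for probability measures on the reals only, so W is copied to the
    numbers 0, ..., \<open>card W\<close> - 1 by the bijection \<open>e\<close>.\<close>
  define \<Omega> where "\<Omega> = real ` {..<K}"
  have \<Omega>: "finite \<Omega>" "card \<Omega> = K" by (auto simp: \<Omega>_def card_image)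
  then have \<Omega>0: "\<Omega> \<noteq> {}" using K by auto
  obtain e where e: "bij_betw e \<Omega> W"
    using finite_same_card_bij[OF \<Omega>(1) W] \<Omega>(2) K_def by auto
  have eW: "e x \<in> W" if "x \<in> \<Omega>" for x using e that by (rule bij_betwE[rule_format])
  have tr: "(\<Sum>x\<in>\<Omega>. h (e x)) = (\<Sum>w\<in>W. h w)" for h :: "'w \<Rightarrow> 'z::comm_monoid_add"
    by (rule sum.reindex_bij_betw[OF e])
  let ?M = "uniform_count_measure \<Omega>"
  let ?F = "\<lambda>i. sigma \<Omega> {A. A \<subseteq> \<Omega> \<and> (\<forall>x\<in>A. \<forall>y\<in>\<Omega>. q i (e x) = q i (e y) \<longrightarrow> y \<in> A)}"
  have md: "martingale_differences ?M ?F N (\<lambda>i x. d i (e x))"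
  proof (rule martingale_differences_uniform[OF \<Omega>(1) \<Omega>0, of N "\<lambda>i x. q i (e x)" "\<lambda>i x. d i (e x)"])
    fix i x assume i: "i < N" and x: "x \<in> \<Omega>"
    have "(\<Sum>x'\<in>{x'\<in>\<Omega>. q i (e x') = q i (e x)}. d (Suc i) (e x')) =
        (\<Sum>x'\<in>\<Omega>. if q i (e x') = q i (e x) then d (Suc i) (e x') else 0)"
      using \<Omega> by (simp add: sum.inter_filter)
    also have "\<dots> = (\<Sum>w'\<in>W. if q i w' = q i (e x) then d (Suc i) w' else 0)"
      by (rule tr)
    also have "\<dots> = (\<Sum>w'\<in>{w'\<in>W. q i w' = q i (e x)}. d (Suc i) w')"
      using W by (simp add: sum.inter_filter)
    also have "\<dots> = 0" by (rule mean[OF i eW[OF x]])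
    finally show "(\<Sum>x'\<in>{x'\<in>\<Omega>. q i (e x') = q i (e x)}. d (Suc i) (e x')) = 0" .
  qed (use eW refine const in blast)+
  have fin: "(AE x in ?M. d i (e x) \<in> V) \<and> Lp_norm ?M (ennreal p) (\<lambda>x. d i (e x)) < \<infinity>"
    if "i \<in> {1..N}" for i
  proof
    show "AE x in ?M. d i (e x) \<in> V"
      using dV[OF that] eW by (intro AE_I2) (auto simp: space_uniform_count_measure)
  qed (use p \<Omega> \<Omega>0 in \<open>simp add: Lp_norm_uniform_count_measure\<close>)
  have "Lp_norm ?M (ennreal p) (\<lambda>x. \<Sum>i=1..N. \<epsilon> i *\<^sub>R d i (e x))
        \<le> ennreal \<beta> * Lp_norm ?M (ennreal p) (\<lambda>x. \<Sum>i=1..N. d i (e x))"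
    using umd[unfolded UMD_bound_def] md fin sign prob_space_uniform_count_measure[OF \<Omega>(1) \<Omega>0]
    by (intro umd[unfolded UMD_bound_def, THEN conjunct2, THEN conjunct2, THEN conjunct2, rule_format]) auto
  define S1 where "S1 = (\<Sum>w\<in>W. norm (\<Sum>i=1..N. \<epsilon> i *\<^sub>R d i w) powr p)"
  define S2 where "S2 = (\<Sum>w\<in>W. norm (\<Sum>i=1..N. d i w) powr p)"
  have S: "0 \<le> S1" "0 \<le> S2" unfolding S1_def S2_def by (auto intro!: sum_nonneg)
  have "ennreal ((S1 / K) powr (1 / p)) \<le> ennreal \<beta> * ennreal ((S2 / K) powr (1 / p))"
    using \<open>Lp_norm ?M _ _ \<le> _\<close> p \<Omega> \<Omega>0
      tr[of "\<lambda>w. norm (\<Sum>i=1..N. \<epsilon> i *\<^sub>R d i w) powr p"] tr[of "\<lambda>w. norm (\<Sum>i=1..N. d i w) powr p"]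
    by (simp add: Lp_norm_uniform_count_measure S1_def S2_def)
  then have "(S1 / K) powr (1 / p) \<le> \<beta> * (S2 / K) powr (1 / p)"
    using \<beta> by (simp add: ennreal_mult'[symmetric])
  then have "((S1 / K) powr (1 / p)) powr p \<le> (\<beta> * (S2 / K) powr (1 / p)) powr p"
    using p by (intro powr_mono2) auto
  then have "S1 / K \<le> \<beta> powr p * (S2 / K)"
    using p S \<beta> K by (simp add: powr_mult powr_powr)
  then show ?thesis
    using K unfolding S1_def[symmetric] S2_def[symmetric] by (simp add: field_simps)
qed simp

section \<open>Stein's inequality\<close>

text \<open>Entries from N on are fixed to 1, which keeps the set finite and closed under pointwise
  products. Sums over it are, up to the factor \<open>2 ^ N\<close>, expectations over N independent
  random signs.\<close>

definition signs :: "nat \<Rightarrow> (nat \<Rightarrow> real) set" where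
  "signs N = {\<epsilon>. (\<forall>i<N. \<epsilon> i = 1 \<or> \<epsilon> i = -1) \<and> (\<forall>i\<ge>N. \<epsilon> i = 1)}"

lemma signs_eq_PiE_dflt: "signs N = PiE_dflt {..<N} 1 (\<lambda>_. {-1, 1})"
  by (auto simp: signs_def PiE_dflt_def not_less)

lemma finite_signs [simp]: "finite (signs N)"
  unfolding signs_eq_PiE_dflt by (intro finite_PiE_dflt) auto

lemma card_signs [simp]: "card (signs N) = 2 ^ N"
  unfolding signs_eq_PiE_dflt by (subst card_PiE_dflt) (auto simp: numeral_2_eq_2)

lemma signs_cases: "\<epsilon> \<in> signs N \<Longrightarrow> \<epsilon> i = 1 \<or> \<epsilon> i = -1"
  by (cases "i < N") (auto simp: signs_def)

lemma signs_nth_sq: "\<epsilon> \<in> signs N \<Longrightarrow> \<epsilon> i * \<epsilon> i = 1"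
  using signs_cases[of \<epsilon> N i] by auto

lemma signs_mult: "\<epsilon> \<in> signs N \<Longrightarrow> \<delta> \<in> signs N \<Longrightarrow> (\<lambda>i. \<delta> i * \<epsilon> i) \<in> signs N"
  using signs_cases[of \<epsilon> N] signs_cases[of \<delta> N] unfolding signs_def
  by simp (metis minus_mult_minus mult_1 mult_minus_left)

text \<open>Symmetry of random signs: multiplication by \<delta> is an involution of
  \<open>signs N\<close>.\<close>

lemma sum_signs_mult:
  assumes "\<delta> \<in> signs N"
  shows "(\<Sum>\<epsilon>\<in>signs N. F (\<lambda>i. \<delta> i * \<epsilon> i)) = (\<Sum>\<epsilon>\<in>signs N. F \<epsilon>)"
  by (rule sum.reindex_bij_witness[of _ "\<lambda>\<epsilon> i. \<delta> i * \<epsilon> i" "\<lambda>\<epsilon> i. \<delta> i * \<epsilon> i"])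
    (auto simp: signs_mult assms mult.assoc[symmetric] signs_nth_sq[OF assms])

text \<open>Independence of the first m signs from the later ones, multiplied out to avoid division.
  The involution \<open>sw\<close> exchanges the entries from m on between two sign
  sequences.\<close>

lemma sum_signs_split:
  fixes u v :: "(nat \<Rightarrow> real) \<Rightarrow> real"
  assumes u: "\<And>\<epsilon> \<epsilon>'. (\<And>i. i < m \<Longrightarrow> \<epsilon> i = \<epsilon>' i) \<Longrightarrow> u \<epsilon> = u \<epsilon>'"
    and v: "\<And>\<epsilon> \<epsilon>'. (\<And>i. m \<le> i \<Longrightarrow> \<epsilon> i = \<epsilon>' i) \<Longrightarrow> v \<epsilon> = v \<epsilon>'"
  shows "2 ^ N * (\<Sum>\<epsilon>\<in>signs N. u \<epsilon> * v \<epsilon>) = (\<Sum>\<epsilon>\<in>signs N. u \<epsilon>) * (\<Sum>\<epsilon>\<in>signs N. v \<epsilon>)"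
proof -
  define sw where "sw = (\<lambda>(\<epsilon>::nat\<Rightarrow>real, \<epsilon>'::nat\<Rightarrow>real). (\<lambda>i. if i < m then \<epsilon> i else \<epsilon>' i, \<lambda>i. if i < m then \<epsilon>' i else \<epsilon> i))"
  have sw: "sw x \<in> signs N \<times> signs N" if "x \<in> signs N \<times> signs N" for x
    using that by (auto simp: sw_def signs_def split: prod.splits)
  have swsw: "sw (sw x) = x" for x by (auto simp: sw_def split: prod.splits)
  have "(\<Sum>\<epsilon>\<in>signs N. u \<epsilon>) * (\<Sum>\<epsilon>\<in>signs N. v \<epsilon>) = (\<Sum>x\<in>signs N \<times> signs N. u (fst x) * v (snd x))"
    by (simp add: sum_product sum.cartesian_product case_prod_unfold)
  also have "\<dots> = (\<Sum>x\<in>signs N \<times> signs N. u (fst (sw x)) * v (snd (sw x)))"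
    by (rule sum.reindex_bij_witness[of _ sw sw]) (use sw swsw in auto)
  also have "\<dots> = (\<Sum>x\<in>signs N \<times> signs N. u (fst x) * v (fst x))"
  proof (intro sum.cong refl)
    fix x
    have "u (fst (sw x)) = u (fst x)" by (rule u) (auto simp: sw_def split: prod.splits)
    moreover have "v (snd (sw x)) = v (fst x)" by (rule v) (auto simp: sw_def split: prod.splits)
    ultimately show "u (fst (sw x)) * v (snd (sw x)) = u (fst x) * v (fst x)" by simp
  qed
  also have "\<dots> = (\<Sum>\<epsilon>\<in>signs N. \<Sum>\<epsilon>'\<in>signs N. u \<epsilon> * v \<epsilon>)"
    by (subst sum.cartesian_product) (simp add: case_prod_unfold)
  finally show ?thesis by (simp add: sum_distrib_left)
qed

text \<open>\<open>cavg W \<kappa> g\<close> is the conditional expectation of \<open>g\<close> given \<open>\<kappa>\<close>, for the uniform measure on \<open>W\<close>.\<close>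

definition cavg :: "'w set \<Rightarrow> ('w \<Rightarrow> 'c) \<Rightarrow> ('w \<Rightarrow> 'a::real_vector) \<Rightarrow> 'w \<Rightarrow> 'a" where
  "cavg W \<kappa> g w = (1 / card {w'\<in>W. \<kappa> w' = \<kappa> w}) *\<^sub>R (\<Sum>w'\<in>{w'\<in>W. \<kappa> w' = \<kappa> w}. g w')"

lemma cavg_cong_cell:
  assumes "\<kappa> w = \<kappa> w'" shows "cavg W \<kappa> g w = cavg W \<kappa> g w'"
  using assms by (simp add: cavg_def)

lemma cavg_in_subspace:
  assumes "subspace V" "\<And>w. w \<in> W \<Longrightarrow> g w \<in> V"
  shows "cavg W \<kappa> g w \<in> V"
  unfolding cavg_def using assms by (intro subspace_scale subspace_sum) auto

text \<open>A is a union of cells, and on each cell the conditional average is a constant with the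
  same total as g.\<close>

lemma sum_cavg:
  assumes "finite W"
    and "A \<subseteq> W" "\<And>w w'. w \<in> A \<Longrightarrow> w' \<in> W \<Longrightarrow> \<kappa> w' = \<kappa> w \<Longrightarrow> w' \<in> A"
  shows "(\<Sum>w\<in>A. cavg W \<kappa> g w) = (\<Sum>w\<in>A. g w)"
proof -
  have A: "finite A" using assms finite_subset by blast
  have "(\<Sum>w\<in>A. cavg W \<kappa> g w) = (\<Sum>c\<in>\<kappa> ` A. \<Sum>w\<in>{w\<in>A. \<kappa> w = c}. cavg W \<kappa> g w)"
    by (rule sum.image_gen[OF A])
  also have "\<dots> = (\<Sum>c\<in>\<kappa> ` A. \<Sum>w\<in>{w\<in>A. \<kappa> w = c}. g w)"
  proof (rule sum.cong[OF refl])
    fix c assume "c \<in> \<kappa> ` A"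
    then obtain w0 where w0: "w0 \<in> A" "c = \<kappa> w0" by auto
    let ?C = "{w\<in>W. \<kappa> w = \<kappa> w0}"
    have C: "{w\<in>A. \<kappa> w = c} = ?C" using assms(2) assms(3)[OF w0(1)] w0(2) by blast
    have "w0 \<in> ?C" using w0 assms by auto
    then have card: "card ?C > 0" using assms(1) by (auto simp: card_gt_0_iff)
    have "(\<Sum>w\<in>?C. cavg W \<kappa> g w) = (\<Sum>w\<in>?C. cavg W \<kappa> g w0)"
      by (intro sum.cong refl cavg_cong_cell) auto
    also have "\<dots> = (\<Sum>w\<in>?C. g w)"
      using card by (simp add: sum_constant_scaleR cavg_def)
    finally show "(\<Sum>w\<in>{w\<in>A. \<kappa> w = c}. cavg W \<kappa> g w) = (\<Sum>w\<in>{w\<in>A. \<kappa> w = c}. g w)"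
      unfolding C .
  qed
  also have "\<dots> = (\<Sum>w\<in>A. g w)"
    by (rule sum.image_gen[OF A, symmetric])
  finally show ?thesis .
qed

text \<open>Given the first k signs, the next one has mean zero: pair each \<epsilon> with the
  sequence whose entry k is flipped.\<close>

lemma sum_signs_prefix_eq_0:
  assumes "k < N"
  shows "(\<Sum>\<epsilon>\<in>{\<epsilon>\<in>signs N. \<forall>i<k. \<epsilon> i = \<delta> i}. \<epsilon> k) = 0"
proof -
  let ?A = "{\<epsilon>\<in>signs N. \<forall>i<k. \<epsilon> i = \<delta> i}"
  let ?f = "\<lambda>\<epsilon>. \<epsilon>(k := - \<epsilon> k)"
  have "(\<Sum>\<epsilon>\<in>?A. \<epsilon> k) = (\<Sum>\<epsilon>\<in>?A. - \<epsilon> k)"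
    by (rule sum.reindex_bij_witness[of _ ?f ?f]) (use assms in \<open>auto simp: signs_def\<close>)
  then show ?thesis by (simp add: sum_negf)
qed

text \<open>Bourgain's argument for Stein's inequality: expose the signs and the cells alternately; then
  the terms \<open>\<epsilon> i *\<^sub>R cavg W (q i) (g i)\<close> are every second difference of the martingale that ends
  in \<open>\<Sum>i<N. \<epsilon> i *\<^sub>R g i\<close>.\<close>

lemma stein_finite:
  fixes q :: "nat \<Rightarrow> 'w \<Rightarrow> 'c" and g :: "nat \<Rightarrow> 'w \<Rightarrow> 'a::banach"
  assumes umd: "UMD_bound V p \<beta>" and W: "finite W"
    and refine: "\<And>i w w'. Suc i < N \<Longrightarrow> w \<in> W \<Longrightarrow> w' \<in> W \<Longrightarrow> q (Suc i) w = q (Suc i) w' \<Longrightarrow> q i w = q i w'"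
    and gV: "\<And>i w. i < N \<Longrightarrow> w \<in> W \<Longrightarrow> g i w \<in> V"
  shows "(\<Sum>w\<in>W. \<Sum>\<epsilon>\<in>signs N. norm (\<Sum>i<N. \<epsilon> i *\<^sub>R cavg W (q i) (g i) w) powr p) \<le>
    (1 + \<beta> powr p) * (\<Sum>w\<in>W. \<Sum>\<epsilon>\<in>signs N. norm (\<Sum>i<N. \<epsilon> i *\<^sub>R g i w) powr p)"
proof -
  have V: "subspace V" and p: "1 < p" and \<beta>: "0 \<le> \<beta>" using umd by (auto simp: UMD_bound_def)
  \<comment> \<open>From index N on the partition is into single points. This adds a last step that
    turns averages into the functions themselves (\<open>E_N\<close>), so that the martingale ends
    in the sum of the \<open>\<epsilon> i *\<^sub>R g i\<close>.\<close>
  define \<kappa> where "\<kappa> k w = (if k < N then Inl (q k w) else Inr w)" for k w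
  define E where "E k = cavg W (\<kappa> k)" for k and h :: "'w \<Rightarrow> 'a"
  have E_q: "cavg W (q k) h w = cavg W (\<kappa> k) h w" if "k < N" for k w and h :: "'w \<Rightarrow> 'a"
    using that by (simp add: cavg_def \<kappa>_def)
  have E_N: "cavg W (\<kappa> N) h w = h w" if "w \<in> W" for w and h :: "'w \<Rightarrow> 'a"
  proof -
    have "{w'\<in>W. \<kappa> N w' = \<kappa> N w} = {w}" using that by (auto simp: \<kappa>_def)
    then show ?thesis by (simp add: cavg_def)
  qed
  have \<kappa>_step: "\<kappa> k w = \<kappa> k w'" if "w \<in> W" "w' \<in> W" "\<kappa> (Suc k) w = \<kappa> (Suc k) w'" for k w w'
    using that refine[of k w w'] by (auto simp: \<kappa>_def split: if_splits)
  \<comment> \<open>At time 2k the cell of index k and k signs are known, at time 2k+1 one more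
    sign. So odd differences expose a sign and even ones refine the cell.\<close>
  define Q where "Q j = (\<lambda>(w, \<epsilon>::nat \<Rightarrow> real). (\<kappa> (j div 2) w, \<lambda>i. if i < (j + 1) div 2 then \<epsilon> i else 1))" for j
  define d where "d j = (\<lambda>(w, \<epsilon>::nat \<Rightarrow> real).
     if odd j then \<epsilon> (j div 2) *\<^sub>R cavg W (\<kappa> (j div 2)) (g (j div 2)) w
     else (\<Sum>i<j div 2. \<epsilon> i *\<^sub>R (cavg W (\<kappa> (j div 2)) (g i) w - cavg W (\<kappa> (j div 2 - 1)) (g i) w)))" for j
  let ?WW = "W \<times> signs N"
  have Q_eq: "Q j (w, \<epsilon>) = Q j (w', \<epsilon>') \<longleftrightarrow>
      \<kappa> (j div 2) w = \<kappa> (j div 2) w' \<and> (\<forall>i<(j + 1) div 2. \<epsilon> i = \<epsilon>' i)" for j w \<epsilon> w' \<epsilon>'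
    by (auto simp: Q_def fun_eq_iff split: if_splits)
  have cV: "cavg W (\<kappa> k) (g i) w \<in> V" if "i < N" for k i w
    by (rule cavg_in_subspace[OF V]) (rule gV[OF that])
  \<comment> \<open>The transform keeps the odd differences and reverses the even ones. Adding it to
    the original martingale leaves twice the odd differences, which form the sum to be
    estimated.\<close>
  have umd': "(\<Sum>x\<in>?WW. norm (\<Sum>j=1..2*N. (if odd j then 1 else -1) *\<^sub>R d j x) powr p) \<le>
    \<beta> powr p * (\<Sum>x\<in>?WW. norm (\<Sum>j=1..2*N. d j x) powr p)"
  proof (rule umd_finite[OF umd, where q = Q])
    fix j x x' assume j: "j < 2 * N" and x: "x \<in> ?WW" "x' \<in> ?WW" and eq: "Q (Suc j) x = Q (Suc j) x'"
    obtain w \<epsilon> w' \<epsilon>' where xx: "x = (w, \<epsilon>)" "x' = (w', \<epsilon>')" by (cases x, cases x')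
    have *: "\<kappa> (Suc j div 2) w = \<kappa> (Suc j div 2) w'" "\<forall>i<(Suc j + 1) div 2. \<epsilon> i = \<epsilon>' i"
      using eq unfolding xx Q_eq by blast+
    have "\<kappa> (j div 2) w = \<kappa> (j div 2) w'"
    proof (cases "odd j")
      case True
      then have "Suc j div 2 = Suc (j div 2)" by presburger
      then show ?thesis using * \<kappa>_step x xx by auto
    next
      case False
      then have "Suc j div 2 = j div 2" by presburger
      then show ?thesis using * by simp
    qed
    moreover have "\<forall>i<(j + 1) div 2. \<epsilon> i = \<epsilon>' i"
    proof (intro allI impI)
      fix i assume "i < (j + 1) div 2"
      then have "i < (Suc j + 1) div 2" by linarith
      then show "\<epsilon> i = \<epsilon>' i" using *(2) by simp
    qed
    ultimately show "Q j x = Q j x'" unfolding xx Q_eq by blast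
  next
    fix j x assume j: "j \<in> {1..2 * N}" and x: "x \<in> ?WW"
    obtain w \<epsilon> where xx: "x = (w, \<epsilon>)" by (cases x)
    show "d j x \<in> V"
    proof (cases "odd j")
      case True
      then have "j div 2 < N" using j by (auto elim!: oddE)
      then show ?thesis using True by (simp add: d_def xx subspace_scale[OF V] cV)
    next
      case False
      have "\<epsilon> i *\<^sub>R (cavg W (\<kappa> (j div 2)) (g i) w - cavg W (\<kappa> (j div 2 - 1)) (g i) w) \<in> V"
        if "i < j div 2" for i
      proof -
        have "i < N" using that j by auto
        then show ?thesis by (intro subspace_scale[OF V] subspace_diff[OF V] cV)
      qed
      then show ?thesis using False unfolding d_def xx by (auto intro: subspace_sum[OF V])
    qed
  next
    fix j x x' assume j: "j \<in> {1..2 * N}" and x: "x \<in> ?WW" "x' \<in> ?WW" and eq: "Q j x = Q j x'"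
    obtain w \<epsilon> w' \<epsilon>' where xx: "x = (w, \<epsilon>)" "x' = (w', \<epsilon>')" by (cases x, cases x')
    have *: "\<kappa> (j div 2) w = \<kappa> (j div 2) w'" "\<forall>i<(j + 1) div 2. \<epsilon> i = \<epsilon>' i"
      using eq unfolding xx Q_eq by blast+
    show "d j x = d j x'"
    proof (cases "odd j")
      case True
      then have "\<epsilon> (j div 2) = \<epsilon>' (j div 2)" using *(2) by (auto elim!: oddE)
      moreover have "cavg W (\<kappa> (j div 2)) (g (j div 2)) w = cavg W (\<kappa> (j div 2)) (g (j div 2)) w'"
        using * by (intro cavg_cong_cell) simp
      ultimately show ?thesis using True by (simp add: d_def xx)
    next
      case False
      moreover have "1 \<le> j" using j by simp
      ultimately have "j = 2 * Suc (j div 2 - 1)" by presburger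
      then obtain k where k: "j = 2 * Suc k" ..
      have "\<kappa> k w = \<kappa> k w'" using \<kappa>_step *(1) x xx k by auto
      then have "(\<Sum>i<Suc k. \<epsilon> i *\<^sub>R (cavg W (\<kappa> (Suc k)) (g i) w - cavg W (\<kappa> k) (g i) w)) =
          (\<Sum>i<Suc k. \<epsilon>' i *\<^sub>R (cavg W (\<kappa> (Suc k)) (g i) w' - cavg W (\<kappa> k) (g i) w'))"
        using * k by (intro sum.cong refl arg_cong2[of _ _ _ _ scaleR] arg_cong2[of _ _ _ _ minus] cavg_cong_cell) auto
      then show ?thesis using k by (simp add: d_def xx del: sum.lessThan_Suc)
    qed
  next
    fix j x assume j: "j < 2 * N" and x: "x \<in> ?WW"
    obtain w \<epsilon> where xx: "x = (w, \<epsilon>)" "w \<in> W" "\<epsilon> \<in> signs N" using x by auto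
    let ?C = "{w'\<in>W. \<kappa> (j div 2) w' = \<kappa> (j div 2) w}"
    let ?P = "{\<epsilon>'\<in>signs N. \<forall>i<(j + 1) div 2. \<epsilon>' i = \<epsilon> i}"
    have "{x'\<in>?WW. Q j x' = Q j x} = ?C \<times> ?P"
      unfolding xx(1) by (auto simp: Q_eq)
    then have eq: "(\<Sum>x'\<in>{x'\<in>?WW. Q j x' = Q j x}. d (Suc j) x') = (\<Sum>w'\<in>?C. \<Sum>\<epsilon>'\<in>?P. d (Suc j) (w', \<epsilon>'))"
      by (simp add: sum.cartesian_product)
    show "(\<Sum>x'\<in>{x'\<in>?WW. Q j x' = Q j x}. d (Suc j) x') = 0"
    proof (cases "odd j")
      case False
      then obtain k where k: "j = 2 * k" by (auto elim!: evenE)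
      have "(\<Sum>\<epsilon>'\<in>?P. d (Suc j) (w', \<epsilon>')) = (\<Sum>\<epsilon>'\<in>?P. \<epsilon>' k) *\<^sub>R cavg W (\<kappa> k) (g k) w'" for w'
        by (simp add: d_def k scaleR_sum_left)
      moreover have "(\<Sum>\<epsilon>'\<in>?P. \<epsilon>' k) = 0"
        using sum_signs_prefix_eq_0[of k N \<epsilon>] j k by simp
      ultimately show ?thesis unfolding eq by simp
    next
      case True
      then obtain k where k: "j = 2 * k + 1" by (auto elim!: oddE)
      have C: "?C = {w'\<in>W. \<kappa> k w' = \<kappa> k w}" using k by simp
      have z: "(\<Sum>w'\<in>?C. cavg W (\<kappa> (Suc k)) h w' - cavg W (\<kappa> k) h w') = 0" for h :: "'w \<Rightarrow> 'a"
      proof -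
        have "(\<Sum>w'\<in>?C. cavg W (\<kappa> (Suc k)) h w') = sum h ?C"
        proof (rule sum_cavg[OF W])
          fix v v' assume "v \<in> ?C" "v' \<in> W" "\<kappa> (Suc k) v' = \<kappa> (Suc k) v"
          then show "v' \<in> ?C" using \<kappa>_step[of v' v k] unfolding C by simp
        qed auto
        moreover have "(\<Sum>w'\<in>?C. cavg W (\<kappa> k) h w') = sum h ?C"
          by (rule sum_cavg[OF W]) (auto simp: C)
        ultimately show ?thesis by (simp add: sum_subtractf)
      qed
      have "(\<Sum>w'\<in>?C. \<Sum>\<epsilon>'\<in>?P. d (Suc j) (w', \<epsilon>')) = (\<Sum>\<epsilon>'\<in>?P. \<Sum>w'\<in>?C. d (Suc j) (w', \<epsilon>'))"
        by (rule sum.swap)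
      also have "\<dots> = (\<Sum>\<epsilon>'\<in>?P. \<Sum>w'\<in>?C. \<Sum>i<Suc k. \<epsilon>' i *\<^sub>R (cavg W (\<kappa> (Suc k)) (g i) w' - cavg W (\<kappa> k) (g i) w'))"
        using k by (simp add: d_def)
      also have "\<dots> = (\<Sum>\<epsilon>'\<in>?P. \<Sum>i<Suc k. \<Sum>w'\<in>?C. \<epsilon>' i *\<^sub>R (cavg W (\<kappa> (Suc k)) (g i) w' - cavg W (\<kappa> k) (g i) w'))"
        by (intro sum.cong refl sum.swap)
      also have "\<dots> = 0"
        unfolding scaleR_sum_right[symmetric] z by simp
      finally show ?thesis unfolding eq .
    qed
  qed (use W in auto)
  \<comment> \<open>At even times the martingale is the randomized sum of all functions so far, each
    averaged over the current cell.\<close>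
  have tel: "(\<Sum>j=1..2*M. d j (w, \<epsilon>)) = (\<Sum>i<M. \<epsilon> i *\<^sub>R cavg W (\<kappa> M) (g i) w)" for M w \<epsilon>
  proof (induction M)
    case (Suc M)
    have "(\<Sum>j=1..2*Suc M. d j (w, \<epsilon>)) = (\<Sum>j=1..2*M. d j (w, \<epsilon>)) + d (2*M+1) (w, \<epsilon>) + d (2*M+2) (w, \<epsilon>)"
      by simp
    then show ?case unfolding Suc by (simp add: d_def scaleR_diff_right sum_subtractf)
  qed simp
  have odd: "(\<Sum>j=1..2*M. d j (w, \<epsilon>)) + (\<Sum>j=1..2*M. (if odd j then 1 else -1) *\<^sub>R d j (w, \<epsilon>)) =
      2 *\<^sub>R (\<Sum>i<M. \<epsilon> i *\<^sub>R cavg W (\<kappa> i) (g i) w)" for M w \<epsilon>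
  proof (induction M)
    case (Suc M)
    have "(\<Sum>j=1..2*Suc M. h j) = (\<Sum>j=1..2*M. h j) + h (2*M+1) + h (2*M+2)" for h :: "nat \<Rightarrow> 'a"
      by simp
    note s = this
    have "d (2*M+1) (w, \<epsilon>) = \<epsilon> M *\<^sub>R cavg W (\<kappa> M) (g M) w"
      by (simp add: d_def)
    moreover have "x + b + c + (y + 1 *\<^sub>R b + (-1) *\<^sub>R c) = (x + y) + 2 *\<^sub>R b" for x y b c :: 'a
      by (simp add: scaleR_2)
    moreover have "(if odd (2*M+1) then 1 else -1::real) = 1" "(if odd (2*M+2) then 1 else -1::real) = -1"
      by simp_all
    ultimately show ?case unfolding s by (simp only: Suc.IH sum.lessThan_Suc scaleR_add_right)
  qed simp
  let ?D = "\<lambda>x. \<Sum>j=1..2*N. d j x" and ?D' = "\<lambda>x. \<Sum>j=1..2*N. (if odd j then 1 else -1) *\<^sub>R d j x"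
  \<comment> \<open>The sum in question is half of \<open>?D + ?D'\<close>, hence at most the larger
    of the two norms; so the constant is 1 + \<open>\<beta> powr p\<close> without a power of
    2.\<close>
  have pw: "norm (\<Sum>i<N. \<epsilon> i *\<^sub>R cavg W (q i) (g i) w) powr p \<le>
      norm (?D (w, \<epsilon>)) powr p + norm (?D' (w, \<epsilon>)) powr p" for w \<epsilon>
  proof -
    define S where "S = (\<Sum>i<N. \<epsilon> i *\<^sub>R cavg W (q i) (g i) w)"
    have "2 *\<^sub>R S = ?D (w, \<epsilon>) + ?D' (w, \<epsilon>)"
      unfolding odd S_def using E_q by simp
    then have "norm (2 *\<^sub>R S) \<le> norm (?D (w, \<epsilon>)) + norm (?D' (w, \<epsilon>))"
      by (simp only: norm_triangle_ineq)
    then have "2 * norm S \<le> norm (?D (w, \<epsilon>)) + norm (?D' (w, \<epsilon>))"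
      by simp
    then have "norm S \<le> max (norm (?D (w, \<epsilon>))) (norm (?D' (w, \<epsilon>)))" by linarith
    then have "norm S powr p \<le> max (norm (?D (w, \<epsilon>))) (norm (?D' (w, \<epsilon>))) powr p"
      using p by (intro powr_mono2) auto
    then show ?thesis unfolding S_def[symmetric] by (simp add: max_def add_increasing add_increasing2 split: if_splits)
  qed
  have cp: "(\<Sum>w\<in>W. \<Sum>\<epsilon>\<in>signs N. h (w, \<epsilon>)) = (\<Sum>x\<in>?WW. h x)" for h :: "'w \<times> (nat \<Rightarrow> real) \<Rightarrow> real"
    by (simp add: sum.cartesian_product)
  have "(\<Sum>w\<in>W. \<Sum>\<epsilon>\<in>signs N. norm (\<Sum>i<N. \<epsilon> i *\<^sub>R cavg W (q i) (g i) w) powr p) \<le>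
     (\<Sum>w\<in>W. \<Sum>\<epsilon>\<in>signs N. norm (?D (w, \<epsilon>)) powr p + norm (?D' (w, \<epsilon>)) powr p)"
    by (intro sum_mono pw)
  also have "\<dots> = (\<Sum>x\<in>?WW. norm (?D x) powr p) + (\<Sum>x\<in>?WW. norm (?D' x) powr p)"
    using cp[of "\<lambda>x. norm (?D x) powr p + norm (?D' x) powr p"] by (simp add: sum.distrib)
  also have "\<dots> \<le> (1 + \<beta> powr p) * (\<Sum>x\<in>?WW. norm (?D x) powr p)"
    using umd' by (simp add: algebra_simps)
  also have "(\<Sum>x\<in>?WW. norm (?D x) powr p) = (\<Sum>w\<in>W. \<Sum>\<epsilon>\<in>signs N. norm (?D (w, \<epsilon>)) powr p)"
    by (rule cp[symmetric])
  also have "\<dots> = (\<Sum>w\<in>W. \<Sum>\<epsilon>\<in>signs N. norm (\<Sum>i<N. \<epsilon> i *\<^sub>R g i w) powr p)"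
    unfolding tel using E_N by (intro sum.cong refl) simp
  finally show ?thesis .
qed

section \<open>Multilinear operators\<close>

text \<open>\<open>H i\<close> has the properties of a normalized Haar function: values 1 and -1,
  mean zero on the cells of step i, known at step i + 1. Then the
  \<open>H i w *\<^sub>R y i w\<close> are martingale differences, and the UMD inequality puts
  independent signs in place of the \<open>H i\<close>.\<close>

lemma umd_unsign:
  fixes q :: "nat \<Rightarrow> 'w \<Rightarrow> 'c" and y :: "nat \<Rightarrow> 'w \<Rightarrow> 'a::banach" and H :: "nat \<Rightarrow> 'w \<Rightarrow> real"
  assumes umd: "UMD_bound V p \<beta>" and W: "finite W"
    and refine: "\<And>i w w'. i < N \<Longrightarrow> w \<in> W \<Longrightarrow> w' \<in> W \<Longrightarrow> q (Suc i) w = q (Suc i) w' \<Longrightarrow> q i w = q i w'"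
    and yV: "\<And>i w. i < N \<Longrightarrow> w \<in> W \<Longrightarrow> y i w \<in> V"
    and y: "\<And>i w w'. i < N \<Longrightarrow> w \<in> W \<Longrightarrow> w' \<in> W \<Longrightarrow> q i w = q i w' \<Longrightarrow> y i w = y i w'"
    and H1: "\<And>i w. i < N \<Longrightarrow> w \<in> W \<Longrightarrow> H i w = 1 \<or> H i w = -1"
    and H: "\<And>i w w'. i < N \<Longrightarrow> w \<in> W \<Longrightarrow> w' \<in> W \<Longrightarrow> q (Suc i) w = q (Suc i) w' \<Longrightarrow> H i w = H i w'"
    and mean: "\<And>i w. i < N \<Longrightarrow> w \<in> W \<Longrightarrow> (\<Sum>w'\<in>{w'\<in>W. q i w' = q i w}. H i w') = 0"
  shows "2 ^ N * (\<Sum>w\<in>W. norm (\<Sum>i<N. H i w *\<^sub>R y i w) powr p) \<le>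
    \<beta> powr p * (\<Sum>w\<in>W. \<Sum>\<epsilon>\<in>signs N. norm (\<Sum>i<N. \<epsilon> i *\<^sub>R y i w) powr p)"
proof -
  have V: "subspace V" using umd by (simp add: UMD_bound_def)
  have one: "(\<Sum>w\<in>W. norm (\<Sum>i<N. H i w *\<^sub>R y i w) powr p) \<le>
      \<beta> powr p * (\<Sum>w\<in>W. norm (\<Sum>i<N. \<epsilon> i *\<^sub>R H i w *\<^sub>R y i w) powr p)" if \<epsilon>: "\<epsilon> \<in> signs N" for \<epsilon>
  proof -
    \<comment> \<open>The differences already contain the sign \<epsilon>, and the transform uses
      the same \<epsilon>: as its square is 1, the transformed sum is the one without random
      signs.\<close>
    let ?d = "\<lambda>j w. \<epsilon> (j - 1) *\<^sub>R H (j - 1) w *\<^sub>R y (j - 1) w"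
    have "(\<Sum>w\<in>W. norm (\<Sum>j=1..N. \<epsilon> (j - 1) *\<^sub>R ?d j w) powr p) \<le>
        \<beta> powr p * (\<Sum>w\<in>W. norm (\<Sum>j=1..N. ?d j w) powr p)"
    proof (rule umd_finite[OF umd W, where q = q])
      fix j w assume "j \<in> {1..N}" "w \<in> W"
      then have "y (j - 1) w \<in> V" by (intro yV) auto
      then show "?d j w \<in> V" by (intro subspace_scale[OF V])
    next
      fix j w w' assume j: "j \<in> {1..N}" and w: "w \<in> W" "w' \<in> W" "q j w = q j w'"
      obtain i where i: "j = Suc i" "i < N" using j by (cases j) auto
      have "q i w = q i w'" using refine[OF i(2) w(1,2)] w(3) i by simp
      then have "y i w = y i w'" using y[OF i(2) w(1,2)] by simp
      moreover have "H i w = H i w'" using H[OF i(2) w(1,2)] w(3) i by simp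
      ultimately show "?d j w = ?d j w'" using i by simp
    next
      fix i w assume i: "i < N" and w: "w \<in> W"
      have "(\<Sum>w'\<in>{w'\<in>W. q i w' = q i w}. ?d (Suc i) w') =
          (\<Sum>w'\<in>{w'\<in>W. q i w' = q i w}. H i w' *\<^sub>R (\<epsilon> i *\<^sub>R y i w))"
      proof (rule sum.cong[OF refl])
        fix w' assume "w' \<in> {w'\<in>W. q i w' = q i w}"
        then have "y i w' = y i w" using y[OF i, of w' w] w by simp
        then show "?d (Suc i) w' = H i w' *\<^sub>R (\<epsilon> i *\<^sub>R y i w)" by (simp add: mult.commute)
      qed
      also have "\<dots> = (\<Sum>w'\<in>{w'\<in>W. q i w' = q i w}. H i w') *\<^sub>R (\<epsilon> i *\<^sub>R y i w)"
        by (rule scaleR_sum_left[symmetric])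
      finally show "(\<Sum>w'\<in>{w'\<in>W. q i w' = q i w}. ?d (Suc i) w') = 0"
        unfolding mean[OF i w] by simp
    next
      fix j assume "j \<in> {1..N}"
      show "\<epsilon> (j - 1) \<in> {-1, 1}" using signs_cases[OF \<epsilon>, of "j - 1"] by auto
    qed (use refine in blast)
    moreover have "\<epsilon> i * (\<epsilon> i * z) = z" for i and z
      using signs_nth_sq[OF \<epsilon>, of i] by (simp add: mult.assoc[symmetric])
    ultimately show ?thesis by (simp add: sum.atLeast1_atMost_eq)
  qed
  have fl: "(\<Sum>\<epsilon>\<in>signs N. norm (\<Sum>i<N. \<epsilon> i *\<^sub>R H i w *\<^sub>R y i w) powr p) =
      (\<Sum>\<epsilon>\<in>signs N. norm (\<Sum>i<N. \<epsilon> i *\<^sub>R y i w) powr p)" if w: "w \<in> W" for w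
  proof -
    \<comment> \<open>At a fixed w the values \<open>H i w\<close> are a sign pattern themselves and
      disappear by the symmetry of the random signs.\<close>
    define \<delta> where "\<delta> i = (if i < N then H i w else 1)" for i
    have \<delta>: "\<delta> \<in> signs N" using H1[OF _ w] by (auto simp: signs_def \<delta>_def)
    have "(\<Sum>i<N. \<epsilon> i *\<^sub>R H i w *\<^sub>R y i w) = (\<Sum>i<N. (\<delta> i * \<epsilon> i) *\<^sub>R y i w)" for \<epsilon>
      by (intro sum.cong refl) (simp add: \<delta>_def mult.commute)
    then show ?thesis
      using sum_signs_mult[OF \<delta>, of "\<lambda>\<epsilon>. norm (\<Sum>i<N. \<epsilon> i *\<^sub>R y i w) powr p"] by simp
  qed
  have "2 ^ N * (\<Sum>w\<in>W. norm (\<Sum>i<N. H i w *\<^sub>R y i w) powr p) =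
      (\<Sum>\<epsilon>\<in>signs N. (\<Sum>w\<in>W. norm (\<Sum>i<N. H i w *\<^sub>R y i w) powr p))"
    by simp
  also have "\<dots> \<le> (\<Sum>\<epsilon>\<in>signs N. \<beta> powr p * (\<Sum>w\<in>W. norm (\<Sum>i<N. \<epsilon> i *\<^sub>R H i w *\<^sub>R y i w) powr p))"
    by (intro sum_mono one)
  also have "\<dots> = \<beta> powr p * (\<Sum>w\<in>W. \<Sum>\<epsilon>\<in>signs N. norm (\<Sum>i<N. \<epsilon> i *\<^sub>R H i w *\<^sub>R y i w) powr p)"
    by (subst sum.swap) (simp only: sum_distrib_left)
  also have "\<dots> = \<beta> powr p * (\<Sum>w\<in>W. \<Sum>\<epsilon>\<in>signs N. norm (\<Sum>i<N. \<epsilon> i *\<^sub>R y i w) powr p)"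
    by (rule arg_cong[OF sum.cong[OF refl fl], where f = "(*) (\<beta> powr p)"])
  finally show ?thesis .
qed

lemma multilinear_ops_sum:
  fixes B :: "('x::real_normed_vector, 'y::real_normed_vector) multop"
  assumes B: "B \<in> multilinear_ops X k" and X: "subspace (X (Suc i))"
    and xs: "length xs = k" "\<And>j. j < k \<Longrightarrow> xs ! j \<in> X (Suc j)" and i: "i < k"
    and u: "\<And>w. w \<in> A \<Longrightarrow> u w \<in> X (Suc i)"
  shows "multop_apply B (xs[i := c *\<^sub>R (\<Sum>w\<in>A. u w)]) = c *\<^sub>R (\<Sum>w\<in>A. multop_apply B (xs[i := u w]))"
proof -
  have lin: "multop_apply B (xs[i := x + c *\<^sub>R y]) = multop_apply B (xs[i := x]) + c *\<^sub>R multop_apply B (xs[i := y])"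
    if "x \<in> X (Suc i)" "y \<in> X (Suc i)" for x y c
    using B xs i that unfolding multilinear_ops_def by blast
  have X0: "0 \<in> X (Suc i)" using X by (rule subspace_0)
  have z: "multop_apply B (xs[i := 0]) = 0"
    using lin[OF X0 X0, of 1] by simp
  have "multop_apply B (xs[i := (\<Sum>w\<in>A. u w)]) = (\<Sum>w\<in>A. multop_apply B (xs[i := u w]))"
    using u
  proof (induction A rule: infinite_finite_induct)
    case (insert w A)
    have "(\<Sum>w\<in>A. u w) \<in> X (Suc i)" using insert.prems by (intro subspace_sum[OF X]) auto
    then show ?case
      using insert lin[of "u w" "\<Sum>w\<in>A. u w" 1] by simp
  qed (auto simp: z)
  moreover have "(\<Sum>w\<in>A. u w) \<in> X (Suc i)" using u by (intro subspace_sum[OF X]) auto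
  ultimately show ?thesis
    using lin[OF X0, of "\<Sum>w\<in>A. u w" c] z by simp
qed

lemma freeze_Nil: "freeze B [] = B"
  by (rule multop_eqI) (simp add: freeze.rep_eq)

lemma freeze_freeze: "freeze (freeze B es) ds = freeze B (ds @ es)"
  by (rule multop_eqI) (simp add: freeze.rep_eq)

lemma norm_freeze_le: "norm (freeze B [x]) \<le> norm B * norm x"
proof (rule norm_multop_bound)
  show "norm (multop_apply (freeze B [x]) xs) \<le> norm B * norm x * prod_list (map norm xs)" for xs
    using norm_multop_apply[of B "xs @ [x]"] by (simp add: freeze.rep_eq mult_ac)
qed simp

lemma multop_apply_sum: "multop_apply (\<Sum>i\<in>A. c i *\<^sub>R B i) xs = (\<Sum>i\<in>A. c i *\<^sub>R multop_apply (B i) xs)"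
  by (induction A rule: infinite_finite_induct)
    (auto simp: zero_multop.rep_eq plus_multop.rep_eq scaleR_multop.rep_eq)

lemma freeze_sum: "freeze (\<Sum>i\<in>A. c i *\<^sub>R B i) es = (\<Sum>i\<in>A. c i *\<^sub>R freeze (B i) es)"
  by (rule multop_eqI) (simp add: freeze.rep_eq multop_apply_sum)

text \<open>One application of Stein's inequality. \<open>\<Phi>\<close> stands for inserting a
  vector into the last open argument; the result is an operator or, for the first argument, an
  element of Y. The \<open>b i\<close> are constant on cells, so averaging commutes with
  \<open>\<Phi> (b i w)\<close>. Once Stein has removed the averages, all terms contain the same
  vector \<open>f w\<close>, which \<open>lin\<close> and \<open>bd\<close> pull out of the
  sum.\<close>

lemma stein_step:
  fixes q :: "nat \<Rightarrow> 'w \<Rightarrow> 'c" and b :: "nat \<Rightarrow> 'w \<Rightarrow> 'a::real_normed_vector"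
    and \<Phi> :: "'a \<Rightarrow> 'x::real_normed_vector \<Rightarrow> 'z::banach"
  assumes umd: "UMD_bound V p \<beta>" and W: "finite W"
    and refine: "\<And>i w w'. Suc i < N \<Longrightarrow> w \<in> W \<Longrightarrow> w' \<in> W \<Longrightarrow> q (Suc i) w = q (Suc i) w' \<Longrightarrow> q i w = q i w'"
    and b: "\<And>i w w'. i < N \<Longrightarrow> w \<in> W \<Longrightarrow> w' \<in> W \<Longrightarrow> q i w = q i w' \<Longrightarrow> b i w = b i w'"
    and lin: "\<And>c B x. \<Phi> (\<Sum>i<N. c i *\<^sub>R B i) x = (\<Sum>i<N. c i *\<^sub>R \<Phi> (B i) x)"
    and bd: "\<And>B x. norm (\<Phi> B x) \<le> norm B * norm x"
    and comm: "\<And>i w. i < N \<Longrightarrow> w \<in> W \<Longrightarrow> \<Phi> (b i w) (cavg W (q i) f w) = cavg W (q i) (\<lambda>w'. \<Phi> (b i w) (f w')) w"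
    and V: "\<And>i w. i < N \<Longrightarrow> w \<in> W \<Longrightarrow> \<Phi> (b i w) (f w) \<in> V"
    and M: "\<And>w. w \<in> W \<Longrightarrow> norm (f w) \<le> M" "0 \<le> M"
  shows "(\<Sum>w\<in>W. \<Sum>\<epsilon>\<in>signs N. norm (\<Sum>i<N. \<epsilon> i *\<^sub>R \<Phi> (b i w) (cavg W (q i) f w)) powr p) \<le>
    (1 + \<beta> powr p) * M powr p * (\<Sum>w\<in>W. \<Sum>\<epsilon>\<in>signs N. norm (\<Sum>i<N. \<epsilon> i *\<^sub>R b i w) powr p)"
proof -
  have p: "1 < p" using umd by (simp add: UMD_bound_def)
  let ?g = "\<lambda>i w. \<Phi> (b i w) (f w)"
  have c: "cavg W (q i) (?g i) w = \<Phi> (b i w) (cavg W (q i) f w)" if "i < N" "w \<in> W" for i w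
  proof -
    have "\<Phi> (b i w') (f w') = \<Phi> (b i w) (f w')" if "w' \<in> {w'\<in>W. q i w' = q i w}" for w'
      using b[OF \<open>i < N\<close>, of w' w] that \<open>w \<in> W\<close> by simp
    then have "cavg W (q i) (?g i) w = cavg W (q i) (\<lambda>w'. \<Phi> (b i w) (f w')) w"
      unfolding cavg_def by (intro arg_cong2[of _ _ _ _ scaleR] refl sum.cong) auto
    then show ?thesis using comm[OF that] by simp
  qed
  have "(\<Sum>w\<in>W. \<Sum>\<epsilon>\<in>signs N. norm (\<Sum>i<N. \<epsilon> i *\<^sub>R \<Phi> (b i w) (cavg W (q i) f w)) powr p) =
     (\<Sum>w\<in>W. \<Sum>\<epsilon>\<in>signs N. norm (\<Sum>i<N. \<epsilon> i *\<^sub>R cavg W (q i) (?g i) w) powr p)"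
    using c by (intro sum.cong refl arg_cong2[of _ _ _ _ "(powr)"] arg_cong[of _ _ norm] arg_cong2[of _ _ _ _ scaleR]) auto
  also have "\<dots> \<le> (1 + \<beta> powr p) * (\<Sum>w\<in>W. \<Sum>\<epsilon>\<in>signs N. norm (\<Sum>i<N. \<epsilon> i *\<^sub>R ?g i w) powr p)"
    by (rule stein_finite[OF umd W refine V])
  also have "\<dots> \<le> (1 + \<beta> powr p) * (\<Sum>w\<in>W. \<Sum>\<epsilon>\<in>signs N. M powr p * norm (\<Sum>i<N. \<epsilon> i *\<^sub>R b i w) powr p)"
  proof (intro mult_left_mono sum_mono)
    fix w \<epsilon> assume w: "w \<in> W"
    have "norm (\<Sum>i<N. \<epsilon> i *\<^sub>R ?g i w) \<le> norm (\<Sum>i<N. \<epsilon> i *\<^sub>R b i w) * norm (f w)"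
      unfolding lin[symmetric] by (rule bd)
    also have "\<dots> \<le> norm (\<Sum>i<N. \<epsilon> i *\<^sub>R b i w) * M"
      by (intro mult_left_mono M(1) w) simp
    finally have "norm (\<Sum>i<N. \<epsilon> i *\<^sub>R ?g i w) powr p \<le> (norm (\<Sum>i<N. \<epsilon> i *\<^sub>R b i w) * M) powr p"
      using p by (intro powr_mono2) auto
    then show "norm (\<Sum>i<N. \<epsilon> i *\<^sub>R ?g i w) powr p \<le> M powr p * norm (\<Sum>i<N. \<epsilon> i *\<^sub>R b i w) powr p"
      using M(2) by (simp add: powr_mult mult.commute)
  qed simp
  finally show ?thesis by (simp add: sum_distrib_left mult.assoc)
qed

text \<open>Peel off the arguments one at a time, from the last to the first: each step is Stein's
  inequality in the space \<open>T k\<close> that contains the operators with the last arguments frozen.\<close>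

lemma multilinear_stein:
  fixes q :: "nat \<Rightarrow> 'w \<Rightarrow> 'c" and a :: "nat \<Rightarrow> 'w \<Rightarrow> ('x::banach, 'y::banach) multop"
    and f :: "nat \<Rightarrow> 'w \<Rightarrow> 'x"
  assumes n: "1 \<le> n" and X: "\<And>m. m \<in> {1..n} \<Longrightarrow> subspace (X m)" and W: "finite W"
    and refine: "\<And>i w w'. Suc i < N \<Longrightarrow> w \<in> W \<Longrightarrow> w' \<in> W \<Longrightarrow> q (Suc i) w = q (Suc i) w' \<Longrightarrow> q i w = q i w'"
    and T: "\<And>k. k \<in> {1..<n} \<Longrightarrow> UMD_bound (T k) p (\<beta> k)"
    and Y: "UMD_bound (UNIV :: 'y set) p (\<beta> 0)"
    and a: "\<And>i w. i < N \<Longrightarrow> w \<in> W \<Longrightarrow> a i w \<in> multilinear_ops X n"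
    and fr: "\<And>i w k e. i < N \<Longrightarrow> w \<in> W \<Longrightarrow> k \<in> {1..<n} \<Longrightarrow> (\<And>m. m \<in> {k+1..n} \<Longrightarrow> e m \<in> X m) \<Longrightarrow>
      freeze (a i w) (map e [k+1..<n+1]) \<in> T k"
    and const: "\<And>i w w'. i < N \<Longrightarrow> w \<in> W \<Longrightarrow> w' \<in> W \<Longrightarrow> q i w = q i w' \<Longrightarrow> a i w = a i w'"
    and f: "\<And>m w. m \<in> {1..n} \<Longrightarrow> w \<in> W \<Longrightarrow> f m w \<in> X m"
    and M: "\<And>m w. m \<in> {1..n} \<Longrightarrow> w \<in> W \<Longrightarrow> norm (f m w) \<le> M m" "\<And>m. m \<in> {1..n} \<Longrightarrow> 0 \<le> M m"
  shows "(\<Sum>w\<in>W. \<Sum>\<epsilon>\<in>signs N. norm (\<Sum>i<N. \<epsilon> i *\<^sub>R multop_apply (a i w) (map (\<lambda>m. cavg W (q i) (f m) w) [1..<n+1])) powr p) \<le>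
    (\<Prod>k<n. 1 + \<beta> k powr p) * (\<Prod>m=1..n. M m) powr p *
      (\<Sum>w\<in>W. \<Sum>\<epsilon>\<in>signs N. norm (\<Sum>i<N. \<epsilon> i *\<^sub>R a i w) powr p)"
proof -
  let ?e = "\<lambda>i w m. cavg W (q i) (f m) w"
  \<comment> \<open>The arguments after k are filled with averages: \<open>b n\<close> is the
    coefficient itself, and passing from k to k + 1 frees argument k + 1.\<close>
  define b where "b k i w = freeze (a i w) (map (?e i w) [k+1..<n+1])" for k i w
  define S where "S k = (\<Sum>w\<in>W. \<Sum>\<epsilon>\<in>signs N. norm (\<Sum>i<N. \<epsilon> i *\<^sub>R b k i w) powr p)" for k
  have eX: "?e i w m \<in> X m" if "m \<in> {1..n}" for i w m
    by (rule cavg_in_subspace[OF X[OF that]]) (rule f[OF that])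
  have S0: "0 \<le> S k" for k unfolding S_def by (intro sum_nonneg) simp
  have b_const: "b k i w = b k i w'" if "i < N" "w \<in> W" "w' \<in> W" "q i w = q i w'" for k i w w'
    unfolding b_def const[OF that] by (intro arg_cong2[of _ _ _ _ freeze] refl map_cong cavg_cong_cell that(4))
  have upt: "[k+1..<n+1] = (k+1) # [k+1+1..<n+1]" if "k < n" for k
    using that by (simp add: upt_conv_Cons)
  have b_Suc: "freeze (b (Suc k) i w) [?e i w (Suc k)] = b k i w" if "k < n" for k i w
    using upt[OF that] by (simp add: b_def freeze_freeze)
  \<comment> \<open>By linearity in slot k + 1; if the first k entries leave the domain, the
    extension by zero makes both sides vanish.\<close>
  have lin: "multop_apply (b (Suc k) i w) (xs @ [?e i w (Suc k)]) =
      cavg W (q i) (\<lambda>w'. multop_apply (b (Suc k) i w) (xs @ [f (Suc k) w'])) w"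
    if k: "k < n" and i: "i < N" and w: "w \<in> W" for k i w xs
  proof -
    let ?es = "map (?e i w) [Suc k+1..<n+1]"
    have ap: "multop_apply (b (Suc k) i w) (xs @ [u]) = multop_apply (a i w) (xs @ u # ?es)" for u
      by (simp add: b_def freeze.rep_eq)
    have len: "length (xs @ u # ?es) = n \<longleftrightarrow> length xs = k" for u
      using k by (auto simp del: upt_Suc)
    have nth_es: "(xs @ u # ?es) ! j = ?e i w (Suc j)" if "length xs = k" "k < j" "j < n" for j u
    proof -
      obtain l where l: "j = k + Suc l" using \<open>k < j\<close> by (metis less_iff_Suc_add add_Suc_right)
      have "l < length [Suc k+1..<n+1]" using that l by (simp del: upt_Suc)
      then show ?thesis using that l by (simp add: nth_append del: upt_Suc)
    qed
    show ?thesis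
    proof (cases "length xs = k \<and> (\<forall>j<k. xs ! j \<in> X (Suc j))")
      case True
      let ?ys = "xs @ ?e i w (Suc k) # ?es"
      have ys: "length ?ys = n" using True len by blast
      have ysX: "?ys ! j \<in> X (Suc j)" if j: "j < n" for j
      proof -
        consider "j < k" | "j = k" | "k < j" by linarith
        then show ?thesis
        proof cases
          case 1 then show ?thesis using True by (simp add: nth_append)
        next
          case 2 then show ?thesis using True eX[of "Suc k"] k by (simp add: nth_append)
        next
          case 3 then show ?thesis using True nth_es[of j] eX[of "Suc j"] j by simp
        qed
      qed
      have upd: "?ys[k := u] = xs @ u # ?es" for u using True by (simp add: list_update_append)
      have "multop_apply (a i w) (?ys[k := (1 / card {w'\<in>W. q i w' = q i w}) *\<^sub>R (\<Sum>w'\<in>{w'\<in>W. q i w' = q i w}. f (Suc k) w')]) =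
         (1 / card {w'\<in>W. q i w' = q i w}) *\<^sub>R (\<Sum>w'\<in>{w'\<in>W. q i w' = q i w}. multop_apply (a i w) (?ys[k := f (Suc k) w']))"
        by (rule multilinear_ops_sum[OF a[OF i w]]) (use X ys ysX k f in auto)
      then show ?thesis unfolding upd ap by (simp add: cavg_def)
    next
      case False
      have "multop_apply (a i w) (xs @ u # ?es) = 0" for u
      proof -
        have "\<not> (length (xs @ u # ?es) = n \<and> (\<forall>j<n. (xs @ u # ?es) ! j \<in> X (Suc j)))"
        proof
          assume *: "length (xs @ u # ?es) = n \<and> (\<forall>j<n. (xs @ u # ?es) ! j \<in> X (Suc j))"
          then have "length xs = k" using len by blast
          moreover have "xs ! j \<in> X (Suc j)" if "j < k" for j
            using *[THEN conjunct2, rule_format, of j] that k \<open>length xs = k\<close> by (simp add: nth_append)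
          ultimately show False using False by blast
        qed
        then show ?thesis using a[OF i w] unfolding multilinear_ops_def by blast
      qed
      then show ?thesis unfolding ap by (simp add: cavg_def)
    qed
  qed
  have step: "S k \<le> (1 + \<beta> k powr p) * M (Suc k) powr p * S (Suc k)" if k: "k \<in> {1..<n}" for k
  proof -
    have "(\<Sum>w\<in>W. \<Sum>\<epsilon>\<in>signs N. norm (\<Sum>i<N. \<epsilon> i *\<^sub>R freeze (b (Suc k) i w) [?e i w (Suc k)]) powr p) \<le>
        (1 + \<beta> k powr p) * M (Suc k) powr p * S (Suc k)"
      unfolding S_def
    proof (rule stein_step[where \<Phi> = "\<lambda>B x. freeze B [x]", OF T[OF k] W refine b_const freeze_sum norm_freeze_le])
      fix i w assume i: "i < N" and w: "w \<in> W"
      show "freeze (b (Suc k) i w) [?e i w (Suc k)] = cavg W (q i) (\<lambda>w'. freeze (b (Suc k) i w) [f (Suc k) w']) w"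
      proof (rule multop_eqI)
        fix xs
        show "multop_apply (freeze (b (Suc k) i w) [?e i w (Suc k)]) xs =
           multop_apply (cavg W (q i) (\<lambda>w'. freeze (b (Suc k) i w) [f (Suc k) w']) w) xs"
          using lin[of k i w xs] k i w
            multop_apply_sum[of "\<lambda>_. 1" "\<lambda>w'. freeze (b (Suc k) i w) [f (Suc k) w']" "{w'\<in>W. q i w' = q i w}" xs]
          by (simp add: freeze.rep_eq cavg_def scaleR_multop.rep_eq)
      qed
      have "freeze (a i w) (map (\<lambda>m. if m = Suc k then f (Suc k) w else ?e i w m) [k+1..<n+1]) \<in> T k"
        by (rule fr[OF i w k]) (use eX f w k in auto)
      moreover have "map (\<lambda>m. if m = Suc k then f (Suc k) w else ?e i w m) [k+1..<n+1] =
          f (Suc k) w # map (?e i w) [Suc k+1..<n+1]"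
        using upt[of k] k by (simp del: upt_Suc)
      ultimately show "freeze (b (Suc k) i w) [f (Suc k) w] \<in> T k"
        by (simp add: b_def freeze_freeze del: upt_Suc)
    qed (use M k in auto)
    then show ?thesis unfolding S_def[of k] using b_Suc[of k] k by simp
  qed
  have chain: "S (n - j) \<le> (\<Prod>k\<in>{n-j..<n}. 1 + \<beta> k powr p) * (\<Prod>m\<in>{n-j+1..n}. M m) powr p * S n" if "j < n" for j
    using that
  proof (induction j)
    case (Suc j)
    define k where "k = n - Suc j"
    have k: "k \<in> {1..<n}" "n - j = Suc k" using Suc.prems by (auto simp: k_def)
    have sp: "{k..<n} = insert k {Suc k..<n}" "{k+1..n} = insert (Suc k) {Suc k+1..n}" using k by auto
    have P: "(\<Prod>m\<in>{k+1..n}. M m) powr p = M (Suc k) powr p * (\<Prod>m\<in>{Suc k+1..n}. M m) powr p"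
      unfolding sp(2) using M(2) k by (subst prod.insert) (auto intro!: powr_mult prod_nonneg)
    have "S k \<le> (1 + \<beta> k powr p) * M (Suc k) powr p * S (Suc k)" by (rule step[OF k(1)])
    also have "\<dots> \<le> (1 + \<beta> k powr p) * M (Suc k) powr p *
        ((\<Prod>k\<in>{Suc k..<n}. 1 + \<beta> k powr p) * (\<Prod>m\<in>{Suc k+1..n}. M m) powr p * S n)"
      using Suc.IH Suc.prems k(2) by (intro mult_left_mono) auto
    also have "\<dots> = (\<Prod>k\<in>{k..<n}. 1 + \<beta> k powr p) * (\<Prod>m\<in>{k+1..n}. M m) powr p * S n"
      unfolding P unfolding sp(1) by (simp add: mult_ac)
    finally show ?case unfolding k_def .
  qed simp
  let ?L = "\<Sum>w\<in>W. \<Sum>\<epsilon>\<in>signs N. norm (\<Sum>i<N. \<epsilon> i *\<^sub>R multop_apply (b 1 i w) [?e i w 1]) powr p"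
  \<comment> \<open>Filling the first argument leaves an element of Y instead of an operator, so
    this step is Stein's inequality in Y, with the constant of index 0.\<close>
  have "?L \<le> (1 + \<beta> 0 powr p) * M 1 powr p * S 1"
    unfolding S_def
  proof (rule stein_step[where \<Phi> = "\<lambda>B x. multop_apply B [x]", OF Y W refine b_const multop_apply_sum])
    show "norm (multop_apply B [x]) \<le> norm B * norm x" for B :: "('x, 'y) multop" and x
      using norm_multop_apply[of B "[x]"] by simp
    show "multop_apply (b 1 i w) [?e i w 1] = cavg W (q i) (\<lambda>w'. multop_apply (b 1 i w) [f 1 w']) w"
      if "i < N" "w \<in> W" for i w
      using lin[of 0 i w "[]"] n that by simp
  qed (use M n in auto)
  also have "S 1 \<le> (\<Prod>k\<in>{1..<n}. 1 + \<beta> k powr p) * (\<Prod>m\<in>{1+1..n}. M m) powr p * S n"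
    using chain[of "n - 1"] n by simp
  also have "(1 + \<beta> 0 powr p) * M 1 powr p * ((\<Prod>k\<in>{1..<n}. 1 + \<beta> k powr p) * (\<Prod>m\<in>{1+1..n}. M m) powr p * S n) =
      (\<Prod>k<n. 1 + \<beta> k powr p) * (\<Prod>m=1..n. M m) powr p * S n"
  proof -
    have sp: "{..<n} = insert 0 {1..<n}" "{1..n} = insert 1 {1+1..n}" using n by auto
    have P: "(\<Prod>m\<in>{1..n}. M m) powr p = M 1 powr p * (\<Prod>m\<in>{1+1..n}. M m) powr p"
      unfolding sp(2) using M(2) n by (subst prod.insert) (auto intro!: powr_mult prod_nonneg)
    show ?thesis unfolding P unfolding sp(1) by (simp add: mult_ac)
  qed
  also have "?L = (\<Sum>w\<in>W. \<Sum>\<epsilon>\<in>signs N. norm (\<Sum>i<N. \<epsilon> i *\<^sub>R multop_apply (a i w) (map (?e i w) [1..<n+1])) powr p)"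
    using upt[of 0] n by (simp add: b_def freeze.rep_eq del: upt_Suc)
  also have "S n = (\<Sum>w\<in>W. \<Sum>\<epsilon>\<in>signs N. norm (\<Sum>i<N. \<epsilon> i *\<^sub>R a i w) powr p)"
    by (simp add: S_def b_def freeze_Nil)
  finally show ?thesis by (simp add: mult_left_mono)
qed

section \<open>The John-Nirenberg inequality\<close>

lemma powr_add_le:
  fixes x y p :: real
  assumes "0 \<le> x" "0 \<le> y" "0 < p"
  shows "(x + y) powr p \<le> 2 powr p * (x powr p + y powr p)"
proof -
  have "(x + y) powr p \<le> (2 * max x y) powr p"
    using assms by (intro powr_mono2) auto
  also have "\<dots> = 2 powr p * max x y powr p"
    using assms by (simp add: powr_mult)
  also have "\<dots> \<le> 2 powr p * (x powr p + y powr p)"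
    by (intro mult_left_mono) (auto simp: max_def)
  finally show ?thesis .
qed

text \<open>Meant for a weight m that counts the sign patterns that have stopped and for \<tau> the
  contribution of the later levels, which is only estimated cell by cell.\<close>

lemma sum_cells_mono:
  fixes m \<tau> :: "'w \<Rightarrow> real" and L :: real
  assumes C: "finite C"
    and m: "\<And>w w'. w \<in> C \<Longrightarrow> w' \<in> C \<Longrightarrow> \<kappa> w = \<kappa> w' \<Longrightarrow> m w = m w'" "\<And>w. w \<in> C \<Longrightarrow> 0 \<le> m w"
    and \<tau>: "\<And>w. w \<in> C \<Longrightarrow> (\<Sum>w'\<in>{w'\<in>C. \<kappa> w' = \<kappa> w}. \<tau> w') \<le> L * card {w'\<in>C. \<kappa> w' = \<kappa> w}"
  shows "(\<Sum>w\<in>C. m w * \<tau> w) \<le> L * (\<Sum>w\<in>C. m w)"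
proof -
  have "(\<Sum>w\<in>C. m w * \<tau> w) = (\<Sum>c\<in>\<kappa> ` C. \<Sum>w\<in>{w\<in>C. \<kappa> w = c}. m w * \<tau> w)"
    by (rule sum.image_gen[OF C])
  also have "\<dots> \<le> (\<Sum>c\<in>\<kappa> ` C. \<Sum>w\<in>{w\<in>C. \<kappa> w = c}. L * m w)"
  proof (rule sum_mono)
    fix c assume "c \<in> \<kappa> ` C"
    then obtain w0 where w0: "w0 \<in> C" "c = \<kappa> w0" by auto
    let ?A = "{w\<in>C. \<kappa> w = c}"
    have mc: "m w = m w0" if "w \<in> ?A" for w using m(1)[of w w0] w0 that by simp
    have "(\<Sum>w\<in>?A. m w * \<tau> w) = m w0 * (\<Sum>w\<in>?A. \<tau> w)"
      unfolding sum_distrib_left by (intro sum.cong refl) (simp add: mc)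
    also have "\<dots> \<le> m w0 * (L * card ?A)"
      using \<tau>[OF w0(1)] m(2)[OF w0(1)] w0(2) by (intro mult_left_mono) auto
    also have "\<dots> = (\<Sum>w\<in>?A. L * m w)"
      using mc by simp
    finally show "(\<Sum>w\<in>?A. m w * \<tau> w) \<le> (\<Sum>w\<in>?A. L * m w)" .
  qed
  also have "\<dots> = (\<Sum>w\<in>C. L * m w)"
    by (rule sum.image_gen[OF C, symmetric])
  finally show ?thesis by (simp add: sum_distrib_left)
qed

text \<open>Stop the partial sums when they exceed \<open>L * B\<close>. By reflection of the later signs this happens with
  probability at most \<open>2 / L powr r\<close>, the stopped sum is at most \<open>(L + 1) * B\<close>, and the remaining
  sum is one of the same kind on smaller cells, which gives a self-improving bound. The signs are
  part of the probability space, so Kahane's inequality is not needed.\<close>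

lemma john_nirenberg:
  fixes q :: "nat \<Rightarrow> 'w \<Rightarrow> 'c" and a :: "nat \<Rightarrow> 'w \<Rightarrow> 'a::real_normed_vector"
  assumes W: "finite W"
    and refine: "\<And>i w w'. Suc i < N \<Longrightarrow> w \<in> W \<Longrightarrow> w' \<in> W \<Longrightarrow> q (Suc i) w = q (Suc i) w' \<Longrightarrow> q i w = q i w'"
    and const: "\<And>i w w'. i < N \<Longrightarrow> w \<in> W \<Longrightarrow> w' \<in> W \<Longrightarrow> q i w = q i w' \<Longrightarrow> a i w = a i w'"
    and r: "0 < r" and p: "0 < p" and B: "0 < B"
    and jump: "\<And>i w. i < N \<Longrightarrow> w \<in> W \<Longrightarrow> norm (a i w) \<le> B"
    and bmo: "\<And>j w. j < N \<Longrightarrow> w \<in> W \<Longrightarrow>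
      (\<Sum>w'\<in>{w'\<in>W. q j w' = q j w}. \<Sum>\<epsilon>\<in>signs N. norm (\<Sum>i\<in>{j..<N}. \<epsilon> i *\<^sub>R a i w') powr r) \<le>
      B powr r * card {w'\<in>W. q j w' = q j w} * 2 ^ N"
    and j: "j \<le> N" and w0: "w0 \<in> W"
  shows "(\<Sum>w'\<in>{w'\<in>W. q j w' = q j w0}. \<Sum>\<epsilon>\<in>signs N. norm (\<Sum>i\<in>{j..<N}. \<epsilon> i *\<^sub>R a i w') powr p) \<le>
    2 powr (p + 1) * (2 powr ((p + 2) / r) + 1) powr p * B powr p * card {w'\<in>W. q j w' = q j w0} * 2 ^ N"
  using j w0
\<comment> \<open>Induction on the number of levels left: after stopping at k the remaining sum
  starts at level k + 1, where the bound is already known with the same constant.\<close>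
proof (induction "N - j" arbitrary: j w0 rule: less_induct)
  case less
  show ?case
  proof (cases "j = N")
    case True
    then show ?thesis using p by simp
  next
  case False
  \<comment> \<open>As \<open>L powr r = 2 powr (p + 2)\<close>, stopping has proportion at most 2 /
    2^(p+2), which times 2^p and K gives K / 2. The sum up to the stopping level costs 2^p (L +
    1)^p, the other half of K; so the bound reproduces itself.\<close>
  define L :: real where "L = 2 powr ((p + 2) / r)"
  define K where "K = 2 powr (p + 1) * (L + 1) powr p"
  have L: "L > 0" "L powr r = 2 powr (p + 2)" using r by (simp_all add: L_def powr_powr)
  have K: "K \<ge> 0" by (simp add: K_def)
  have j: "j < N" using less.prems False by simp
  define C where "C = {w'\<in>W. q j w' = q j w0}"
  have C: "finite C" "C \<subseteq> W" using W by (auto simp: C_def)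
  define Z where "Z = C \<times> signs N"
  have Z: "finite Z" "card Z = card C * 2 ^ N" using C by (auto simp: Z_def card_cartesian_product)
  have cp: "(\<Sum>z\<in>Z. F z) = (\<Sum>w\<in>C. \<Sum>\<epsilon>\<in>signs N. F (w, \<epsilon>))" for F :: "'w \<times> (nat \<Rightarrow> real) \<Rightarrow> real"
    unfolding Z_def by (simp add: sum.cartesian_product)
  define s where "s k = (\<lambda>(w, \<epsilon>). \<Sum>i\<in>{j..<k}. \<epsilon> i *\<^sub>R a i w)" for k
  define t where "t k = (\<lambda>(w, \<epsilon>). \<Sum>i\<in>{k..<N}. \<epsilon> i *\<^sub>R a i w)" for k
  \<comment> \<open>The event that the term of index k takes the partial sums above
    \<open>L * B\<close> for the first time.\<close>
  define Ev where "Ev k = {z\<in>Z. L * B < norm (s (Suc k) z) \<and> (\<forall>l\<in>{j..<k}. norm (s (Suc l) z) \<le> L * B)}" for k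
  have Ev: "finite (Ev k)" "Ev k \<subseteq> Z" for k using Z by (auto simp: Ev_def)
  have IH: "(\<Sum>w'\<in>{w'\<in>W. q k w' = q k w}. \<Sum>\<epsilon>\<in>signs N. norm (\<Sum>i\<in>{k..<N}. \<epsilon> i *\<^sub>R a i w') powr p) \<le>
      K * B powr p * card {w'\<in>W. q k w' = q k w} * 2 ^ N" if "j < k" "k \<le> N" "w \<in> W" for k w
    using less.hyps[of k w] that j by (simp add: K_def L_def)
  have refine_le: "q j w = q j w'" if "w \<in> W" "w' \<in> W" "j \<le> k" "k < N" "q k w = q k w'" for k w w'
    using that(3,4,5)
  proof (induction k rule: dec_induct)
    case (step k)
    then show ?case using refine[OF _ that(1,2), of k] by simp
  qed
  have split: "s N z = s (Suc k) z + t (Suc k) z" if "j \<le> k" "k < N" for k z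
    by (cases z, simp only: s_def t_def prod.case, rule sum.atLeastLessThan_concat[symmetric]) (use that in auto)
  have pw: "norm (s N z) powr p \<le> 2 powr p * ((L + 1) * B) powr p +
      (\<Sum>k\<in>{j..<N}. 2 powr p * (indicator (Ev k) z * norm (t (Suc k) z) powr p))" (is "_ \<le> _ + ?R")
    if z: "z \<in> Z" for z
  proof (cases "\<exists>k\<in>{j..<N}. z \<in> Ev k")
    case False
    have "norm (s (Suc l) z) \<le> L * B" if "l \<in> {j..<N}" for l
      using that
    proof (induction l rule: less_induct)
      case (less l)
      have "\<forall>i\<in>{j..<l}. norm (s (Suc i) z) \<le> L * B" using less by auto
      moreover have "z \<notin> Ev l" using False less.prems by blast
      ultimately show ?case using z by (simp add: Ev_def not_less)
    qed
    from this[of "N - 1"] j have "norm (s N z) \<le> L * B" by simp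
    also have "\<dots> \<le> (L + 1) * B" using B by (simp add: algebra_simps)
    finally have "norm (s N z) powr p \<le> ((L + 1) * B) powr p" using p by (intro powr_mono2) auto
    also have "\<dots> \<le> 2 powr p * ((L + 1) * B) powr p"
      using p by (simp add: mult_le_cancel_right1 ge_one_powr_ge_zero)
    finally have 1: "norm (s N z) powr p \<le> 2 powr p * ((L + 1) * B) powr p" .
    have "0 \<le> ?R" by (intro sum_nonneg) auto
    then show ?thesis using 1 by linarith
  next
    case True
    then obtain k where k: "k \<in> {j..<N}" and zk: "z \<in> Ev k" by blast
    obtain w \<epsilon> where wz: "z = (w, \<epsilon>)" "w \<in> W" "\<epsilon> \<in> signs N" using z C(2) by (auto simp: Z_def)
    have "norm (s k z) \<le> L * B"
    proof (cases "k = j")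
      case True
      then show ?thesis using L B by (simp add: s_def split: prod.splits)
    next
      case False
      then obtain l where "k = Suc l" "l \<in> {j..<k}" using k by (cases k) auto
      then show ?thesis using zk by (auto simp: Ev_def)
    qed
    moreover have "s (Suc k) z = s k z + \<epsilon> k *\<^sub>R a k w" using k by (simp add: s_def wz)
    moreover have "norm (\<epsilon> k *\<^sub>R a k w) \<le> B"
      using jump[of k w] signs_cases[OF wz(3), of k] k wz(2) by auto
    ultimately have 1: "norm (s (Suc k) z) \<le> (L + 1) * B"
      using norm_triangle_ineq[of "s k z" "\<epsilon> k *\<^sub>R a k w"] by (simp add: algebra_simps)
    have "norm (s N z) \<le> (L + 1) * B + norm (t (Suc k) z)"
      using split[of k z] k 1 norm_triangle_ineq[of "s (Suc k) z" "t (Suc k) z"] by simp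
    then have "norm (s N z) powr p \<le> ((L + 1) * B + norm (t (Suc k) z)) powr p"
      using p by (intro powr_mono2) auto
    also have "\<dots> \<le> 2 powr p * (((L + 1) * B) powr p + norm (t (Suc k) z) powr p)"
      using L B p by (intro powr_add_le) auto
    also have "\<dots> = 2 powr p * ((L + 1) * B) powr p + 2 powr p * (indicator (Ev k) z * norm (t (Suc k) z) powr p)"
      using zk by (simp add: distrib_left)
    also have "\<dots> \<le> 2 powr p * ((L + 1) * B) powr p + ?R"
      using k by (intro add_left_mono member_le_sum) auto
    finally show ?thesis .
  qed
  \<comment> \<open>Stopping at k depends on the signs up to k and on coefficients that are constant
    on the cells of level k + 1. It is independent of the later signs, so the induction hypothesis
    applies on each of these cells.\<close>
  have tail: "(\<Sum>z\<in>Z. indicator (Ev k) z * norm (t (Suc k) z) powr p) \<le> K * B powr p * card (Ev k)"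
    if k: "k \<in> {j..<N}" for k
  proof (cases "Suc k = N")
    case True
    then have "t (Suc k) z = 0" for z by (simp add: t_def split: prod.splits)
    then show ?thesis using p K by simp
  next
    case False
    then have kN: "Suc k < N" using k by simp
    define I where "I w \<epsilon> = (L * B < norm (\<Sum>i\<in>{j..<Suc k}. \<epsilon> i *\<^sub>R a i w) \<and>
      (\<forall>l\<in>{j..<k}. norm (\<Sum>i\<in>{j..<Suc l}. \<epsilon> i *\<^sub>R a i w) \<le> L * B))" for w \<epsilon>
    have I_Ev: "indicator (Ev k) (w, \<epsilon>) = of_bool (I w \<epsilon>)" if "w \<in> C" "\<epsilon> \<in> signs N" for w \<epsilon>
      using that by (auto simp: Ev_def I_def s_def Z_def indicator_def)
    have I_eps: "I w \<epsilon> = I w \<epsilon>'" if "\<And>i. i < Suc k \<Longrightarrow> \<epsilon> i = \<epsilon>' i" for w \<epsilon> \<epsilon>'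
    proof -
      have "(\<Sum>i\<in>{j..<Suc l}. \<epsilon> i *\<^sub>R a i w) = (\<Sum>i\<in>{j..<Suc l}. \<epsilon>' i *\<^sub>R a i w)" if "l \<le> k" for l
        using \<open>\<And>i. i < Suc k \<Longrightarrow> \<epsilon> i = \<epsilon>' i\<close> that by (intro sum.cong refl) auto
      then show ?thesis unfolding I_def by (simp del: sum.op_ivl_Suc)
    qed
    define m where "m w = (\<Sum>\<epsilon>\<in>signs N. of_bool (I w \<epsilon>) :: real)" for w
    define \<tau> where "\<tau> w = (\<Sum>\<epsilon>\<in>signs N. norm (\<Sum>i\<in>{Suc k..<N}. \<epsilon> i *\<^sub>R a i w) powr p)" for w
    have ind: "2 ^ N * (\<Sum>\<epsilon>\<in>signs N. of_bool (I w \<epsilon>) * norm (\<Sum>i\<in>{Suc k..<N}. \<epsilon> i *\<^sub>R a i w) powr p) = m w * \<tau> w" for w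
      unfolding m_def \<tau>_def
    proof (rule sum_signs_split[of "Suc k"])
      fix \<epsilon> \<epsilon>' :: "nat \<Rightarrow> real" assume "\<And>i. Suc k \<le> i \<Longrightarrow> \<epsilon> i = \<epsilon>' i"
      then show "norm (\<Sum>i\<in>{Suc k..<N}. \<epsilon> i *\<^sub>R a i w) powr p = norm (\<Sum>i\<in>{Suc k..<N}. \<epsilon>' i *\<^sub>R a i w) powr p"
        by (intro arg_cong2[of _ _ _ _ "(powr)"] arg_cong[of _ _ norm] sum.cong refl) auto
    next
      fix \<epsilon> \<epsilon>' :: "nat \<Rightarrow> real" assume "\<And>i. i < Suc k \<Longrightarrow> \<epsilon> i = \<epsilon>' i"
      then have "I w \<epsilon> = I w \<epsilon>'" by (rule I_eps)
      then show "(of_bool (I w \<epsilon>) :: real) = of_bool (I w \<epsilon>')" by (rule arg_cong)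
    qed
    have "(\<Sum>z\<in>Z. indicator (Ev k) z * norm (t (Suc k) z) powr p) =
        (\<Sum>w\<in>C. \<Sum>\<epsilon>\<in>signs N. indicator (Ev k) (w, \<epsilon>) * norm (t (Suc k) (w, \<epsilon>)) powr p)"
      by (rule cp)
    also have "\<dots> = (\<Sum>w\<in>C. \<Sum>\<epsilon>\<in>signs N. of_bool (I w \<epsilon>) * norm (\<Sum>i\<in>{Suc k..<N}. \<epsilon> i *\<^sub>R a i w) powr p)"
      by (intro sum.cong refl) (simp only: I_Ev t_def prod.case)
    finally have "2 ^ N * (\<Sum>z\<in>Z. indicator (Ev k) z * norm (t (Suc k) z) powr p) =
        (\<Sum>w\<in>C. 2 ^ N * (\<Sum>\<epsilon>\<in>signs N. of_bool (I w \<epsilon>) * norm (\<Sum>i\<in>{Suc k..<N}. \<epsilon> i *\<^sub>R a i w) powr p))"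
      by (simp only: sum_distrib_left)
    also have "\<dots> = (\<Sum>w\<in>C. m w * \<tau> w)" unfolding ind ..
    also have "\<dots> \<le> (K * B powr p * 2 ^ N) * (\<Sum>w\<in>C. m w)"
    proof (rule sum_cells_mono[OF C(1), where \<kappa> = "q (Suc k)"])
      fix w w' assume w: "w \<in> C" "w' \<in> C" "q (Suc k) w = q (Suc k) w'"
      have "q i w = q i w'" if "i \<le> k" for i
      proof -
        have "i \<le> Suc k" using that by simp
        then show ?thesis using w(3)
        proof (induction rule: inc_induct)
          case (step l)
          show ?case using w C(2) kN step by (intro refine[of l]) auto
        qed
      qed
      then have "a i w = a i w'" if "i \<le> k" for i
        using const[of i w w'] w C(2) that kN by auto
      then have "(\<Sum>i\<in>{j..<Suc l}. \<epsilon> i *\<^sub>R a i w) = (\<Sum>i\<in>{j..<Suc l}. \<epsilon> i *\<^sub>R a i w')" if "l \<le> k" for l and \<epsilon> :: "nat \<Rightarrow> real"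
        using that by (intro sum.cong refl) auto
      then have "I w \<epsilon> = I w' \<epsilon>" for \<epsilon> unfolding I_def by (simp del: sum.op_ivl_Suc)
      then show "m w = m w'" unfolding m_def by simp
    next
      fix w assume w: "w \<in> C"
      have "{w'\<in>C. q (Suc k) w' = q (Suc k) w} = {w'\<in>W. q (Suc k) w' = q (Suc k) w}"
        using w refine_le[of _ w "Suc k"] kN k by (auto simp: C_def)
      then show "(\<Sum>w'\<in>{w'\<in>C. q (Suc k) w' = q (Suc k) w}. \<tau> w') \<le>
          K * B powr p * 2 ^ N * card {w'\<in>C. q (Suc k) w' = q (Suc k) w}"
        using IH[of "Suc k" w] kN k w C(2) unfolding \<tau>_def by (simp add: mult_ac subset_iff)
    qed (simp add: m_def sum_nonneg)
    also have "(\<Sum>w\<in>C. m w) = (\<Sum>w\<in>C. \<Sum>\<epsilon>\<in>signs N. indicator (Ev k) (w, \<epsilon>))"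
      unfolding m_def by (intro sum.cong refl) (simp only: I_Ev)
    also have "\<dots> = (\<Sum>z\<in>Z. indicator (Ev k) z)"
      by (rule cp[symmetric])
    also have "(\<Sum>z\<in>Z. indicator (Ev k) z) = real (card (Ev k))"
    proof -
      have "(\<Sum>z\<in>Z. indicator (Ev k) z) = (\<Sum>z\<in>Ev k. 1 :: real)"
        using Ev[of k] Z(1) by (intro sum.mono_neutral_cong_right) auto
      then show ?thesis by simp
    qed
    finally show ?thesis by (simp add: mult_ac)
  qed
  \<comment> \<open>Levy's reflection: reversing the signs after k preserves the event, and the two
    full sums have the stopped sum as their mean, so at least one of them is large as well.\<close>
  have levy: "card (Ev k) \<le> 2 * card {z\<in>Ev k. L * B < norm (s N z)}" if k: "k \<in> {j..<N}" for k
  proof -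
    let ?G = "{z\<in>Ev k. L * B < norm (s N z)}"
    define \<delta> :: "nat \<Rightarrow> real" where "\<delta> i = (if k < i \<and> i < N then -1 else 1)" for i
    define \<rho> where "\<rho> = (\<lambda>(w::'w, \<epsilon>). (w, \<lambda>i. \<delta> i * \<epsilon> i))"
    have \<delta>: "\<delta> \<in> signs N" by (auto simp: signs_def \<delta>_def)
    have \<rho>\<rho>: "\<rho> (\<rho> z) = z" for z
      using signs_nth_sq[OF \<delta>] by (auto simp: \<rho>_def mult.assoc[symmetric] split: prod.splits)
    have \<rho>Z: "\<rho> z \<in> Z" if "z \<in> Z" for z using that signs_mult[OF _ \<delta>] by (auto simp: \<rho>_def Z_def)
    have s\<rho>: "s (Suc l) (\<rho> z) = s (Suc l) z" if "l \<le> k" for l z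
      using that by (auto simp: s_def \<rho>_def \<delta>_def split: prod.splits intro!: sum.cong)
    have t\<rho>: "t (Suc k) (\<rho> z) = - t (Suc k) z" for z
      by (auto simp: t_def \<rho>_def \<delta>_def sum_negf[symmetric] split: prod.splits intro!: sum.cong)
    have \<rho>Ev: "\<rho> z \<in> Ev k" if "z \<in> Ev k" for z
      using that \<rho>Z s\<rho> by (auto simp: Ev_def)
    have "Ev k \<subseteq> ?G \<union> \<rho> ` ?G"
    proof
      fix z assume z: "z \<in> Ev k"
      have "2 *\<^sub>R s (Suc k) z = s N z + s N (\<rho> z)"
        using k s\<rho>[of k z] t\<rho>[of z] by (simp add: split[of k] scaleR_2)
      then have "2 * norm (s (Suc k) z) \<le> norm (s N z) + norm (s N (\<rho> z))"
        using norm_triangle_ineq[of "s N z" "s N (\<rho> z)"] by (metis norm_scaleR abs_numeral)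
      moreover have "L * B < norm (s (Suc k) z)" using z by (simp add: Ev_def)
      ultimately have "L * B < norm (s N z) \<or> L * B < norm (s N (\<rho> z))" by linarith
      then show "z \<in> ?G \<union> \<rho> ` ?G"
        using z \<rho>Ev[OF z] \<rho>\<rho>[of z] by (metis (mono_tags, lifting) UnI1 UnI2 imageI mem_Collect_eq)
    qed
    then have "card (Ev k) \<le> card (?G \<union> \<rho> ` ?G)" using Ev(1)[of k] by (intro card_mono) auto
    also have "\<dots> \<le> card ?G + card (\<rho> ` ?G)" by (rule card_Un_le)
    also have "card (\<rho> ` ?G) \<le> card ?G" using Ev(1)[of k] by (intro card_image_le) auto
    finally show ?thesis by simp
  qed
  have disj: "Ev k \<inter> Ev l = {}" if "k \<in> {j..<N}" "l \<in> {j..<N}" "k < l" for k l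
    using that by (force simp: Ev_def not_less)
  let ?G = "{z\<in>Z. L * B < norm (s N z)}"
  have "(\<Sum>k\<in>{j..<N}. card {z\<in>Ev k. L * B < norm (s N z)}) = card (\<Union>k\<in>{j..<N}. {z\<in>Ev k. L * B < norm (s N z)})"
  proof (rule card_UN_disjoint[symmetric])
    show "\<forall>k\<in>{j..<N}. \<forall>l\<in>{j..<N}. k \<noteq> l \<longrightarrow>
        {z\<in>Ev k. L * B < norm (s N z)} \<inter> {z\<in>Ev l. L * B < norm (s N z)} = {}"
    proof (intro ballI impI)
      fix k l assume kl: "k \<in> {j..<N}" "l \<in> {j..<N}" "k \<noteq> l"
      then have "Ev k \<inter> Ev l = {}" using disj[of k l] disj[of l k] by (cases "k < l") auto
      then show "{z\<in>Ev k. L * B < norm (s N z)} \<inter> {z\<in>Ev l. L * B < norm (s N z)} = {}" by blast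
    qed
  qed (use Ev in auto)
  also have "\<dots> \<le> card ?G" using Z(1) Ev(2) by (intro card_mono) auto
  finally have cG: "(\<Sum>k\<in>{j..<N}. card {z\<in>Ev k. L * B < norm (s N z)}) \<le> card ?G" .
  \<comment> \<open>Chebyshev's inequality with exponent r, from the BMO hypothesis on the cell of
    level j.\<close>
  have "(L * B) powr r * card ?G = (\<Sum>z\<in>?G. (L * B) powr r)" by simp
  also have "\<dots> \<le> (\<Sum>z\<in>?G. norm (s N z) powr r)"
    using r L B by (intro sum_mono powr_mono2) auto
  also have "\<dots> \<le> (\<Sum>z\<in>Z. norm (s N z) powr r)"
    using Z(1) by (intro sum_mono2) auto
  also have "\<dots> \<le> B powr r * card Z"
    using bmo[of j w0] less.prems j Z(2)
    unfolding cp by (simp add: s_def C_def mult_ac)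
  finally have "(L powr r * card ?G) * B powr r \<le> real (card Z) * B powr r"
    using L B by (simp add: powr_mult mult_ac)
  then have mk: "2 powr (p + 2) * card ?G \<le> card Z"
    using B unfolding L(2) by (subst (asm) mult_le_cancel_right_pos) auto
  have "(\<Sum>k\<in>{j..<N}. real (card (Ev k))) \<le> (\<Sum>k\<in>{j..<N}. real (2 * card {z\<in>Ev k. L * B < norm (s N z)}))"
    by (intro sum_mono of_nat_mono levy)
  also have "\<dots> = 2 * real (\<Sum>k\<in>{j..<N}. card {z\<in>Ev k. L * B < norm (s N z)})"
    by (simp add: sum_distrib_left)
  also have "\<dots> \<le> 2 * real (card ?G)" by (rule mult_left_mono[OF of_nat_mono[OF cG]]) simp
  finally have evs: "(\<Sum>k\<in>{j..<N}. real (card (Ev k))) \<le> 2 * real (card ?G)" .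
  have "(\<Sum>z\<in>Z. norm (s N z) powr p) \<le> (\<Sum>z\<in>Z. 2 powr p * ((L + 1) * B) powr p +
      (\<Sum>k\<in>{j..<N}. 2 powr p * (indicator (Ev k) z * norm (t (Suc k) z) powr p)))"
    by (intro sum_mono pw)
  also have "\<dots> = 2 powr p * ((L + 1) * B) powr p * card Z +
      2 powr p * (\<Sum>k\<in>{j..<N}. \<Sum>z\<in>Z. indicator (Ev k) z * norm (t (Suc k) z) powr p)"
    by (simp add: sum.distrib sum.swap[of _ _ Z] sum_distrib_left)
  also have "\<dots> \<le> 2 powr p * ((L + 1) * B) powr p * card Z +
      2 powr p * (\<Sum>k\<in>{j..<N}. K * B powr p * card (Ev k))"
    by (intro add_left_mono mult_left_mono sum_mono tail) auto
  also have "\<dots> = 2 powr p * ((L + 1) * B) powr p * card Z +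
      2 powr p * (K * B powr p * (\<Sum>k\<in>{j..<N}. real (card (Ev k))))"
    by (simp add: sum_distrib_left)
  also have "\<dots> \<le> 2 powr p * ((L + 1) * B) powr p * card Z + 2 powr p * (K * B powr p * (2 * real (card ?G)))"
    using K by (intro add_left_mono mult_left_mono evs) auto
  also have "\<dots> = K / 2 * B powr p * card Z + K / 2 * B powr p * (2 powr (p + 2) * card ?G)"
    using L B by (simp add: K_def powr_mult powr_add)
  also have "\<dots> \<le> K / 2 * B powr p * card Z + K / 2 * B powr p * card Z"
    using K by (intro add_left_mono mult_left_mono mk) auto
  also have "\<dots> = K * B powr p * card C * 2 ^ N" by (simp add: Z(2))
  also have "(\<Sum>z\<in>Z. norm (s N z) powr p) = (\<Sum>w'\<in>C. \<Sum>\<epsilon>\<in>signs N. norm (\<Sum>i\<in>{j..<N}. \<epsilon> i *\<^sub>R a i w') powr p)"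
    unfolding cp by (simp add: s_def)
  finally show ?thesis unfolding C_def K_def L_def .
  qed
qed

section \<open>Dyadic cubes and Haar functions\<close>

definition grid_shift :: "(int \<Rightarrow> real^'d) \<Rightarrow> int \<Rightarrow> real^'d" where
  "grid_shift \<omega> k = (\<Sum>\<^sub>\<infinity>j\<in>{j. 2 powi (-j) < (2 powi (-k) :: real)}. (2 powi (-j)) *\<^sub>R \<omega> j)"

text \<open>Level k means side length \<open>2 powi (-k)\<close>. With a cube described as a fibre
  of an integer-valued index, disjointness of cubes of one level is automatic and nestedness becomes
  integer division.\<close>

definition cube_index :: "(int \<Rightarrow> real^'d) \<Rightarrow> int \<Rightarrow> real^'d \<Rightarrow> int^'d" where
  "cube_index \<omega> k x = (\<chi> i. \<lfloor>2 powi k * (x $ i - grid_shift \<omega> k $ i)\<rfloor>)"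

definition cube_at :: "(int \<Rightarrow> real^'d) \<Rightarrow> int \<Rightarrow> real^'d \<Rightarrow> (real^'d) set" where
  "cube_at \<omega> k x = {y. cube_index \<omega> k y = cube_index \<omega> k x}"

lemma powi_less_iff: "(2 powi (-j) < (2 powi (-k) :: real)) \<longleftrightarrow> k < j"
proof
  assume "k < j"
  then show "2 powi (-j) < (2 powi (-k) :: real)" by (intro power_int_strict_increasing) auto
next
  assume *: "2 powi (-j) < (2 powi (-k) :: real)"
  show "k < j"
  proof (rule ccontr)
    assume "\<not> k < j"
    then have "2 powi (-k) \<le> (2 powi (-j) :: real)"
      using power_int_strict_increasing[of "-k" "-j" "2::real"] by (cases "j = k") auto
    then show False using * by simp
  qed
qed

lemma summable_on_powi: "(\<lambda>j. 2 powi (-j) :: real) summable_on {k<..}"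
proof -
  have "summable (\<lambda>n. 2 powi (-(k+1)) * (1/2::real) ^ n)"
    by (intro summable_mult summable_geometric) simp
  then have "(\<lambda>n. 2 powi (-(k+1)) * (1/2::real) ^ n) summable_on UNIV"
    by (subst summable_on_UNIV_nonneg_real_iff) auto
  moreover have "2 powi (-(k+1)) * (1/2::real) ^ n = 2 powi (-(k + 1 + int n))" for n
  proof -
    have e: "-(k + 1 + int n) = -(k+1) + - int n" by simp
    have "2 powi (-(k + 1 + int n)) = (2 powi (-(k+1)) * 2 powi (- int n) :: real)"
      unfolding e by (rule power_int_add) simp
    then show ?thesis by (simp add: power_int_minus power_one_over inverse_eq_divide)
  qed
  ultimately have "(\<lambda>n. 2 powi (-(k + 1 + int n)) :: real) summable_on UNIV"
    by simp
  moreover have "bij_betw (\<lambda>n. k + 1 + int n) UNIV {k<..}"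
    by (rule bij_betw_byWitness[where f' = "\<lambda>j. nat (j - k - 1)"]) auto
  ultimately show ?thesis
    using summable_on_reindex_bij_betw[of "\<lambda>n. k + 1 + int n" UNIV "{k<..}" "\<lambda>j. 2 powi (-j) :: real"] by simp
qed

text \<open>Splits off the coarsest term. Summability of the rest has to be proved first, since
  \<open>infsum\<close> is 0 for families that are not summable.\<close>

lemma grid_shift_Suc:
  fixes \<omega> :: "int \<Rightarrow> real^'d"
  assumes "\<omega> \<in> dyadic_shifts"
  shows "grid_shift \<omega> k = (2 powi (-(k+1))) *\<^sub>R \<omega> (k+1) + grid_shift \<omega> (k+1)"
proof -
  have b: "norm (\<omega> j) \<le> real CARD('d)" for j
  proof -
    have "norm (\<omega> j) \<le> (\<Sum>i\<in>UNIV. \<bar>\<omega> j $ i\<bar>)" by (rule norm_le_l1_cart)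
    also have "\<dots> \<le> (\<Sum>i\<in>(UNIV::'d set). 1)"
      using assms by (intro sum_mono) (auto simp: dyadic_shifts_def split: if_splits; metis abs_0 abs_1 order_refl zero_le_one)
    finally show ?thesis by simp
  qed
  have s: "(\<lambda>j. (2 powi (-j)) *\<^sub>R \<omega> j) summable_on {k+1<..}"
  proof (rule abs_summable_summable, rule summable_on_comparison_test)
    show "(\<lambda>j. real CARD('d) * (2 powi (-j) :: real)) summable_on {k+1<..}"
      by (rule summable_on_cmult_right[OF summable_on_powi])
    show "norm ((2 powi (-j)) *\<^sub>R \<omega> j) \<le> real CARD('d) * (2 powi (-j) :: real)" for j
      using b[of j] by (simp add: mult.commute mult_right_mono)
  qed simp
  have "{j. k < j} = insert (k+1) {k+1<..}" by auto
  then have "grid_shift \<omega> k = infsum (\<lambda>j. (2 powi (-j)) *\<^sub>R \<omega> j) (insert (k+1) {k+1<..})"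
    unfolding grid_shift_def powi_less_iff by simp
  also have "\<dots> = (2 powi (-(k+1))) *\<^sub>R \<omega> (k+1) + infsum (\<lambda>j. (2 powi (-j)) *\<^sub>R \<omega> j) {k+1<..}"
    by (rule infsum_insert[OF s]) simp
  also have "{k+1<..} = {j. k + 1 < j}" by auto
  finally show ?thesis unfolding grid_shift_def powi_less_iff .
qed

text \<open>The shifts of levels k and k + 1 differ by one binary digit, so the index of the child
  determines the index of the parent. Nestedness of the grid rests on this.\<close>

lemma cube_index_Suc:
  fixes \<omega> :: "int \<Rightarrow> real^'d"
  assumes "\<omega> \<in> dyadic_shifts"
  shows "cube_index \<omega> k x $ i = (cube_index \<omega> (k+1) x $ i - \<lfloor>\<omega> (k+1) $ i\<rfloor>) div 2"
proof -
  let ?u = "2 powi (k+1) * (x $ i - grid_shift \<omega> (k+1) $ i)"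
  have w: "\<omega> (k+1) $ i = of_int \<lfloor>\<omega> (k+1) $ i\<rfloor>"
    using assms unfolding dyadic_shifts_def by (auto; metis floor_of_int floor_one floor_zero of_int_0 of_int_1)
  have "2 powi k * (x $ i - grid_shift \<omega> k $ i) = (?u - \<omega> (k+1) $ i) / 2"
  proof -
    define c :: real where "c = 2 powi k"
    have c: "c > 0" "2 powi (k+1) = 2 * c" "2 powi (-(k+1)) = inverse (2 * c)"
      unfolding power_int_minus by (simp_all add: c_def power_int_add)
    show ?thesis
      unfolding grid_shift_Suc[OF assms, of k] c(2,3) using c(1) by (simp add: c_def[symmetric] field_simps)
  qed
  then have "\<lfloor>2 powi k * (x $ i - grid_shift \<omega> k $ i)\<rfloor> = \<lfloor>(?u - \<omega> (k+1) $ i) / 2\<rfloor>"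
    by (simp only:)
  then have "cube_index \<omega> k x $ i = \<lfloor>(?u - \<omega> (k+1) $ i) / 2\<rfloor>"
    by (simp add: cube_index_def)
  also have "\<dots> = \<lfloor>(?u - of_int \<lfloor>\<omega> (k+1) $ i\<rfloor>) / of_int 2\<rfloor>"
    using w by simp
  also have "\<dots> = \<lfloor>?u - of_int \<lfloor>\<omega> (k+1) $ i\<rfloor>\<rfloor> div 2"
    by (rule floor_divide_real_eq_div) simp
  finally show ?thesis by (simp add: cube_index_def)
qed

lemma cube_index_coarser:
  assumes "\<omega> \<in> dyadic_shifts" "cube_index \<omega> l x = cube_index \<omega> l y" "k \<le> l"
  shows "cube_index \<omega> k x = cube_index \<omega> k y"
  using assms(3,2)
proof (induction k rule: int_le_induct)
  case (step i)
  then show ?case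
    using cube_index_Suc[OF assms(1), of "i - 1"] by (simp add: vec_eq_iff)
qed simp

lemma mem_cube_at: "y \<in> cube_at \<omega> k x \<longleftrightarrow> cube_index \<omega> k y = cube_index \<omega> k x"
  by (simp add: cube_at_def)

lemma self_mem_cube_at [simp]: "x \<in> cube_at \<omega> k x"
  by (simp add: cube_at_def)

lemma cube_at_eq_iff: "cube_at \<omega> k x = cube_at \<omega> k y \<longleftrightarrow> cube_index \<omega> k x = cube_index \<omega> k y"
  by (auto simp: cube_at_def)

lemma cube_at_eq: "y \<in> cube_at \<omega> k x \<Longrightarrow> cube_at \<omega> k y = cube_at \<omega> k x"
  by (auto simp: cube_at_def)

lemma cube_at_mono:
  assumes "\<omega> \<in> dyadic_shifts" "k \<le> l"
  shows "cube_at \<omega> l x \<subseteq> cube_at \<omega> k x"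
proof
  fix y assume "y \<in> cube_at \<omega> l x"
  then have "cube_index \<omega> l y = cube_index \<omega> l x" by (simp add: cube_at_def)
  from cube_index_coarser[OF assms(1) this assms(2)] show "y \<in> cube_at \<omega> k x" by (simp add: cube_at_def)
qed

definition cube_corner :: "(int \<Rightarrow> real^'d) \<Rightarrow> int \<Rightarrow> real^'d \<Rightarrow> real^'d" where
  "cube_corner \<omega> k x = (\<chi> i. 2 powi (-k) * cube_index \<omega> k x $ i + grid_shift \<omega> k $ i)"

lemma cube_at_eq_box:
  "cube_at \<omega> k x = {y. \<forall>i. cube_corner \<omega> k x $ i \<le> y $ i \<and> y $ i < cube_corner \<omega> k x $ i + 2 powi (-k)}"
proof -
  have "cube_index \<omega> k y $ i = cube_index \<omega> k x $ i \<longleftrightarrow>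
      cube_corner \<omega> k x $ i \<le> y $ i \<and> y $ i < cube_corner \<omega> k x $ i + 2 powi (-k)" for y i
  proof -
    let ?m = "cube_index \<omega> k x $ i" and ?s = "grid_shift \<omega> k $ i"
    have "cube_index \<omega> k y $ i = ?m \<longleftrightarrow> of_int ?m \<le> 2 powi k * (y $ i - ?s) \<and> 2 powi k * (y $ i - ?s) < of_int ?m + 1"
      by (subst cube_index_def) (simp add: floor_eq_iff)
    also have "\<dots> \<longleftrightarrow> cube_corner \<omega> k x $ i \<le> y $ i \<and> y $ i < cube_corner \<omega> k x $ i + 2 powi (-k)"
      by (simp add: cube_corner_def power_int_minus field_simps)
    finally show ?thesis .
  qed
  then show ?thesis by (auto simp: cube_at_def vec_eq_iff)
qed

lemma dyadic_grid_eq: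
  fixes \<omega> :: "int \<Rightarrow> real^'d"
  shows "dyadic_grid \<omega> = {cube_at \<omega> k x | k x. True}"
proof -
  have *: "(\<lambda>x. x + grid_shift \<omega> k) ` dyadic_cube k m = {y. cube_index \<omega> k y = m}" for k m
  proof (rule set_eqI)
    fix y :: "real^'d"
    let ?z = "(2 powi k) *\<^sub>R (y - grid_shift \<omega> k)"
    have "y \<in> (\<lambda>x. x + grid_shift \<omega> k) ` dyadic_cube k m \<longleftrightarrow>
       (\<exists>x. (\<forall>i. 0 \<le> x $ i \<and> x $ i < 1) \<and> y = (2 powi (-k)) *\<^sub>R (x + (\<chi> i. real_of_int (m $ i))) + grid_shift \<omega> k)"
      unfolding dyadic_cube_def by (simp add: image_iff)
    also have "\<dots> \<longleftrightarrow> (\<exists>x. (\<forall>i. 0 \<le> x $ i \<and> x $ i < 1) \<and> x = ?z - (\<chi> i. real_of_int (m $ i)))"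
      by (intro arg_cong[of _ _ Ex] ext conj_cong refl) (auto simp: vec_eq_iff power_int_minus field_simps)
    also have "\<dots> \<longleftrightarrow> (\<forall>i. 0 \<le> (?z - (\<chi> i. real_of_int (m $ i))) $ i \<and> (?z - (\<chi> i. real_of_int (m $ i))) $ i < 1)"
      by blast
    also have "\<dots> \<longleftrightarrow> (\<forall>i. real_of_int (m $ i) \<le> ?z $ i \<and> ?z $ i < real_of_int (m $ i) + 1)"
      by (simp add: algebra_simps)
    also have "\<dots> \<longleftrightarrow> cube_index \<omega> k y = m"
      by (simp add: cube_index_def vec_eq_iff floor_eq_iff)
    finally show "y \<in> (\<lambda>x. x + grid_shift \<omega> k) ` dyadic_cube k m \<longleftrightarrow> y \<in> {y. cube_index \<omega> k y = m}" by simp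
  qed
  \<comment> \<open>Every integer vector is the index of some point, so labelling cubes by their
    points loses none.\<close>
  have ex: "\<exists>y. cube_index \<omega> k y = m" for k m
  proof
    show "cube_index \<omega> k (\<chi> i. 2 powi (-k) * real_of_int (m $ i) + grid_shift \<omega> k $ i) = m"
      by (simp add: cube_index_def vec_eq_iff power_int_minus mult.assoc[symmetric])
  qed
  have "dyadic_grid \<omega> = {{y. cube_index \<omega> k y = m} | k m. True}"
    unfolding dyadic_grid_def grid_shift_def[symmetric] * by simp
  also have "\<dots> = {cube_at \<omega> k x | k x. True}"
    unfolding cube_at_def using ex by (auto; metis)
  finally show ?thesis .
qed

lemma cube_at_in_grid [simp]: "cube_at \<omega> k x \<in> dyadic_grid \<omega>"
  unfolding dyadic_grid_eq by blast

lemma grid_cases: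
  assumes "Q \<in> dyadic_grid \<omega>"
  obtains k x where "Q = cube_at \<omega> k x"
  using assms unfolding dyadic_grid_eq by blast

lemma cube_at_measure:
  fixes \<omega> :: "int \<Rightarrow> real^'d"
  shows "cube_at \<omega> k x \<in> sets borel" "emeasure lborel (cube_at \<omega> k x) = ennreal ((2 powi (-k)) ^ CARD('d))"
proof -
  let ?a = "cube_corner \<omega> k x" and ?l = "2 powi (-k) :: real"
  let ?b = "?a + (\<chi> i. ?l)"
  have "cube_at \<omega> k x = (\<Inter>i. {y. ?a $ i \<le> y $ i} \<inter> {y. y $ i < ?a $ i + ?l})"
    unfolding cube_at_eq_box by auto
  also have "\<dots> \<in> sets borel" by measurable
  finally show b: "cube_at \<omega> k x \<in> sets borel" .
  have pr: "(\<Prod>b\<in>Basis. (\<chi> i. ?l) \<bullet> (b :: real^'d)) = ?l ^ CARD('d)"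
  proof -
    have "(\<chi> i. ?l) \<bullet> b = ?l" if "b \<in> Basis" for b :: "real^'d"
      using that by (auto simp: Basis_vec_def inner_axis)
    then show ?thesis by simp
  qed
  have le: "?a \<bullet> b \<le> ?b \<bullet> b" if "b \<in> Basis" for b
    using that by (auto simp: Basis_vec_def inner_axis inner_add_left)
  \<comment> \<open>The half-open cube lies between an open and a closed box of the same
    volume.\<close>
  have "emeasure lborel (cube_at \<omega> k x) \<le> emeasure lborel (cbox ?a ?b)"
    by (intro emeasure_mono) (auto simp: cube_at_eq_box mem_box_cart less_imp_le)
  moreover have "emeasure lborel (box ?a ?b) \<le> emeasure lborel (cube_at \<omega> k x)"
    using b by (intro emeasure_mono) (auto simp: cube_at_eq_box mem_box_cart less_imp_le)
  ultimately show "emeasure lborel (cube_at \<omega> k x) = ennreal (?l ^ CARD('d))"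
    using le by (simp add: emeasure_lborel_cbox_eq emeasure_lborel_box_eq pr antisym)
qed

lemma cube_at_lebesgue [measurable, simp]: "cube_at \<omega> k x \<in> sets lebesgue"
  by (rule sets_completionI_sets) (simp add: cube_at_measure)

text \<open>The volume depends on the level only; the type argument carries the dimension.\<close>

definition cube_vol :: "'d::finite itself \<Rightarrow> int \<Rightarrow> real" where
  "cube_vol _ k = (2 powi (-k)) ^ CARD('d)"

lemma emeasure_cube_at: "emeasure lebesgue (cube_at \<omega> k x :: (real^'d) set) = ennreal (cube_vol TYPE('d) k)"
  using cube_at_measure[of \<omega> k x] by (simp add: cube_vol_def)

lemma cube_vol_pos [simp]: "0 < cube_vol TYPE('d::finite) k"
  by (simp add: cube_vol_def)

lemma cube_vol_nonzero [simp]: "cube_vol TYPE('d::finite) k \<noteq> 0"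
  by (rule less_imp_neq[THEN not_sym]) (rule cube_vol_pos)

lemma measure_cube_at: "measure lebesgue (cube_at \<omega> k x :: (real^'d) set) = cube_vol TYPE('d) k"
  using emeasure_cube_at[of \<omega> k x] less_imp_le[OF cube_vol_pos[where 'd='d]] by (simp add: measure_def)

lemma cube_vol_add: "cube_vol TYPE('d::finite) k = 2 ^ (CARD('d) * n) * cube_vol TYPE('d) (k + int n)"
proof -
  have e: "-k = int n + -(k + int n)" by simp
  have "2 powi (-k) = (2 powi (int n) * 2 powi (-(k + int n)) :: real)"
    by (subst e, rule power_int_add) simp
  then have "2 powi (-k) = (2 ^ n * 2 powi (-(k + int n)) :: real)" by simp
  then show ?thesis
    unfolding cube_vol_def by (simp only: power_mult_distrib power_mult[symmetric] mult.commute)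
qed

lemma cube_vol_less_iff: "cube_vol TYPE('d::finite) k < cube_vol TYPE('d) l \<longleftrightarrow> l < k"
proof -
  have "cube_vol TYPE('d) l \<le> cube_vol TYPE('d) k \<longleftrightarrow> (2 powi (-l) :: real) \<le> 2 powi (-k)"
    unfolding cube_vol_def by (rule power_mono_iff) auto
  then show ?thesis using powi_less_iff[of k l] by linarith
qed

text \<open>Elements of the grid are bare sets; their volume determines the level.\<close>

lemma cube_at_level_unique:
  fixes \<omega> :: "int \<Rightarrow> real^'d"
  assumes "cube_at \<omega> k x = cube_at \<omega> l y"
  shows "k = l"
proof -
  have "cube_vol TYPE('d) k = cube_vol TYPE('d) l"
    using assms measure_cube_at[of \<omega> k x] measure_cube_at[of \<omega> l y] by simp
  then show ?thesis
    using cube_vol_less_iff[where 'd='d, of k l] cube_vol_less_iff[where 'd='d, of l k] by linarith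
qed

lemma cube_at_nested:
  assumes "\<omega> \<in> dyadic_shifts" "cube_at \<omega> k x \<inter> cube_at \<omega> l y \<noteq> {}" "l \<le> k"
  shows "cube_at \<omega> k x \<subseteq> cube_at \<omega> l y"
proof -
  obtain z where "z \<in> cube_at \<omega> k x" "z \<in> cube_at \<omega> l y" using assms(2) by blast
  then have "cube_at \<omega> k x = cube_at \<omega> k z" "cube_at \<omega> l y = cube_at \<omega> l z" by (auto simp: cube_at_eq)
  then show ?thesis using cube_at_mono[OF assms(1,3)] by simp
qed

lemma cube_at_subset_level:
  fixes \<omega> :: "int \<Rightarrow> real^'d"
  assumes "cube_at \<omega> k x \<subseteq> cube_at \<omega> l y"
  shows "l \<le> k"
proof (rule ccontr)
  assume "\<not> l \<le> k"
  then have "cube_vol TYPE('d) l < cube_vol TYPE('d) k" by (simp add: cube_vol_less_iff)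
  moreover have "emeasure lebesgue (cube_at \<omega> k x) \<le> emeasure lebesgue (cube_at \<omega> l y)"
    by (rule emeasure_mono[OF assms]) simp
  ultimately show False
    using less_imp_le[OF cube_vol_pos[where 'd='d]] by (simp add: emeasure_cube_at ennreal_le_iff)
qed

lemma grid_countable: "countable (dyadic_grid (\<omega> :: int \<Rightarrow> real^'d))"
proof -
  have "dyadic_grid \<omega> \<subseteq> (\<lambda>(k, m). {y. cube_index \<omega> k y = m}) ` UNIV"
    unfolding dyadic_grid_eq cube_at_def by auto
  moreover have "countable (UNIV :: (int \<times> (int^'d)) set)"
  proof -
    have "inj (\<lambda>v :: int^'d. vec_nth v)" by (simp add: inj_def vec_eq_iff fun_eq_iff)
    moreover have "countable (UNIV :: ('d \<Rightarrow> int) set)" 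
      using countable_PiE[of "UNIV :: 'd set" "\<lambda>_. UNIV :: int set"] by (simp add: PiE_UNIV_domain)
    ultimately have "countable (UNIV :: (int^'d) set)"
      by (metis countable_image_inj_on countable_subset subset_UNIV countableI_type inj_on_subset countable_image_inj_eq)
    then show ?thesis using countable_SIGMA[of "UNIV :: int set" "\<lambda>_. UNIV :: (int^'d) set"] by simp
  qed
  ultimately show ?thesis by (meson countable_image countable_subset)
qed

section \<open>Atoms and ancestors in a fixed grid\<close>

locale dyadic_system =
  fixes \<omega> :: "int \<Rightarrow> real^'d"
  assumes shifts: "\<omega> \<in> dyadic_shifts"
begin

text \<open>For a cube R of level at most l these are its subcubes of level l, the points of the
  finite probability space.\<close>

definition atoms :: "int \<Rightarrow> (real^'d) set \<Rightarrow> (real^'d) set set" where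
  "atoms l R = cube_at \<omega> l ` R"

text \<open>A map on sets, so that \<open>anc k\<close> can serve as partition map on atoms. All
  points of an atom of level at least k have the same ancestor, hence the choice of the point is
  immaterial.\<close>

definition anc :: "int \<Rightarrow> (real^'d) set \<Rightarrow> (real^'d) set" where
  "anc k w = cube_at \<omega> k (SOME x. x \<in> w)"

lemma anc_eq:
  assumes "k \<le> l" "x \<in> cube_at \<omega> l y"
  shows "anc k (cube_at \<omega> l y) = cube_at \<omega> k x"
proof -
  have "(SOME x. x \<in> cube_at \<omega> l y) \<in> cube_at \<omega> l y" by (rule someI[of _ y]) simp
  then have "cube_index \<omega> l (SOME x. x \<in> cube_at \<omega> l y) = cube_index \<omega> l x"
    using assms(2) by (simp add: mem_cube_at)
  then show ?thesis
    unfolding anc_def cube_at_eq_iff by (rule cube_index_coarser[OF shifts _ assms(1)])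
qed

lemma some_mem_cube_at: "(SOME x. x \<in> cube_at \<omega> l y) \<in> cube_at \<omega> l y"
  by (rule someI[of _ y]) simp

lemma atomsE:
  assumes "w \<in> atoms l R" obtains x where "x \<in> R" "w = cube_at \<omega> l x"
  using assms by (auto simp: atoms_def)

lemma atom_subset:
  assumes "k \<le> l" "w \<in> atoms l (cube_at \<omega> k x)"
  shows "w \<subseteq> cube_at \<omega> k x"
  using assms(2)
proof (rule atomsE)
  fix y assume "y \<in> cube_at \<omega> k x" "w = cube_at \<omega> l y"
  then show ?thesis using cube_at_mono[OF shifts assms(1), of y] cube_at_eq[of y \<omega> k x] by simp
qed

lemma mem_atom: "x \<in> R \<Longrightarrow> cube_at \<omega> l x \<in> atoms l R"
  by (auto simp: atoms_def)

lemma atom_eqI: "w \<in> atoms l R \<Longrightarrow> x \<in> w \<Longrightarrow> w = cube_at \<omega> l x"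
  by (auto elim!: atomsE simp: cube_at_eq)

lemma Union_atoms:
  assumes "k \<le> l" shows "\<Union>(atoms l (cube_at \<omega> k x)) = cube_at \<omega> k x"
proof
  show "\<Union>(atoms l (cube_at \<omega> k x)) \<subseteq> cube_at \<omega> k x"
    using atom_subset[OF assms] by (intro Union_least)
  show "cube_at \<omega> k x \<subseteq> \<Union>(atoms l (cube_at \<omega> k x))"
    using self_mem_cube_at mem_atom by blast
qed

lemma disjoint_atoms: "disjoint_family_on (\<lambda>w. w) (atoms l R)"
  unfolding disjoint_family_on_def using atom_eqI by blast

lemma atom_lebesgue: "w \<in> atoms l R \<Longrightarrow> w \<in> sets lebesgue"
  by (auto elim!: atomsE)

lemma emeasure_atom: "w \<in> atoms l R \<Longrightarrow> emeasure lebesgue w = ennreal (cube_vol TYPE('d) l)"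
  by (auto elim!: atomsE simp: emeasure_cube_at)

lemma vol_nonneg [simp]: "0 \<le> cube_vol TYPE('d) k"
  by (rule less_imp_le) simp

text \<open>A packing bound: cubes of one level are disjoint and of equal volume, so their number is
  at most the volume of S divided by theirs.\<close>

lemma finite_disjoint_cubes:
  assumes "\<And>w. w \<in> F \<Longrightarrow> \<exists>x. w = cube_at \<omega> l x" "\<Union>F \<subseteq> S" "emeasure lebesgue S < \<infinity>" "S \<in> sets lebesgue"
  shows "finite F"
proof -
  let ?C = "nat \<lceil>measure lebesgue S / cube_vol TYPE('d) l\<rceil>"
  have "card G \<le> ?C" if G: "G \<subseteq> F" "finite G" for G
  proof -
    have ex: "\<exists>x. w = cube_at \<omega> l x" if "w \<in> G" for w
      using assms(1) G(1) that by blast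
    have eq: "w = cube_at \<omega> l x" if w: "w \<in> G" "x \<in> w" for w x
    proof -
      obtain y where "w = cube_at \<omega> l y" using ex[OF w(1)] ..
      then show ?thesis using w(2) cube_at_eq[of x \<omega> l y] by simp
    qed
    have disj: "disjoint_family_on (\<lambda>w. w) G"
      unfolding disjoint_family_on_def using eq by blast
    have leb: "w \<in> sets lebesgue" if "w \<in> G" for w
      using ex[OF that] by auto
    have "(\<Sum>w\<in>G. emeasure lebesgue w) = emeasure lebesgue (\<Union>w\<in>G. w)"
      using disj leb G(2) by (intro sum_emeasure) auto
    also have "\<dots> \<le> emeasure lebesgue S"
      using assms(2,4) G(1) by (intro emeasure_mono) auto
    also have "(\<Sum>w\<in>G. emeasure lebesgue w) = (\<Sum>w\<in>G. ennreal (cube_vol TYPE('d) l))"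
    proof (rule sum.cong[OF refl])
      fix w assume "w \<in> G"
      then obtain y where "w = cube_at \<omega> l y" using ex by blast
      then show "emeasure lebesgue w = ennreal (cube_vol TYPE('d) l)" by (simp only: emeasure_cube_at)
    qed
    also have "emeasure lebesgue S = ennreal (measure lebesgue S)"
      using assms(3) by (intro emeasure_eq_ennreal_measure) auto
    finally have "real (card G) * cube_vol TYPE('d) l \<le> measure lebesgue S"
      by (simp add: ennreal_of_nat_eq_real_of_nat ennreal_mult''[symmetric])
    then have "real (card G) \<le> measure lebesgue S / cube_vol TYPE('d) l"
      by (simp add: pos_le_divide_eq)
    then show ?thesis by linarith
  qed
  then show ?thesis using finite_if_finite_subsets_card_bdd[of F ?C] by blast
qed

lemma finite_atoms:
  assumes "k \<le> l" shows "finite (atoms l (cube_at \<omega> k x))"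
  using Union_atoms[OF assms]
  by (intro finite_disjoint_cubes[of _ l "cube_at \<omega> k x"]) (auto elim!: atomsE simp: emeasure_cube_at)

lemma indicator_atoms:
  assumes "k \<le> l" "x \<in> cube_at \<omega> k x0"
  shows "(\<Sum>w\<in>atoms l (cube_at \<omega> k x0). c w * indicator w x) = (c (cube_at \<omega> l x) :: 'a::semiring_1)"
proof -
  let ?w = "cube_at \<omega> l x"
  have "(\<Sum>w\<in>atoms l (cube_at \<omega> k x0). c w * indicator w x) =
      (\<Sum>w\<in>atoms l (cube_at \<omega> k x0). if w = ?w then c ?w else 0)"
    by (intro sum.cong refl) (auto simp: indicator_def dest: atom_eqI)
  also have "\<dots> = c ?w"
    using finite_atoms[OF assms(1)] mem_atom[OF assms(2)] by simp
  finally show ?thesis .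
qed

text \<open>On the cube, F is a finite combination of indicators of atoms. Together with
  \<open>set_integral_atoms\<close> this translates between integrals and the finite model.\<close>

lemma nn_integral_atoms:
  assumes "k \<le> l"
    and F: "\<And>w x. w \<in> atoms l (cube_at \<omega> k x0) \<Longrightarrow> x \<in> w \<Longrightarrow> F x = c w"
  shows "(\<integral>\<^sup>+x. F x * indicator (cube_at \<omega> k x0) x \<partial>lebesgue) =
    (\<Sum>w\<in>atoms l (cube_at \<omega> k x0). c w * ennreal (cube_vol TYPE('d) l))"
proof -
  let ?A = "atoms l (cube_at \<omega> k x0)"
  have "F x * indicator (cube_at \<omega> k x0) x = (\<Sum>w\<in>?A. c w * indicator w x)" for x
  proof (cases "x \<in> cube_at \<omega> k x0")
    case True
    then show ?thesis using indicator_atoms[OF assms(1) True, of c] F[OF mem_atom[OF True] self_mem_cube_at] by simp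
  next
    case False
    then have "x \<notin> w" if "w \<in> ?A" for w using atom_subset[OF assms(1) that] by blast
    then show ?thesis using False by simp
  qed
  then have "(\<integral>\<^sup>+x. F x * indicator (cube_at \<omega> k x0) x \<partial>lebesgue) = (\<integral>\<^sup>+x. (\<Sum>w\<in>?A. c w * indicator w x) \<partial>lebesgue)"
    by simp
  also have "\<dots> = (\<Sum>w\<in>?A. \<integral>\<^sup>+x. c w * indicator w x \<partial>lebesgue)"
    by (rule nn_integral_sum) (intro borel_measurable_times_ennreal borel_measurable_const borel_measurable_indicator atom_lebesgue)
  also have "\<dots> = (\<Sum>w\<in>?A. c w * ennreal (cube_vol TYPE('d) l))"
    by (intro sum.cong refl) (simp only: nn_integral_cmult_indicator[OF atom_lebesgue] emeasure_atom)
  finally show ?thesis .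
qed

lemma card_atoms:
  assumes "k \<le> l"
  shows "real (card (atoms l (cube_at \<omega> k x))) * cube_vol TYPE('d) l = cube_vol TYPE('d) k"
proof -
  have "ennreal (cube_vol TYPE('d) k) = (\<integral>\<^sup>+y. 1 * indicator (cube_at \<omega> k x) y \<partial>lebesgue)"
    by (simp add: emeasure_cube_at)
  also have "\<dots> = (\<Sum>w\<in>atoms l (cube_at \<omega> k x). 1 * ennreal (cube_vol TYPE('d) l))"
    by (rule nn_integral_atoms[OF assms]) simp
  finally show ?thesis
    by (simp add: ennreal_of_nat_eq_real_of_nat ennreal_mult''[symmetric] del: nn_integral_indicator)
qed

lemma set_integral_atoms:
  fixes h :: "real^'d \<Rightarrow> real"
  assumes "k \<le> l" "integrable lebesgue h"
  shows "(LINT x:cube_at \<omega> k x0|lebesgue. h x) = (\<Sum>w\<in>atoms l (cube_at \<omega> k x0). LINT x:w|lebesgue. h x)"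
proof -
  let ?A = "atoms l (cube_at \<omega> k x0)"
  have "(LINT x:(\<Union>w\<in>?A. w)|lebesgue. h x) = (\<Sum>w\<in>?A. LINT x:w|lebesgue. h x)"
  proof (rule set_integral_finite_Union[OF finite_atoms[OF assms(1)] disjoint_atoms])
    fix w assume w: "w \<in> ?A"
    show "set_integrable lebesgue w h"
      unfolding set_integrable_def
      by (rule integrable_mult_indicator[OF atom_lebesgue[OF w] assms(2)])
  qed (simp add: atom_lebesgue)
  then show ?thesis using Union_atoms[OF assms(1), of x0] by simp
qed

lemma set_integral_atom_const:
  fixes h :: "real^'d \<Rightarrow> real"
  assumes "w \<in> atoms l R" "\<And>x. x \<in> w \<Longrightarrow> h x = c"
  shows "(LINT x:w|lebesgue. h x) = c * cube_vol TYPE('d) l"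
proof -
  have "(LINT x:w|lebesgue. h x) = (LINT x|lebesgue. indicator w x *\<^sub>R c)"
    unfolding set_lebesgue_integral_def using assms(2) by (intro Bochner_Integration.integral_cong) (auto simp: indicator_def)
  also have "\<dots> = measure lebesgue w * c"
    using atom_lebesgue[OF assms(1)] emeasure_atom[OF assms(1)]
    by (subst integral_scaleR_left) (auto intro: integrable_real_indicator)
  also have "measure lebesgue w = cube_vol TYPE('d) l"
    using emeasure_atom[OF assms(1)] by (simp add: measure_def)
  finally show ?thesis by simp
qed

end

section \<open>Haar functions on half-open cubes\<close>

lemma haar1_Ico:
  fixes c l t :: real
  assumes "0 < l"
  shows "haar1 b {c..<c + l} t = l powr (-1/2) *
    (if c \<le> t \<and> t < c + l then (if b \<and> c + l / 2 \<le> t then -1 else 1) else 0)"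
proof -
  have "measure lebesgue {c..<c + l} = l" using assms by simp
  moreover have "Inf {c..<c + l} = c" "Sup {c..<c + l} = c + l" using assms by simp_all
  moreover have "(c + (c + l)) / 2 = c + l / 2" by simp
  ultimately show ?thesis unfolding haar1_def by (auto simp: indicator_def)
qed

context dyadic_system
begin

lemma cube_projection: "(\<lambda>y. y $ i) ` cube_at \<omega> k x = {cube_corner \<omega> k x $ i ..< cube_corner \<omega> k x $ i + 2 powi (-k)}"
proof (rule set_eqI, rule iffI)
  fix t assume t: "t \<in> {cube_corner \<omega> k x $ i ..< cube_corner \<omega> k x $ i + 2 powi (-k)}"
  have "(\<chi> j. if j = i then t else cube_corner \<omega> k x $ j) \<in> cube_at \<omega> k x"
    using t by (auto simp: cube_at_eq_box)
  then show "t \<in> (\<lambda>y. y $ i) ` cube_at \<omega> k x" by (rule rev_image_eqI) simp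
qed (auto simp: cube_at_eq_box)

lemma haar_cube_at:
  "haar \<theta> (cube_at \<omega> k x) y =
    (if y \<in> cube_at \<omega> k x
     then (\<Prod>i\<in>UNIV. if \<theta> i \<and> cube_corner \<omega> k x $ i + 2 powi (-k) / 2 \<le> y $ i then -1 else 1) / sqrt (cube_vol TYPE('d) k)
     else 0)"
proof -
  let ?c = "cube_corner \<omega> k x" and ?l = "2 powi (-k) :: real"
  have l: "0 < ?l" by simp
  have eq: "haar \<theta> (cube_at \<omega> k x) y = (\<Prod>i\<in>UNIV. ?l powr (-1/2) *
    (if ?c $ i \<le> y $ i \<and> y $ i < ?c $ i + ?l then (if \<theta> i \<and> ?c $ i + ?l / 2 \<le> y $ i then -1 else 1) else 0))"
    unfolding haar_def cube_projection haar1_Ico[OF l] ..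
  show ?thesis
  proof (cases "y \<in> cube_at \<omega> k x")
    case True
    then have in_Q: "?c $ i \<le> y $ i \<and> y $ i < ?c $ i + ?l" for i by (auto simp: cube_at_eq_box)
    have "(?l powr (-1/2)) ^ CARD('d) = 1 / sqrt (cube_vol TYPE('d) k)"
      using l by (simp add: cube_vol_def powr_minus_divide powr_half_sqrt power_one_over real_sqrt_power)
    then show ?thesis using True unfolding eq by (simp add: in_Q prod.distrib)
  next
    case False
    then obtain i where "\<not> (?c $ i \<le> y $ i \<and> y $ i < ?c $ i + ?l)" by (auto simp: cube_at_eq_box)
    then have "haar \<theta> (cube_at \<omega> k x) y = 0"
      unfolding eq by (intro prod_zero) (auto intro!: exI[of _ i])
    then show ?thesis using False by simp
  qed
qed

lemma haar_outside: "y \<notin> cube_at \<omega> k x \<Longrightarrow> haar \<theta> (cube_at \<omega> k x) y = 0"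
  by (simp add: haar_cube_at)

lemma haar_inside:
  assumes "y \<in> cube_at \<omega> k x"
  shows "sqrt (cube_vol TYPE('d) k) * haar \<theta> (cube_at \<omega> k x) y = 1 \<or>
    sqrt (cube_vol TYPE('d) k) * haar \<theta> (cube_at \<omega> k x) y = -1"
proof -
  have *: "(\<Prod>i\<in>A. if P i then -1 else 1) = (1::real) \<or> (\<Prod>i\<in>A. if P i then -1 else 1) = (-1::real)"
    if "finite A" for A :: "'d set" and P
    using that by induction auto
  have "sqrt (cube_vol TYPE('d) k) \<noteq> 0" by (simp add: less_imp_neq[THEN not_sym])
  then show ?thesis using assms *[OF finite] by (simp add: haar_cube_at)
qed

lemma abs_haar: "\<bar>haar \<theta> (cube_at \<omega> k x) y\<bar> = indicator (cube_at \<omega> k x) y / sqrt (cube_vol TYPE('d) k)"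
proof (cases "y \<in> cube_at \<omega> k x")
  case True
  have s: "sqrt (cube_vol TYPE('d) k) > 0" by simp
  have "\<bar>sqrt (cube_vol TYPE('d) k) * haar \<theta> (cube_at \<omega> k x) y\<bar> = 1"
    using haar_inside[OF True, of \<theta>] by auto
  then show ?thesis using s True by (simp add: abs_mult eq_divide_eq mult.commute)
qed (simp add: haar_outside)

text \<open>A Haar function is constant on the children of its cube: the cut at the midpoint is an
  integer inequality for the index of level k + 1.\<close>

lemma haar_const:
  assumes "cube_index \<omega> (k+1) y = cube_index \<omega> (k+1) z"
  shows "haar \<theta> (cube_at \<omega> k x) y = haar \<theta> (cube_at \<omega> k x) z"
proof -
  have "cube_index \<omega> k y = cube_index \<omega> k z"
    by (rule cube_index_coarser[OF shifts assms]) simp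
  then have 1: "y \<in> cube_at \<omega> k x \<longleftrightarrow> z \<in> cube_at \<omega> k x" by (simp add: mem_cube_at)
  have 2: "cube_corner \<omega> k x $ i + 2 powi (-k) / 2 \<le> y $ i \<longleftrightarrow>
      2 * cube_index \<omega> k x $ i + \<lfloor>\<omega> (k+1) $ i\<rfloor> + 1 \<le> cube_index \<omega> (k+1) y $ i" for y i
  proof -
    define c :: real where "c = 2 powi k"
    have c: "c > 0" "2 powi (k+1) = 2 * c" "2 powi (-k) = inverse c" "2 powi (-(k+1)) = inverse (2 * c)"
      unfolding power_int_minus by (simp_all add: c_def power_int_add)
    have w: "\<omega> (k+1) $ i = of_int \<lfloor>\<omega> (k+1) $ i\<rfloor>"
    proof -
      have "\<omega> (k+1) $ i = 0 \<or> \<omega> (k+1) $ i = 1" using shifts by (auto simp: dyadic_shifts_def)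
      then show ?thesis by auto
    qed
    have "cube_corner \<omega> k x $ i + 2 powi (-k) / 2 \<le> y $ i \<longleftrightarrow>
       2 * of_int (cube_index \<omega> k x $ i) + \<omega> (k+1) $ i + 1 \<le> 2 powi (k+1) * (y $ i - grid_shift \<omega> (k+1) $ i)"
      unfolding cube_corner_def grid_shift_Suc[OF shifts, of k] c(2,3,4) using c(1)
      by (simp add: field_simps)
    also have "\<dots> \<longleftrightarrow> of_int (2 * cube_index \<omega> k x $ i + \<lfloor>\<omega> (k+1) $ i\<rfloor> + 1) \<le> 2 powi (k+1) * (y $ i - grid_shift \<omega> (k+1) $ i)"
      using w by simp
    also have "\<dots> \<longleftrightarrow> 2 * cube_index \<omega> k x $ i + \<lfloor>\<omega> (k+1) $ i\<rfloor> + 1 \<le> cube_index \<omega> (k+1) y $ i"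
      unfolding le_floor_iff[symmetric] by (simp add: cube_index_def)
    finally show ?thesis .
  qed
  show ?thesis unfolding haar_cube_at 1 2 assms ..
qed

lemma haar_borel: "haar \<theta> (cube_at \<omega> k x) \<in> borel_measurable borel"
proof -
  have [measurable]: "cube_at \<omega> k x \<in> sets borel" by (rule cube_at_measure)
  have "(\<lambda>y. if y \<in> cube_at \<omega> k x
     then (\<Prod>i\<in>UNIV. if \<theta> i \<and> cube_corner \<omega> k x $ i + 2 powi (-k) / 2 \<le> y $ i then -1 else 1) / sqrt (cube_vol TYPE('d) k)
     else 0) \<in> borel_measurable borel"
    by measurable
  then show ?thesis unfolding haar_cube_at[abs_def] .
qed

lemma haar_integrable: "integrable lborel (haar \<theta> (cube_at \<omega> k x))"
proof -
  have "integrable lborel (\<lambda>y. indicator (cube_at \<omega> k x) y *\<^sub>R haar \<theta> (cube_at \<omega> k x) y)"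
  proof (rule integrableI_bounded_set_indicator[where B = "1 / sqrt (cube_vol TYPE('d) k)"])
    show "cube_at \<omega> k x \<in> sets lborel" "haar \<theta> (cube_at \<omega> k x) \<in> borel_measurable lborel"
      using cube_at_measure(1) haar_borel by auto
    show "emeasure lborel (cube_at \<omega> k x) < \<infinity>" by (simp add: cube_at_measure(2))
    show "AE y in lborel. y \<in> cube_at \<omega> k x \<longrightarrow> norm (haar \<theta> (cube_at \<omega> k x) y) \<le> 1 / sqrt (cube_vol TYPE('d) k)"
      by (simp add: abs_haar)
  qed
  moreover have "(\<lambda>y. indicator (cube_at \<omega> k x) y *\<^sub>R haar \<theta> (cube_at \<omega> k x) y) = haar \<theta> (cube_at \<omega> k x)"
    by (rule ext) (simp add: haar_cube_at)
  ultimately show ?thesis by simp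
qed

text \<open>Choose a coordinate j with \<open>\<theta> j\<close>. Translation by half a side in this
  direction takes the lower half of the cube to the upper one and reverses the sign of the Haar
  function, so the integrals over the halves cancel.\<close>

lemma integral_haar:
  assumes "cancellative \<theta>"
  shows "(\<integral>y. haar \<theta> (cube_at \<omega> k x) y \<partial>lborel) = 0"
proof -
  obtain j where j: "\<theta> j" using assms by (auto simp: cancellative_def)
  let ?h = "haar \<theta> (cube_at \<omega> k x)" and ?c = "cube_corner \<omega> k x" and ?l = "2 powi (-k) :: real"
  have l: "0 < ?l" by simp
  define U where "U = {y::real^'d. ?c $ j + ?l / 2 \<le> y $ j}"
  define v :: "real^'d" where "v = (\<chi> i. if i = j then ?l / 2 else 0)"
  have U[measurable]: "U \<in> sets borel" unfolding U_def by measurable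
  note haar_borel[measurable]
  have i1: "integrable lborel (\<lambda>y. indicator U y *\<^sub>R ?h y)" "integrable lborel (\<lambda>y. indicator (-U) y *\<^sub>R ?h y)"
    by (rule integrable_mult_indicator[OF _ haar_integrable]; simp)+
  have shift: "indicator U (v + y) *\<^sub>R ?h (v + y) = - (indicator (-U) y *\<^sub>R ?h y)" for y
  proof (cases "y \<in> cube_at \<omega> k x \<and> y \<notin> U")
    case True
    then have y: "?c $ i \<le> y $ i" "y $ i < ?c $ i + ?l" "y $ j < ?c $ j + ?l / 2" for i
      by (auto simp: cube_at_eq_box U_def)
    have vy: "v + y \<in> cube_at \<omega> k x" "v + y \<in> U"
    proof -
      have "?c $ i \<le> (v + y) $ i \<and> (v + y) $ i < ?c $ i + ?l" for i
      proof (cases "i = j")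
        case True
        have "v $ j = ?l / 2" by (simp add: v_def)
        then show ?thesis using y(1)[of j] y(3) l unfolding True vector_add_component by linarith
      next
        case False
        then have "v $ i = 0" by (simp add: v_def)
        then show ?thesis using y(1,2)[of i] unfolding vector_add_component by linarith
      qed
      then show "v + y \<in> cube_at \<omega> k x" unfolding cube_at_eq_box by blast
      have "v $ j = ?l / 2" by (simp add: v_def)
      then show "v + y \<in> U" using y(1)[of j] unfolding U_def mem_Collect_eq vector_add_component by linarith
    qed
    let ?s = "\<lambda>y i. if \<theta> i \<and> ?c $ i + ?l / 2 \<le> y $ i then -1 else 1 :: real"
    have "(\<Prod>i\<in>UNIV. ?s (v + y) i) = ?s (v + y) j * (\<Prod>i\<in>UNIV - {j}. ?s (v + y) i)"
      by (rule prod.remove) auto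
    also have "(\<Prod>i\<in>UNIV - {j}. ?s (v + y) i) = (\<Prod>i\<in>UNIV - {j}. ?s y i)"
      by (intro prod.cong refl) (auto simp: v_def)
    also have "?s (v + y) j = - ?s y j"
      using j y(3) vy(2) by (auto simp: U_def)
    also have "- ?s y j * (\<Prod>i\<in>UNIV - {j}. ?s y i) = - (\<Prod>i\<in>UNIV. ?s y i)"
      by (subst prod.remove[of UNIV j "?s y"]) auto
    finally have "(\<Prod>i\<in>UNIV. ?s (v + y) i) = - (\<Prod>i\<in>UNIV. ?s y i)" .
    then show ?thesis using True vy by (simp add: haar_cube_at)
  next
    case False
    have "?h (v + y) = 0" if "v + y \<in> U"
    proof -
      have "v + y \<notin> cube_at \<omega> k x"
      proof
        assume vy: "v + y \<in> cube_at \<omega> k x"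
        have "?c $ i \<le> y $ i \<and> y $ i < ?c $ i + ?l \<and> (i = j \<longrightarrow> y $ j < ?c $ j + ?l / 2)" for i
        proof (cases "i = j")
          case True
          have "?c $ j \<le> v $ j + y $ j" "v $ j + y $ j < ?c $ j + ?l" using vy by (auto simp: cube_at_eq_box)
          moreover have "?c $ j + ?l / 2 \<le> v $ j + y $ j" using that by (simp add: U_def)
          moreover have "v $ j = ?l / 2" by (simp add: v_def)
          ultimately show ?thesis using True l by simp
        next
          case False
          have "?c $ i \<le> v $ i + y $ i" "v $ i + y $ i < ?c $ i + ?l" using vy by (auto simp: cube_at_eq_box)
          moreover have "v $ i = 0" using False by (simp add: v_def)
          ultimately show ?thesis using False by simp
        qed
        then show False using False by (auto simp: cube_at_eq_box U_def)
      qed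
      then show ?thesis by (rule haar_outside)
    qed
    moreover have "y \<notin> U \<Longrightarrow> ?h y = 0" using False by (simp add: haar_outside)
    ultimately show ?thesis by (auto simp: indicator_def)
  qed
  have "(\<integral>y. indicator U y *\<^sub>R ?h y \<partial>lborel) = (\<integral>y. indicator U y *\<^sub>R ?h y \<partial>distr lborel borel ((+) v))"
    unfolding lborel_distr_plus ..
  also have "\<dots> = (\<integral>y. indicator U (v + y) *\<^sub>R ?h (v + y) \<partial>lborel)"
    by (rule integral_distr) measurable
  also have "\<dots> = - (\<integral>y. indicator (-U) y *\<^sub>R ?h y \<partial>lborel)"
    unfolding shift by simp
  finally have e: "(\<integral>y. indicator U y *\<^sub>R ?h y \<partial>lborel) = - (\<integral>y. indicator (-U) y *\<^sub>R ?h y \<partial>lborel)" .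
  have "(\<integral>y. ?h y \<partial>lborel) = (\<integral>y. indicator U y *\<^sub>R ?h y + indicator (-U) y *\<^sub>R ?h y \<partial>lborel)"
    by (intro Bochner_Integration.integral_cong refl) (auto simp: indicator_def)
  also have "\<dots> = 0" using e by (subst Bochner_Integration.integral_add[OF i1]) simp
  finally show ?thesis .
qed

text \<open>Finite form of the vanishing integral: for l > k the function is constant on atoms of
  level l, so any point may represent its atom.\<close>

lemma sum_haar_atoms:
  assumes "cancellative \<theta>" "k < l"
  shows "(\<Sum>w\<in>atoms l (cube_at \<omega> k x). haar \<theta> (cube_at \<omega> k x) (SOME y. y \<in> w)) = 0"
proof -
  let ?Q = "cube_at \<omega> k x" and ?h = "haar \<theta> (cube_at \<omega> k x)"
  have int: "integrable lebesgue ?h"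
    using haar_integrable haar_borel integrable_completion by (simp add: integrable_completion)
  have c: "?h y = ?h (SOME y. y \<in> w)" if w: "w \<in> atoms l ?Q" "y \<in> w" for w y
  proof (rule haar_const)
    have "w = cube_at \<omega> l y" using atom_eqI[OF w] .
    moreover have "(SOME y. y \<in> w) \<in> w" using w(2) by (rule someI)
    ultimately have "cube_index \<omega> l y = cube_index \<omega> l (SOME y. y \<in> w)" by (auto simp: mem_cube_at)
    then show "cube_index \<omega> (k+1) y = cube_index \<omega> (k+1) (SOME y. y \<in> w)"
      by (rule cube_index_coarser[OF shifts]) (use assms(2) in simp)
  qed
  have "(LINT y:?Q|lebesgue. ?h y) = (\<Sum>w\<in>atoms l ?Q. LINT y:w|lebesgue. ?h y)"
    by (rule set_integral_atoms[OF _ int]) (use assms(2) in simp)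
  also have "\<dots> = (\<Sum>w\<in>atoms l ?Q. ?h (SOME y. y \<in> w) * cube_vol TYPE('d) l)"
    by (intro sum.cong refl set_integral_atom_const) (auto intro: c)
  also have "\<dots> = (\<Sum>w\<in>atoms l ?Q. ?h (SOME y. y \<in> w)) * cube_vol TYPE('d) l"
    by (rule sum_distrib_right[symmetric])
  also have "(LINT y:?Q|lebesgue. ?h y) = (\<integral>y. ?h y \<partial>lebesgue)"
    unfolding set_lebesgue_integral_def
    by (intro Bochner_Integration.integral_cong refl) (auto simp: indicator_def haar_outside)
  also have "\<dots> = (\<integral>y. ?h y \<partial>lborel)"
    using haar_borel by (intro integral_completion) simp
  also have "\<dots> = 0" by (rule integral_haar[OF assms(1)])
  finally show ?thesis by (simp add: less_imp_neq[THEN not_sym])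
qed

end

section \<open>Strong integrals of bounded functions with compact support\<close>

abbreviation "sbi \<equiv> Bochner_Integration.simple_bochner_integral"
abbreviation "sbi_able \<equiv> Bochner_Integration.simple_bochner_integrable"

lemma sbi_dist:
  fixes f g :: "'w \<Rightarrow> 'a::real_normed_vector"
  assumes "sbi_able M f" "sbi_able M g"
  shows "ennreal (norm (sbi M f - sbi M g)) \<le> (\<integral>\<^sup>+x. ennreal (norm (f x - g x)) \<partial>M)"
proof -
  have d: "sbi_able M (\<lambda>x. f x - g x)"
    by (rule Bochner_Integration.simple_bochner_integrable_compose2[OF _ assms]) simp
  have n: "sbi_able M (\<lambda>x. norm (f x - g x))"
    by (rule Bochner_Integration.simple_bochner_integrable_compose2[OF _ d d, of "\<lambda>x y. norm x"]) simp
  have "ennreal (norm (sbi M f - sbi M g)) = ennreal (norm (sbi M (\<lambda>x. f x - g x)))"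
    using Bochner_Integration.simple_bochner_integral_diff[OF assms] by simp
  also have "\<dots> \<le> ennreal (sbi M (\<lambda>x. norm (f x - g x)))"
    by (intro ennreal_leI Bochner_Integration.simple_bochner_integral_norm_bound d)
  also have "\<dots> = (\<integral>\<^sup>+x. ennreal (norm (f x - g x)) \<partial>M)"
    by (rule Bochner_Integration.simple_bochner_integral_eq_nn_integral[OF n]) simp
  finally show ?thesis .
qed

text \<open>In a nonseparable space the difference itself is delicate, but its norm is a pointwise
  limit of real simple functions.\<close>

lemma measurable_norm_diff_simple:
  fixes h :: "'w \<Rightarrow> 'a::real_normed_vector"
  assumes "\<And>j::nat. simple_function M (t j)" "\<And>x. x \<in> space M \<Longrightarrow> (\<lambda>j. t j x) \<longlonglongrightarrow> h x"
    and "simple_function M s"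
  shows "(\<lambda>x. norm (h x - s x)) \<in> borel_measurable M"
proof (rule borel_measurable_LIMSEQ_real)
  show "(\<lambda>j. norm (t j x - s x)) \<longlonglongrightarrow> norm (h x - s x)" if "x \<in> space M" for x
    by (intro tendsto_intros assms(2) that)
  show "(\<lambda>x. norm (t j x - s x)) \<in> borel_measurable M" for j
    by (intro borel_measurable_simple_function simple_function_compose2[OF assms(1,3)])
qed

lemma ennreal_norm_diff_le:
  fixes a b c :: "'a::real_normed_vector"
  shows "ennreal (norm (a - b)) \<le> ennreal (norm (c - a)) + ennreal (norm (c - b))"
proof -
  have "norm (a - b) \<le> norm (c - a) + norm (c - b)"
    by (metis norm_minus_commute norm_triangle_sub add.commute diff_add_cancel norm_diff_triangle_le order_refl)
  then show ?thesis by (simp add: ennreal_plus[symmetric] del: ennreal_plus)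
qed

text \<open>The triangle inequality through h. It makes the integrals along an approximating
  sequence Cauchy and forces two such sequences to the same limit.\<close>

lemma sbi_dist_limit:
  fixes h :: "'w \<Rightarrow> 'a::real_normed_vector"
  assumes t: "\<And>j::nat. simple_function M (t j)" "\<And>x. x \<in> space M \<Longrightarrow> (\<lambda>j. t j x) \<longlonglongrightarrow> h x"
    and s: "sbi_able M s" "sbi_able M s'"
  shows "ennreal (norm (sbi M s - sbi M s')) \<le>
    (\<integral>\<^sup>+x. ennreal (norm (h x - s x)) \<partial>M) + (\<integral>\<^sup>+x. ennreal (norm (h x - s' x)) \<partial>M)"
proof -
  have sf: "simple_function M s" "simple_function M s'"
    using s by (auto elim: Bochner_Integration.simple_bochner_integrable.cases)
  have [measurable]: "(\<lambda>x. norm (h x - s x)) \<in> borel_measurable M" "(\<lambda>x. norm (h x - s' x)) \<in> borel_measurable M"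
    by (rule measurable_norm_diff_simple[OF t sf(1)], assumption, rule measurable_norm_diff_simple[OF t sf(2)], assumption)
  have "ennreal (norm (sbi M s - sbi M s')) \<le> (\<integral>\<^sup>+x. ennreal (norm (s x - s' x)) \<partial>M)"
    by (rule sbi_dist[OF s])
  also have "\<dots> \<le> (\<integral>\<^sup>+x. ennreal (norm (h x - s x)) + ennreal (norm (h x - s' x)) \<partial>M)"
    by (intro nn_integral_mono ennreal_norm_diff_le)
  also have "\<dots> = (\<integral>\<^sup>+x. ennreal (norm (h x - s x)) \<partial>M) + (\<integral>\<^sup>+x. ennreal (norm (h x - s' x)) \<partial>M)"
    by (rule nn_integral_add) measurable
  finally show ?thesis .
qed

text \<open>Besides convergence this contains the uniqueness of the integral, so that the
  \<open>THE\<close> in \<open>strong_integral\<close> denotes it.\<close>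

lemma has_strong_integral_approx:
  fixes h :: "'w \<Rightarrow> 'a::banach"
  assumes s: "\<And>i::nat. sbi_able M (s i)" "\<And>x. x \<in> space M \<Longrightarrow> (\<lambda>i. s i x) \<longlonglongrightarrow> h x"
    and lim: "(\<lambda>i. \<integral>\<^sup>+x. ennreal (norm (h x - s i x)) \<partial>M) \<longlonglongrightarrow> 0"
  shows "has_strong_integral M h (strong_integral M h) \<and> (\<lambda>i. sbi M (s i)) \<longlonglongrightarrow> strong_integral M h"
proof -
  have sf: "simple_function M (s i)" for i
    using s(1) by (auto elim: Bochner_Integration.simple_bochner_integrable.cases)
  let ?e = "\<lambda>i. \<integral>\<^sup>+x. ennreal (norm (h x - s i x)) \<partial>M"
  have "Cauchy (\<lambda>i. sbi M (s i))"
  proof (rule CauchyI)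
    fix e :: real assume e: "0 < e"
    then have "\<forall>\<^sub>F i in sequentially. ?e i < ennreal (e/2)"
      using lim by (intro order_tendstoD) auto
    then obtain N where N: "\<And>i. i \<ge> N \<Longrightarrow> ?e i < ennreal (e/2)"
      by (auto simp: eventually_sequentially)
    have "norm (sbi M (s i) - sbi M (s j)) < e" if "i \<ge> N" "j \<ge> N" for i j
    proof -
      have "ennreal (norm (sbi M (s i) - sbi M (s j))) \<le> ?e i + ?e j"
        by (rule sbi_dist_limit[OF sf s(2) s(1) s(1)])
      also have "\<dots> < ennreal (e/2) + ennreal (e/2)"
        using N that by (intro add_strict_mono) auto
      also have "\<dots> = ennreal e" using e by (simp add: ennreal_plus[symmetric] del: ennreal_plus)
      finally show ?thesis using e by (simp add: ennreal_less_iff)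
    qed
    then show "\<exists>N. \<forall>i\<ge>N. \<forall>j\<ge>N. norm (sbi M (s i) - sbi M (s j)) < e" by blast
  qed
  then obtain v where v: "(\<lambda>i. sbi M (s i)) \<longlonglongrightarrow> v"
    by (auto simp: Cauchy_convergent_iff convergent_def)
  have sm: "strongly_measurable M h"
    unfolding strongly_measurable_def using sf s(2) by (intro exI[of _ s]) auto
  have hv: "has_strong_integral M h v"
    unfolding has_strong_integral_def using sm s(1) lim v by blast
  have un: "v' = v" if hv': "has_strong_integral M h v'" for v'
  proof -
    obtain s' where s': "\<And>i::nat. sbi_able M (s' i)"
      "(\<lambda>i. \<integral>\<^sup>+x. ennreal (norm (h x - s' i x)) \<partial>M) \<longlonglongrightarrow> 0" "(\<lambda>i. sbi M (s' i)) \<longlonglongrightarrow> v'"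
    proof -
      from hv' have "\<exists>s. (\<forall>i::nat. sbi_able M (s i)) \<and>
        (\<lambda>i. \<integral>\<^sup>+x. ennreal (norm (h x - s i x)) \<partial>M) \<longlonglongrightarrow> 0 \<and> (\<lambda>i. sbi M (s i)) \<longlonglongrightarrow> v'"
        unfolding has_strong_integral_def by (rule conjunct2)
      then show thesis by (elim exE conjE) (rule that(1), auto)
    qed
    have a1: "(\<lambda>i. ennreal (norm (sbi M (s' i) - sbi M (s i)))) \<longlonglongrightarrow> ennreal (norm (v' - v))"
      by (intro tendsto_intros s'(3) v)
    have a2: "(\<lambda>i. (\<integral>\<^sup>+x. ennreal (norm (h x - s' i x)) \<partial>M) + ?e i) \<longlonglongrightarrow> 0 + 0"
      by (intro tendsto_intros s'(2) lim)
    have a3: "ennreal (norm (sbi M (s' i) - sbi M (s i))) \<le> (\<integral>\<^sup>+x. ennreal (norm (h x - s' i x)) \<partial>M) + ?e i" for i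
      by (rule sbi_dist_limit[OF sf s(2) s'(1) s(1)])
    have "ennreal (norm (v' - v)) \<le> 0 + 0"
      by (rule LIMSEQ_le[OF a1 a2]) (intro exI[of _ 0] allI impI a3)
    then show ?thesis by (simp add: ennreal_eq_0_iff)
  qed
  have "strong_integral M h = v"
    unfolding strong_integral_def using hv un by (rule the_equality)
  then show ?thesis using hv v by simp
qed

lemma has_strong_integral_AE_cong:
  assumes "AE x in M. f x = g x"
  shows "has_strong_integral M f v \<longleftrightarrow> has_strong_integral M g v"
proof -
  have "strongly_measurable M g" if "strongly_measurable M f" "AE x in M. f x = g x" for f g
  proof -
    from that(1) obtain s where "(\<forall>i. simple_function M (s i)) \<and> (AE x in M. (\<lambda>i::nat. s i x) \<longlonglongrightarrow> f x)"
      unfolding strongly_measurable_def ..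
    then have s: "\<forall>i. simple_function M (s i)" "AE x in M. (\<lambda>i::nat. s i x) \<longlonglongrightarrow> f x" by simp_all
    have "AE x in M. (\<lambda>i. s i x) \<longlonglongrightarrow> g x" using s(2) that(2) by eventually_elim simp
    then show ?thesis using s(1) unfolding strongly_measurable_def by (intro exI[of _ s] conjI)
  qed
  then have "strongly_measurable M f = strongly_measurable M g"
    using assms AE_symmetric[OF assms] by (intro iffI)
  moreover have "(\<integral>\<^sup>+x. ennreal (norm (f x - s x)) \<partial>M) = (\<integral>\<^sup>+x. ennreal (norm (g x - s x)) \<partial>M)" for s
    using assms by (intro nn_integral_cong_AE) auto
  ultimately show ?thesis unfolding has_strong_integral_def by simp
qed

lemma strong_integral_AE_cong:
  assumes "AE x in M. f x = g x"
  shows "strong_integral M f = strong_integral M g"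
proof -
  have "has_strong_integral M f = has_strong_integral M g"
    by (rule ext) (rule has_strong_integral_AE_cong[OF assms])
  then show ?thesis unfolding strong_integral_def by simp
qed

text \<open>A sequence of simple functions that converges to an \<open>X\<close>-valued function is moved into \<open>X\<close> by a
  map that takes each point to an almost nearest point of \<open>X\<close>.\<close>

lemma Linfc_approx:
  fixes f :: "real^'d \<Rightarrow> 'a::banach"
  assumes X: "subspace X" "closed X" and f: "Linfc X f"
  obtains s f0 B K where "\<And>i::nat. simple_function lebesgue (s i)" "\<And>i x. s i x \<in> X" "\<And>i x. norm (s i x) \<le> B"
    "compact K" "\<And>i x. x \<notin> K \<Longrightarrow> s i x = 0" "\<And>x. (\<lambda>i. s i x) \<longlonglongrightarrow> f0 x" "AE x in lebesgue. f x = f0 x" "0 \<le> B"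
proof -
  obtain s0 B0 K where s0: "\<And>i::nat. simple_function lebesgue (s0 i)" "AE x in lebesgue. (\<lambda>i. s0 i x) \<longlonglongrightarrow> f x"
    and B0: "AE x in lebesgue. norm (f x) \<le> B0" and K: "compact K" "AE x in lebesgue. x \<notin> K \<longrightarrow> f x = 0"
    and fX: "AE x in lebesgue. f x \<in> X"
    using f unfolding Linfc_def strongly_measurable_def by blast
  \<comment> \<open>The extra 1 leaves room: the modified approximants converge to a value of norm
    at most \<open>B0\<close>, so the cut-off at B is eventually inactive.\<close>
  define B where "B = \<bar>B0\<bar> + 1"
  have X0: "0 \<in> X" using X(1) by (rule subspace_0)
  \<comment> \<open>A nearest point of X may not exist, but at positive distance some point is
    within twice the distance; closedness of X makes the distance positive outside of X.\<close>
  have near: "\<exists>z\<in>X. norm (z - y) \<le> 2 * infdist y X" for y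
  proof (cases "y \<in> X")
    case False
    then have "infdist y X > 0" using X(2) X0 by (metis closure_closed empty_iff in_closure_iff_infdist_zero infdist_nonneg order_le_less)
    have "\<exists>z\<in>X. dist y z \<le> 2 * infdist y X"
    proof (rule ccontr)
      assume far: "\<not> (\<exists>z\<in>X. dist y z \<le> 2 * infdist y X)"
      have inf: "infdist y X = (INF z\<in>X. dist y z)" using X0 by (auto simp: infdist_def)
      have "2 * infdist y X \<le> (INF z\<in>X. dist y z)"
        by (rule cINF_greatest) (use X0 far in force)+
      then show False using \<open>infdist y X > 0\<close> inf by simp
    qed
    then obtain z where "z \<in> X" "dist y z \<le> 2 * infdist y X" by blast
    then show ?thesis by (auto simp: dist_norm norm_minus_commute intro!: bexI[of _ z])
  qed (auto intro!: bexI[of _ y])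
  define \<phi> where "\<phi> y = (SOME z. z \<in> X \<and> norm (z - y) \<le> 2 * infdist y X)" for y
  have \<phi>: "\<phi> y \<in> X" "norm (\<phi> y - y) \<le> 2 * infdist y X" for y
    using someI_ex[OF near[of y, unfolded Bex_def]] unfolding \<phi>_def by auto
  define \<psi> where "\<psi> y = (if norm (\<phi> y) \<le> B then \<phi> y else 0)" for y
  have ae: "AE x in lebesgue. (\<lambda>i. s0 i x) \<longlonglongrightarrow> f x \<and> norm (f x) \<le> B0 \<and> (x \<notin> K \<longrightarrow> f x = 0) \<and> f x \<in> X"
    using s0(2) B0 K(2) fX by eventually_elim simp
  obtain N where N: "N \<in> null_sets lebesgue"
    and good': "\<And>x. x \<in> space lebesgue - N \<Longrightarrow> (\<lambda>i. s0 i x) \<longlonglongrightarrow> f x \<and> norm (f x) \<le> B0 \<and> (x \<notin> K \<longrightarrow> f x = 0) \<and> f x \<in> X"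
    by (rule AE_E3[OF ae]) blast
  have good: "(\<lambda>i. s0 i x) \<longlonglongrightarrow> f x" "norm (f x) \<le> B0" "x \<notin> K \<Longrightarrow> f x = 0" "f x \<in> X" if "x \<notin> N" for x
    using good'[of x] that by auto
  define s where "s i x = (if x \<in> K - N then \<psi> (s0 i x) else 0)" for i x
  define f0 where "f0 x = (if x \<in> K - N then f x else 0)" for x
  have Ks: "K \<in> sets lebesgue" using K(1) by (simp add: compact_imp_closed)
  then have KN: "K - N \<in> sets lebesgue" using N by auto
  show ?thesis
  proof (rule that[of s B K f0])
    show "simple_function lebesgue (s i)" for i
    proof -
      have "simple_function lebesgue (indicat_real (K - N))" using KN by (rule simple_function_indicator)
      then have "simple_function lebesgue (\<lambda>x. if indicat_real (K - N) x = 1 then \<psi> (s0 i x) else 0)"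
        by (rule simple_function_compose2[OF _ s0(1), where h = "\<lambda>a b. if a = 1 then \<psi> b else 0"])
      also have "(\<lambda>x. if indicat_real (K - N) x = 1 then \<psi> (s0 i x) else 0) = s i"
        by (auto simp: s_def indicator_def fun_eq_iff)
      finally show ?thesis .
    qed
    show "s i x \<in> X" for i x using \<phi>(1) X0 by (simp add: s_def \<psi>_def)
    show "norm (s i x) \<le> B" for i x by (simp add: s_def \<psi>_def B_def)
    show "s i x = 0" if "x \<notin> K" for i x using that by (simp add: s_def)
    show "AE x in lebesgue. f x = f0 x"
    proof (rule AE_I'[OF N])
      show "{x \<in> space lebesgue. f x \<noteq> f0 x} \<subseteq> N" using good(3) by (auto simp: f0_def)
    qed
    show "(\<lambda>i. s i x) \<longlonglongrightarrow> f0 x" for x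
    proof (cases "x \<in> K - N")
      case True
      then have x: "x \<notin> N" by simp
      \<comment> \<open>As \<open>f x\<close> is in X, the distance of \<open>s0 i x\<close> to X is
        at most its distance to \<open>f x\<close>.\<close>
      have "(\<lambda>i. \<phi> (s0 i x) - s0 i x) \<longlonglongrightarrow> 0"
      proof (rule Lim_null_comparison)
        have "norm (\<phi> (s0 i x) - s0 i x) \<le> 2 * norm (s0 i x - f x)" for i
          using \<phi>(2)[of "s0 i x"] infdist_le[OF good(4)[OF x], of "s0 i x"] by (simp add: dist_norm)
        then show "\<forall>\<^sub>F i in sequentially. norm (\<phi> (s0 i x) - s0 i x) \<le> 2 * norm (s0 i x - f x)" by simp
        show "(\<lambda>i. 2 * norm (s0 i x - f x)) \<longlonglongrightarrow> 0"
          by (rule tendsto_mult_right_zero, rule tendsto_norm_zero, rule LIM_zero, rule good(1)[OF x])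
      qed
      from tendsto_add[OF this good(1)[OF x]] have lim: "(\<lambda>i. \<phi> (s0 i x)) \<longlonglongrightarrow> f x" by simp
      have "\<forall>\<^sub>F i in sequentially. norm (\<phi> (s0 i x)) < B"
        using good(2)[OF x] by (intro order_tendstoD(2)[OF tendsto_norm[OF lim]]) (simp add: B_def)
      then have "\<forall>\<^sub>F i in sequentially. \<phi> (s0 i x) = s i x"
        by eventually_elim (use True in \<open>simp add: s_def \<psi>_def\<close>)
      then show ?thesis using lim True by (simp add: f0_def tendsto_cong)
    next
      case False
      then have "s i x = 0" "f0 x = 0" for i unfolding s_def f0_def by (simp_all only: if_False)
      then show ?thesis by simp
    qed
  qed (use K in \<open>simp_all add: B_def\<close>)
qed

definition strong_set_integral :: "(real^'d \<Rightarrow> 'a::banach) \<Rightarrow> (real^'d) set \<Rightarrow> 'a" where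
  "strong_set_integral f A = strong_integral lebesgue (\<lambda>x. indicator A x *\<^sub>R f x)"

text \<open>Collects what the later estimates need of f: a real function \<phi>, defined everywhere,
  in place of the norm of f, and set integrals that form a finitely additive X-valued set function
  dominated by that of \<phi>. All of it passes to the limit from simple functions with values in
  X.\<close>

lemma Linfc_integrals:
  fixes f :: "real^'d \<Rightarrow> 'a::banach"
  assumes X: "subspace X" "closed X" and f: "Linfc X f"
  shows "\<exists>\<phi> K. integrable lebesgue \<phi> \<and> (\<forall>x. 0 \<le> \<phi> x) \<and> compact K \<and> (\<forall>x. x \<notin> K \<longrightarrow> \<phi> x = 0) \<and>
      (AE x in lebesgue. norm (f x) = \<phi> x) \<and> (\<exists>B. \<forall>x. \<phi> x \<le> B) \<and>
      (\<forall>A\<in>sets lebesgue. strong_set_integral f A \<in> X \<and> norm (strong_set_integral f A) \<le> (LINT x:A|lebesgue. \<phi> x)) \<and>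
      (\<forall>A\<in>sets lebesgue. \<forall>B\<in>sets lebesgue. A \<inter> B = {} \<longrightarrow>
        strong_set_integral f (A \<union> B) = strong_set_integral f A + strong_set_integral f B)"
proof -
  obtain s f0 B K where s: "\<And>i::nat. simple_function lebesgue (s i)" "\<And>i x. s i x \<in> X" "\<And>i x. norm (s i x) \<le> B"
    and K: "compact K" "\<And>i x. x \<notin> K \<Longrightarrow> s i x = 0" and lim: "\<And>x. (\<lambda>i. s i x) \<longlonglongrightarrow> f0 x"
    and ff0: "AE x in lebesgue. f x = f0 x" and B: "0 \<le> B"
    by (rule Linfc_approx[OF X f]) blast
  have X0: "0 \<in> X" using X(1) by (rule subspace_0)
  have Ks: "K \<in> sets lebesgue" "emeasure lebesgue K < \<infinity>"
    using lmeasurable_compact[OF K(1)] by (auto simp: fmeasurable_def)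
  define \<phi> where "\<phi> x = norm (f0 x)" for x
  have \<phi>m[measurable]: "\<phi> \<in> borel_measurable lebesgue"
    unfolding \<phi>_def
    by (rule borel_measurable_LIMSEQ_real[where u = "\<lambda>i x. norm (s i x)"])
      (auto intro!: tendsto_norm lim borel_measurable_simple_function simple_function_compose1[OF s(1)])
  have \<phi>B: "\<phi> x \<le> B" for x
    unfolding \<phi>_def by (rule LIMSEQ_le_const2[OF tendsto_norm[OF lim]]) (use s(3) in auto)
  have \<phi>0: "0 \<le> \<phi> x" for x by (simp add: \<phi>_def)
  have \<phi>K: "\<phi> x = 0" if "x \<notin> K" for x
    using LIMSEQ_unique[OF lim[of x]] K(2)[OF that] by (simp add: \<phi>_def)
  have \<phi>i: "integrable lebesgue \<phi>"
  proof -
    have "integrable lebesgue (\<lambda>x. indicator K x *\<^sub>R \<phi> x)"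
      by (rule integrableI_bounded_set_indicator[where B = B]) (use Ks \<phi>m \<phi>B \<phi>0 in auto)
    moreover have "(\<lambda>x. indicator K x *\<^sub>R \<phi> x) = \<phi>" using \<phi>K by (auto simp: indicator_def fun_eq_iff)
    ultimately show ?thesis by simp
  qed
  let ?s = "\<lambda>A i x. indicator A x *\<^sub>R s i x"
  have sbiA: "sbi_able lebesgue (?s A i)" if A: "A \<in> sets lebesgue" for A i
  proof (rule Bochner_Integration.simple_bochner_integrableI_bounded)
    have "simple_function lebesgue (indicat_real A)" using A by (rule simple_function_indicator)
    then show "simple_function lebesgue (?s A i)"
      by (rule simple_function_compose2[OF _ s(1), where h = "scaleR"])
    have "norm (?s A i x) \<le> B * indicator K x" for x
      using s(3)[of i x] B K(2)[of x i] by (auto simp: indicator_def)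
    then have "(\<integral>\<^sup>+x. ennreal (norm (?s A i x)) \<partial>lebesgue) \<le> (\<integral>\<^sup>+x. ennreal B * indicator K x \<partial>lebesgue)"
      using B by (intro nn_integral_mono) (auto simp: ennreal_mult'[symmetric] ennreal_indicator[symmetric] simp del: ennreal_indicator intro!: ennreal_leI)
    also have "\<dots> < \<infinity>" using Ks by (simp add: nn_integral_cmult_indicator ennreal_mult_less_top)
    finally show "(\<integral>\<^sup>+x. ennreal (norm (?s A i x)) \<partial>lebesgue) < \<infinity>" .
  qed
  have limA: "(\<lambda>i. ?s A i x) \<longlonglongrightarrow> indicator A x *\<^sub>R f0 x" for A x
    by (intro tendsto_intros lim)
  \<comment> \<open>Dominated convergence for the real errors, with majorant 2 B on K.\<close>
  have l1: "(\<lambda>i. \<integral>\<^sup>+x. ennreal (norm (indicator A x *\<^sub>R f0 x - ?s A i x)) \<partial>lebesgue) \<longlonglongrightarrow> 0"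
    if A: "A \<in> sets lebesgue" for A
  proof -
    have sfA: "simple_function lebesgue (?s A i)" for i
      using sbiA[OF A] by (auto elim: Bochner_Integration.simple_bochner_integrable.cases)
    have "(\<lambda>i. \<integral>\<^sup>+x. ennreal (norm (indicator A x *\<^sub>R f0 x - ?s A i x)) \<partial>lebesgue) \<longlonglongrightarrow> (\<integral>\<^sup>+x. 0 \<partial>(lebesgue :: (real^'d) measure))"
    proof (rule nn_integral_dominated_convergence[where w = "\<lambda>x. ennreal (2 * B) * indicator K x"])
      show "(\<lambda>x. ennreal (norm (indicator A x *\<^sub>R f0 x - ?s A i x))) \<in> borel_measurable lebesgue" for i
        using measurable_norm_diff_simple[of lebesgue "?s A" "\<lambda>x. indicator A x *\<^sub>R f0 x" "?s A i", OF sfA limA sfA] by simp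
      show "(\<lambda>x. ennreal (2 * B) * indicator K x) \<in> borel_measurable lebesgue"
        using Ks by (intro borel_measurable_times_ennreal borel_measurable_indicator) auto
      show "(\<integral>\<^sup>+x. ennreal (2 * B) * indicator K x \<partial>lebesgue) < \<infinity>"
        using Ks by (simp add: nn_integral_cmult_indicator ennreal_mult_less_top)
      show "AE x in lebesgue. ennreal (norm (indicator A x *\<^sub>R f0 x - ?s A i x)) \<le> ennreal (2 * B) * indicator K x" for i
      proof (rule AE_I2)
        fix x :: "real^'d"
        have "norm (f0 x - s i x) \<le> 2 * B"
          using \<phi>B[of x] s(3)[of i x] norm_triangle_ineq4[of "f0 x" "s i x"] by (simp add: \<phi>_def)
        moreover have "f0 x = 0 \<and> s i x = 0" if "x \<notin> K" using \<phi>K[OF that] K(2)[OF that] by (simp add: \<phi>_def)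
        ultimately show "ennreal (norm (indicator A x *\<^sub>R f0 x - ?s A i x)) \<le> ennreal (2 * B) * indicator K x"
          using B by (cases "x \<in> K"; cases "x \<in> A") (auto intro: ennreal_leI)
      qed
      show "AE x in lebesgue. (\<lambda>i. ennreal (norm (indicator A x *\<^sub>R f0 x - ?s A i x))) \<longlonglongrightarrow> 0"
      proof (rule AE_I2)
        fix x :: "real^'d"
        have "(\<lambda>i. ennreal (norm (indicator A x *\<^sub>R f0 x - ?s A i x))) \<longlonglongrightarrow> ennreal (norm (indicator A x *\<^sub>R f0 x - indicator A x *\<^sub>R f0 x))"
          by (intro tendsto_intros lim)
        then show "(\<lambda>i. ennreal (norm (indicator A x *\<^sub>R f0 x - ?s A i x))) \<longlonglongrightarrow> 0" by simp
      qed
    qed simp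
    then show ?thesis by simp
  qed
  define L where "L A = strong_set_integral f A" for A
  have L: "(\<lambda>i. sbi lebesgue (?s A i)) \<longlonglongrightarrow> L A" if A: "A \<in> sets lebesgue" for A
  proof -
    have "(\<lambda>i. sbi lebesgue (?s A i)) \<longlonglongrightarrow> strong_integral lebesgue (\<lambda>x. indicator A x *\<^sub>R f0 x)"
      using has_strong_integral_approx[of lebesgue "?s A" "\<lambda>x. indicator A x *\<^sub>R f0 x", OF sbiA[OF A] limA l1[OF A]] by blast
    moreover have "strong_integral lebesgue (\<lambda>x. indicator A x *\<^sub>R f x) = strong_integral lebesgue (\<lambda>x. indicator A x *\<^sub>R f0 x)"
      by (rule strong_integral_AE_cong) (use ff0 in auto)
    ultimately show ?thesis by (simp add: L_def strong_set_integral_def)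
  qed
  have LX: "L A \<in> X" if A: "A \<in> sets lebesgue" for A
  proof (rule closed_sequentially[OF X(2) _ L[OF A]])
    show "sbi lebesgue (?s A i) \<in> X" for i
      unfolding Bochner_Integration.simple_bochner_integral_def
      using s(2) by (intro subspace_sum[OF X(1)] subspace_scale[OF X(1)]) (auto intro!: subspace_scale[OF X(1)])
  qed
  have Ln: "norm (L A) \<le> (LINT x:A|lebesgue. \<phi> x)" if A: "A \<in> sets lebesgue" for A
  proof -
    have intA: "integrable lebesgue (\<lambda>x. indicator A x *\<^sub>R \<phi> x)"
      by (rule integrable_mult_indicator[OF A \<phi>i])
    have sfA: "simple_function lebesgue (?s A i)" for i
      using sbiA[OF A] by (auto elim: Bochner_Integration.simple_bochner_integrable.cases)
    let ?c = "\<integral>\<^sup>+x. ennreal (indicator A x *\<^sub>R \<phi> x) \<partial>lebesgue"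
    let ?e = "\<lambda>i. \<integral>\<^sup>+x. ennreal (norm (indicator A x *\<^sub>R f0 x - ?s A i x)) \<partial>lebesgue"
    have a3: "ennreal (norm (sbi lebesgue (?s A i))) \<le> ?e i + ?c" for i
    proof -
      have "sbi_able lebesgue (\<lambda>x. 0 :: 'a)"
        by (rule Bochner_Integration.simple_bochner_integrableI_bounded) auto
      from sbi_dist_limit[of lebesgue "?s A" "\<lambda>x. indicator A x *\<^sub>R f0 x", OF sfA limA sbiA[OF A] this]
      show ?thesis by (simp add: Bochner_Integration.simple_bochner_integral_def \<phi>_def)
    qed
    have a2: "(\<lambda>i. ?e i + ?c) \<longlonglongrightarrow> 0 + ?c"
      by (intro tendsto_add tendsto_const l1[OF A])
    have a1: "(\<lambda>i. ennreal (norm (sbi lebesgue (?s A i)))) \<longlonglongrightarrow> ennreal (norm (L A))"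
      by (intro tendsto_intros L[OF A])
    have "ennreal (norm (L A)) \<le> 0 + ?c"
      by (rule LIMSEQ_le[OF a1 a2]) (intro exI[of _ 0] allI impI a3)
    also have "0 + ?c = ennreal (\<integral>x. indicator A x *\<^sub>R \<phi> x \<partial>lebesgue)"
      using nn_integral_eq_integral[OF intA] by (simp add: \<phi>_def)
    finally show ?thesis
      unfolding set_lebesgue_integral_def
      by (subst (asm) ennreal_le_iff) (auto intro!: integral_nonneg_AE simp: \<phi>_def)
  qed
  have La: "L (A \<union> C) = L A + L C" if A: "A \<in> sets lebesgue" and C: "C \<in> sets lebesgue" and AC: "A \<inter> C = {}" for A C
  proof -
    have "(\<lambda>x. ?s A i x + ?s C i x) = ?s (A \<union> C) i" for i
      using AC by (auto simp: indicator_def fun_eq_iff)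
    then have "sbi lebesgue (?s (A \<union> C) i) = sbi lebesgue (?s A i) + sbi lebesgue (?s C i)" for i
      using Bochner_Integration.simple_bochner_integral_add[OF sbiA[OF A, of i] sbiA[OF C, of i]] by simp
    then have "(\<lambda>i. sbi lebesgue (?s (A \<union> C) i)) \<longlonglongrightarrow> L A + L C"
      using tendsto_add[OF L[OF A] L[OF C]] by simp
    moreover have "A \<union> C \<in> sets lebesgue" using A C by auto
    ultimately show ?thesis using LIMSEQ_unique L by blast
  qed
  have ae: "AE x in lebesgue. norm (f x) = \<phi> x" using ff0 by eventually_elim (simp add: \<phi>_def)
  show ?thesis
  proof (intro exI[of _ \<phi>] exI[of _ K] conjI ballI allI impI)
    show "strong_set_integral f A \<in> X" if "A \<in> sets lebesgue" for A using LX[OF that] by (simp add: L_def)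
    show "norm (strong_set_integral f A) \<le> (LINT x:A|lebesgue. \<phi> x)" if "A \<in> sets lebesgue" for A
      using Ln[OF that] by (simp add: L_def)
    show "strong_set_integral f (A \<union> C) = strong_set_integral f A + strong_set_integral f C"
      if "A \<in> sets lebesgue" "C \<in> sets lebesgue" "A \<inter> C = {}" for A C
      using La[OF that] by (simp add: L_def)
    show "\<exists>B. \<forall>x. \<phi> x \<le> B" using \<phi>B by blast
  qed (use \<phi>i K(1) \<phi>K ae in \<open>simp_all add: \<phi>_def\<close>)
qed

section \<open>Sparse stopping collections\<close>

context dyadic_system
begin

definition mass :: "(real^'d \<Rightarrow> real) \<Rightarrow> (real^'d) set \<Rightarrow> real" where
  "mass \<phi> A = (LINT x:A|lebesgue. \<phi> x)"

definition ave :: "(real^'d \<Rightarrow> real) \<Rightarrow> (real^'d) set \<Rightarrow> real" where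
  "ave \<phi> A = mass \<phi> A / measure lebesgue A"

lemma nn_mass:
  assumes "integrable lebesgue \<phi>" "\<And>x. 0 \<le> \<phi> x" "A \<in> sets lebesgue"
  shows "(\<integral>\<^sup>+x. ennreal (\<phi> x) * indicator A x \<partial>lebesgue) = ennreal (mass \<phi> A)"
proof -
  have i: "integrable lebesgue (\<lambda>x. indicator A x *\<^sub>R \<phi> x)"
    by (rule integrable_mult_indicator[OF assms(3,1)])
  have "(\<integral>\<^sup>+x. ennreal (\<phi> x) * indicator A x \<partial>lebesgue) = (\<integral>\<^sup>+x. ennreal (indicator A x *\<^sub>R \<phi> x) \<partial>lebesgue)"
    by (intro nn_integral_cong) (auto simp: indicator_def)
  also have "\<dots> = ennreal (mass \<phi> A)"
    unfolding mass_def set_lebesgue_integral_def by (rule nn_integral_eq_integral[OF i]) (simp add: assms(2))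
  finally show ?thesis .
qed

lemma mass_nonneg: "(\<And>x. 0 \<le> \<phi> x) \<Longrightarrow> 0 \<le> mass \<phi> A"
  unfolding mass_def set_lebesgue_integral_def by (intro integral_nonneg_AE) auto

lemma ave_nonneg: "(\<And>x. 0 \<le> \<phi> x) \<Longrightarrow> 0 \<le> ave \<phi> A"
  unfolding ave_def by (intro divide_nonneg_nonneg mass_nonneg) auto

lemma mass_eq: "mass \<phi> (cube_at \<omega> k x) = ave \<phi> (cube_at \<omega> k x) * cube_vol TYPE('d) k"
  by (simp add: ave_def measure_cube_at)

lemma mass_mono:
  assumes "integrable lebesgue \<phi>" "\<And>x. 0 \<le> \<phi> x" "A \<in> sets lebesgue" "B \<in> sets lebesgue" "A \<subseteq> B"
  shows "mass \<phi> A \<le> mass \<phi> B"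
  unfolding mass_def set_lebesgue_integral_def
  by (intro integral_mono integrable_mult_indicator assms) (use assms(2,5) in \<open>auto simp: indicator_def\<close>)

text \<open>The child has no more mass, and its volume is smaller by the factor
  \<open>2 ^ CARD('d)\<close>.\<close>

lemma ave_child_le:
  assumes "integrable lebesgue \<phi>" "\<And>x. 0 \<le> \<phi> x"
  shows "ave \<phi> (cube_at \<omega> (k + 1) x) \<le> 2 ^ CARD('d) * ave \<phi> (cube_at \<omega> k x)"
proof -
  have "mass \<phi> (cube_at \<omega> (k + 1) x) \<le> mass \<phi> (cube_at \<omega> k x)"
    by (intro mass_mono assms cube_at_mono shifts) auto
  moreover have "cube_vol TYPE('d) k = 2 ^ CARD('d) * cube_vol TYPE('d) (k + 1)"
    using cube_vol_add[where 'd='d, of k 1] by simp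
  ultimately have "ave \<phi> (cube_at \<omega> (k + 1) x) * cube_vol TYPE('d) (k + 1) \<le>
      (2 ^ CARD('d) * ave \<phi> (cube_at \<omega> k x)) * cube_vol TYPE('d) (k + 1)"
    unfolding mass_eq by (simp add: mult_ac)
  then show ?thesis by (rule mult_right_le_imp_le) simp
qed

lemma mass_atoms:
  assumes "integrable lebesgue \<phi>" "k \<le> l"
  shows "mass \<phi> (cube_at \<omega> k x) = (\<Sum>w\<in>atoms l (cube_at \<omega> k x). mass \<phi> w)"
  unfolding mass_def by (rule set_integral_atoms[OF assms(2,1)])

definition maximal_cubes :: "(real^'d) set set \<Rightarrow> (real^'d) set set" where
  "maximal_cubes F = {Q\<in>F. \<forall>Q'\<in>F. Q \<subseteq> Q' \<longrightarrow> Q' = Q}"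

lemma grid_nested:
  assumes "Q \<in> dyadic_grid \<omega>" "Q' \<in> dyadic_grid \<omega>" "Q \<inter> Q' \<noteq> {}"
  shows "Q \<subseteq> Q' \<or> Q' \<subseteq> Q"
proof -
  obtain k x l y where Q: "Q = cube_at \<omega> k x" "Q' = cube_at \<omega> l y" using assms(1,2) by (meson grid_cases)
  show ?thesis
  proof (cases "l \<le> k")
    case True
    then show ?thesis using cube_at_nested[OF shifts, of k x l y] assms(3) unfolding Q by blast
  next
    case False
    then show ?thesis using cube_at_nested[OF shifts, of l y k x] assms(3) unfolding Q by (simp add: Int_commute)
  qed
qed

lemma maximal_cubes_disjoint:
  assumes "F \<subseteq> dyadic_grid \<omega>" "Q \<in> maximal_cubes F" "Q' \<in> maximal_cubes F" "Q \<noteq> Q'"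
  shows "Q \<inter> Q' = {}"
proof (rule ccontr)
  assume "Q \<inter> Q' \<noteq> {}"
  then have "Q \<subseteq> Q' \<or> Q' \<subseteq> Q" using assms(1-3) by (intro grid_nested) (auto simp: maximal_cubes_def)
  then show False using assms(2-4) by (auto simp: maximal_cubes_def)
qed

text \<open>An upper bound for the size of the cubes of F, which guarantees that maximal cubes
  exist.\<close>

definition levels_ge :: "int \<Rightarrow> (real^'d) set set \<Rightarrow> bool" where
  "levels_ge k0 F \<longleftrightarrow> (\<forall>k x. cube_at \<omega> k x \<in> F \<longrightarrow> k0 \<le> k)"

text \<open>Take the least level at which the cube around a fixed point of Q belongs to F.\<close>

lemma maximal_cube_above:
  assumes F: "F \<subseteq> dyadic_grid \<omega>" and lev: "levels_ge k0 F" and Q: "Q \<in> F"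
  obtains P where "P \<in> maximal_cubes F" "Q \<subseteq> P"
proof -
  obtain k x where kx: "Q = cube_at \<omega> k x" using F Q by (meson grid_cases subsetD)
  have k0: "k0 \<le> k" if "cube_at \<omega> k x \<in> F" for k x using lev that unfolding levels_ge_def by blast
  define n where "n = (LEAST n. cube_at \<omega> (k0 + int n) x \<in> F)"
  have k: "k0 \<le> k" using k0 Q kx by blast
  then have "cube_at \<omega> (k0 + int (nat (k - k0))) x \<in> F" using Q kx by simp
  then have n: "cube_at \<omega> (k0 + int n) x \<in> F" and le: "n \<le> nat (k - k0)"
    unfolding n_def by (rule LeastI, rule Least_le)
  have le': "k0 + int n \<le> k" using le k by linarith
  have "Q' = cube_at \<omega> (k0 + int n) x" if Q': "Q' \<in> F" "cube_at \<omega> (k0 + int n) x \<subseteq> Q'" for Q'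
  proof -
    obtain l y where ly: "Q' = cube_at \<omega> l y" using F Q'(1) by (meson grid_cases subsetD)
    have "x \<in> Q'" using Q'(2) self_mem_cube_at by blast
    then have lx: "Q' = cube_at \<omega> l x" using ly by (simp add: cube_at_eq)
    have "k0 \<le> l" using k0 Q'(1) ly by blast
    then have "cube_at \<omega> (k0 + int (nat (l - k0))) x \<in> F" using Q'(1) lx by simp
    then have "n \<le> nat (l - k0)" unfolding n_def by (rule Least_le)
    moreover have "l \<le> k0 + int n" using Q'(2) lx cube_at_subset_level by blast
    ultimately have "l = k0 + int n" using \<open>k0 \<le> l\<close> by linarith
    then show ?thesis using lx by simp
  qed
  then have "cube_at \<omega> (k0 + int n) x \<in> maximal_cubes F" using n by (auto simp: maximal_cubes_def)
  moreover have "Q \<subseteq> cube_at \<omega> (k0 + int n) x" unfolding kx by (rule cube_at_mono[OF shifts le'])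
  ultimately show ?thesis by (rule that)
qed

lemma Union_maximal_cubes:
  assumes "F \<subseteq> dyadic_grid \<omega>" "levels_ge k0 F"
  shows "\<Union>(maximal_cubes F) = \<Union>F"
proof
  show "\<Union>F \<subseteq> \<Union>(maximal_cubes F)"
  proof
    fix x assume "x \<in> \<Union>F"
    then obtain Q where Q: "Q \<in> F" "x \<in> Q" by blast
    obtain P where "P \<in> maximal_cubes F" "Q \<subseteq> P" by (rule maximal_cube_above[OF assms Q(1)])
    then show "x \<in> \<Union>(maximal_cubes F)" using Q(2) by blast
  qed
qed (auto simp: maximal_cubes_def)

lemma grid_lebesgue: "Q \<in> dyadic_grid \<omega> \<Longrightarrow> Q \<in> sets lebesgue"
  by (metis grid_cases cube_at_lebesgue)

lemma Union_grid_lebesgue: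
  assumes "F \<subseteq> dyadic_grid \<omega>" shows "\<Union>F \<in> sets lebesgue"
  using assms countable_subset[OF assms grid_countable] grid_lebesgue by (intro sets.countable_Union) auto

text \<open>The weak type (1,1) bound of the dyadic maximal function, localized to the union. The
  maximal cubes are disjoint and both sides are measures, so the hypothesis on single cubes adds
  up.\<close>

lemma maximal_inequality:
  assumes F: "F \<subseteq> dyadic_grid \<omega>" and k0: "levels_ge k0 F"
    and \<phi>: "integrable lebesgue \<phi>" "\<And>x. 0 \<le> \<phi> x"
    and c: "0 \<le> c" "\<And>Q. Q \<in> F \<Longrightarrow> c * measure lebesgue Q \<le> mass \<phi> Q"
  shows "ennreal c * emeasure lebesgue (\<Union>F) \<le> (\<integral>\<^sup>+x. ennreal (\<phi> x) * indicator (\<Union>F) x \<partial>lebesgue)"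
proof -
  let ?M = "maximal_cubes F" and ?\<nu> = "density lebesgue (\<lambda>x. ennreal (\<phi> x))"
  have MF: "?M \<subseteq> F" by (auto simp: maximal_cubes_def)
  have cnt: "countable ?M" using MF F grid_countable by (meson countable_subset order_trans)
  have leb: "Q \<in> sets lebesgue" if "Q \<in> ?M" for Q using that MF F grid_lebesgue by blast
  have disj: "disjoint_family_on (\<lambda>Q. Q) ?M"
    using maximal_cubes_disjoint[OF F] by (auto simp: disjoint_family_on_def)
  have [measurable]: "(\<lambda>x. ennreal (\<phi> x)) \<in> borel_measurable lebesgue" using \<phi>(1) by auto
  have le: "ennreal c * emeasure lebesgue Q \<le> emeasure ?\<nu> Q" if QM: "Q \<in> ?M" for Q
  proof -
    have "Q \<in> dyadic_grid \<omega>" using QM MF F by blast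
    then obtain k x where Q: "Q = cube_at \<omega> k x" by (rule grid_cases)
    have "ennreal c * emeasure lebesgue Q = ennreal (c * measure lebesgue Q)"
      unfolding Q using c(1) by (simp add: emeasure_cube_at measure_cube_at ennreal_mult'')
    also have "\<dots> \<le> ennreal (mass \<phi> Q)" using c(2) QM MF by (intro ennreal_leI) blast
    also have "\<dots> = emeasure ?\<nu> Q"
      using nn_mass[OF \<phi> leb[OF QM]] leb[OF QM] by (simp add: emeasure_density)
    finally show ?thesis .
  qed
  have "ennreal c * emeasure lebesgue (\<Union>Q\<in>?M. Q) = ennreal c * (\<integral>\<^sup>+Q. emeasure lebesgue Q \<partial>count_space ?M)"
    by (subst emeasure_UN_countable[OF leb cnt disj]) auto
  also have "\<dots> = (\<integral>\<^sup>+Q. ennreal c * emeasure lebesgue Q \<partial>count_space ?M)"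
    by (subst nn_integral_cmult) auto
  also have "\<dots> \<le> (\<integral>\<^sup>+Q. emeasure ?\<nu> Q \<partial>count_space ?M)"
    by (intro nn_integral_mono) (auto intro: le)
  also have "\<dots> = emeasure ?\<nu> (\<Union>Q\<in>?M. Q)"
    by (subst emeasure_UN_countable[OF _ cnt disj]) (auto intro: leb)
  also have "(\<Union>Q\<in>?M. Q) = \<Union>F" using Union_maximal_cubes[OF F k0] by simp
  also have "emeasure ?\<nu> (\<Union>F) = (\<integral>\<^sup>+x. ennreal (\<phi> x) * indicator (\<Union>F) x \<partial>lebesgue)"
    by (rule emeasure_density) (use Union_grid_lebesgue[OF F] in auto)
  finally show ?thesis .
qed

definition bad_cubes :: "'i set \<Rightarrow> ('i \<Rightarrow> real^'d \<Rightarrow> real) \<Rightarrow> real \<Rightarrow> (real^'d) set \<Rightarrow> (real^'d) set set" where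
  "bad_cubes I \<phi> A R = {P\<in>dyadic_grid \<omega>. P \<subset> R \<and> (\<exists>i\<in>I. A * ave (\<phi> i) R < ave (\<phi> i) P)}"

definition stopping_cubes :: "'i set \<Rightarrow> ('i \<Rightarrow> real^'d \<Rightarrow> real) \<Rightarrow> real \<Rightarrow> (real^'d) set \<Rightarrow> (real^'d) set set" where
  "stopping_cubes I \<phi> A R = maximal_cubes (bad_cubes I \<phi> A R)"

lemma bad_cubes_level:
  "levels_ge k (bad_cubes I \<phi> A (cube_at \<omega> k x))"
  unfolding levels_ge_def bad_cubes_def using cube_at_subset_level[of \<omega> _ _ k x] by blast

text \<open>For each i the cubes whose average exceeds A times that of R fill at most the fraction 1
  / A of R, by the maximal inequality; the factor \<open>card I\<close> is the union over i.\<close>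

lemma emeasure_stopping_cubes:
  assumes I: "finite I" and A: "0 < A"
    and \<phi>: "\<And>i. i \<in> I \<Longrightarrow> integrable lebesgue (\<phi> i)" "\<And>i x. i \<in> I \<Longrightarrow> 0 \<le> \<phi> i x"
  shows "emeasure lebesgue (\<Union>(stopping_cubes I \<phi> A (cube_at \<omega> k x))) \<le> ennreal (card I / A * cube_vol TYPE('d) k)"
proof -
  let ?R = "cube_at \<omega> k x"
  define F where "F i = {P\<in>dyadic_grid \<omega>. P \<subset> ?R \<and> A * ave (\<phi> i) ?R < ave (\<phi> i) P}" for i
  have FF: "F i \<subseteq> bad_cubes I \<phi> A ?R" if "i \<in> I" for i using that by (auto simp: F_def bad_cubes_def)
  have Fg: "F i \<subseteq> dyadic_grid \<omega>" for i by (auto simp: F_def)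
  have lev: "levels_ge k (F i)" for i
    unfolding levels_ge_def F_def using cube_at_subset_level[of \<omega> _ _ k x] by blast
  have one: "emeasure lebesgue (\<Union>(F i)) \<le> ennreal (1 / A * cube_vol TYPE('d) k)" if i: "i \<in> I" for i
  proof (cases "ave (\<phi> i) ?R = 0")
    case True
    \<comment> \<open>With average 0 the threshold is 0 and cannot be divided out; but then no
      subcube has mass.\<close>
    have "F i = {}"
    proof (rule ccontr)
      assume "F i \<noteq> {}"
      then obtain P where P: "P \<in> dyadic_grid \<omega>" "P \<subset> ?R" "0 < ave (\<phi> i) P" using True by (auto simp: F_def)
      have "mass (\<phi> i) P \<le> mass (\<phi> i) ?R"
        using P by (intro mass_mono \<phi> i) (auto intro: grid_lebesgue)
      then have "mass (\<phi> i) P \<le> 0" using True by (simp add: mass_eq)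
      then have "ave (\<phi> i) P \<le> 0" unfolding ave_def by (intro divide_nonpos_nonneg) auto
      then show False using P(3) by simp
    qed
    then show ?thesis by simp
  next
    case False
    define c where "c = A * ave (\<phi> i) ?R"
    have av: "0 < ave (\<phi> i) ?R" using False ave_nonneg[of "\<phi> i" ?R, OF \<phi>(2)[OF i]] by simp
    have c: "0 < c" using av A by (simp add: c_def)
    have "c * measure lebesgue Q \<le> mass (\<phi> i) Q" if QF: "Q \<in> F i" for Q
    proof -
      have "Q \<in> dyadic_grid \<omega>" using QF Fg by blast
      then obtain l y where Q: "Q = cube_at \<omega> l y" by (rule grid_cases)
      have "c \<le> ave (\<phi> i) Q" using QF by (simp add: F_def c_def)
      then show ?thesis unfolding Q mass_eq measure_cube_at by (intro mult_right_mono) auto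
    qed
    then have "ennreal c * emeasure lebesgue (\<Union>(F i)) \<le> (\<integral>\<^sup>+x. ennreal (\<phi> i x) * indicator (\<Union>(F i)) x \<partial>lebesgue)"
      using c by (intro maximal_inequality[OF Fg lev \<phi>(1)[OF i] \<phi>(2)[OF i]]) auto
    also have "\<dots> \<le> (\<integral>\<^sup>+x. ennreal (\<phi> i x) * indicator ?R x \<partial>lebesgue)"
      by (intro nn_integral_mono) (auto simp: F_def indicator_def)
    also have "\<dots> = ennreal (ave (\<phi> i) ?R * cube_vol TYPE('d) k)"
      by (subst nn_mass[OF \<phi>(1)[OF i] \<phi>(2)[OF i]]) (auto simp: mass_eq)
    also have "\<dots> = ennreal c * ennreal (1 / A * cube_vol TYPE('d) k)"
      using A c by (simp add: ennreal_mult'[symmetric] c_def)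
    finally show ?thesis using c by (subst (asm) ennreal_mult_le_mult_iff) auto
  qed
  have "\<Union>(stopping_cubes I \<phi> A ?R) = \<Union>(bad_cubes I \<phi> A ?R)"
    unfolding stopping_cubes_def
    by (rule Union_maximal_cubes[OF _ bad_cubes_level]) (auto simp: bad_cubes_def)
  also have "\<dots> = (\<Union>i\<in>I. \<Union>(F i))" by (auto simp: F_def bad_cubes_def)
  finally have "emeasure lebesgue (\<Union>(stopping_cubes I \<phi> A ?R)) = emeasure lebesgue (\<Union>i\<in>I. \<Union>(F i))" by simp
  also have "\<dots> \<le> (\<Sum>i\<in>I. emeasure lebesgue (\<Union>(F i)))"
    using I Union_grid_lebesgue[OF Fg] by (intro emeasure_subadditive_finite) auto
  also have "\<dots> \<le> (\<Sum>i\<in>I. ennreal (1 / A * cube_vol TYPE('d) k))"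
    by (intro sum_mono one)
  also have "\<dots> = ennreal (card I / A * cube_vol TYPE('d) k)"
    using A by (simp add: ennreal_of_nat_eq_real_of_nat ennreal_mult''[symmetric])
  finally show ?thesis .
qed

lemma stopping_cubesD:
  assumes "P \<in> stopping_cubes I \<phi> A R"
  shows "P \<in> dyadic_grid \<omega>" "P \<subset> R"
  using assms by (auto simp: stopping_cubes_def maximal_cubes_def bad_cubes_def)

text \<open>Generation 0 consists of all cubes of one level, so the stopping trees start at a common
  scale and cover the whole space.\<close>

primrec generation :: "'i set \<Rightarrow> ('i \<Rightarrow> real^'d \<Rightarrow> real) \<Rightarrow> real \<Rightarrow> int \<Rightarrow> nat \<Rightarrow> (real^'d) set set" where
  "generation I \<phi> A k 0 = range (cube_at \<omega> k)"
| "generation I \<phi> A k (Suc j) = (\<Union>R\<in>generation I \<phi> A k j. stopping_cubes I \<phi> A R)"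

lemma generation_grid: "generation I \<phi> A k j \<subseteq> dyadic_grid \<omega>"
proof (cases j)
  case (Suc j)
  then show ?thesis by (auto dest: stopping_cubesD)
qed auto

lemma generation_disjoint:
  "Q \<in> generation I \<phi> A k j \<Longrightarrow> Q' \<in> generation I \<phi> A k j \<Longrightarrow> Q \<noteq> Q' \<Longrightarrow> Q \<inter> Q' = {}"
proof (induction j arbitrary: Q Q')
  case 0
  then show ?case by (auto simp: cube_at_def)
next
  case (Suc j)
  then obtain R R' where R: "R \<in> generation I \<phi> A k j" "Q \<in> stopping_cubes I \<phi> A R"
    "R' \<in> generation I \<phi> A k j" "Q' \<in> stopping_cubes I \<phi> A R'" by auto
  show ?case
  proof (cases "R = R'")
    case True
    have "bad_cubes I \<phi> A R \<subseteq> dyadic_grid \<omega>" by (auto simp: bad_cubes_def)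
    from maximal_cubes_disjoint[OF this] show ?thesis
      using R Suc.prems True unfolding stopping_cubes_def by blast
  next
    case False
    then have "R \<inter> R' = {}" using Suc.IH R by blast
    then show ?thesis using stopping_cubesD(2)[OF R(2)] stopping_cubesD(2)[OF R(4)] by blast
  qed
qed

lemma generation_below:
  "Q \<in> generation I \<phi> A k (i + j) \<Longrightarrow> \<exists>R\<in>generation I \<phi> A k i. Q \<subseteq> R"
proof (induction j arbitrary: Q)
  case (Suc j)
  then obtain R where "R \<in> generation I \<phi> A k (i + j)" "Q \<in> stopping_cubes I \<phi> A R" by auto
  then show ?case using Suc.IH[of R] stopping_cubesD(2) by (meson order_trans psubset_imp_subset)
qed auto

text \<open>\<open>E R\<close> is what remains of R after removing its stopping children, which
  cover less than 1 - \<eta> of it. The last conclusion provides the stopping parent. It controls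
  every cube between a given one and its parent, because later the whole chain of ancestors enters
  the stopped averages.\<close>

theorem sparse_stopping:
  assumes I: "finite I" and A: "1 \<le> A" "card I / A < 1 - \<eta>"
    and \<phi>: "\<And>i. i \<in> I \<Longrightarrow> integrable lebesgue (\<phi> i)" "\<And>i x. i \<in> I \<Longrightarrow> 0 \<le> \<phi> i x"
  obtains S where "S \<subseteq> dyadic_grid \<omega>" "sparse_collection \<eta> S" "\<And>x. cube_at \<omega> k0 x \<in> S"
    "\<And>R k x. R \<in> S \<Longrightarrow> R = cube_at \<omega> k x \<Longrightarrow> k0 \<le> k"
    "\<And>k x. k0 \<le> k \<Longrightarrow> \<exists>R\<in>S. cube_at \<omega> k x \<subseteq> R \<and>
      (\<forall>Q\<in>dyadic_grid \<omega>. cube_at \<omega> k x \<subseteq> Q \<and> Q \<subseteq> R \<longrightarrow> (\<forall>i\<in>I. ave (\<phi> i) Q \<le> A * ave (\<phi> i) R))"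
proof -
  let ?G = "generation I \<phi> A k0" and ?ch = "stopping_cubes I \<phi> A"
  define S where "S = (\<Union>j. ?G j)"
  define E where "E R = R - \<Union>(?ch R)" for R
  have Sg: "S \<subseteq> dyadic_grid \<omega>" unfolding S_def using generation_grid by blast
  have chS: "P \<in> S" if RP: "R \<in> S" "P \<in> ?ch R" for R P
  proof -
    obtain j where "R \<in> ?G j" using RP(1) by (auto simp: S_def)
    then have "P \<in> ?G (Suc j)" using RP(2) by auto
    then show ?thesis unfolding S_def by blast
  qed
  have EE: "E R \<inter> E R' = {}" if RR: "R \<in> ?G i" "R' \<in> ?G j" "i \<le> j" "R \<noteq> R'" for R R' i j
  proof (cases "i = j")
    case True
    then show ?thesis using generation_disjoint RR unfolding E_def by blast
  next
    case False
    then have "R' \<in> ?G (Suc i + (j - Suc i))" using RR by simp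
    then obtain P where P: "P \<in> ?G (Suc i)" "R' \<subseteq> P" using generation_below by blast
    then obtain R0 where R0: "R0 \<in> ?G i" "P \<in> ?ch R0" by auto
    show ?thesis
    proof (cases "R0 = R")
      case True
      then show ?thesis using P R0 unfolding E_def by blast
    next
      case False
      then have "R0 \<inter> R = {}" using generation_disjoint R0(1) RR(1) by blast
      then show ?thesis using P R0 stopping_cubesD(2)[OF R0(2)] unfolding E_def by blast
    qed
  qed
  have sp: "E Q \<in> sets lebesgue \<and> E Q \<subseteq> Q \<and> \<eta> * measure lebesgue Q < measure lebesgue (E Q)" if Q: "Q \<in> S" for Q
  proof -
    obtain k x where kx: "Q = cube_at \<omega> k x" using Sg Q by (meson grid_cases subsetD)
    let ?V = "cube_vol TYPE('d) k" and ?U = "\<Union>(?ch Q)"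
    have U: "?U \<in> sets lebesgue" by (rule Union_grid_lebesgue) (auto dest: stopping_cubesD)
    have UQ: "?U \<subseteq> Q" using stopping_cubesD(2) by blast
    have eU: "emeasure lebesgue ?U \<le> ennreal (card I / A * ?V)"
      unfolding kx using A by (intro emeasure_stopping_cubes I \<phi>) auto
    then have fin: "emeasure lebesgue ?U < \<infinity>" by (rule order_le_less_trans) simp
    have mU: "measure lebesgue ?U \<le> card I / A * ?V"
      using eU A by (simp add: measure_def enn2real_leI)
    have "measure lebesgue (E Q) = measure lebesgue Q - measure lebesgue ?U"
      unfolding E_def using U UQ fin kx by (intro measure_Diff) (auto simp: emeasure_cube_at)
    also have "\<dots> \<ge> ?V - card I / A * ?V" using mU kx by (simp add: measure_cube_at)
    finally have "?V * (1 - card I / A) \<le> measure lebesgue (E Q)" by (simp add: algebra_simps)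
    moreover have "?V * \<eta> < ?V * (1 - card I / A)" using A(2) by (intro mult_strict_left_mono) auto
    ultimately have "?V * \<eta> < measure lebesgue (E Q)" by linarith
    then have "\<eta> * measure lebesgue Q < measure lebesgue (E Q)" unfolding kx measure_cube_at by (simp only: mult.commute)
    then show ?thesis using U kx by (auto simp: E_def)
  qed
  show ?thesis
  proof (rule that[of S])
    show "S \<subseteq> dyadic_grid \<omega>" by (rule Sg)
    show "sparse_collection \<eta> S"
      unfolding sparse_collection_def
    proof (intro exI[of _ E] conjI ballI)
      show "disjoint_family_on E S"
        unfolding disjoint_family_on_def
      proof (intro ballI impI)
        fix R R' assume "R \<in> S" "R' \<in> S" "R \<noteq> R'"
        then obtain i j where "R \<in> ?G i" "R' \<in> ?G j" by (auto simp: S_def)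
        then show "E R \<inter> E R' = {}"
          using EE[of R i R' j] EE[of R' j R i] \<open>R \<noteq> R'\<close> by (cases "i \<le> j") auto
      qed
    qed (use sp in auto)
    show "cube_at \<omega> k0 x \<in> S" for x
      unfolding S_def by (rule UN_I[of 0]) auto
    show "k0 \<le> k" if RS: "R \<in> S" "R = cube_at \<omega> k x" for R k x
    proof -
      obtain j where "R \<in> ?G j" using RS(1) by (auto simp: S_def)
      then have "R \<in> ?G (0 + j)" by simp
      then obtain R0 where "R0 \<in> ?G 0" "R \<subseteq> R0" using generation_below by blast
      then show ?thesis using RS(2) cube_at_subset_level by auto
    qed
    show "\<exists>R\<in>S. cube_at \<omega> k x \<subseteq> R \<and>
      (\<forall>Q\<in>dyadic_grid \<omega>. cube_at \<omega> k x \<subseteq> Q \<and> Q \<subseteq> R \<longrightarrow> (\<forall>i\<in>I. ave (\<phi> i) Q \<le> A * ave (\<phi> i) R))"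
      if k: "k0 \<le> k" for k x
    proof -
      \<comment> \<open>The parent is to be the smallest cube of S that contains the given one, so l
        is the largest candidate level.\<close>
      define L where "L = {l\<in>{k0..k}. cube_at \<omega> l x \<in> S}"
      have "cube_at \<omega> k0 x \<in> S" unfolding S_def by (rule UN_I[of 0]) auto
      then have "k0 \<in> L" using k unfolding L_def by auto
      moreover have "finite L" by (rule finite_subset[of L "{k0..k}"]) (auto simp: L_def)
      ultimately have L: "finite L" "k0 \<in> L" by simp_all
      define l where "l = Max L"
      have lL: "l \<in> L" using L unfolding l_def by (intro Max_in) auto
      let ?R = "cube_at \<omega> l x"
      have R: "?R \<in> S" "l \<le> k" using lL by (auto simp: L_def)
      have "ave (\<phi> i) Q \<le> A * ave (\<phi> i) ?R"
        if Q: "Q \<in> dyadic_grid \<omega>" "cube_at \<omega> k x \<subseteq> Q" "Q \<subseteq> ?R" and i: "i \<in> I" for Q i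
      proof (rule ccontr)
        \<comment> \<open>An average that is too large puts Q inside a stopping child of the parent.
          This child belongs to S and is smaller than the parent, against the choice of l.\<close>
        assume neg: "\<not> ave (\<phi> i) Q \<le> A * ave (\<phi> i) ?R"
        have "ave (\<phi> i) ?R \<le> A * ave (\<phi> i) ?R"
          using A(1) ave_nonneg[of "\<phi> i" ?R, OF \<phi>(2)[OF i]] by (simp add: mult_le_cancel_right1)
        then have "Q \<subset> ?R" using neg Q(3) by auto
        then have "Q \<in> bad_cubes I \<phi> A ?R" using Q(1) neg i by (auto simp: bad_cubes_def not_le)
        moreover have "bad_cubes I \<phi> A ?R \<subseteq> dyadic_grid \<omega>" by (auto simp: bad_cubes_def)
        ultimately obtain P where P: "P \<in> ?ch ?R" "Q \<subseteq> P"
          unfolding stopping_cubes_def using maximal_cube_above[OF _ bad_cubes_level] by metis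
        obtain l' y where ly: "P = cube_at \<omega> l' y" using stopping_cubesD(1)[OF P(1)] by (rule grid_cases)
        have "x \<in> P" using Q(2) P(2) self_mem_cube_at by blast
        then have lx: "P = cube_at \<omega> l' x" using ly by (simp add: cube_at_eq)
        have "P \<subset> ?R" by (rule stopping_cubesD(2)[OF P(1)])
        then have "l \<le> l'" "l' \<noteq> l" using lx cube_at_subset_level[of \<omega> l' x l x] by auto
        moreover have "l' \<le> k" using Q(2) P(2) lx cube_at_subset_level[of \<omega> k x l' x] by blast
        moreover have "P \<in> S" using chS[OF R(1) P(1)] .
        ultimately have "l' \<in> L" using lx lL by (auto simp: L_def)
        then have "l' \<le> l" unfolding l_def using L(1) by simp
        then show False using \<open>l \<le> l'\<close> \<open>l' \<noteq> l\<close> by simp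
      qed
      then show ?thesis using R cube_at_mono[OF shifts R(2)] by blast
    qed
  qed
qed

end

section \<open>Paraproducts below a stopping cube\<close>

text \<open>The factors of the constant come from replacing H by random signs in Y, from Stein's
  inequality in Y (k = 0) and in each \<open>T k\<close>, and from the John-Nirenberg inequality;
  \<open>local_const\<close> will name their product.\<close>

lemma discrete_paraproduct:
  fixes q :: "nat \<Rightarrow> 'w \<Rightarrow> 'c" and a :: "nat \<Rightarrow> 'w \<Rightarrow> ('x::banach, 'y::banach) multop"
    and f :: "nat \<Rightarrow> 'w \<Rightarrow> 'x" and H :: "nat \<Rightarrow> 'w \<Rightarrow> real"
  assumes n: "1 \<le> n" and X: "\<And>m. m \<in> {1..n} \<Longrightarrow> subspace (X m)" and W: "finite W"
    and refine: "\<And>i w w'. i < N \<Longrightarrow> w \<in> W \<Longrightarrow> w' \<in> W \<Longrightarrow> q (Suc i) w = q (Suc i) w' \<Longrightarrow> q i w = q i w'"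
    and root: "\<And>w w'. w \<in> W \<Longrightarrow> w' \<in> W \<Longrightarrow> q 0 w = q 0 w'"
    and T: "\<And>k. k \<in> {1..<n} \<Longrightarrow> UMD_bound (T k) p (\<beta> k)"
    and Y: "UMD_bound (UNIV :: 'y set) p (\<beta> 0)"
    and a: "\<And>i w. i < N \<Longrightarrow> w \<in> W \<Longrightarrow> a i w \<in> multilinear_ops X n"
    and fr: "\<And>i w k e. i < N \<Longrightarrow> w \<in> W \<Longrightarrow> k \<in> {1..<n} \<Longrightarrow> (\<And>m. m \<in> {k+1..n} \<Longrightarrow> e m \<in> X m) \<Longrightarrow>
      freeze (a i w) (map e [k+1..<n+1]) \<in> T k"
    and const: "\<And>i w w'. i < N \<Longrightarrow> w \<in> W \<Longrightarrow> w' \<in> W \<Longrightarrow> q i w = q i w' \<Longrightarrow> a i w = a i w'"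
    and f: "\<And>m w. m \<in> {1..n} \<Longrightarrow> w \<in> W \<Longrightarrow> f m w \<in> X m"
    and M: "\<And>m w. m \<in> {1..n} \<Longrightarrow> w \<in> W \<Longrightarrow> norm (f m w) \<le> M m" "\<And>m. m \<in> {1..n} \<Longrightarrow> 0 \<le> M m"
    and H1: "\<And>i w. i < N \<Longrightarrow> w \<in> W \<Longrightarrow> H i w = 1 \<or> H i w = -1"
    and H: "\<And>i w w'. i < N \<Longrightarrow> w \<in> W \<Longrightarrow> w' \<in> W \<Longrightarrow> q (Suc i) w = q (Suc i) w' \<Longrightarrow> H i w = H i w'"
    and mean: "\<And>i w. i < N \<Longrightarrow> w \<in> W \<Longrightarrow> (\<Sum>w'\<in>{w'\<in>W. q i w' = q i w}. H i w') = 0"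
    and r: "0 < r" and B: "0 \<le> B"
    and jump: "\<And>i w. i < N \<Longrightarrow> w \<in> W \<Longrightarrow> norm (a i w) \<le> B"
    and bmo: "\<And>j w. j < N \<Longrightarrow> w \<in> W \<Longrightarrow>
      (\<Sum>w'\<in>{w'\<in>W. q j w' = q j w}. \<Sum>\<epsilon>\<in>signs N. norm (\<Sum>i\<in>{j..<N}. \<epsilon> i *\<^sub>R a i w') powr r) \<le>
      B powr r * card {w'\<in>W. q j w' = q j w} * 2 ^ N"
  shows "(\<Sum>w\<in>W. norm (\<Sum>i<N. H i w *\<^sub>R multop_apply (a i w) (map (\<lambda>m. cavg W (q i) (f m) w) [1..<n+1])) powr p) \<le>
    \<beta> 0 powr p * (\<Prod>k<n. 1 + \<beta> k powr p) * (2 powr (p + 1) * (2 powr ((p + 2) / r) + 1) powr p) *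
      (B * (\<Prod>m=1..n. M m)) powr p * card W"
    (is "?L \<le> _")
\<comment> \<open>The John-Nirenberg inequality is stated for B > 0; for B = 0 the coefficients
  vanish by \<open>jump\<close>.\<close>
proof (cases "W = {} \<or> B = 0")
  case True
  have "multop_apply (a i w) xs = 0" if "i < N" "w \<in> W" for i w xs
  proof -
    have "norm (a i w) \<le> 0" using True that jump[OF that] by auto
    then show ?thesis by (simp add: zero_multop.rep_eq)
  qed
  moreover have p: "1 < p" using Y by (simp add: UMD_bound_def)
  ultimately have "?L = 0" by simp
  moreover have "0 \<le> (\<Prod>k<n. 1 + \<beta> k powr p)" by (intro prod_nonneg) auto
  ultimately show ?thesis by simp
next
  case False
  then obtain w0 where w0: "w0 \<in> W" and B0: "0 < B" using B by auto
  have p: "1 < p" using Y by (simp add: UMD_bound_def)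
  let ?y = "\<lambda>i w. multop_apply (a i w) (map (\<lambda>m. cavg W (q i) (f m) w) [1..<n+1])"
  let ?P = "\<Prod>k<n. 1 + \<beta> k powr p" and ?K = "2 powr (p + 1) * (2 powr ((p + 2) / r) + 1) powr p"
  let ?S = "\<Sum>w\<in>W. \<Sum>\<epsilon>\<in>signs N. norm (\<Sum>i<N. \<epsilon> i *\<^sub>R a i w) powr p"
  have P0: "0 \<le> ?P" by (intro prod_nonneg) auto
  have Wq: "{w'\<in>W. q 0 w' = q 0 w0} = W" using root w0 by blast
  have "2 ^ N * ?L \<le> \<beta> 0 powr p * (\<Sum>w\<in>W. \<Sum>\<epsilon>\<in>signs N. norm (\<Sum>i<N. \<epsilon> i *\<^sub>R ?y i w) powr p)"
  proof (rule umd_unsign[OF Y W refine _ _ H1 H mean])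
    fix i w w' assume i: "i < N" and w: "w \<in> W" "w' \<in> W" "q i w = q i w'"
    have "map (\<lambda>m. cavg W (q i) (f m) w) [1..<n+1] = map (\<lambda>m. cavg W (q i) (f m) w') [1..<n+1]"
      by (intro map_cong refl cavg_cong_cell w(3))
    then show "?y i w = ?y i w'" by (simp only: const[OF i w])
  qed auto
  also have "\<dots> \<le> \<beta> 0 powr p * (?P * (\<Prod>m=1..n. M m) powr p * ?S)"
  proof (rule mult_left_mono)
    show "(\<Sum>w\<in>W. \<Sum>\<epsilon>\<in>signs N. norm (\<Sum>i<N. \<epsilon> i *\<^sub>R ?y i w) powr p) \<le> ?P * (\<Prod>m=1..n. M m) powr p * ?S"
    proof (rule multilinear_stein[OF n X W _ T Y a fr const f M])
      show "q i w = q i w'" if "Suc i < N" "w \<in> W" "w' \<in> W" "q (Suc i) w = q (Suc i) w'" for i w w'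
        using refine[of i w w'] that by simp
    qed
  qed simp
  also have "?S \<le> ?K * B powr p * card W * 2 ^ N"
  proof -
    have "(\<Sum>w'\<in>{w'\<in>W. q 0 w' = q 0 w0}. \<Sum>\<epsilon>\<in>signs N. norm (\<Sum>i\<in>{0..<N}. \<epsilon> i *\<^sub>R a i w') powr p) \<le>
        ?K * B powr p * card {w'\<in>W. q 0 w' = q 0 w0} * 2 ^ N"
    proof (rule john_nirenberg[OF W _ const r _ B0 jump bmo le0 w0])
      show "q i w = q i w'" if "Suc i < N" "w \<in> W" "w' \<in> W" "q (Suc i) w = q (Suc i) w'" for i w w'
        using refine[of i w w'] that by simp
      show "0 < p" using p by simp
    qed
    then show ?thesis unfolding Wq by (simp add: atLeast0LessThan)
  qed
  finally have "2 ^ N * ?L \<le> \<beta> 0 powr p * (?P * (\<Prod>m=1..n. M m) powr p * (?K * B powr p * card W * 2 ^ N))"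
    using P0 by (simp add: mult_left_mono)
  also have "\<dots> = 2 ^ N * (\<beta> 0 powr p * ?P * ?K * (B * (\<Prod>m=1..n. M m)) powr p * card W)"
    using B M(2) by (simp add: powr_mult prod_nonneg mult_ac)
  finally show ?thesis by (rule mult_left_le_imp_le) simp
qed

section \<open>Conditional averages and stopped martingales\<close>

lemma cavg_tower:
  assumes W: "finite W" and w: "w \<in> W"
    and finer: "\<And>w w'. w \<in> W \<Longrightarrow> w' \<in> W \<Longrightarrow> \<kappa>' w = \<kappa>' w' \<Longrightarrow> \<kappa> w = \<kappa> w'"
  shows "cavg W \<kappa> (cavg W \<kappa>' g) w = cavg W \<kappa> g w"
proof -
  have "(\<Sum>w'\<in>{w'\<in>W. \<kappa> w' = \<kappa> w}. cavg W \<kappa>' g w') = (\<Sum>w'\<in>{w'\<in>W. \<kappa> w' = \<kappa> w}. g w')"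
  proof (rule sum_cavg[OF W])
    fix v v' assume v: "v \<in> {w'\<in>W. \<kappa> w' = \<kappa> w}" "v' \<in> W" "\<kappa>' v' = \<kappa>' v"
    then have "\<kappa> v' = \<kappa> v" by (intro finer) auto
    then show "v' \<in> {w'\<in>W. \<kappa> w' = \<kappa> w}" using v by simp
  qed auto
  then show ?thesis by (simp add: cavg_def)
qed

lemma cavg_const:
  assumes W: "finite W" and w: "w \<in> W" and c: "\<And>w'. w' \<in> W \<Longrightarrow> \<kappa> w' = \<kappa> w \<Longrightarrow> g w' = c"
  shows "cavg W \<kappa> g w = c"
proof -
  let ?A = "{w'\<in>W. \<kappa> w' = \<kappa> w}"
  have "card ?A > 0" using W w by (auto simp: card_gt_0_iff)
  moreover have "(\<Sum>w'\<in>?A. g w') = (\<Sum>w'\<in>?A. c)" using c by (intro sum.cong) auto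
  ultimately show ?thesis by (simp add: cavg_def sum_constant_scaleR)
qed

text \<open>The martingale of averages, frozen on the first cell that is not good. Step i + 1 is
  decided by \<open>gd i\<close>, which is known at step i: this gives the martingale property, and
  the average over that first cell still enters.\<close>

primrec stopped :: "'w set \<Rightarrow> (nat \<Rightarrow> 'w \<Rightarrow> 'c) \<Rightarrow> ('w \<Rightarrow> 'a::real_vector) \<Rightarrow> (nat \<Rightarrow> 'w \<Rightarrow> bool) \<Rightarrow> nat \<Rightarrow> 'w \<Rightarrow> 'a" where
  "stopped W q g gd 0 w = cavg W (q 0) g w"
| "stopped W q g gd (Suc i) w = (if gd i w then cavg W (q (Suc i)) g w else stopped W q g gd i w)"

locale stopping =
  fixes W :: "'w set" and q :: "nat \<Rightarrow> 'w \<Rightarrow> 'c" and N :: nat and gd :: "nat \<Rightarrow> 'w \<Rightarrow> bool"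
  assumes W: "finite W"
    and refine: "\<And>i w w'. i < N \<Longrightarrow> w \<in> W \<Longrightarrow> w' \<in> W \<Longrightarrow> q (Suc i) w = q (Suc i) w' \<Longrightarrow> q i w = q i w'"
    and gd_q: "\<And>i w w'. w \<in> W \<Longrightarrow> w' \<in> W \<Longrightarrow> q i w = q i w' \<Longrightarrow> gd i w = gd i w'"
    and gd_anti: "\<And>i w. i < N \<Longrightarrow> w \<in> W \<Longrightarrow> gd (Suc i) w \<Longrightarrow> gd i w"
begin

lemma refine_le:
  assumes "i \<le> j" "j \<le> N" "w \<in> W" "w' \<in> W" "q j w = q j w'"
  shows "q i w = q i w'"
  using assms(1,2,5)
proof (induction j rule: dec_induct)
  case (step k)
  then show ?case using refine[of k w w'] assms(3,4) by simp
qed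

lemma stopped_good: "i \<le> N \<Longrightarrow> w \<in> W \<Longrightarrow> gd i w \<Longrightarrow> stopped W q g gd i w = cavg W (q i) g w"
  by (cases i) (auto dest: gd_anti[rotated -1])

lemma stopped_subspace:
  assumes "subspace V" "\<And>w. w \<in> W \<Longrightarrow> g w \<in> V"
  shows "stopped W q g gd i w \<in> V"
  by (induction i) (auto intro: cavg_in_subspace[OF assms])

lemma stopped_bound:
  assumes "norm (cavg W (q 0) g w) \<le> M" "\<And>i. i < N \<Longrightarrow> gd i w \<Longrightarrow> norm (cavg W (q (Suc i)) g w) \<le> M" "i \<le> N"
  shows "norm (stopped W q g gd i w) \<le> M"
  using assms(3) by (induction i) (auto intro: assms(1,2))

lemma stopped_q: "i \<le> N \<Longrightarrow> w \<in> W \<Longrightarrow> w' \<in> W \<Longrightarrow> q i w = q i w' \<Longrightarrow> stopped W q g gd i w = stopped W q g gd i w'"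
proof (induction i)
  case 0
  then show ?case using cavg_cong_cell[of "q 0" w w'] by simp
next
  case (Suc i)
  then have qi: "q i w = q i w'" using refine[of i w w'] by simp
  then have "gd i w = gd i w'" using gd_q Suc.prems by blast
  moreover have "cavg W (q (Suc i)) g w = cavg W (q (Suc i)) g w'" by (rule cavg_cong_cell) (rule Suc.prems(4))
  ultimately show ?case using Suc.IH Suc.prems qi by simp
qed

text \<open>The martingale property: on good cells it is the tower property, on the others nothing
  changes any more.\<close>

lemma cavg_stopped_Suc:
  assumes i: "i < N" and w: "w \<in> W"
  shows "cavg W (q i) (stopped W q g gd (Suc i)) w = stopped W q g gd i w"
proof (cases "gd i w")
  case True
  have "cavg W (q i) (stopped W q g gd (Suc i)) w = cavg W (q i) (cavg W (q (Suc i)) g) w"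
  proof -
    have "stopped W q g gd (Suc i) w' = cavg W (q (Suc i)) g w'" if "w' \<in> W" "q i w' = q i w" for w'
      using gd_q[of w' w i] that w True by simp
    then show ?thesis by (simp add: cavg_def)
  qed
  also have "\<dots> = cavg W (q i) g w" by (rule cavg_tower[OF W w]) (rule refine[OF i])
  finally show ?thesis using stopped_good[of i w g] True i w by simp
next
  case False
  show ?thesis
  proof (rule cavg_const[OF W w])
    fix w' assume w': "w' \<in> W" "q i w' = q i w"
    then have "\<not> gd i w'" using False gd_q[of w' w i] w by simp
    then show "stopped W q g gd (Suc i) w' = stopped W q g gd i w"
      using stopped_q[of i w' w] w w' i by simp
  qed
qed

lemma cavg_stopped:
  assumes "i \<le> j" "j \<le> N" "w \<in> W"
  shows "cavg W (q i) (stopped W q g gd j) w = stopped W q g gd i w"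
  using assms(1,2)
proof (induction j rule: dec_induct)
  case base
  show ?case
  proof (rule cavg_const[OF W assms(3)])
    fix w' assume "w' \<in> W" "q i w' = q i w"
    then show "stopped W q g gd i w' = stopped W q g gd i w" using base assms(3) by (intro stopped_q)
  qed
next
  case (step j)
  have "cavg W (q i) (stopped W q g gd (Suc j)) w = cavg W (q i) (cavg W (q j) (stopped W q g gd (Suc j))) w"
  proof (rule cavg_tower[OF W assms(3), symmetric])
    fix v v' assume "v \<in> W" "v' \<in> W" "q j v = q j v'"
    then show "q i v = q i v'" using step.hyps(1) step.prems by (intro refine_le[of i j]) auto
  qed
  also have "\<dots> = cavg W (q i) (stopped W q g gd j) w"
  proof -
    have "cavg W (q j) (stopped W q g gd (Suc j)) w' = stopped W q g gd j w'" if "w' \<in> W" for w'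
      using cavg_stopped_Suc[of j w' g] step.prems that by simp
    then show ?thesis by (simp add: cavg_def[of W "q i"])
  qed
  also have "\<dots> = stopped W q g gd i w" using step by simp
  finally show ?case .
qed

text \<open>Optional stopping inside a pairing. F is constant on each cell that is not good, so
  there it only sees the mean of g, and g may be replaced by its stopped version.\<close>

lemma sum_stopped:
  fixes F :: "'w \<Rightarrow> real" and g :: "'w \<Rightarrow> real"
  assumes F: "\<And>i w w'. i < N \<Longrightarrow> w \<in> W \<Longrightarrow> w' \<in> W \<Longrightarrow> q i w = q i w' \<Longrightarrow> \<not> gd i w \<Longrightarrow> F w = F w'"
    and j: "j \<le> N"
  shows "(\<Sum>w\<in>W. F w * stopped W q g gd j w) = (\<Sum>w\<in>W. F w * cavg W (q j) g w)"
  using j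
proof (induction j)
  case (Suc j)
  let ?v = "stopped W q g gd j" and ?e = "\<lambda>i. cavg W (q i) g"
  \<comment> \<open>The part of F outside the good cells is constant on the cells of step j; against
    it the averages of steps j and j + 1 have the same sum.\<close>
  let ?I = "\<lambda>w. if gd j w then 0 else F w"
  have "(\<Sum>w\<in>W. ?I w * ?e (Suc j) w) = (\<Sum>w\<in>W. cavg W (q j) (\<lambda>w. ?I w * ?e (Suc j) w) w)"
    by (rule sum_cavg[OF W, symmetric]) auto
  also have "\<dots> = (\<Sum>w\<in>W. ?I w * ?e j w)"
  proof (rule sum.cong[OF refl])
    fix w assume w: "w \<in> W"
    have I: "?I w' = ?I w" if "w' \<in> W" "q j w' = q j w" for w'
      using that w gd_q[of w' w j] F[of j w' w] Suc.prems by auto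
    have "cavg W (q j) (\<lambda>w. ?I w * ?e (Suc j) w) w = ?I w * cavg W (q j) (?e (Suc j)) w"
    proof -
      have "(\<Sum>w'\<in>{w'\<in>W. q j w' = q j w}. ?I w' * ?e (Suc j) w') = ?I w * (\<Sum>w'\<in>{w'\<in>W. q j w' = q j w}. ?e (Suc j) w')"
        unfolding sum_distrib_left by (rule sum.cong[OF refl]) (use I in \<open>simp only: mem_Collect_eq\<close>)
      then show ?thesis by (simp add: cavg_def[of W "q j"])
    qed
    also have "cavg W (q j) (?e (Suc j)) w = ?e j w"
      by (rule cavg_tower[OF W w]) (rule refine, use Suc.prems in auto)
    finally show "cavg W (q j) (\<lambda>w. ?I w * ?e (Suc j) w) w = ?I w * ?e j w" .
  qed
  finally have key: "(\<Sum>w\<in>W. ?I w * ?e (Suc j) w) = (\<Sum>w\<in>W. ?I w * ?e j w)" .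
  have "(\<Sum>w\<in>W. F w * ?e (Suc j) w) - (\<Sum>w\<in>W. F w * stopped W q g gd (Suc j) w) =
      (\<Sum>w\<in>W. ?I w * ?e (Suc j) w) - (\<Sum>w\<in>W. ?I w * ?v w)"
    unfolding sum_subtractf[symmetric] by (rule sum.cong) auto
  also have "\<dots> = (\<Sum>w\<in>W. ?I w * ?e j w) - (\<Sum>w\<in>W. ?I w * ?v w)" unfolding key ..
  also have "\<dots> = (\<Sum>w\<in>W. F w * ?e j w) - (\<Sum>w\<in>W. F w * ?v w)"
    unfolding sum_subtractf[symmetric]
    using stopped_good[of j _ g] Suc.prems by (intro sum.cong) auto
  also have "\<dots> = 0" using Suc by simp
  finally show ?case by simp
qed simp

end

section \<open>The BMO norm in terms of levels and atoms\<close>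

lemma random_signs_eq: "finite G \<Longrightarrow> random_signs G = pmf_of_set (PiE_dflt G 1 (\<lambda>_. {-1, 1}))"
  unfolding random_signs_def by (rule Pi_pmf_of_set) auto

lemma pmf_signs: "pmf_of_set (signs N) = Pi_pmf {..<N} 1 (\<lambda>_. pmf_of_set {-1, 1})"
  unfolding signs_eq_PiE_dflt by (subst Pi_pmf_of_set) (auto simp: insert_commute)

lemma signs_nonempty [simp]: "signs N \<noteq> {}"
  using card_signs[of N] by (metis card.empty power_eq_0_iff zero_neq_numeral)

text \<open>For a fixed point the cubes that contain it are indexed by their level, and so are their signs.\<close>

lemma nn_integral_random_signs:
  fixes q :: "nat \<Rightarrow> 'q" and h :: "(nat \<Rightarrow> real) \<Rightarrow> ennreal"
  assumes G: "finite G" and inj: "inj_on q {..<N}" and I: "I = {i. i < N \<and> q i \<in> G}"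
  shows "(\<integral>\<^sup>+\<epsilon>. h (\<lambda>i. if i \<in> I then \<epsilon> (q i) else 1) \<partial>measure_pmf (random_signs G)) =
    (\<Sum>\<epsilon>\<in>signs N. h (\<lambda>i. if i \<in> I then \<epsilon> i else 1)) / 2 ^ N"
proof -
  let ?U = "pmf_of_set {-1, 1::real}" and ?J = "q ` I"
  have I': "finite I" "I \<subseteq> {..<N}" "?J \<subseteq> G" using I by auto
  have injI: "inj_on q I" using inj I'(2) by (rule inj_on_subset)
  let ?f = "\<lambda>\<epsilon> i. if i \<in> I then \<epsilon> (q i) else (1::real)"
  let ?g = "\<lambda>\<delta> Q. if Q \<in> ?J then \<delta> (inv_into I q Q) else (1::real)"
  let ?A = "PiE_dflt ?J 1 (\<lambda>_. {-1, 1::real})" and ?B = "PiE_dflt I 1 (\<lambda>_. {-1, 1::real})"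
  \<comment> \<open>The signs are restricted to the cubes \<open>q i\<close> that belong to G and
    then carried over to their indices i by the injective map q.\<close>
  have bij: "bij_betw ?f ?A ?B"
  proof (rule bij_betw_byWitness[where f' = ?g])
    show "\<forall>\<epsilon>\<in>?A. ?g (?f \<epsilon>) = \<epsilon>"
      using injI by (auto simp: PiE_dflt_def fun_eq_iff)
    show "\<forall>\<delta>\<in>?B. ?f (?g \<delta>) = \<delta>"
      using injI by (auto simp: PiE_dflt_def fun_eq_iff)
    show "?f ` ?A \<subseteq> ?B" by (auto simp: PiE_dflt_def)
    show "?g ` ?B \<subseteq> ?A" using injI by (auto simp: PiE_dflt_def)
  qed
  have AB: "finite ?A" "?A \<noteq> {}" "finite ?B" using I' by (auto intro!: finite_PiE_dflt)
  have "map_pmf ?f (Pi_pmf ?J 1 (\<lambda>_. ?U)) = map_pmf ?f (pmf_of_set ?A)"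
    by (subst Pi_pmf_of_set) (use I' in auto)
  also have "\<dots> = pmf_of_set ?B" by (rule map_pmf_of_set_bij_betw[OF bij AB(2,1)])
  also have "\<dots> = Pi_pmf I 1 (\<lambda>_. ?U)" by (subst Pi_pmf_of_set) (use I' in auto)
  finally have 1: "map_pmf ?f (Pi_pmf ?J 1 (\<lambda>_. ?U)) = Pi_pmf I 1 (\<lambda>_. ?U)" .
  have "map_pmf ?f (random_signs G) = map_pmf ?f (map_pmf (\<lambda>\<epsilon> Q. if Q \<in> ?J then \<epsilon> Q else 1) (random_signs G))"
    unfolding map_pmf_comp by (intro map_pmf_cong refl) (auto simp: fun_eq_iff)
  also have "\<dots> = map_pmf ?f (Pi_pmf ?J 1 (\<lambda>_. ?U))"
    unfolding random_signs_def by (subst Pi_pmf_subset[OF G I'(3)]) simp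
  finally have 2: "map_pmf ?f (random_signs G) = Pi_pmf I 1 (\<lambda>_. ?U)" unfolding 1 .
  have 3: "map_pmf (\<lambda>\<epsilon> i. if i \<in> I then \<epsilon> i else 1) (pmf_of_set (signs N)) = Pi_pmf I 1 (\<lambda>_. ?U)"
    unfolding pmf_signs by (rule Pi_pmf_subset[symmetric]) (use I' in auto)
  have "(\<integral>\<^sup>+\<epsilon>. h (?f \<epsilon>) \<partial>measure_pmf (random_signs G)) = (\<integral>\<^sup>+\<epsilon>. h \<epsilon> \<partial>measure_pmf (map_pmf ?f (random_signs G)))"
    by (simp add: nn_integral_map_pmf)
  also have "\<dots> = (\<integral>\<^sup>+\<epsilon>. h (\<lambda>i. if i \<in> I then \<epsilon> i else 1) \<partial>measure_pmf (pmf_of_set (signs N)))"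
    unfolding 2 3[symmetric] by (simp add: nn_integral_map_pmf)
  also have "\<dots> = (\<Sum>\<epsilon>\<in>signs N. h (\<lambda>i. if i \<in> I then \<epsilon> i else 1)) / 2 ^ N"
    by (subst nn_integral_pmf_of_set) auto
  finally show ?thesis .
qed

lemma ennreal_pow_le_imp:
  assumes "ennreal_pow x (1 / r) \<le> ennreal B" "0 < r" "0 \<le> B"
  shows "x \<le> ennreal (B powr r)"
proof (cases x)
  case (real y)
  then have "y powr (1 / r) \<le> B" using assms by (simp add: ennreal_pow_def)
  then have "(y powr (1 / r)) powr r \<le> B powr r" using assms(2) by (intro powr_mono2) auto
  then show ?thesis using real assms(2) by (simp add: powr_powr ennreal_leI)
next
  case top
  then show ?thesis using assms(1) by (simp add: ennreal_pow_def top_unique)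
qed

context dyadic_system
begin

text \<open>In the finite model the cells of a partition by ancestors are dyadic cubes
  again.\<close>

lemma mem_atoms_anc_iff:
  assumes "k0 \<le> k" "k \<le> l" "w \<in> atoms l (cube_at \<omega> k0 x0)"
  shows "{w'\<in>atoms l (cube_at \<omega> k0 x0). anc k w' = anc k w} = atoms l (anc k w)"
proof -
  obtain x where x: "x \<in> cube_at \<omega> k0 x0" "w = cube_at \<omega> l x" using assms(3) by (rule atomsE)
  have aw: "anc k w = cube_at \<omega> k x" unfolding x(2) by (rule anc_eq[OF assms(2)]) simp
  have sub: "cube_at \<omega> k x \<subseteq> cube_at \<omega> k0 x0"
    using cube_at_mono[OF shifts assms(1), of x] cube_at_eq[OF x(1)] by simp
  show ?thesis
  proof (intro set_eqI iffI)
    fix w' assume w': "w' \<in> {w'\<in>atoms l (cube_at \<omega> k0 x0). anc k w' = anc k w}"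
    then obtain y where y: "w' = cube_at \<omega> l y" by (auto elim: atomsE)
    then have "cube_at \<omega> k y = cube_at \<omega> k x" using w' aw anc_eq[OF assms(2), of y y] by simp
    then have "y \<in> cube_at \<omega> k x" using self_mem_cube_at by blast
    then show "w' \<in> atoms l (anc k w)" unfolding aw y by (rule mem_atom)
  next
    fix w' assume "w' \<in> atoms l (anc k w)"
    then obtain y where y: "y \<in> cube_at \<omega> k x" "w' = cube_at \<omega> l y" unfolding aw by (rule atomsE)
    then have "anc k w' = anc k w" unfolding aw using anc_eq[OF assms(2), of y y] cube_at_eq by simp
    then show "w' \<in> {w'\<in>atoms l (cube_at \<omega> k0 x0). anc k w' = anc k w}"
      using y sub mem_atom by auto
  qed
qed

text \<open>The factor is the height of the Haar function of Q. Cubes outside of G get coefficient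
  0, so that every atom has a term on every level.\<close>

definition scaled_coeff :: "(real^'d) set set \<Rightarrow> ((real^'d) set \<Rightarrow> 'b::real_vector) \<Rightarrow> (real^'d) set \<Rightarrow> 'b" where
  "scaled_coeff G a Q = (if Q \<in> G then (1 / sqrt (measure lebesgue Q)) *\<^sub>R a Q else 0)"

text \<open>The cubes of the grid that contain x form a chain with one cube per level.\<close>

lemma sum_cubes_eq_sum_levels:
  fixes a :: "(real^'d) set \<Rightarrow> 'b::real_vector"
  assumes G: "finite G" "G \<subseteq> dyadic_grid \<omega>" and lev: "\<And>k y. cube_at \<omega> k y \<in> G \<Longrightarrow> k < k0 + int N"
    and j: "j \<le> N" and x: "x \<in> cube_at \<omega> (k0 + int j) x0"
  shows "(\<Sum>Q\<in>{Q\<in>G. Q \<subseteq> cube_at \<omega> (k0 + int j) x0}. indicator Q x *\<^sub>R a Q) =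
    (\<Sum>i\<in>{j..<N}. if cube_at \<omega> (k0 + int i) x \<in> G then a (cube_at \<omega> (k0 + int i) x) else 0)"
proof -
  let ?Q0 = "cube_at \<omega> (k0 + int j) x0" and ?q = "\<lambda>i. cube_at \<omega> (k0 + int i) x"
  let ?I = "{i\<in>{j..<N}. ?q i \<in> G}"
  have Q0: "?Q0 = ?q j" using cube_at_eq[OF x] by simp
  have inj: "inj_on ?q ?I"
  proof (rule inj_onI)
    fix i i' assume "?q i = ?q i'"
    then have "k0 + int i = k0 + int i'" by (rule cube_at_level_unique)
    then show "i = i'" by simp
  qed
  have im: "?q ` ?I = {Q\<in>G. Q \<subseteq> ?Q0 \<and> x \<in> Q}"
  proof (intro set_eqI iffI)
    fix Q assume "Q \<in> ?q ` ?I"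
    then obtain i where i: "Q = ?q i" "j \<le> i" "?q i \<in> G" by auto
    then have "?q i \<subseteq> ?q j" by (intro cube_at_mono[OF shifts]) simp
    then show "Q \<in> {Q\<in>G. Q \<subseteq> ?Q0 \<and> x \<in> Q}" unfolding Q0 using i by simp
  next
    fix Q assume Q: "Q \<in> {Q\<in>G. Q \<subseteq> ?Q0 \<and> x \<in> Q}"
    then have "Q \<in> dyadic_grid \<omega>" using G by blast
    then obtain k y where "Q = cube_at \<omega> k y" by (rule grid_cases)
    then have kx: "Q = cube_at \<omega> k x" using Q cube_at_eq[of x \<omega> k y] by simp
    have "k0 + int j \<le> k" using Q kx cube_at_subset_level[of \<omega> k x] by blast
    moreover have "k < k0 + int N" using lev[of k x] Q kx by simp
    ultimately have "k = k0 + int (nat (k - k0))" "nat (k - k0) \<in> {j..<N}" by auto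
    then show "Q \<in> ?q ` ?I" using kx Q by (metis (mono_tags, lifting) image_eqI mem_Collect_eq)
  qed
  have "(\<Sum>Q\<in>{Q\<in>G. Q \<subseteq> ?Q0}. indicator Q x *\<^sub>R a Q) = (\<Sum>Q\<in>{Q\<in>G. Q \<subseteq> ?Q0 \<and> x \<in> Q}. a Q)"
    using G by (intro sum.mono_neutral_cong_right) auto
  also have "\<dots> = (\<Sum>i\<in>?I. a (?q i))"
    unfolding im[symmetric] by (rule sum.reindex_cong[OF inj]) auto
  also have "\<dots> = (\<Sum>i\<in>{j..<N}. if ?q i \<in> G then a (?q i) else 0)"
    by (rule sum.inter_filter) simp
  finally show ?thesis .
qed

text \<open>The BMO condition with subcollection G and a test cube of level
  \<open>k0 + int j\<close>, written on the finite space: this is the hypothesis \<open>bmo\<close>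
  of \<open>john_nirenberg\<close>.\<close>

lemma bmo_discrete:
  fixes a :: "(real^'d) set \<Rightarrow> 'b::banach"
  assumes BMO: "BMO_norm (dyadic_grid \<omega>) r a \<le> ennreal B" and r: "0 < r" and B: "0 \<le> B"
    and G: "finite G" "G \<subseteq> dyadic_grid \<omega>" and lev: "\<And>k y. cube_at \<omega> k y \<in> G \<Longrightarrow> k < k0 + int N"
    and j: "j < N"
  shows "(\<Sum>w\<in>atoms (k0 + int N) (cube_at \<omega> (k0 + int j) x0). \<Sum>\<epsilon>\<in>signs N.
      norm (\<Sum>i\<in>{j..<N}. \<epsilon> i *\<^sub>R scaled_coeff G a (anc (k0 + int i) w)) powr r) \<le>
    B powr r * card (atoms (k0 + int N) (cube_at \<omega> (k0 + int j) x0)) * 2 ^ N"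
proof -
  let ?l = "k0 + int N" and ?Q0 = "cube_at \<omega> (k0 + int j) x0"
  let ?A = "atoms ?l ?Q0" and ?V = "cube_vol TYPE('d) (k0 + int j)" and ?v = "cube_vol TYPE('d) (k0 + int N)"
  let ?F = "\<lambda>\<epsilon> x. norm (\<Sum>Q\<in>{Q\<in>G. Q \<subseteq> ?Q0}. (\<epsilon> Q * indicator Q x / sqrt (measure lebesgue Q)) *\<^sub>R a Q)"
  let ?b = "\<lambda>i w. scaled_coeff G a (anc (k0 + int i) w)"
  let ?\<Phi> = "\<lambda>\<epsilon> w. norm (\<Sum>i\<in>{j..<N}. \<epsilon> i *\<^sub>R ?b i w) powr r"
  have jl: "k0 + int j \<le> ?l" using j by simp
  have fin: "finite ?A" by (rule finite_atoms[OF jl])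
  have "ennreal_pow ((\<integral>\<^sup>+\<epsilon>. (\<integral>\<^sup>+x. ennreal (?F \<epsilon> x powr r) \<partial>lebesgue) \<partial>measure_pmf (random_signs G)) / emeasure lebesgue ?Q0) (1 / r)
      \<le> BMO_norm (dyadic_grid \<omega>) r a"
    unfolding BMO_norm_def by (rule SUP_upper2[of G], use G in simp, rule SUP_upper) simp
  also note BMO
  finally have "(\<integral>\<^sup>+\<epsilon>. (\<integral>\<^sup>+x. ennreal (?F \<epsilon> x powr r) \<partial>lebesgue) \<partial>measure_pmf (random_signs G)) / ennreal ?V \<le> ennreal (B powr r)"
    unfolding emeasure_cube_at using r B by (rule ennreal_pow_le_imp)
  then have "ennreal ?V * ((\<integral>\<^sup>+\<epsilon>. (\<integral>\<^sup>+x. ennreal (?F \<epsilon> x powr r) \<partial>lebesgue) \<partial>measure_pmf (random_signs G)) / ennreal ?V)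
      \<le> ennreal ?V * ennreal (B powr r)"
    by (rule mult_left_mono) simp
  moreover have "ennreal ?V * (y / ennreal ?V) = y" for y
    unfolding ennreal_times_divide by (subst mult.commute) (rule ennreal_mult_divide_eq, auto)
  ultimately have le: "(\<integral>\<^sup>+\<epsilon>. (\<integral>\<^sup>+x. ennreal (?F \<epsilon> x powr r) \<partial>lebesgue) \<partial>measure_pmf (random_signs G)) \<le> ennreal (B powr r) * ennreal ?V"
    by (simp only: mult.commute)
  have F0: "?F \<epsilon> x = 0" if "x \<notin> ?Q0" for \<epsilon> x
  proof -
    have "x \<notin> Q" if "Q \<subseteq> ?Q0" for Q using that \<open>x \<notin> ?Q0\<close> by blast
    then have "(\<Sum>Q\<in>{Q\<in>G. Q \<subseteq> ?Q0}. (\<epsilon> Q * indicator Q x / sqrt (measure lebesgue Q)) *\<^sub>R a Q) = 0"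
      by (intro sum.neutral) simp
    then show ?thesis by simp
  qed
  have FA: "?F \<epsilon> x = norm (\<Sum>i\<in>{j..<N}. \<epsilon> (anc (k0 + int i) w) *\<^sub>R ?b i w)"
    if w: "w \<in> ?A" and x: "x \<in> w" for \<epsilon> x w
  proof -
    have xQ: "x \<in> ?Q0" using atom_subset[OF jl w] x by blast
    have wl: "w = cube_at \<omega> ?l x" by (rule atom_eqI[OF w x])
    have an: "anc (k0 + int i) w = cube_at \<omega> (k0 + int i) x" if "i < N" for i
      unfolding wl by (rule anc_eq) (use that in auto)
    have "(\<Sum>Q\<in>{Q\<in>G. Q \<subseteq> ?Q0}. (\<epsilon> Q * indicator Q x / sqrt (measure lebesgue Q)) *\<^sub>R a Q) =
        (\<Sum>Q\<in>{Q\<in>G. Q \<subseteq> ?Q0}. indicator Q x *\<^sub>R ((\<epsilon> Q / sqrt (measure lebesgue Q)) *\<^sub>R a Q))"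
      by (intro sum.cong refl) simp
    also have "\<dots> = (\<Sum>i\<in>{j..<N}. if cube_at \<omega> (k0 + int i) x \<in> G
        then (\<epsilon> (cube_at \<omega> (k0 + int i) x) / sqrt (measure lebesgue (cube_at \<omega> (k0 + int i) x))) *\<^sub>R a (cube_at \<omega> (k0 + int i) x) else 0)"
      by (rule sum_cubes_eq_sum_levels[OF G lev less_imp_le[OF j] xQ])
    also have "\<dots> = (\<Sum>i\<in>{j..<N}. \<epsilon> (anc (k0 + int i) w) *\<^sub>R ?b i w)"
      by (intro sum.cong refl) (auto simp: an scaled_coeff_def)
    finally show ?thesis by simp
  qed
  have inner: "(\<integral>\<^sup>+x. ennreal (?F \<epsilon> x powr r) \<partial>lebesgue) =
      (\<Sum>w\<in>?A. ennreal (?\<Phi> (\<lambda>i. \<epsilon> (anc (k0 + int i) w)) w) * ennreal ?v)" for \<epsilon>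
  proof -
    have "(\<integral>\<^sup>+x. ennreal (?F \<epsilon> x powr r) \<partial>lebesgue) = (\<integral>\<^sup>+x. ennreal (?F \<epsilon> x powr r) * indicator ?Q0 x \<partial>lebesgue)"
      using F0 r by (intro nn_integral_cong) (auto simp: indicator_def)
    also have "\<dots> = (\<Sum>w\<in>?A. ennreal (?\<Phi> (\<lambda>i. \<epsilon> (anc (k0 + int i) w)) w) * ennreal ?v)"
      by (rule nn_integral_atoms[OF jl]) (simp only: FA)
    finally show ?thesis .
  qed
  \<comment> \<open>Around one atom the cubes of different levels are distinct, so their signs are
    independent; on levels without a cube of G the coefficient is 0 and the sign may be set to
    1.\<close>
  have rad: "(\<integral>\<^sup>+\<epsilon>. ennreal (?\<Phi> (\<lambda>i. \<epsilon> (anc (k0 + int i) w)) w) \<partial>measure_pmf (random_signs G)) =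
      ennreal ((\<Sum>\<epsilon>\<in>signs N. ?\<Phi> \<epsilon> w) / 2 ^ N)" if w: "w \<in> ?A" for w
  proof -
    obtain x where x: "w = cube_at \<omega> ?l x" using w by (rule atomsE)
    have an: "anc (k0 + int i) w = cube_at \<omega> (k0 + int i) x" if "i < N" for i
      unfolding x by (rule anc_eq) (use that in auto)
    define I where "I = {i. i < N \<and> anc (k0 + int i) w \<in> G}"
    have inj: "inj_on (\<lambda>i. anc (k0 + int i) w) {..<N}"
    proof (rule inj_onI)
      fix i i' assume "i \<in> {..<N}" "i' \<in> {..<N}" "anc (k0 + int i) w = anc (k0 + int i') w"
      then have "cube_at \<omega> (k0 + int i) x = cube_at \<omega> (k0 + int i') x" by (simp add: an)
      then have "k0 + int i = k0 + int i'" by (rule cube_at_level_unique)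
      then show "i = i'" by simp
    qed
    have cut: "?\<Phi> (\<lambda>i. if i \<in> I then \<epsilon> i else 1) w = ?\<Phi> \<epsilon> w" for \<epsilon>
    proof -
      have "(\<Sum>i\<in>{j..<N}. (if i \<in> I then \<epsilon> i else 1) *\<^sub>R ?b i w) = (\<Sum>i\<in>{j..<N}. \<epsilon> i *\<^sub>R ?b i w)"
        by (intro sum.cong refl) (auto simp: I_def scaled_coeff_def)
      then show ?thesis by simp
    qed
    have "(\<integral>\<^sup>+\<epsilon>. ennreal (?\<Phi> (\<lambda>i. \<epsilon> (anc (k0 + int i) w)) w) \<partial>measure_pmf (random_signs G)) =
        (\<integral>\<^sup>+\<epsilon>. ennreal (?\<Phi> (\<lambda>i. if i \<in> I then \<epsilon> (anc (k0 + int i) w) else 1) w) \<partial>measure_pmf (random_signs G))"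
      by (simp only: cut[of "\<lambda>i. _ (anc (k0 + int i) w)"])
    also have "\<dots> = (\<Sum>\<epsilon>\<in>signs N. ennreal (?\<Phi> (\<lambda>i. if i \<in> I then \<epsilon> i else 1) w)) / 2 ^ N"
      by (rule nn_integral_random_signs[OF G(1) inj I_def, where h = "\<lambda>\<epsilon>. ennreal (?\<Phi> \<epsilon> w)"])
    also have "\<dots> = (\<Sum>\<epsilon>\<in>signs N. ennreal (?\<Phi> \<epsilon> w)) / 2 ^ N" by (simp only: cut)
    also have "\<dots> = ennreal (\<Sum>\<epsilon>\<in>signs N. ?\<Phi> \<epsilon> w) / ennreal (2 ^ N)"
      by (subst sum_ennreal) (auto simp: ennreal_power[symmetric])
    also have "\<dots> = ennreal ((\<Sum>\<epsilon>\<in>signs N. ?\<Phi> \<epsilon> w) / 2 ^ N)"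
      by (rule divide_ennreal) (auto intro: sum_nonneg)
    finally show ?thesis .
  qed
  have "(\<integral>\<^sup>+\<epsilon>. (\<integral>\<^sup>+x. ennreal (?F \<epsilon> x powr r) \<partial>lebesgue) \<partial>measure_pmf (random_signs G)) =
      (\<Sum>w\<in>?A. (\<integral>\<^sup>+\<epsilon>. ennreal (?\<Phi> (\<lambda>i. \<epsilon> (anc (k0 + int i) w)) w) \<partial>measure_pmf (random_signs G)) * ennreal ?v)"
    unfolding inner by (subst nn_integral_sum) (auto simp: nn_integral_multc)
  also have "\<dots> = (\<Sum>w\<in>?A. ennreal ((\<Sum>\<epsilon>\<in>signs N. ?\<Phi> \<epsilon> w) / 2 ^ N * ?v))"
    by (intro sum.cong refl) (simp add: rad ennreal_mult''[symmetric])
  also have "\<dots> = ennreal ((\<Sum>w\<in>?A. \<Sum>\<epsilon>\<in>signs N. ?\<Phi> \<epsilon> w) / 2 ^ N * ?v)"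
    by (subst sum_ennreal) (auto intro!: mult_nonneg_nonneg divide_nonneg_nonneg sum_nonneg simp: sum_divide_distrib sum_distrib_right)
  finally have "ennreal ((\<Sum>w\<in>?A. \<Sum>\<epsilon>\<in>signs N. ?\<Phi> \<epsilon> w) / 2 ^ N * ?v) \<le> ennreal (B powr r * ?V)"
    using le by (simp add: ennreal_mult''[symmetric])
  then have "(\<Sum>w\<in>?A. \<Sum>\<epsilon>\<in>signs N. ?\<Phi> \<epsilon> w) / 2 ^ N * ?v \<le> B powr r * ?V"
    by (subst (asm) ennreal_le_iff) auto
  also have "?V = real (card ?A) * ?v" by (rule card_atoms[OF jl, symmetric])
  finally have "((\<Sum>w\<in>?A. \<Sum>\<epsilon>\<in>signs N. ?\<Phi> \<epsilon> w) / 2 ^ N) * ?v \<le> (B powr r * card ?A) * ?v" by (simp add: mult.assoc)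
  then have "(\<Sum>w\<in>?A. \<Sum>\<epsilon>\<in>signs N. ?\<Phi> \<epsilon> w) / 2 ^ N \<le> B powr r * card ?A"
    by (rule mult_right_le_imp_le) simp
  then show ?thesis by (simp add: pos_divide_le_eq)
qed

text \<open>The BMO condition for a single cube: there is one level, and the random sign does not
  affect the norm.\<close>

lemma bmo_jump:
  fixes a :: "(real^'d) set \<Rightarrow> 'b::banach"
  assumes BMO: "BMO_norm (dyadic_grid \<omega>) r a \<le> ennreal B" and r: "0 < r" and B: "0 \<le> B"
  shows "norm (a (cube_at \<omega> k x)) / sqrt (cube_vol TYPE('d) k) \<le> B"
proof -
  let ?Q = "cube_at \<omega> k x"
  let ?c = "norm (a ?Q) / sqrt (cube_vol TYPE('d) k)"
  have lev: "l < k + int 1" if "cube_at \<omega> l y \<in> {?Q}" for l y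
    using that cube_at_level_unique[of \<omega> l y k x] by simp
  let ?A = "atoms (k + int 1) ?Q"
  have val: "norm (\<Sum>i\<in>{0..<1}. \<epsilon> i *\<^sub>R scaled_coeff {?Q} a (anc (k + int i) w)) powr r = ?c powr r"
    if w: "w \<in> ?A" and \<epsilon>: "\<epsilon> \<in> signs 1" for w \<epsilon>
  proof -
    obtain y where y: "y \<in> ?Q" "w = cube_at \<omega> (k + int 1) y" using w by (rule atomsE)
    have "anc k w = ?Q" unfolding y(2) using anc_eq[of k "k + int 1" y y] cube_at_eq[OF y(1)] by simp
    then show ?thesis using signs_cases[OF \<epsilon>, of 0] by (auto simp: scaled_coeff_def measure_cube_at)
  qed
  have "(\<Sum>w\<in>?A. \<Sum>\<epsilon>\<in>signs 1. norm (\<Sum>i\<in>{0..<1}. \<epsilon> i *\<^sub>R scaled_coeff {?Q} a (anc (k + int i) w)) powr r) \<le>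
      B powr r * card ?A * 2 ^ 1"
    using bmo_discrete[OF BMO r B, of "{?Q}" k 1 0 x] lev by simp
  also have "(\<Sum>w\<in>?A. \<Sum>\<epsilon>\<in>signs 1. norm (\<Sum>i\<in>{0..<1}. \<epsilon> i *\<^sub>R scaled_coeff {?Q} a (anc (k + int i) w)) powr r) =
      (\<Sum>w\<in>?A. \<Sum>\<epsilon>\<in>signs 1. ?c powr r)"
    by (intro sum.cong refl val)
  finally have "real (card ?A) * ?c powr r \<le> real (card ?A) * B powr r" by (simp add: mult_ac)
  moreover have "0 < real (card ?A)"
  proof (rule ccontr)
    assume "\<not> 0 < real (card ?A)"
    then have "cube_vol TYPE('d) k = 0" using card_atoms[of k "k + int 1" x] by simp
    then show False by simp
  qed
  ultimately have "?c powr r \<le> B powr r" by simp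
  then show ?thesis using r B powr_less_mono2[of r B ?c] by linarith
qed

end

text \<open>The set integrals of f as an X-valued additive set function with majorant \<phi>. The
  local estimates work with this pair; that \<phi> is almost everywhere the norm of f enters only in
  the final bounds.\<close>

definition controlled :: "'a::banach set \<Rightarrow> (real^'d \<Rightarrow> 'a) \<Rightarrow> (real^'d \<Rightarrow> real) \<Rightarrow> bool" where
  "controlled X f \<phi> \<longleftrightarrow> integrable lebesgue \<phi> \<and> (\<forall>x. 0 \<le> \<phi> x) \<and>
    (\<forall>A\<in>sets lebesgue. strong_set_integral f A \<in> X \<and> norm (strong_set_integral f A) \<le> (LINT x:A|lebesgue. \<phi> x)) \<and>
    (\<forall>A\<in>sets lebesgue. \<forall>B\<in>sets lebesgue. A \<inter> B = {} \<longrightarrow>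
      strong_set_integral f (A \<union> B) = strong_set_integral f A + strong_set_integral f B)"

lemma strong_set_integral_Union:
  assumes f: "controlled X f \<phi>" and F: "finite F" "\<And>A. A \<in> F \<Longrightarrow> A \<in> sets lebesgue" "disjoint_family_on (\<lambda>A. A) F"
  shows "strong_set_integral f (\<Union>F) = (\<Sum>A\<in>F. strong_set_integral f A)"
  using F
proof (induction F)
  case empty
  have "strong_set_integral f ({} \<union> {}) = strong_set_integral f {} + strong_set_integral f {}"
    using f unfolding controlled_def by blast
  then show ?case by simp
next
  case (insert A F)
  have "A \<inter> B = {}" if "B \<in> F" for B
    by (rule disjoint_family_onD[OF insert.prems(2)]) (use insert.hyps(2) that in auto)
  then have "A \<inter> \<Union>F = {}" by blast
  moreover have "\<Union>F \<in> sets lebesgue" using insert by (intro sets.finite_Union) auto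
  moreover have "A \<in> sets lebesgue" using insert.prems(1) by blast
  ultimately have "strong_set_integral f (A \<union> \<Union>F) = strong_set_integral f A + strong_set_integral f (\<Union>F)"
    using f unfolding controlled_def by blast
  moreover have "disjoint_family_on (\<lambda>A. A) F" using insert.prems(2) by (auto simp: disjoint_family_on_def)
  ultimately show ?case using insert by simp
qed

section \<open>Dyadic averages as conditional expectations\<close>

context dyadic_system
begin

lemma avg_eq: "avg f Q = (1 / measure lebesgue Q) *\<^sub>R strong_set_integral f Q"
  by (simp add: avg_def strong_set_integral_def)

lemma avg_in_subspace:
  assumes "controlled X f \<phi>" "subspace X" "Q \<in> sets lebesgue"
  shows "avg f Q \<in> X"
  unfolding avg_eq using assms by (intro subspace_scale) (auto simp: controlled_def)

lemma norm_avg_le_ave: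
  assumes "controlled X f \<phi>" "Q \<in> sets lebesgue"
  shows "norm (avg f Q) \<le> ave \<phi> Q"
proof -
  have "norm (strong_set_integral f Q) \<le> mass \<phi> Q" using assms by (auto simp: controlled_def mass_def)
  then show ?thesis unfolding avg_eq ave_def by (simp add: divide_right_mono)
qed

lemma anc_atom:
  assumes "k \<le> l" "w \<in> atoms l R" "x \<in> w"
  shows "anc k w = cube_at \<omega> k x"
  using atom_eqI[OF assms(2,3)] anc_eq[OF assms(1), of x x] by simp

text \<open>If J is additive over atoms, the quotients of J by the volume form a martingale. This
  serves the vector averages \<open>avg f\<close> and the real averages \<open>ave \<phi>\<close>
  alike.\<close>

lemma cavg_additive:
  fixes J :: "(real^'d) set \<Rightarrow> 'a::real_vector"
  assumes J: "\<And>k x. k \<le> l \<Longrightarrow> J (cube_at \<omega> k x) = (\<Sum>w\<in>atoms l (cube_at \<omega> k x). J w)"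
    and k: "k0 \<le> k" "k \<le> l" and w: "w \<in> atoms l (cube_at \<omega> k0 x0)"
  shows "cavg (atoms l (cube_at \<omega> k0 x0)) (anc k) (\<lambda>Q. (1 / measure lebesgue Q) *\<^sub>R J Q) w =
    (1 / measure lebesgue (anc k w)) *\<^sub>R J (anc k w)"
proof -
  obtain x where x: "w = cube_at \<omega> l x" using w by (rule atomsE)
  have an: "anc k w = cube_at \<omega> k x" unfolding x by (rule anc_eq[OF k(2)]) simp
  let ?A = "atoms l (cube_at \<omega> k x)"
  have A: "{w'\<in>atoms l (cube_at \<omega> k0 x0). anc k w' = anc k w} = ?A"
    using mem_atoms_anc_iff[OF k w] an by simp
  have card: "real (card ?A) * cube_vol TYPE('d) l = cube_vol TYPE('d) k" by (rule card_atoms[OF k(2)])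
  have vol: "measure lebesgue w' = cube_vol TYPE('d) l" if "w' \<in> ?A" for w'
    using that by (auto elim!: atomsE simp: measure_cube_at)
  have "(\<Sum>w'\<in>?A. (1 / measure lebesgue w') *\<^sub>R J w') = (1 / cube_vol TYPE('d) l) *\<^sub>R J (cube_at \<omega> k x)"
    unfolding J[OF k(2)] scaleR_sum_right by (intro sum.cong refl) (simp add: vol)
  then show ?thesis
    unfolding cavg_def A unfolding an measure_cube_at card[symmetric] by simp
qed

lemma cavg_avg:
  assumes "controlled X f \<phi>" "k0 \<le> k" "k \<le> l" "w \<in> atoms l (cube_at \<omega> k0 x0)"
  shows "cavg (atoms l (cube_at \<omega> k0 x0)) (anc k) (avg f) w = avg f (anc k w)"
proof -
  have "strong_set_integral f (cube_at \<omega> k x) = (\<Sum>w\<in>atoms l (cube_at \<omega> k x). strong_set_integral f w)"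
    if "k \<le> l" for k x
    using strong_set_integral_Union[OF assms(1) finite_atoms[OF that] atom_lebesgue disjoint_atoms]
    unfolding Union_atoms[OF that] .
  from cavg_additive[OF this assms(2-4)] show ?thesis unfolding avg_eq[abs_def] .
qed

lemma cavg_ave:
  assumes "integrable lebesgue \<phi>" "k0 \<le> k" "k \<le> l" "w \<in> atoms l (cube_at \<omega> k0 x0)"
  shows "cavg (atoms l (cube_at \<omega> k0 x0)) (anc k) (ave \<phi>) w = ave \<phi> (anc k w)"
proof -
  have "ave \<phi> = (\<lambda>Q. (1 / measure lebesgue Q) *\<^sub>R mass \<phi> Q)" by (simp add: ave_def fun_eq_iff)
  then show ?thesis using cavg_additive[of l "mass \<phi>", OF mass_atoms[OF assms(1)] assms(2-4)] by simp
qed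

end

section \<open>Estimates below one stopping cube\<close>

definition local_const :: "nat \<Rightarrow> real \<Rightarrow> real \<Rightarrow> (nat \<Rightarrow> real) \<Rightarrow> real" where
  "local_const n p r \<beta> = \<beta> 0 powr p * (\<Prod>k<n. 1 + \<beta> k powr p) * (2 powr (p + 1) * (2 powr ((p + 2) / r) + 1) powr p)"

lemma local_const_nonneg: "0 \<le> local_const n p r \<beta>"
  unfolding local_const_def by (intro mult_nonneg_nonneg prod_nonneg) auto

text \<open>G is meant to be the set of cubes with stopping parent R. The atoms are strictly finer
  than all cubes of G, so that the Haar functions of G are constant on atoms.\<close>

locale stopping_region = dyadic_system \<omega> for \<omega> :: "int \<Rightarrow> real^'d" +
  fixes k0 :: int and x0 :: "real^'d" and N :: nat and G :: "(real^'d) set set"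
  assumes G: "finite G" "G \<subseteq> dyadic_grid \<omega>" and G_sub: "\<And>Q. Q \<in> G \<Longrightarrow> Q \<subseteq> cube_at \<omega> k0 x0"
    and G_level: "\<And>k y. cube_at \<omega> k y \<in> G \<Longrightarrow> k < k0 + int N"
begin

abbreviation "R \<equiv> cube_at \<omega> k0 x0"
abbreviation "W \<equiv> atoms (k0 + int N) R"
abbreviation "q i \<equiv> anc (k0 + int i)"

text \<open>A cell is good as long as it contains a cube of G, since the growth of averages is
  controlled only along the ancestors of such cubes.\<close>

definition gd :: "nat \<Rightarrow> (real^'d) set \<Rightarrow> bool" where
  "gd i w \<longleftrightarrow> (\<exists>Q\<in>G. Q \<subseteq> q i w)"

lemma q_eq: "i \<le> N \<Longrightarrow> w \<in> W \<Longrightarrow> x \<in> w \<Longrightarrow> q i w = cube_at \<omega> (k0 + int i) x"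
  by (rule anc_atom) auto

lemma some_mem: "w \<in> W \<Longrightarrow> (SOME x. x \<in> w) \<in> w"
  by (auto elim!: atomsE intro: some_mem_cube_at)

lemma q_N: "w \<in> W \<Longrightarrow> q N w = w"
  using q_eq[OF order_refl _ some_mem] atom_eqI[OF _ some_mem] by metis

lemma q_sub_R: "i \<le> N \<Longrightarrow> w \<in> W \<Longrightarrow> q i w \<subseteq> R"
proof -
  assume i: "i \<le> N" and w: "w \<in> W"
  obtain x where x: "x \<in> R" "w = cube_at \<omega> (k0 + int N) x" using w by (rule atomsE)
  have "q i w = cube_at \<omega> (k0 + int i) x" using q_eq[OF i w, of x] x by simp
  also have "\<dots> \<subseteq> cube_at \<omega> k0 x" by (rule cube_at_mono[OF shifts]) simp
  also have "\<dots> = R" by (rule cube_at_eq[OF x(1)])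
  finally show ?thesis .
qed

lemma q_0: "w \<in> W \<Longrightarrow> q 0 w = R"
proof -
  assume w: "w \<in> W"
  obtain x where x: "x \<in> R" "w = cube_at \<omega> (k0 + int N) x" using w by (rule atomsE)
  then show ?thesis using q_eq[OF _ w, of 0 x] cube_at_eq[OF x(1)] by simp
qed

lemma q_mono:
  assumes "i \<le> j" "j \<le> N" "w \<in> W"
  shows "q j w \<subseteq> q i w"
  using assms q_eq[of i w, OF _ _ some_mem] q_eq[of j w, OF _ _ some_mem] cube_at_mono[OF shifts] by simp

lemma q_grid: "i \<le> N \<Longrightarrow> w \<in> W \<Longrightarrow> q i w \<in> dyadic_grid \<omega>"
  using q_eq[OF _ _ some_mem] by simp

lemma q_refine:
  assumes i: "i < N" and w: "w \<in> W" "w' \<in> W" "q (Suc i) w = q (Suc i) w'"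
  shows "q i w = q i w'"
proof -
  let ?x = "SOME x. x \<in> w" and ?y = "SOME y. y \<in> w'"
  have "cube_at \<omega> (k0 + int (Suc i)) ?x = cube_at \<omega> (k0 + int (Suc i)) ?y"
    using w(3) q_eq[of "Suc i", OF _ w(1) some_mem[OF w(1)]] q_eq[of "Suc i", OF _ w(2) some_mem[OF w(2)]] i by simp
  then have "cube_at \<omega> (k0 + int i) ?x = cube_at \<omega> (k0 + int i) ?y"
    unfolding cube_at_eq_iff by (rule cube_index_coarser[OF shifts]) simp
  then show ?thesis
    using q_eq[of i, OF _ w(1) some_mem[OF w(1)]] q_eq[of i, OF _ w(2) some_mem[OF w(2)]] i by simp
qed

sublocale stopping W "\<lambda>i. q i" N gd
proof
  show "finite W" by (rule finite_atoms) simp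
  show "q i w = q i w'" if "i < N" "w \<in> W" "w' \<in> W" "q (Suc i) w = q (Suc i) w'" for i w w'
    using that by (rule q_refine)
  show "gd i w = gd i w'" if "q i w = q i w'" for i w w' using that by (simp add: gd_def)
  show "gd i w" if "i < N" "w \<in> W" "gd (Suc i) w" for i w
    using that q_mono[of i "Suc i" w] unfolding gd_def by auto
qed

text \<open>The Haar function of the ancestor at step i, scaled to the values 1 and -1 and evaluated
  on the atom.\<close>

definition step_sign :: "((real^'d) set \<Rightarrow> 'd \<Rightarrow> bool) \<Rightarrow> nat \<Rightarrow> (real^'d) set \<Rightarrow> real" where
  "step_sign \<theta> i w = sqrt (cube_vol TYPE('d) (k0 + int i)) * haar (\<theta> (q i w)) (q i w) (SOME x. x \<in> w)"

text \<open>At a point of an atom the Haar sum has one term per level; this brings it into the form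
  of \<open>discrete_paraproduct\<close>.\<close>

lemma haar_sum_eq:
  fixes y :: "(real^'d) set \<Rightarrow> 'b::real_vector"
  assumes w: "w \<in> W" and x: "x \<in> w"
  shows "(\<Sum>Q\<in>G. haar (\<theta> Q) Q x *\<^sub>R y Q) = (\<Sum>i<N. step_sign \<theta> i w *\<^sub>R scaled_coeff G y (q i w))"
proof -
  have xR: "x \<in> R" using atom_subset[OF _ w] x by auto
  have GR: "{Q\<in>G. Q \<subseteq> R} = G" using G_sub by blast
  have "(\<Sum>Q\<in>G. haar (\<theta> Q) Q x *\<^sub>R y Q) = (\<Sum>Q\<in>{Q\<in>G. Q \<subseteq> cube_at \<omega> (k0 + int 0) x0}. indicator Q x *\<^sub>R (haar (\<theta> Q) Q x *\<^sub>R y Q))"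
  proof (rule sum.cong)
    show "G = {Q\<in>G. Q \<subseteq> cube_at \<omega> (k0 + int 0) x0}" using GR by simp
    fix Q assume "Q \<in> {Q\<in>G. Q \<subseteq> cube_at \<omega> (k0 + int 0) x0}"
    then have "Q \<in> dyadic_grid \<omega>" using G by blast
    then obtain k z where "Q = cube_at \<omega> k z" by (rule grid_cases)
    then show "haar (\<theta> Q) Q x *\<^sub>R y Q = indicator Q x *\<^sub>R (haar (\<theta> Q) Q x *\<^sub>R y Q)"
      by (cases "x \<in> Q") (auto simp: haar_outside)
  qed
  also have "\<dots> = (\<Sum>i\<in>{0..<N}. if cube_at \<omega> (k0 + int i) x \<in> G
      then haar (\<theta> (cube_at \<omega> (k0 + int i) x)) (cube_at \<omega> (k0 + int i) x) x *\<^sub>R y (cube_at \<omega> (k0 + int i) x) else 0)"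
    by (rule sum_cubes_eq_sum_levels[OF G G_level]) (use xR in simp_all)
  also have "\<dots> = (\<Sum>i<N. step_sign \<theta> i w *\<^sub>R scaled_coeff G y (q i w))"
    unfolding atLeast0LessThan
  proof (rule sum.cong[OF refl])
    fix i assume "i \<in> {..<N}"
    then have i: "i \<le> N" "i < N" by auto
    have qx: "q i w = cube_at \<omega> (k0 + int i) x" by (rule q_eq[OF i(1) w x])
    have "cube_at \<omega> (k0 + int N) (SOME x. x \<in> w) = cube_at \<omega> (k0 + int N) x"
      using atom_eqI[OF w x] atom_eqI[OF w some_mem[OF w]] by simp
    then have "cube_index \<omega> (k0 + int i + 1) (SOME x. x \<in> w) = cube_index \<omega> (k0 + int i + 1) x"
      unfolding cube_at_eq_iff by (rule cube_index_coarser[OF shifts]) (use i in simp)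
    then have h: "haar (\<theta> (q i w)) (q i w) (SOME x. x \<in> w) = haar (\<theta> (q i w)) (q i w) x"
      unfolding qx by (rule haar_const)
    show "(if cube_at \<omega> (k0 + int i) x \<in> G
      then haar (\<theta> (cube_at \<omega> (k0 + int i) x)) (cube_at \<omega> (k0 + int i) x) x *\<^sub>R y (cube_at \<omega> (k0 + int i) x) else 0) =
      step_sign \<theta> i w *\<^sub>R scaled_coeff G y (q i w)"
      unfolding qx[symmetric] step_sign_def h by (simp add: scaled_coeff_def qx measure_cube_at)
  qed
  finally show ?thesis .
qed

lemma haar_sum_outside:
  fixes y :: "(real^'d) set \<Rightarrow> 'b::real_vector"
  assumes "x \<notin> R"
  shows "(\<Sum>Q\<in>G. haar (\<theta> Q) Q x *\<^sub>R y Q) = 0"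
proof (rule sum.neutral, rule ballI)
  fix Q assume Q: "Q \<in> G"
  then have "Q \<in> dyadic_grid \<omega>" using G by blast
  then obtain k z where "Q = cube_at \<omega> k z" by (rule grid_cases)
  moreover have "x \<notin> Q" using G_sub[OF Q] assms by blast
  ultimately show "haar (\<theta> Q) Q x *\<^sub>R y Q = 0" by (simp add: haar_outside)
qed

text \<open>A cube Q of G that is strictly larger than the cell has a Haar function that is constant
  there. A cube that is not larger is disjoint from the cell, which contains no cube of G.\<close>

lemma haar_bad_const:
  assumes i: "i < N" and w: "w \<in> W" "w' \<in> W" "q i w = q i w'" and bad: "\<not> gd i w"
    and x: "x \<in> w" "x' \<in> w'" and Q: "Q \<in> G"
  shows "haar \<theta> Q x = haar \<theta> Q x'"
proof -
  have "Q \<in> dyadic_grid \<omega>" using Q G by blast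
  then obtain k z where kz: "Q = cube_at \<omega> k z" by (rule grid_cases)
  have qx: "q i w = cube_at \<omega> (k0 + int i) x" "q i w = cube_at \<omega> (k0 + int i) x'"
    using q_eq[OF _ w(1) x(1), of i] q_eq[OF _ w(2) x(2), of i] w(3) i by simp_all
  show ?thesis
  proof (cases "k + 1 \<le> k0 + int i")
    case True
    have "cube_at \<omega> (k0 + int i) x = cube_at \<omega> (k0 + int i) x'" using qx by simp
    then have "cube_index \<omega> (k + 1) x = cube_index \<omega> (k + 1) x'"
      unfolding cube_at_eq_iff by (rule cube_index_coarser[OF shifts _ True])
    then show ?thesis unfolding kz by (rule haar_const)
  next
    case False
    then have le: "k0 + int i \<le> k" by simp
    have "Q \<inter> q i w = {}"
    proof (rule ccontr)
      assume "Q \<inter> q i w \<noteq> {}"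
      then have "Q \<subseteq> q i w" unfolding kz qx(1) by (rule cube_at_nested[OF shifts _ le])
      then show False using bad Q by (auto simp: gd_def)
    qed
    then have "x \<notin> Q" "x' \<notin> Q" using qx self_mem_cube_at by blast+
    then show ?thesis unfolding kz by (simp add: haar_outside)
  qed
qed

definition growth_le :: "(real^'d \<Rightarrow> real) \<Rightarrow> real \<Rightarrow> bool" where
  "growth_le \<phi> A \<longleftrightarrow> (\<forall>Q\<in>G. \<forall>Q'\<in>dyadic_grid \<omega>. Q \<subseteq> Q' \<and> Q' \<subseteq> R \<longrightarrow> ave \<phi> Q' \<le> A * ave \<phi> R)"

text \<open>On a good cell the growth condition bounds the average; the next cell is a child, whose
  average can be larger by at most \<open>2 ^ CARD('d)\<close>.\<close>

lemma stopped_ave_bound: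
  assumes \<phi>: "integrable lebesgue \<phi>" "\<And>x. 0 \<le> \<phi> x" and A: "1 \<le> A"
    and good: "growth_le \<phi> A"
    and w: "w \<in> W"
  shows "ave \<phi> (q 0 w) \<le> 2 ^ CARD('d) * A * ave \<phi> R"
    and "\<And>i. i < N \<Longrightarrow> gd i w \<Longrightarrow> ave \<phi> (q (Suc i) w) \<le> 2 ^ CARD('d) * A * ave \<phi> R"
proof -
  have R0: "0 \<le> ave \<phi> R" by (rule ave_nonneg[OF \<phi>(2)])
  have "1 * 1 \<le> 2 ^ CARD('d) * A" using A by (intro mult_mono) auto
  then show "ave \<phi> (q 0 w) \<le> 2 ^ CARD('d) * A * ave \<phi> R"
    using q_0[OF w] mult_right_mono[OF _ R0, of 1 "2 ^ CARD('d) * A"] by simp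
  fix i assume i: "i < N" and g: "gd i w"
  obtain Q where Q: "Q \<in> G" "Q \<subseteq> q i w" using g by (auto simp: gd_def)
  have "ave \<phi> (q i w) \<le> A * ave \<phi> R"
    using good Q q_grid[of i w] q_sub_R[of i w] i w unfolding growth_le_def by auto
  moreover have "ave \<phi> (q (Suc i) w) \<le> 2 ^ CARD('d) * ave \<phi> (q i w)"
    using ave_child_le[OF \<phi>, of "k0 + int i" "SOME x. x \<in> w"]
      q_eq[of i, OF _ w some_mem[OF w]] q_eq[of "Suc i", OF _ w some_mem[OF w]] i by (simp add: ac_simps)
  ultimately show "ave \<phi> (q (Suc i) w) \<le> 2 ^ CARD('d) * A * ave \<phi> R"
    by (smt (verit) mult.assoc mult_left_mono zero_le_numeral zero_le_power)
qed

lemma nn_integral_haar_sum: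
  fixes y :: "(real^'d) set \<Rightarrow> 'b::real_normed_vector"
  assumes "\<Psi> 0 = 0"
  shows "(\<integral>\<^sup>+x. \<Psi> (norm (\<Sum>Q\<in>G. haar (\<theta> Q) Q x *\<^sub>R y Q)) \<partial>lebesgue) =
    (\<Sum>w\<in>W. \<Psi> (norm (\<Sum>i<N. step_sign \<theta> i w *\<^sub>R scaled_coeff G y (q i w))) * ennreal (cube_vol TYPE('d) (k0 + int N)))"
proof -
  have "(\<integral>\<^sup>+x. \<Psi> (norm (\<Sum>Q\<in>G. haar (\<theta> Q) Q x *\<^sub>R y Q)) \<partial>lebesgue) =
      (\<integral>\<^sup>+x. \<Psi> (norm (\<Sum>Q\<in>G. haar (\<theta> Q) Q x *\<^sub>R y Q)) * indicator R x \<partial>lebesgue)"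
    using assms by (intro nn_integral_cong) (auto simp: indicator_def haar_sum_outside)
  also have "\<dots> = (\<Sum>w\<in>W. \<Psi> (norm (\<Sum>i<N. step_sign \<theta> i w *\<^sub>R scaled_coeff G y (q i w))) * ennreal (cube_vol TYPE('d) (k0 + int N)))"
  proof (rule nn_integral_atoms)
    fix w x assume "w \<in> W" "x \<in> w"
    then show "\<Psi> (norm (\<Sum>Q\<in>G. haar (\<theta> Q) Q x *\<^sub>R y Q)) = \<Psi> (norm (\<Sum>i<N. step_sign \<theta> i w *\<^sub>R scaled_coeff G y (q i w)))"
      by (simp only: haar_sum_eq)
  qed simp
  finally show ?thesis .
qed

text \<open>The norm of the Haar sum is constant on each cell that is not good, so the averages of
  \<phi> on atoms may be replaced by the stopped ones, which are bounded pointwise.\<close>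

lemma local_pairing:
  fixes y :: "(real^'d) set \<Rightarrow> 'b::real_normed_vector"
  assumes \<phi>: "integrable lebesgue \<phi>" "\<And>x. 0 \<le> \<phi> x" and A: "1 \<le> A"
    and good: "growth_le \<phi> A"
  shows "(\<integral>\<^sup>+x. ennreal (\<phi> x) * ennreal (norm (\<Sum>Q\<in>G. haar (\<theta> Q) Q x *\<^sub>R y Q)) \<partial>lebesgue) \<le>
    ennreal (2 ^ CARD('d) * A * ave \<phi> R) * (\<integral>\<^sup>+x. ennreal (norm (\<Sum>Q\<in>G. haar (\<theta> Q) Q x *\<^sub>R y Q)) \<partial>lebesgue)"
proof -
  let ?l = "k0 + int N" and ?M = "2 ^ CARD('d) * A * ave \<phi> R"
  let ?S = "\<lambda>x. \<Sum>Q\<in>G. haar (\<theta> Q) Q x *\<^sub>R y Q"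
  define F where "F w = norm (\<Sum>i<N. step_sign \<theta> i w *\<^sub>R scaled_coeff G y (q i w))" for w
  have FS: "norm (?S x) = F w" if "w \<in> W" "x \<in> w" for w x
    unfolding F_def haar_sum_eq[OF that] ..
  have F0: "0 \<le> F w" for w by (simp add: F_def)
  have M0: "0 \<le> ?M" using A ave_nonneg[of \<phi> R, OF \<phi>(2)] by simp
  have finW: "finite W" by (rule finite_atoms) simp
  have \<phi>m: "(\<lambda>x. ennreal (\<phi> x)) \<in> borel_measurable lebesgue" using \<phi>(1) by auto
  have massw: "mass \<phi> w = ave \<phi> w * cube_vol TYPE('d) ?l" if "w \<in> W" for w
    using that by (auto elim!: atomsE simp: mass_eq)
  have "ennreal (\<phi> x) * ennreal (norm (?S x)) = (\<Sum>w\<in>W. ennreal (F w) * (ennreal (\<phi> x) * indicator w x))" for x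
  proof (cases "x \<in> R")
    case True
    have "(\<Sum>w\<in>W. ennreal (F w) * (ennreal (\<phi> x) * indicator w x)) = (\<Sum>w\<in>W. (ennreal (F w) * ennreal (\<phi> x)) * indicator w x)"
      by (simp add: mult.assoc)
    also have "\<dots> = ennreal (F (cube_at \<omega> ?l x)) * ennreal (\<phi> x)"
      by (rule indicator_atoms[OF _ True]) simp
    also have "F (cube_at \<omega> ?l x) = norm (?S x)" by (rule FS[symmetric]) (use mem_atom[OF True] in auto)
    finally show ?thesis by (simp add: mult.commute)
  next
    case False
    then have "x \<notin> w" if "w \<in> W" for w using atom_subset[OF _ that] by auto
    then show ?thesis using False by (simp add: haar_sum_outside)
  qed
  then have "(\<integral>\<^sup>+x. ennreal (\<phi> x) * ennreal (norm (?S x)) \<partial>lebesgue) =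
      (\<integral>\<^sup>+x. (\<Sum>w\<in>W. ennreal (F w) * (ennreal (\<phi> x) * indicator w x)) \<partial>lebesgue)" by simp
  also have "\<dots> = (\<Sum>w\<in>W. \<integral>\<^sup>+x. ennreal (F w) * (ennreal (\<phi> x) * indicator w x) \<partial>lebesgue)"
    by (rule nn_integral_sum) (intro borel_measurable_times_ennreal borel_measurable_const \<phi>m borel_measurable_indicator atom_lebesgue)
  also have "\<dots> = (\<Sum>w\<in>W. ennreal (F w) * ennreal (mass \<phi> w))"
  proof (rule sum.cong[OF refl])
    fix w assume w: "w \<in> W"
    have "(\<integral>\<^sup>+x. ennreal (F w) * (ennreal (\<phi> x) * indicator w x) \<partial>lebesgue) = ennreal (F w) * (\<integral>\<^sup>+x. ennreal (\<phi> x) * indicator w x \<partial>lebesgue)"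
      by (rule nn_integral_cmult) (intro borel_measurable_times_ennreal \<phi>m borel_measurable_indicator atom_lebesgue[OF w])
    then show "(\<integral>\<^sup>+x. ennreal (F w) * (ennreal (\<phi> x) * indicator w x) \<partial>lebesgue) = ennreal (F w) * ennreal (mass \<phi> w)"
      by (simp only: nn_mass[OF \<phi> atom_lebesgue[OF w]])
  qed
  also have "\<dots> = ennreal (\<Sum>w\<in>W. F w * mass \<phi> w)"
    using F0 mass_nonneg[OF \<phi>(2)] by (subst sum_ennreal[symmetric]) (auto simp: ennreal_mult)
  also have "(\<Sum>w\<in>W. F w * mass \<phi> w) \<le> ?M * (\<Sum>w\<in>W. F w * cube_vol TYPE('d) ?l)"
  proof -
    have e: "cavg W (q i) (ave \<phi>) w = ave \<phi> (q i w)" if "i \<le> N" "w \<in> W" for i w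
      by (rule cavg_ave[OF \<phi>(1)]) (use that in auto)
    have "(\<Sum>w\<in>W. F w * ave \<phi> w) = (\<Sum>w\<in>W. F w * cavg W (q N) (ave \<phi>) w)"
      by (intro sum.cong refl) (simp add: e q_N)
    also have "\<dots> = (\<Sum>w\<in>W. F w * stopped W (\<lambda>i. q i) (ave \<phi>) gd N w)"
    proof (rule sum_stopped[symmetric])
      fix i w w' assume *: "i < N" "w \<in> W" "w' \<in> W" "q i w = q i w'" "\<not> gd i w"
      let ?x = "SOME x. x \<in> w" and ?x' = "SOME x. x \<in> w'"
      have "?S ?x = ?S ?x'"
        by (intro sum.cong refl arg_cong2[of _ _ _ _ scaleR] haar_bad_const[OF *] some_mem *)
      then show "F w = F w'" using FS[OF *(2) some_mem[OF *(2)]] FS[OF *(3) some_mem[OF *(3)]] by simp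
    qed simp
    also have "\<dots> \<le> (\<Sum>w\<in>W. F w * ?M)"
    proof (intro sum_mono mult_left_mono F0)
      fix w assume w: "w \<in> W"
      have "norm (stopped W (\<lambda>i. q i) (ave \<phi>) gd N w) \<le> ?M"
      proof (rule stopped_bound)
        show "norm (cavg W (q 0) (ave \<phi>) w) \<le> ?M"
          using stopped_ave_bound(1)[OF \<phi> A good w] e[of 0 w] w ave_nonneg[of \<phi> "q 0 w", OF \<phi>(2)] by simp
        show "norm (cavg W (q (Suc i)) (ave \<phi>) w) \<le> ?M" if "i < N" "gd i w" for i
          using stopped_ave_bound(2)[OF \<phi> A good w that] e[of "Suc i" w] w that ave_nonneg[of \<phi> "q (Suc i) w", OF \<phi>(2)] by simp
      qed simp
      then show "stopped W (\<lambda>i. q i) (ave \<phi>) gd N w \<le> ?M" by simp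
    qed
    also have "\<dots> = ?M * (\<Sum>w\<in>W. F w)" by (subst sum_distrib_right[symmetric]) (rule mult.commute)
    finally have "(\<Sum>w\<in>W. F w * ave \<phi> w) \<le> ?M * (\<Sum>w\<in>W. F w)" .
    then have "(\<Sum>w\<in>W. F w * ave \<phi> w) * cube_vol TYPE('d) ?l \<le> ?M * (\<Sum>w\<in>W. F w) * cube_vol TYPE('d) ?l"
      by (rule mult_right_mono) simp
    moreover have "(\<Sum>w\<in>W. F w * mass \<phi> w) = (\<Sum>w\<in>W. F w * ave \<phi> w) * cube_vol TYPE('d) ?l"
      by (simp add: sum_distrib_right massw mult.assoc)
    ultimately show ?thesis by (simp add: sum_distrib_right mult.assoc)
  qed
  also have "ennreal (?M * (\<Sum>w\<in>W. F w * cube_vol TYPE('d) ?l)) = ennreal ?M * (\<Sum>w\<in>W. ennreal (F w) * ennreal (cube_vol TYPE('d) ?l))"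
    using M0 F0 by (subst ennreal_mult) (auto intro!: sum_nonneg simp: sum_ennreal[symmetric] ennreal_mult)
  also have "(\<Sum>w\<in>W. ennreal (F w) * ennreal (cube_vol TYPE('d) ?l)) = (\<integral>\<^sup>+x. ennreal (norm (?S x)) \<partial>lebesgue)"
    using nn_integral_haar_sum[of ennreal \<theta> y] by (simp add: F_def)
  finally show ?thesis by (simp add: ennreal_leI)
qed

text \<open>An instance of \<open>discrete_paraproduct\<close> on the atoms of R: the cells are
  ancestors, H is \<open>step_sign\<close>, and the operators are the scaled coefficients.
  Multiplication by the common volume of the atoms turns the sum into an integral.\<close>

lemma local_Lp:
  fixes a :: "(real^'d) set \<Rightarrow> ('x::banach, 'y::banach) multop" and f :: "nat \<Rightarrow> real^'d \<Rightarrow> 'x"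
  assumes n: "1 \<le> n" and X: "\<And>m. m \<in> {1..n} \<Longrightarrow> subspace (X m)"
    and f: "\<And>m. m \<in> {1..n} \<Longrightarrow> controlled (X m) (f m) (\<phi> m)"
    and A: "1 \<le> A"
    and good: "\<And>m. m \<in> {1..n} \<Longrightarrow> growth_le (\<phi> m) A"
    and T: "\<And>k. k \<in> {1..<n} \<Longrightarrow> UMD_bound (T k) p (\<beta> k)"
    and Y: "UMD_bound (UNIV :: 'y set) p (\<beta> 0)"
    and cond: "UMD_subspace_condition (dyadic_grid \<omega>) n X T a"
    and \<theta>: "\<And>Q. Q \<in> dyadic_grid \<omega> \<Longrightarrow> cancellative (\<theta> Q)"
    and r: "0 < r" and B: "0 \<le> B" and BMO: "BMO_norm (dyadic_grid \<omega>) r a \<le> ennreal B"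
  shows "(\<integral>\<^sup>+x. ennreal (norm (\<Sum>Q\<in>G. haar (\<theta> Q) Q x *\<^sub>R multop_apply (a Q) (map (\<lambda>m. avg (f m) Q) [1..<n+1])) powr p) \<partial>lebesgue) \<le>
    ennreal (local_const n p r \<beta> * (B * (\<Prod>m=1..n. 2 ^ CARD('d) * A * ave (\<phi> m) R)) powr p * cube_vol TYPE('d) k0)"
proof -
  let ?l = "k0 + int N" and ?M = "\<lambda>m. 2 ^ CARD('d) * A * ave (\<phi> m) R"
  let ?y = "\<lambda>Q. multop_apply (a Q) (map (\<lambda>m. avg (f m) Q) [1..<n+1])"
  let ?a = "\<lambda>i w. scaled_coeff G a (q i w)"
  \<comment> \<open>The final values of the stopped averages play the part of the functions; they
    are bounded by \<open>?M m\<close>, which the averages on atoms need not be.\<close>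
  let ?f = "\<lambda>m. stopped W (\<lambda>i. q i) (avg (f m)) gd N"
  have \<phi>: "integrable lebesgue (\<phi> m)" "\<And>x. 0 \<le> \<phi> m x" if "m \<in> {1..n}" for m
    using f[OF that] by (auto simp: controlled_def)
  have finW: "finite W" by (rule finite_atoms) simp
  have p: "1 < p" using Y by (simp add: UMD_bound_def)
  have n1: "n \<in> {1..n}" using n by simp
  have Tn: "subspace (T n)" "T n \<subseteq> multilinear_ops X n"
    using cond n1 unfolding UMD_subspace_condition_def UMD_space_def by blast+
  have Tk: "subspace (T k)" if "k \<in> {1..<n}" for k using T[OF that] by (simp add: UMD_bound_def)
  have e: "cavg W (q i) (avg (f m)) w = avg (f m) (q i w)" if "m \<in> {1..n}" "i \<le> N" "w \<in> W" for m i w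
    by (rule cavg_avg[OF f[OF that(1)]]) (use that in auto)
  have qleb: "q i w \<in> sets lebesgue" if "i \<le> N" "w \<in> W" for i w
    using q_grid[OF that] by (rule grid_lebesgue)
  have "(\<Sum>w\<in>W. norm (\<Sum>i<N. step_sign \<theta> i w *\<^sub>R multop_apply (?a i w) (map (\<lambda>m. cavg W (q i) (?f m) w) [1..<n+1])) powr p) \<le>
      \<beta> 0 powr p * (\<Prod>k<n. 1 + \<beta> k powr p) * (2 powr (p + 1) * (2 powr ((p + 2) / r) + 1) powr p) *
      (B * (\<Prod>m=1..n. ?M m)) powr p * card W"
  proof (rule discrete_paraproduct[where q = "\<lambda>i. q i" and W = W and N = N and X = X and T = T and M = ?M])
    show "1 \<le> n" "finite W" "0 < r" "0 \<le> B" by fact+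
    show "subspace (X m)" if "m \<in> {1..n}" for m by (rule X[OF that])
    show "q i w = q i w'" if "i < N" "w \<in> W" "w' \<in> W" "q (Suc i) w = q (Suc i) w'" for i w w'
      using that by (rule q_refine)
    show "UMD_bound (T k) p (\<beta> k)" if "k \<in> {1..<n}" for k by (rule T[OF that])
    show "UMD_bound (UNIV :: 'y set) p (\<beta> 0)" by (rule Y)
    show "q 0 w = q 0 w'" if "w \<in> W" "w' \<in> W" for w w' using q_0 that by simp
    show "?a i w \<in> multilinear_ops X n" if "i < N" "w \<in> W" for i w
    proof -
      have "q i w \<in> dyadic_grid \<omega>" using q_grid[of i w] that by simp
      then have "a (q i w) \<in> T n" using cond unfolding UMD_subspace_condition_def by blast
      then have "?a i w \<in> T n" by (simp add: scaled_coeff_def subspace_scale[OF Tn(1)] subspace_0[OF Tn(1)])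
      then show ?thesis using Tn(2) by blast
    qed
    show "freeze (?a i w) (map e [k+1..<n+1]) \<in> T k"
      if i: "i < N" and w: "w \<in> W" and k: "k \<in> {1..<n}" and ex: "\<And>m. m \<in> {k+1..n} \<Longrightarrow> e m \<in> X m" for i w k e
    proof -
      have "q i w \<in> dyadic_grid \<omega>" using q_grid[of i w] i w by simp
      then have fa: "freeze (a (q i w)) (map e [k+1..<n+1]) \<in> T k"
        using cond k ex unfolding UMD_subspace_condition_def by blast
      have sc: "freeze (c *\<^sub>R b) es = c *\<^sub>R freeze b es" for c and b :: "('x, 'y) multop" and es
        by (rule multop_eqI) (simp add: freeze.rep_eq scaleR_multop.rep_eq)
      have z: "freeze (0 :: ('x, 'y) multop) es = 0" for es
        by (rule multop_eqI) (simp add: freeze.rep_eq zero_multop.rep_eq)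
      show ?thesis
        using fa by (simp add: scaled_coeff_def sc z subspace_scale[OF Tk[OF k]] subspace_0[OF Tk[OF k]] del: upt_Suc)
    qed
    show "?a i w = ?a i w'" if "q i w = q i w'" for i w w' using that by simp
    show "?f m w \<in> X m" if "m \<in> {1..n}" "w \<in> W" for m w
      by (rule stopped_subspace[OF X[OF that(1)]])
        (rule avg_in_subspace[OF f[OF that(1)] X[OF that(1)] atom_lebesgue])
    show "norm (?f m w) \<le> ?M m" if m: "m \<in> {1..n}" and w: "w \<in> W" for m w
    proof (rule stopped_bound)
      have na: "norm (avg (f m) (q i w)) \<le> ave (\<phi> m) (q i w)" if "i \<le> N" for i
        by (rule norm_avg_le_ave[OF f[OF m] qleb[OF that w]])
      show "norm (cavg W (q 0) (avg (f m)) w) \<le> ?M m"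
        unfolding e[OF m le0 w] using na[of 0] stopped_ave_bound(1)[OF \<phi>[OF m] A good[OF m] w] by simp
      show "norm (cavg W (q (Suc i)) (avg (f m)) w) \<le> ?M m" if "i < N" "gd i w" for i
        using na[of "Suc i"] stopped_ave_bound(2)[OF \<phi>[OF m] A good[OF m] w that] e[OF m _ w, of "Suc i"] that by simp
    qed simp
    show "0 \<le> ?M m" if "m \<in> {1..n}" for m
      using A ave_nonneg[of "\<phi> m" R, OF \<phi>(2)[OF that]] by simp
    show "step_sign \<theta> i w = 1 \<or> step_sign \<theta> i w = -1" if i: "i < N" and w: "w \<in> W" for i w
    proof -
      let ?x = "SOME x. x \<in> w"
      have "q i w = cube_at \<omega> (k0 + int i) ?x" using q_eq[OF _ w some_mem[OF w], of i] i by simp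
      then show ?thesis unfolding step_sign_def using haar_inside[of ?x "k0 + int i" ?x] by simp
    qed
    show "step_sign \<theta> i w = step_sign \<theta> i w'"
      if i: "i < N" and w: "w \<in> W" "w' \<in> W" "q (Suc i) w = q (Suc i) w'" for i w w'
    proof -
      let ?x = "SOME x. x \<in> w" and ?y = "SOME x. x \<in> w'"
      have qx: "q i w = cube_at \<omega> (k0 + int i) ?x" using q_eq[OF _ w(1) some_mem[OF w(1)], of i] i by simp
      have "cube_at \<omega> (k0 + int (Suc i)) ?x = cube_at \<omega> (k0 + int (Suc i)) ?y"
        using w(3) q_eq[of "Suc i", OF _ w(1) some_mem[OF w(1)]] q_eq[of "Suc i", OF _ w(2) some_mem[OF w(2)]] i by simp
      then have "cube_index \<omega> (k0 + int i + 1) ?x = cube_index \<omega> (k0 + int i + 1) ?y"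
        unfolding cube_at_eq_iff by (simp add: ac_simps)
      then have "haar (\<theta> (q i w)) (q i w) ?x = haar (\<theta> (q i w)) (q i w) ?y"
        unfolding qx by (rule haar_const)
      then show ?thesis unfolding step_sign_def using q_refine[OF i w] by simp
    qed
    show "(\<Sum>w'\<in>{w'\<in>W. q i w' = q i w}. step_sign \<theta> i w') = 0" if i: "i < N" and w: "w \<in> W" for i w
    proof -
      let ?x = "SOME x. x \<in> w"
      have qx: "q i w = cube_at \<omega> (k0 + int i) ?x" using q_eq[OF _ w some_mem[OF w], of i] i by simp
      have C: "{w'\<in>W. q i w' = q i w} = atoms ?l (q i w)"
        by (rule mem_atoms_anc_iff) (use i w in auto)
      have "(\<Sum>w'\<in>{w'\<in>W. q i w' = q i w}. step_sign \<theta> i w') =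
          (\<Sum>w'\<in>{w'\<in>W. q i w' = q i w}. sqrt (cube_vol TYPE('d) (k0 + int i)) * haar (\<theta> (q i w)) (q i w) (SOME x. x \<in> w'))"
        by (intro sum.cong refl) (simp add: step_sign_def)
      also have "\<dots> = (\<Sum>w'\<in>atoms ?l (q i w). sqrt (cube_vol TYPE('d) (k0 + int i)) * haar (\<theta> (q i w)) (q i w) (SOME x. x \<in> w'))"
        unfolding C ..
      also have "\<dots> = sqrt (cube_vol TYPE('d) (k0 + int i)) * (\<Sum>w'\<in>atoms ?l (q i w). haar (\<theta> (q i w)) (q i w) (SOME x. x \<in> w'))"
        by (rule sum_distrib_left[symmetric])
      also have "(\<Sum>w'\<in>atoms ?l (q i w). haar (\<theta> (q i w)) (q i w) (SOME x. x \<in> w')) = 0"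
        unfolding qx by (rule sum_haar_atoms) (use i \<theta> in auto)
      finally show ?thesis by simp
    qed
    show "norm (?a i w) \<le> B" if i: "i < N" and w: "w \<in> W" for i w
    proof -
      let ?x = "SOME x. x \<in> w"
      have qx: "q i w = cube_at \<omega> (k0 + int i) ?x" using q_eq[OF _ w some_mem[OF w], of i] i by simp
      show ?thesis
        using bmo_jump[OF BMO r B, of "k0 + int i" ?x] B by (simp add: scaled_coeff_def qx measure_cube_at)
    qed
    show "(\<Sum>w'\<in>{w'\<in>W. q j w' = q j w}. \<Sum>\<epsilon>\<in>signs N. norm (\<Sum>i\<in>{j..<N}. \<epsilon> i *\<^sub>R ?a i w') powr r) \<le>
        B powr r * card {w'\<in>W. q j w' = q j w} * 2 ^ N" if j: "j < N" and w: "w \<in> W" for j w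
    proof -
      let ?x = "SOME x. x \<in> w"
      have qx: "q j w = cube_at \<omega> (k0 + int j) ?x" using q_eq[OF _ w some_mem[OF w], of j] j by simp
      have "{w'\<in>W. q j w' = q j w} = atoms ?l (cube_at \<omega> (k0 + int j) ?x)"
        unfolding qx[symmetric] by (rule mem_atoms_anc_iff) (use j w in auto)
      then show ?thesis using bmo_discrete[OF BMO r B G G_level j, where ?x0.0 = ?x] by simp
    qed
  qed
  \<comment> \<open>On a cube of G the cell is good, so the stopped averages agree there with those
    of \<open>f m\<close>; elsewhere the coefficient is 0.\<close>
  also have "(\<Sum>w\<in>W. norm (\<Sum>i<N. step_sign \<theta> i w *\<^sub>R multop_apply (?a i w) (map (\<lambda>m. cavg W (q i) (?f m) w) [1..<n+1])) powr p) =
      (\<Sum>w\<in>W. norm (\<Sum>i<N. step_sign \<theta> i w *\<^sub>R scaled_coeff G ?y (q i w)) powr p)"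
  proof (rule sum.cong[OF refl])
    fix w assume w: "w \<in> W"
    have "multop_apply (?a i w) (map (\<lambda>m. cavg W (q i) (?f m) w) [1..<n+1]) = scaled_coeff G ?y (q i w)" if i: "i < N" for i
    proof (cases "q i w \<in> G")
      case True
      then have g: "gd i w" by (auto simp: gd_def)
      have "cavg W (q i) (?f m) w = avg (f m) (q i w)" if m: "m \<in> {1..n}" for m
        using cavg_stopped[of i N w "avg (f m)"] stopped_good[of i w "avg (f m)"] e[OF m, of i w] i w g by simp
      then have eq: "map (\<lambda>m. cavg W (q i) (?f m) w) [1..<n+1] = map (\<lambda>m. avg (f m) (q i w)) [1..<n+1]"
        by (intro map_cong refl) auto
      show ?thesis unfolding eq using True by (simp add: scaled_coeff_def scaleR_multop.rep_eq del: upt_Suc)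
    next
      case False
      then show ?thesis by (simp add: scaled_coeff_def zero_multop.rep_eq)
    qed
    then show "norm (\<Sum>i<N. step_sign \<theta> i w *\<^sub>R multop_apply (?a i w) (map (\<lambda>m. cavg W (q i) (?f m) w) [1..<n+1])) powr p =
      norm (\<Sum>i<N. step_sign \<theta> i w *\<^sub>R scaled_coeff G ?y (q i w)) powr p"
      by (intro arg_cong2[of _ _ _ _ "(powr)"] arg_cong[of _ _ norm] refl sum.cong) auto
  qed
  finally have S: "(\<Sum>w\<in>W. norm (\<Sum>i<N. step_sign \<theta> i w *\<^sub>R scaled_coeff G ?y (q i w)) powr p) \<le>
      local_const n p r \<beta> * (B * (\<Prod>m=1..n. ?M m)) powr p * card W"
    by (simp add: local_const_def)
  have "(\<integral>\<^sup>+x. ennreal (norm (\<Sum>Q\<in>G. haar (\<theta> Q) Q x *\<^sub>R ?y Q) powr p) \<partial>lebesgue) =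
      (\<Sum>w\<in>W. ennreal (norm (\<Sum>i<N. step_sign \<theta> i w *\<^sub>R scaled_coeff G ?y (q i w)) powr p) * ennreal (cube_vol TYPE('d) ?l))"
    using nn_integral_haar_sum[of "\<lambda>t. ennreal (t powr p)" \<theta> ?y] p by simp
  also have "\<dots> = ennreal ((\<Sum>w\<in>W. norm (\<Sum>i<N. step_sign \<theta> i w *\<^sub>R scaled_coeff G ?y (q i w)) powr p) * cube_vol TYPE('d) ?l)"
    by (simp add: ennreal_mult''[symmetric] sum_distrib_right[symmetric])
  also have "\<dots> \<le> ennreal (local_const n p r \<beta> * (B * (\<Prod>m=1..n. ?M m)) powr p * card W * cube_vol TYPE('d) ?l)"
    by (intro ennreal_leI mult_right_mono S) simp
  also have "card W * cube_vol TYPE('d) ?l = cube_vol TYPE('d) k0"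
    by (rule card_atoms) simp
  then have "local_const n p r \<beta> * (B * (\<Prod>m=1..n. ?M m)) powr p * card W * cube_vol TYPE('d) ?l =
      local_const n p r \<beta> * (B * (\<Prod>m=1..n. ?M m)) powr p * cube_vol TYPE('d) k0"
    by (simp only: mult.assoc)
  finally show ?thesis .
qed

end

context stopping_region
begin

text \<open>The sum is supported in R, so a smaller exponent is possible. Values up to L have t-th
  power at most \<open>L powr t\<close>; above L the power t is dominated by the power p. Each part
  contributes once, whence the factor 2.\<close>

lemma Lq_of_Lp:
  fixes y :: "(real^'d) set \<Rightarrow> 'b::real_normed_vector"
  assumes Lp: "(\<integral>\<^sup>+x. ennreal (norm (\<Sum>Q\<in>G. haar (\<theta> Q) Q x *\<^sub>R y Q) powr p) \<partial>lebesgue) \<le> ennreal (L powr p * cube_vol TYPE('d) k0)"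
    and L: "0 \<le> L" and qp: "0 < t" "t \<le> p"
  shows "(\<integral>\<^sup>+x. ennreal (norm (\<Sum>Q\<in>G. haar (\<theta> Q) Q x *\<^sub>R y Q) powr t) \<partial>lebesgue) \<le> ennreal (2 * L powr t * cube_vol TYPE('d) k0)"
proof -
  let ?v = "cube_vol TYPE('d) (k0 + int N)" and ?V = "cube_vol TYPE('d) k0"
  define F where "F w = norm (\<Sum>i<N. step_sign \<theta> i w *\<^sub>R scaled_coeff G y (q i w))" for w
  have F0: "0 \<le> F w" for w by (simp add: F_def)
  have int: "(\<integral>\<^sup>+x. ennreal (norm (\<Sum>Q\<in>G. haar (\<theta> Q) Q x *\<^sub>R y Q) powr t) \<partial>lebesgue) = ennreal ((\<Sum>w\<in>W. F w powr t) * ?v)"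
    if "0 < t" for t
    using nn_integral_haar_sum[of "\<lambda>s. ennreal (s powr t)" \<theta> y] that
    by (simp add: F_def ennreal_mult''[symmetric] sum_distrib_right[symmetric])
  have finW: "finite W" by (rule finite_atoms) simp
  have "ennreal ((\<Sum>w\<in>W. F w powr p) * ?v) \<le> ennreal (L powr p * ?V)"
    using Lp int[of p] qp by simp
  then have le: "(\<Sum>w\<in>W. F w powr p) * ?v \<le> L powr p * ?V"
    by (subst (asm) ennreal_le_iff) auto
  have "(\<Sum>w\<in>W. F w powr t) * ?v \<le> 2 * L powr t * ?V"
  proof (cases "L = 0")
    case True
    have "(\<Sum>w\<in>W. F w powr p) * ?v \<le> 0" using le True by simp
    have "(\<Sum>w\<in>W. F w powr p) \<le> 0"
    proof (rule ccontr)
      assume "\<not> (\<Sum>w\<in>W. F w powr p) \<le> 0"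
      then have "0 < (\<Sum>w\<in>W. F w powr p) * ?v" by (intro mult_pos_pos) auto
      then show False using \<open>(\<Sum>w\<in>W. F w powr p) * ?v \<le> 0\<close> by simp
    qed
    then have "(\<Sum>w\<in>W. F w powr p) = 0" by (intro antisym sum_nonneg) auto
    then have "F w = 0" if "w \<in> W" for w using that finW by (auto simp: sum_nonneg_eq_0_iff)
    then show ?thesis using True by simp
  next
    case False
    then have L0: "0 < L" using L by simp
    have pw: "F w powr t \<le> L powr t + F w powr p * L powr (t - p)" for w
    proof (cases "F w \<le> L")
      case True
      then have "F w powr t \<le> L powr t" using qp F0 by (intro powr_mono2) auto
      then show ?thesis by (simp add: add_increasing2)
    next
      case False
      then have "F w powr (t - p) \<le> L powr (t - p)" using L0 qp by (intro powr_mono2') auto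
      then have "F w powr p * F w powr (t - p) \<le> F w powr p * L powr (t - p)" by (intro mult_left_mono) auto
      moreover have "F w powr p * F w powr (t - p) = F w powr t" by (simp add: powr_add[symmetric])
      ultimately show ?thesis by (simp add: add_increasing)
    qed
    have "(\<Sum>w\<in>W. F w powr t) * ?v \<le> (\<Sum>w\<in>W. L powr t + F w powr p * L powr (t - p)) * ?v"
      by (intro mult_right_mono sum_mono pw) simp
    also have "\<dots> = L powr t * (real (card W) * ?v) + L powr (t - p) * ((\<Sum>w\<in>W. F w powr p) * ?v)"
      by (simp add: sum.distrib sum_distrib_right[symmetric] distrib_left distrib_right mult_ac)
    also have "\<dots> \<le> L powr t * ?V + L powr (t - p) * (L powr p * ?V)"
      by (intro add_mono mult_left_mono le) (use card_atoms[of k0 "k0 + int N" x0] in auto)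
    also have "L powr (t - p) * (L powr p * ?V) = L powr t * ?V"
      by (simp add: mult.assoc[symmetric] powr_add[symmetric])
    finally show ?thesis by (simp add: mult_ac)
  qed
  then show ?thesis unfolding int[OF qp(1)] by (rule ennreal_leI)
qed

end

section \<open>Measurability, finiteness of the BMO norm, coarse scales\<close>

context dyadic_system
begin

lemma haar_simple:
  assumes "Q \<in> dyadic_grid \<omega>"
  shows "simple_function lebesgue (haar \<theta> Q)"
proof -
  obtain k x where Q: "Q = cube_at \<omega> k x" using assms by (rule grid_cases)
  have m: "haar \<theta> Q \<in> borel_measurable lebesgue"
    unfolding Q using haar_borel by (simp add: measurable_completion)
  have "haar \<theta> Q ` space lebesgue \<subseteq> {0, 1 / sqrt (cube_vol TYPE('d) k), - 1 / sqrt (cube_vol TYPE('d) k)}"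
  proof
    fix t assume "t \<in> haar \<theta> Q ` space lebesgue"
    then obtain y where t: "t = haar \<theta> Q y" by auto
    have "\<bar>t\<bar> = 0 \<or> \<bar>t\<bar> = 1 / sqrt (cube_vol TYPE('d) k)"
      unfolding t Q abs_haar by (cases "y \<in> cube_at \<omega> k x") auto
    then show "t \<in> {0, 1 / sqrt (cube_vol TYPE('d) k), - 1 / sqrt (cube_vol TYPE('d) k)}" by (auto simp: abs_if split: if_splits)
  qed
  then have "finite (haar \<theta> Q ` space lebesgue)" by (rule finite_subset) simp
  then show ?thesis using m by (intro simple_function_borel_measurable)
qed

text \<open>Haar functions take finitely many values, and simple functions can be composed with
  arbitrary maps; so the norm is measurable for nonseparable targets, too.\<close>

lemma haar_sum_simple:
  fixes y :: "(real^'d) set \<Rightarrow> 'b::real_normed_vector"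
  assumes "Z \<subseteq> dyadic_grid \<omega>"
  shows "simple_function lebesgue (\<lambda>x. norm (\<Sum>Q\<in>Z. haar (\<theta> Q) Q x *\<^sub>R y Q))"
proof (rule simple_function_compose1, rule simple_function_sum)
  fix Q assume "Q \<in> Z"
  then have "simple_function lebesgue (haar (\<theta> Q) Q)" using assms by (intro haar_simple) auto
  then show "simple_function lebesgue (\<lambda>x. haar (\<theta> Q) Q x *\<^sub>R y Q)" by (rule simple_function_compose1)
qed

lemma haar_sum_measurable:
  fixes y :: "(real^'d) set \<Rightarrow> 'b::real_normed_vector"
  assumes "Z \<subseteq> dyadic_grid \<omega>"
  shows "(\<lambda>x. norm (\<Sum>Q\<in>Z. haar (\<theta> Q) Q x *\<^sub>R y Q)) \<in> borel_measurable lebesgue"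
  by (rule borel_measurable_simple_function[OF haar_sum_simple[OF assms]])

text \<open>The triangle inequality bounds every test sum by c on its cube. Finiteness allows to
  treat the norm as a real number B.\<close>

lemma BMO_norm_finite:
  fixes a :: "(real^'d) set \<Rightarrow> 'b::banach"
  assumes fin: "finite {Q\<in>dyadic_grid \<omega>. a Q \<noteq> 0}" and r: "0 < r"
  shows "BMO_norm (dyadic_grid \<omega>) r a < \<infinity>"
proof -
  let ?Z = "{Q\<in>dyadic_grid \<omega>. a Q \<noteq> 0}"
  define c where "c = (\<Sum>Q\<in>?Z. norm (a Q) / sqrt (measure lebesgue Q))"
  have c0: "0 \<le> c" unfolding c_def by (intro sum_nonneg) simp
  have "BMO_norm (dyadic_grid \<omega>) r a \<le> ennreal c"
    unfolding BMO_norm_def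
  proof (intro SUP_least)
    fix D' Q0 assume D': "D' \<in> {D'. finite D' \<and> D' \<subseteq> dyadic_grid \<omega>}" and Q0: "Q0 \<in> dyadic_grid \<omega>"
    obtain k x0 where kx: "Q0 = cube_at \<omega> k x0" using Q0 by (rule grid_cases)
    let ?V = "cube_vol TYPE('d) k"
    let ?F = "\<lambda>\<epsilon> x. norm (\<Sum>Q\<in>{Q\<in>D'. Q \<subseteq> Q0}. (\<epsilon> Q * indicator Q x / sqrt (measure lebesgue Q)) *\<^sub>R a Q)"
    have D'': "finite D'" "D' \<subseteq> dyadic_grid \<omega>" using D' by auto
    have F: "?F \<epsilon> x \<le> c * indicator Q0 x" if \<epsilon>: "\<epsilon> \<in> set_pmf (random_signs D')" for \<epsilon> x
    proof -
      have e1: "\<bar>\<epsilon> Q\<bar> = 1" if "Q \<in> D'" for Q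
      proof -
        have "\<epsilon> \<in> PiE_dflt D' 1 (\<lambda>_. {-1, 1})"
          using \<epsilon> unfolding random_signs_eq[OF D''(1)]
          by (subst (asm) set_pmf_of_set) (use D''(1) in auto)
        then show ?thesis using that by (auto simp: PiE_dflt_def)
      qed
      show ?thesis
      proof (cases "x \<in> Q0")
        case True
        have "?F \<epsilon> x \<le> (\<Sum>Q\<in>{Q\<in>D'. Q \<subseteq> Q0}. norm (a Q) / sqrt (measure lebesgue Q))"
        proof (rule sum_norm_le)
          fix Q assume "Q \<in> {Q\<in>D'. Q \<subseteq> Q0}"
          then have "\<bar>\<epsilon> Q\<bar> = 1" using e1 by blast
          then show "norm ((\<epsilon> Q * indicator Q x / sqrt (measure lebesgue Q)) *\<^sub>R a Q) \<le> norm (a Q) / sqrt (measure lebesgue Q)"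
            by (simp add: abs_mult indicator_def)
        qed
        also have "\<dots> = (\<Sum>Q\<in>{Q\<in>D'. Q \<subseteq> Q0} \<inter> ?Z. norm (a Q) / sqrt (measure lebesgue Q))"
          using D'' by (intro sum.mono_neutral_right) auto
        also have "\<dots> \<le> c"
          unfolding c_def using fin by (intro sum_mono2) auto
        finally show ?thesis using True by simp
      next
        case False
        then have "x \<notin> Q" if "Q \<subseteq> Q0" for Q using that by blast
        then have "(\<Sum>Q\<in>{Q\<in>D'. Q \<subseteq> Q0}. (\<epsilon> Q * indicator Q x / sqrt (measure lebesgue Q)) *\<^sub>R a Q) = 0"
          by (intro sum.neutral) simp
        then show ?thesis using False by simp
      qed
    qed
    have inner: "(\<integral>\<^sup>+x. ennreal (?F \<epsilon> x powr r) \<partial>lebesgue) \<le> ennreal (c powr r) * ennreal ?V"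
      if \<epsilon>: "\<epsilon> \<in> set_pmf (random_signs D')" for \<epsilon>
    proof -
      have "(\<integral>\<^sup>+x. ennreal (?F \<epsilon> x powr r) \<partial>lebesgue) \<le> (\<integral>\<^sup>+x. ennreal (c powr r) * indicator Q0 x \<partial>lebesgue)"
      proof (rule nn_integral_mono)
        fix x
        have "?F \<epsilon> x powr r \<le> (c * indicator Q0 x) powr r" using F[OF \<epsilon>, of x] r by (intro powr_mono2) auto
        also have "\<dots> = c powr r * indicator Q0 x" using r by (simp add: indicator_def)
        finally have "ennreal (?F \<epsilon> x powr r) \<le> ennreal (c powr r * indicator Q0 x)" by (rule ennreal_leI)
        then show "ennreal (?F \<epsilon> x powr r) \<le> ennreal (c powr r) * indicator Q0 x"
          by (cases "x \<in> Q0") simp_all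
      qed
      also have "\<dots> = ennreal (c powr r) * ennreal ?V"
        by (subst nn_integral_cmult_indicator) (auto simp: kx emeasure_cube_at)
      finally show ?thesis .
    qed
    have "(\<integral>\<^sup>+\<epsilon>. (\<integral>\<^sup>+x. ennreal (?F \<epsilon> x powr r) \<partial>lebesgue) \<partial>measure_pmf (random_signs D')) \<le>
        (\<integral>\<^sup>+\<epsilon>. ennreal (c powr r) * ennreal ?V \<partial>measure_pmf (random_signs D'))"
      by (intro nn_integral_mono_AE AE_pmfI inner)
    also have "\<dots> = ennreal (c powr r) * ennreal ?V" by simp
    finally have "(\<integral>\<^sup>+\<epsilon>. (\<integral>\<^sup>+x. ennreal (?F \<epsilon> x powr r) \<partial>lebesgue) \<partial>measure_pmf (random_signs D')) / emeasure lebesgue Q0 \<le> ennreal (c powr r)"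
      unfolding kx emeasure_cube_at by (intro divide_le_posI_ennreal) (auto simp: mult.commute)
    then obtain t where t: "(\<integral>\<^sup>+\<epsilon>. (\<integral>\<^sup>+x. ennreal (?F \<epsilon> x powr r) \<partial>lebesgue) \<partial>measure_pmf (random_signs D')) / emeasure lebesgue Q0 = ennreal t"
      "0 \<le> t" "t \<le> c powr r"
      by (cases "(\<integral>\<^sup>+\<epsilon>. (\<integral>\<^sup>+x. ennreal (?F \<epsilon> x powr r) \<partial>lebesgue) \<partial>measure_pmf (random_signs D')) / emeasure lebesgue Q0")
        (auto simp: top_unique)
    have "t powr (1 / r) \<le> (c powr r) powr (1 / r)" using t r by (intro powr_mono2) auto
    also have "\<dots> = c" using r c0 by (simp add: powr_powr)
    finally show "ennreal_pow ((\<integral>\<^sup>+\<epsilon>. (\<integral>\<^sup>+x. ennreal (?F \<epsilon> x powr r) \<partial>lebesgue) \<partial>measure_pmf (random_signs D')) / emeasure lebesgue Q0) (1 / r) \<le> ennreal c"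
      unfolding t(1) using t(2) by (simp add: ennreal_pow_def ennreal_leI)
  qed
  then show ?thesis by (rule order_le_less_trans) simp
qed

text \<open>On coarse scales the cubes that meet a bounded set are decreasing in number, so from some scale on
  passing to parents does not merge any two of them.\<close>

lemma coarse_level:
  assumes K: "compact K"
  obtains k0 where "\<And>k x y. k \<le> k0 \<Longrightarrow> x \<in> K \<Longrightarrow> y \<in> K \<Longrightarrow> y \<in> cube_at \<omega> k x \<Longrightarrow> y \<in> cube_at \<omega> k0 x"
proof -
  define C where "C j = cube_at \<omega> (- int j) ` K" for j
  have fin0: "finite (C 0)"
  proof -
    obtain b where b: "\<And>x. x \<in> K \<Longrightarrow> norm x \<le> b" using compact_imp_bounded[OF K] unfolding bounded_iff by blast
    let ?u = "(\<chi> i. b + 1) :: real^'d"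
    have "\<Union>(C 0) \<subseteq> cbox (- ?u) ?u"
    proof
      fix y assume "y \<in> \<Union>(C 0)"
      then obtain x where x: "x \<in> K" "y \<in> cube_at \<omega> 0 x" by (auto simp: C_def)
      have y: "\<bar>y $ i\<bar> \<le> b + 1" for i
      proof -
        have "x \<in> cube_at \<omega> 0 x" by simp
        then have "\<bar>y $ i - x $ i\<bar> \<le> 1" using x(2) unfolding cube_at_eq_box mem_Collect_eq
          by (smt (verit, best) power_int_0_right minus_zero)
        moreover have "\<bar>x $ i\<bar> \<le> b" using b[OF x(1)] component_le_norm_cart[of x i] by linarith
        ultimately show ?thesis by linarith
      qed
      have "- (b + 1) \<le> y $ i \<and> y $ i \<le> b + 1" for i using y[of i] by linarith
      then show "y \<in> cbox (- ?u) ?u" by (simp add: mem_box_cart)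
    qed
    then show ?thesis
      by (rule finite_disjoint_cubes[rotated, where l = 0]) (auto simp: C_def emeasure_lborel_cbox_finite[simplified])
  qed
  \<comment> \<open>The cubes that meet K on the coarser scale are the ancestors of those on the
    finer one, so their number does not grow.\<close>
  have im: "C (i + j) = anc (- int (i + j)) ` C i" for i j
  proof -
    have "cube_at \<omega> (- int (i + j)) x = anc (- int (i + j)) (cube_at \<omega> (- int i) x)" for x
      by (rule anc_eq[symmetric]) auto
    then show ?thesis unfolding C_def image_image by simp
  qed
  have fin: "finite (C i)" for i using im[of 0 i] fin0 by simp
  \<comment> \<open>On a scale with the least number of cubes, passing to ancestors on a coarser
    scale loses none of them, hence is injective.\<close>
  obtain j0 where j0: "\<And>j. card (C j0) \<le> card (C j)"
  proof -
    have "\<exists>j0. \<forall>j. card (C j0) \<le> card (C j)"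
      using ex_has_least_nat[of "\<lambda>_. True" 0 "\<lambda>j. card (C j)"] by auto
    then show thesis using that by blast
  qed
  show thesis
  proof (rule that[of "- int j0"])
    fix k x y assume k: "k \<le> - int j0" and x: "x \<in> K" "y \<in> K" and yx: "y \<in> cube_at \<omega> k x"
    define i where "i = nat (- int j0 - k)"
    have ki: "k = - int (j0 + i)" using k by (simp add: i_def)
    have "card (anc k ` C j0) = card (C j0)"
    proof (rule antisym)
      show "card (anc k ` C j0) \<le> card (C j0)" by (rule card_image_le[OF fin])
      show "card (C j0) \<le> card (anc k ` C j0)" using j0[of "j0 + i"] im[of j0 i] ki by simp
    qed
    then have inj: "inj_on (anc k) (C j0)" by (rule eq_card_imp_inj_on[OF fin])
    have "anc k (cube_at \<omega> (- int j0) y) = anc k (cube_at \<omega> (- int j0) x)"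
      using anc_eq[OF k, of y y] anc_eq[OF k, of x x] cube_at_eq[OF yx] by simp
    moreover have "cube_at \<omega> (- int j0) x \<in> C j0" "cube_at \<omega> (- int j0) y \<in> C j0"
      using x by (simp_all add: C_def)
    ultimately have "cube_at \<omega> (- int j0) y = cube_at \<omega> (- int j0) x"
      using inj_onD[OF inj] by blast
    then show "y \<in> cube_at \<omega> (- int j0) x" using self_mem_cube_at by blast
  qed
qed

end

section \<open>Sparse domination\<close>

context dyadic_system
begin

text \<open>Hides the parameters of the locale \<open>stopping_region\<close>, so that statements
  about regions can be summed over R.\<close>

definition region_ok :: "'i set \<Rightarrow> ('i \<Rightarrow> real^'d \<Rightarrow> real) \<Rightarrow> real \<Rightarrow> (real^'d) set \<Rightarrow> (real^'d) set set \<Rightarrow> bool" where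
  "region_ok I \<phi> A R G \<longleftrightarrow> (\<exists>k x N. R = cube_at \<omega> k x \<and> stopping_region \<omega> k x N G \<and>
    (\<forall>i\<in>I. stopping_region.growth_le \<omega> k x G (\<phi> i) A))"

text \<open>P assigns a stopping parent to each cube; what matters of it is the growth control along
  the chain from Q to \<open>P Q\<close>. The fibres of P are the regions.\<close>

lemma parent_decomposition:
  assumes par: "\<And>k x. k0 \<le> k \<Longrightarrow> \<exists>R\<in>S. cube_at \<omega> k x \<subseteq> R \<and>
      (\<forall>Q\<in>dyadic_grid \<omega>. cube_at \<omega> k x \<subseteq> Q \<and> Q \<subseteq> R \<longrightarrow> (\<forall>i\<in>I. ave (\<phi> i) Q \<le> A * ave (\<phi> i) R))"
    and S: "S \<subseteq> dyadic_grid \<omega>"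
    and Z: "finite Z" "Z \<subseteq> dyadic_grid \<omega>" "levels_ge k0 Z"
  obtains P where "\<And>Q. Q \<in> Z \<Longrightarrow> P Q \<in> S" "\<And>R. R \<in> P ` Z \<Longrightarrow> region_ok I \<phi> A R {Q\<in>Z. P Q = R}"
proof -
  have "\<forall>Q\<in>Z. \<exists>R. R \<in> S \<and> Q \<subseteq> R \<and>
      (\<forall>Q'\<in>dyadic_grid \<omega>. Q \<subseteq> Q' \<and> Q' \<subseteq> R \<longrightarrow> (\<forall>i\<in>I. ave (\<phi> i) Q' \<le> A * ave (\<phi> i) R))"
  proof
    fix Q assume Q: "Q \<in> Z"
    then have "Q \<in> dyadic_grid \<omega>" using Z by blast
    then obtain k x where kx: "Q = cube_at \<omega> k x" by (rule grid_cases)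
    then have "k0 \<le> k" using Q Z(3) by (auto simp: levels_ge_def)
    from par[OF this, of x] show "\<exists>R. R \<in> S \<and> Q \<subseteq> R \<and>
      (\<forall>Q'\<in>dyadic_grid \<omega>. Q \<subseteq> Q' \<and> Q' \<subseteq> R \<longrightarrow> (\<forall>i\<in>I. ave (\<phi> i) Q' \<le> A * ave (\<phi> i) R))"
      unfolding kx by blast
  qed
  then obtain P where P: "\<forall>Q\<in>Z. P Q \<in> S \<and> Q \<subseteq> P Q \<and>
      (\<forall>Q'\<in>dyadic_grid \<omega>. Q \<subseteq> Q' \<and> Q' \<subseteq> P Q \<longrightarrow> (\<forall>i\<in>I. ave (\<phi> i) Q' \<le> A * ave (\<phi> i) (P Q)))"
    by (rule bchoice[THEN exE])
  \<comment> \<open>A common bound for the levels in the finite set Z, from which each region gets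
    its number of levels.\<close>
  have lev: "\<exists>b. \<forall>Q\<in>Z. \<forall>k x. Q = cube_at \<omega> k x \<longrightarrow> k < b"
  proof -
    have "\<forall>Q\<in>Z. \<exists>k. \<exists>x. Q = cube_at \<omega> k x" using Z(2) by (meson grid_cases subsetD)
    then obtain kk where kk: "\<forall>Q\<in>Z. \<exists>x. Q = cube_at \<omega> (kk Q) x" by (rule bchoice[THEN exE])
    obtain b where b: "\<forall>Q\<in>Z. kk Q < b"
    proof
      show "\<forall>Q\<in>Z. kk Q < Max (insert 0 (kk ` Z)) + 1"
        using Z(1) by (auto intro!: zle_add1_eq_le[THEN iffD2] Max_ge)
    qed
    have "k < b" if Q: "Q \<in> Z" "Q = cube_at \<omega> k x" for Q k x
    proof -
      obtain y where "Q = cube_at \<omega> (kk Q) y" using kk Q(1) by blast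
      then have "kk Q = k" using Q(2) cube_at_level_unique by metis
      then show ?thesis using b Q(1) by blast
    qed
    then show ?thesis by blast
  qed
  then obtain b where b: "\<And>Q k x. Q \<in> Z \<Longrightarrow> Q = cube_at \<omega> k x \<Longrightarrow> k < b" by blast
  show ?thesis
  proof (rule that[of P])
    show "P Q \<in> S" if "Q \<in> Z" for Q using P that by blast
    show "region_ok I \<phi> A R {Q\<in>Z. P Q = R}" if R: "R \<in> P ` Z" for R
    proof -
      have "R \<in> dyadic_grid \<omega>" using R P S by blast
      then obtain k x where kx: "R = cube_at \<omega> k x" by (rule grid_cases)
      let ?G = "{Q\<in>Z. P Q = R}" and ?N = "nat (b - k)"
      have sr: "stopping_region \<omega> k x ?N ?G"
      proof (unfold_locales)
        show "finite ?G" "?G \<subseteq> dyadic_grid \<omega>" using Z by auto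
        show "Q \<subseteq> cube_at \<omega> k x" if "Q \<in> ?G" for Q using that P kx by blast
        show "l < k + int ?N" if "cube_at \<omega> l y \<in> ?G" for l y
          using b[of "cube_at \<omega> l y" l y] that by auto
      qed
      have "stopping_region.growth_le \<omega> k x ?G (\<phi> i) A" if "i \<in> I" for i
        unfolding stopping_region.growth_le_def[OF sr]
      proof (intro ballI impI)
        fix Q Q' assume Q: "Q \<in> ?G" "Q' \<in> dyadic_grid \<omega>" "Q \<subseteq> Q' \<and> Q' \<subseteq> cube_at \<omega> k x"
        have "Q \<in> Z" "P Q = cube_at \<omega> k x" using Q(1) kx by auto
        then show "ave (\<phi> i) Q' \<le> A * ave (\<phi> i) (cube_at \<omega> k x)"
          using P Q(2,3) that by auto
      qed
      then show ?thesis unfolding region_ok_def using kx sr by blast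
    qed
  qed
qed

lemma region_pairing:
  fixes y :: "(real^'d) set \<Rightarrow> 'b::real_normed_vector"
  assumes "region_ok I \<phi> A R G" "i \<in> I" "integrable lebesgue (\<phi> i)" "\<And>x. 0 \<le> \<phi> i x" "1 \<le> A"
  shows "(\<integral>\<^sup>+x. ennreal (\<phi> i x) * ennreal (norm (\<Sum>Q\<in>G. haar (\<theta> Q) Q x *\<^sub>R y Q)) \<partial>lebesgue) \<le>
    ennreal (2 ^ CARD('d) * A * ave (\<phi> i) R) * (\<integral>\<^sup>+x. ennreal (norm (\<Sum>Q\<in>G. haar (\<theta> Q) Q x *\<^sub>R y Q)) \<partial>lebesgue)"
proof -
  obtain k x N where R: "R = cube_at \<omega> k x" and sr: "stopping_region \<omega> k x N G"
    and g: "stopping_region.growth_le \<omega> k x G (\<phi> i) A"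
    using assms(1,2) unfolding region_ok_def by blast
  interpret stopping_region \<omega> k x N G by (rule sr)
  show ?thesis unfolding R by (rule local_pairing[OF assms(3-5) g])
qed

text \<open>The local estimates freed from the locale. L consists of the p-th root of the local
  constant, the BMO bound, and one factor \<open>2 ^ CARD('d) * A\<close> and one average per
  function.\<close>

lemma region_Lp:
  fixes a :: "(real^'d) set \<Rightarrow> ('x::banach, 'y::banach) multop" and f :: "nat \<Rightarrow> real^'d \<Rightarrow> 'x"
  assumes reg: "region_ok I \<phi> A R G" and I: "{1..n} \<subseteq> I"
    and n: "1 \<le> n" and X: "\<And>m. m \<in> {1..n} \<Longrightarrow> subspace (X m)"
    and f: "\<And>m. m \<in> {1..n} \<Longrightarrow> controlled (X m) (f m) (\<phi> m)"
    and A: "1 \<le> A"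
    and T: "\<And>k. k \<in> {1..<n} \<Longrightarrow> UMD_bound (T k) p (\<beta> k)"
    and Y: "UMD_bound (UNIV :: 'y set) p (\<beta> 0)"
    and cond: "UMD_subspace_condition (dyadic_grid \<omega>) n X T a"
    and \<theta>: "\<And>Q. Q \<in> dyadic_grid \<omega> \<Longrightarrow> cancellative (\<theta> Q)"
    and r: "0 < r" and B: "0 \<le> B" and BMO: "BMO_norm (dyadic_grid \<omega>) r a \<le> ennreal B"
  defines "L \<equiv> local_const n p r \<beta> powr (1 / p) * (B * (2 ^ CARD('d) * A) ^ n * (\<Prod>m=1..n. ave (\<phi> m) R))"
    and "F \<equiv> \<lambda>x. norm (\<Sum>Q\<in>G. haar (\<theta> Q) Q x *\<^sub>R multop_apply (a Q) (map (\<lambda>m. avg (f m) Q) [1..<n+1]))"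
  shows "0 \<le> L"
    and "(\<integral>\<^sup>+x. ennreal (F x powr p) \<partial>lebesgue) \<le> ennreal (L powr p * measure lebesgue R)"
    and "\<And>t. 0 < t \<Longrightarrow> t \<le> p \<Longrightarrow> (\<integral>\<^sup>+x. ennreal (F x powr t) \<partial>lebesgue) \<le> ennreal (2 * L powr t * measure lebesgue R)"
    and "\<And>x. x \<notin> R \<Longrightarrow> F x = 0"
proof -
  obtain k x0 N where R: "R = cube_at \<omega> k x0" and sr: "stopping_region \<omega> k x0 N G"
    and g: "\<And>i. i \<in> I \<Longrightarrow> stopping_region.growth_le \<omega> k x0 G (\<phi> i) A"
    using reg unfolding region_ok_def by blast
  interpret stopping_region \<omega> k x0 N G by (rule sr)
  have p: "1 < p" using Y by (simp add: UMD_bound_def)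
  have ave0: "0 \<le> ave (\<phi> m) R" if "m \<in> {1..n}" for m
    using f[OF that] by (intro ave_nonneg) (auto simp: controlled_def)
  have pr: "(\<Prod>m=1..n. 2 ^ CARD('d) * A * ave (\<phi> m) (cube_at \<omega> k x0)) = (2 ^ CARD('d) * A) ^ n * (\<Prod>m=1..n. ave (\<phi> m) R)"
    unfolding R prod.distrib by (simp add: power_mult_distrib)
  have P0: "0 \<le> B * (2 ^ CARD('d) * A) ^ n * (\<Prod>m=1..n. ave (\<phi> m) R)"
    using B A by (intro mult_nonneg_nonneg prod_nonneg ave0) auto
  show L0: "0 \<le> L" unfolding L_def by (intro mult_nonneg_nonneg P0) auto
  have Lp: "L powr p = local_const n p r \<beta> * (B * ((2 ^ CARD('d) * A) ^ n * (\<Prod>m=1..n. ave (\<phi> m) R))) powr p"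
    using p P0 local_const_nonneg[of n p r \<beta>] unfolding L_def by (simp add: powr_mult powr_powr mult.assoc)
  have main: "(\<integral>\<^sup>+x. ennreal (F x powr p) \<partial>lebesgue) \<le> ennreal (L powr p * cube_vol TYPE('d) k)"
  proof -
    have gm: "growth_le (\<phi> m) A" if "m \<in> {1..n}" for m using g I that by blast
    show ?thesis
      using local_Lp[OF n X f A gm T Y cond \<theta> r B BMO] unfolding F_def Lp pr .
  qed
  then show "(\<integral>\<^sup>+x. ennreal (F x powr p) \<partial>lebesgue) \<le> ennreal (L powr p * measure lebesgue R)"
    by (simp add: R measure_cube_at)
  show "(\<integral>\<^sup>+x. ennreal (F x powr t) \<partial>lebesgue) \<le> ennreal (2 * L powr t * measure lebesgue R)" if t: "0 < t" "t \<le> p" for t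
    unfolding R measure_cube_at F_def by (rule Lq_of_Lp[OF main[unfolded F_def] L0 t])
  show "F x = 0" if "x \<notin> R" for x
  proof -
    have "x \<notin> cube_at \<omega> k x0" using that R by simp
    show ?thesis unfolding F_def haar_sum_outside[OF \<open>x \<notin> cube_at \<omega> k x0\<close>] by (rule norm_zero)
  qed
qed

section \<open>The sparse form and the cubes above the top level\<close>

lemma norm_coeff_le:
  fixes a :: "(real^'d) set \<Rightarrow> ('x::banach, 'y::banach) multop" and f :: "nat \<Rightarrow> real^'d \<Rightarrow> 'x"
  assumes f: "\<And>m. m \<in> {1..n} \<Longrightarrow> controlled (X m) (f m) (\<phi> m)" and Q: "Q \<in> sets lebesgue"
  shows "norm (multop_apply (a Q) (map (\<lambda>m. avg (f m) Q) [1..<n+1])) \<le> norm (a Q) * (\<Prod>m=1..n. ave (\<phi> m) Q)"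
proof -
  have "norm (multop_apply (a Q) (map (\<lambda>m. avg (f m) Q) [1..<n+1])) \<le>
      norm (a Q) * prod_list (map norm (map (\<lambda>m. avg (f m) Q) [1..<n+1]))"
    by (rule norm_multop_apply)
  also have "prod_list (map norm (map (\<lambda>m. avg (f m) Q) [1..<n+1])) = (\<Prod>m\<in>set [1..<n+1]. norm (avg (f m) Q))"
    by (subst prod.distinct_set_conv_list) (simp_all add: comp_def del: upt_Suc)
  also have "set [1..<n+1] = {1..n}" by auto
  also have "norm (a Q) * (\<Prod>m=1..n. norm (avg (f m) Q)) \<le> norm (a Q) * (\<Prod>m=1..n. ave (\<phi> m) Q)"
    by (intro mult_left_mono prod_mono conjI norm_ge_zero norm_avg_le_ave[OF f Q])
  finally show ?thesis .
qed

text \<open>A summand of the sparse form; index 0 belongs to the dual function.\<close>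

definition form_term :: "nat \<Rightarrow> (nat \<Rightarrow> real^'d \<Rightarrow> real) \<Rightarrow> (real^'d) set \<Rightarrow> real" where
  "form_term n \<phi> Q = measure lebesgue Q * (\<Prod>m=1..n. ave (\<phi> m) Q) * ave (\<phi> 0) Q"

lemma form_term_nonneg: "(\<And>i x. i \<le> n \<Longrightarrow> 0 \<le> \<phi> i x) \<Longrightarrow> 0 \<le> form_term n \<phi> Q"
  unfolding form_term_def by (intro mult_nonneg_nonneg prod_nonneg ave_nonneg) auto

text \<open>A cube above the top level \<open>k + j\<close> has no more mass than the top cube inside it, so that its term
  decays geometrically in \<open>j\<close>.\<close>

lemma form_term_coarse:
  assumes n: "1 \<le> n" and \<phi>: "\<And>i x. i \<le> n \<Longrightarrow> 0 \<le> \<phi> i x"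
    and m: "\<And>i. i \<le> n \<Longrightarrow> mass (\<phi> i) (cube_at \<omega> k x) = mass (\<phi> i) (cube_at \<omega> (k + int j) x)"
  shows "form_term n \<phi> (cube_at \<omega> k x) \<le> (1/2) ^ j * form_term n \<phi> (cube_at \<omega> (k + int j) x)"
proof -
  let ?Q = "cube_at \<omega> k x" and ?T = "cube_at \<omega> (k + int j) x" and ?v = "cube_vol TYPE('d) (k + int j)"
  define \<rho> :: real where "\<rho> = (1/2) ^ (CARD('d) * j)"
  have \<rho>: "0 \<le> \<rho>" "\<rho> \<le> 1" "\<rho> \<le> (1/2) ^ j"
    by (auto simp: \<rho>_def power_le_one intro!: power_decreasing)
  have V: "cube_vol TYPE('d) k * \<rho> = ?v"
    using cube_vol_add[where 'd='d, of k j] by (simp add: \<rho>_def power_one_over)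
  have av: "ave (\<phi> i) ?Q = \<rho> * ave (\<phi> i) ?T" if "i \<le> n" for i
  proof -
    have "\<rho> \<noteq> 0" by (simp add: \<rho>_def)
    then show ?thesis unfolding ave_def m[OF that] measure_cube_at V[symmetric] by simp
  qed
  have "(\<Prod>m=1..n. ave (\<phi> m) ?Q) = (\<Prod>m=1..n. \<rho> * ave (\<phi> m) ?T)"
    by (intro prod.cong refl av) auto
  also have "\<dots> = \<rho> ^ n * (\<Prod>m=1..n. ave (\<phi> m) ?T)" by (simp add: prod.distrib)
  finally have "form_term n \<phi> ?Q = (cube_vol TYPE('d) k * \<rho>) * (\<rho> ^ n * (\<Prod>m=1..n. ave (\<phi> m) ?T)) * ave (\<phi> 0) ?T"
    unfolding form_term_def measure_cube_at using av[of 0] by simp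
  also have "\<dots> = \<rho> ^ n * form_term n \<phi> ?T"
    unfolding V by (simp add: form_term_def measure_cube_at)
  also have "\<dots> \<le> (1/2) ^ j * form_term n \<phi> ?T"
  proof (rule mult_right_mono)
    have "\<rho> ^ n \<le> \<rho> ^ 1" using n \<rho> by (intro power_decreasing) auto
    then show "\<rho> ^ n \<le> (1/2) ^ j" using \<rho>(3) by simp
  qed (rule form_term_nonneg[OF \<phi>])
  finally show ?thesis .
qed

lemma sum_half_powers_le:
  assumes "finite (J :: nat set)" shows "(\<Sum>j\<in>J. (1/2 :: real) ^ j) \<le> 2"
proof -
  have "(\<Sum>j\<in>J. (1/2 :: real) ^ j) \<le> (\<Sum>j. (1/2) ^ j)"
    by (rule sum_le_suminf) (use assms in \<open>auto intro: summable_geometric\<close>)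
  also have "\<dots> = 2" by (simp add: suminf_geometric)
  finally show ?thesis .
qed

text \<open>Charge each coarse cube that meets K to the cube of level \<open>k0\<close> around a
  point of K in it. By \<open>k0\<close> both contain the same part of K, so the masses agree and
  the term decays with the difference of levels. Cubes charged to the same top cube have different
  levels, so the series is at most 2.\<close>

lemma sum_coarse_terms:
  assumes n: "1 \<le> n" and \<phi>: "\<And>i. i \<le> n \<Longrightarrow> integrable lebesgue (\<phi> i)" "\<And>i x. i \<le> n \<Longrightarrow> 0 \<le> \<phi> i x"
    and K: "\<And>i x. i \<le> n \<Longrightarrow> x \<notin> K \<Longrightarrow> \<phi> i x = 0"
    and k0: "\<And>k x y. k \<le> k0 \<Longrightarrow> x \<in> K \<Longrightarrow> y \<in> K \<Longrightarrow> y \<in> cube_at \<omega> k x \<Longrightarrow> y \<in> cube_at \<omega> k0 x"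
    and Z: "finite Z" "\<And>Q. Q \<in> Z \<Longrightarrow> \<exists>k x. Q = cube_at \<omega> k x \<and> k \<le> k0"
  obtains TT where "finite TT" "TT \<subseteq> range (cube_at \<omega> k0)" "(\<Sum>Q\<in>Z. form_term n \<phi> Q) \<le> 2 * (\<Sum>T\<in>TT. form_term n \<phi> T)"
proof -
  let ?Z = "{Q\<in>Z. Q \<inter> K \<noteq> {}}"
  \<comment> \<open>The pair c consists of the number of levels above the top and a point of Q in
    K.\<close>
  have "\<forall>Q\<in>?Z. \<exists>c. Q = cube_at \<omega> (k0 - int (fst c)) (snd c) \<and> snd c \<in> K"
  proof
    fix Q assume Q: "Q \<in> ?Z"
    obtain k x where kx: "Q = cube_at \<omega> k x" "k \<le> k0" using Z(2) Q by blast
    obtain y where y: "y \<in> Q" "y \<in> K" using Q by blast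
    have "Q = cube_at \<omega> k y" using kx(1) y(1) cube_at_eq[of y \<omega> k x] by simp
    then have "Q = cube_at \<omega> (k0 - int (nat (k0 - k))) y" using kx(2) by simp
    then show "\<exists>c. Q = cube_at \<omega> (k0 - int (fst c)) (snd c) \<and> snd c \<in> K"
      using y(2) by (intro exI[of _ "(nat (k0 - k), y)"]) simp
  qed
  then obtain c where c: "\<forall>Q\<in>?Z. Q = cube_at \<omega> (k0 - int (fst (c Q))) (snd (c Q)) \<and> snd (c Q) \<in> K"
    by (rule bchoice[THEN exE])
  define t where "t Q = cube_at \<omega> k0 (snd (c Q))" for Q
  have le: "form_term n \<phi> Q \<le> (1/2) ^ fst (c Q) * form_term n \<phi> (t Q)" if Q: "Q \<in> ?Z" for Q
  proof -
    let ?k = "k0 - int (fst (c Q))" and ?x = "snd (c Q)"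
    have Qc: "Q = cube_at \<omega> ?k ?x" "?x \<in> K" using c Q by blast+
    have tQ: "t Q = cube_at \<omega> (?k + int (fst (c Q))) ?x" by (simp add: t_def)
    have "mass (\<phi> i) (cube_at \<omega> ?k ?x) = mass (\<phi> i) (cube_at \<omega> (?k + int (fst (c Q))) ?x)" if i: "i \<le> n" for i
      unfolding mass_def set_lebesgue_integral_def
    proof (intro Bochner_Integration.integral_cong refl)
      fix y :: "real^'d"
      show "indicator (cube_at \<omega> ?k ?x) y *\<^sub>R \<phi> i y = indicator (cube_at \<omega> (?k + int (fst (c Q))) ?x) y *\<^sub>R \<phi> i y"
      proof (cases "y \<in> K")
        case True
        have "y \<in> cube_at \<omega> k0 ?x" if "y \<in> cube_at \<omega> ?k ?x"
          using k0[of ?k ?x y] Qc(2) True that by simp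
        moreover have "cube_at \<omega> k0 ?x \<subseteq> cube_at \<omega> ?k ?x" by (rule cube_at_mono[OF shifts]) simp
        ultimately show ?thesis by (auto simp: indicator_def)
      next
        case False
        then show ?thesis using K[OF i False] by simp
      qed
    qed
    from form_term_coarse[OF n \<phi>(2) this] show ?thesis using Qc(1) tQ by simp
  qed
  have zero: "form_term n \<phi> Q = 0" if "Q \<in> Z - ?Z" for Q
  proof -
    have "(\<lambda>x. indicator Q x *\<^sub>R \<phi> 0 x) = (\<lambda>x. 0)"
      using that K[of 0] by (auto simp: indicator_def fun_eq_iff)
    then have "mass (\<phi> 0) Q = 0" by (simp add: mass_def set_lebesgue_integral_def)
    then show ?thesis by (simp add: form_term_def ave_def)
  qed
  have T0: "0 \<le> form_term n \<phi> Q" for Q by (rule form_term_nonneg[OF \<phi>(2)])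
  have inj: "inj_on (\<lambda>Q. fst (c Q)) {Q\<in>?Z. t Q = T}" for T
  proof (rule inj_onI)
    fix Q Q' assume Q: "Q \<in> {Q\<in>?Z. t Q = T}" "Q' \<in> {Q\<in>?Z. t Q = T}" "fst (c Q) = fst (c Q')"
    then have "cube_index \<omega> k0 (snd (c Q)) = cube_index \<omega> k0 (snd (c Q'))"
      by (auto simp: t_def cube_at_eq_iff)
    then have "cube_index \<omega> (k0 - int (fst (c Q))) (snd (c Q)) = cube_index \<omega> (k0 - int (fst (c Q))) (snd (c Q'))"
      by (rule cube_index_coarser[OF shifts]) simp
    then have "cube_at \<omega> (k0 - int (fst (c Q))) (snd (c Q)) = cube_at \<omega> (k0 - int (fst (c Q'))) (snd (c Q'))"
      using Q(3) by (simp add: cube_at_eq_iff)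
    moreover have "Q = cube_at \<omega> (k0 - int (fst (c Q))) (snd (c Q))" "Q' = cube_at \<omega> (k0 - int (fst (c Q'))) (snd (c Q'))"
      using c Q(1,2) by blast+
    ultimately show "Q = Q'" by simp
  qed
  have "(\<Sum>Q\<in>Z. form_term n \<phi> Q) = (\<Sum>Q\<in>?Z. form_term n \<phi> Q)"
    using Z(1) zero by (intro sum.mono_neutral_right) auto
  also have "\<dots> \<le> (\<Sum>Q\<in>?Z. (1/2) ^ fst (c Q) * form_term n \<phi> (t Q))"
    by (intro sum_mono le)
  also have "\<dots> = (\<Sum>T\<in>t ` ?Z. \<Sum>Q\<in>{Q\<in>?Z. t Q = T}. (1/2) ^ fst (c Q) * form_term n \<phi> (t Q))"
    by (rule sum.image_gen) (use Z(1) in simp)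
  also have "\<dots> \<le> (\<Sum>T\<in>t ` ?Z. 2 * form_term n \<phi> T)"
  proof (rule sum_mono)
    fix T
    have "(\<Sum>Q\<in>{Q\<in>?Z. t Q = T}. (1/2) ^ fst (c Q) * form_term n \<phi> (t Q)) = (\<Sum>Q\<in>{Q\<in>?Z. t Q = T}. (1/2) ^ fst (c Q)) * form_term n \<phi> T"
      unfolding sum_distrib_right by (intro sum.cong) auto
    also have "(\<Sum>Q\<in>{Q\<in>?Z. t Q = T}. (1/2 :: real) ^ fst (c Q)) = (\<Sum>j\<in>(\<lambda>Q. fst (c Q)) ` {Q\<in>?Z. t Q = T}. (1/2) ^ j)"
      by (rule sum.reindex_cong[OF inj, symmetric]) auto
    also have "\<dots> * form_term n \<phi> T \<le> 2 * form_term n \<phi> T"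
      by (intro mult_right_mono sum_half_powers_le T0) (use Z(1) in auto)
    finally show "(\<Sum>Q\<in>{Q\<in>?Z. t Q = T}. (1/2) ^ fst (c Q) * form_term n \<phi> (t Q)) \<le> 2 * form_term n \<phi> T" .
  qed
  finally have "(\<Sum>Q\<in>Z. form_term n \<phi> Q) \<le> 2 * (\<Sum>T\<in>t ` ?Z. form_term n \<phi> T)"
    by (simp add: sum_distrib_left)
  moreover have "t ` ?Z \<subseteq> range (cube_at \<omega> k0)" by (auto simp: t_def)
  ultimately show ?thesis using that[of "t ` ?Z"] Z(1) by simp
qed

text \<open>A single cube is estimated by size alone: the coefficient is bounded by
  \<open>bmo_jump\<close> and cancels the height of the Haar function.\<close>

lemma coarse_pairing:
  fixes a :: "(real^'d) set \<Rightarrow> ('x::banach, 'y::banach) multop" and f :: "nat \<Rightarrow> real^'d \<Rightarrow> 'x"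
  assumes f: "\<And>m. m \<in> {1..n} \<Longrightarrow> controlled (X m) (f m) (\<phi> m)"
    and \<phi>0: "integrable lebesgue (\<phi> 0)" "\<And>x. 0 \<le> \<phi> 0 x" and Q: "Q \<in> dyadic_grid \<omega>"
    and r: "0 < r" and B: "0 \<le> B" and BMO: "BMO_norm (dyadic_grid \<omega>) r a \<le> ennreal B"
  shows "(\<integral>\<^sup>+x. ennreal (\<phi> 0 x) * ennreal (norm (haar \<theta> Q x *\<^sub>R multop_apply (a Q) (map (\<lambda>m. avg (f m) Q) [1..<n+1]))) \<partial>lebesgue)
    \<le> ennreal (B * form_term n \<phi> Q)"
proof -
  obtain k x0 where kx: "Q = cube_at \<omega> k x0" using Q by (rule grid_cases)
  let ?y = "multop_apply (a Q) (map (\<lambda>m. avg (f m) Q) [1..<n+1])" and ?s = "sqrt (cube_vol TYPE('d) k)"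
  let ?P = "\<Prod>m=1..n. ave (\<phi> m) Q"
  have P0: "0 \<le> ?P"
    by (intro prod_nonneg ballI ave_nonneg) (use f in \<open>auto simp: controlled_def\<close>)
  have s: "0 < ?s" by simp
  have "norm (a Q) \<le> B * ?s"
    using bmo_jump[OF BMO r B, of k x0] s unfolding kx by (simp add: pos_divide_le_eq)
  then have "norm (a Q) * ?P \<le> B * ?s * ?P" using P0 by (intro mult_right_mono)
  then have y: "norm ?y \<le> B * ?s * ?P"
    using norm_coeff_le[OF f grid_lebesgue[OF Q], where a = a] by (rule order_trans[rotated])
  have pw: "norm (haar \<theta> Q x *\<^sub>R ?y) \<le> (B * ?P) * indicator Q x" for x
  proof -
    have "norm (haar \<theta> Q x *\<^sub>R ?y) = indicator Q x / ?s * norm ?y" by (simp add: kx abs_haar)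
    also have "\<dots> \<le> indicator Q x / ?s * (B * ?s * ?P)" using y s by (intro mult_left_mono) auto
    also have "\<dots> = (B * ?P) * indicator Q x" using s by simp
    finally show ?thesis .
  qed
  have "(\<integral>\<^sup>+x. ennreal (\<phi> 0 x) * ennreal (norm (haar \<theta> Q x *\<^sub>R ?y)) \<partial>lebesgue) \<le>
      (\<integral>\<^sup>+x. ennreal (B * ?P) * (ennreal (\<phi> 0 x) * indicator Q x) \<partial>lebesgue)"
  proof (rule nn_integral_mono)
    fix x
    have "ennreal (norm (haar \<theta> Q x *\<^sub>R ?y)) \<le> ennreal ((B * ?P) * indicator Q x)" by (rule ennreal_leI[OF pw])
    also have "\<dots> = ennreal (B * ?P) * indicator Q x" by (cases "x \<in> Q") simp_all
    finally have "ennreal (\<phi> 0 x) * ennreal (norm (haar \<theta> Q x *\<^sub>R ?y)) \<le> ennreal (\<phi> 0 x) * (ennreal (B * ?P) * indicator Q x)"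
      by (rule mult_left_mono) simp
    then show "ennreal (\<phi> 0 x) * ennreal (norm (haar \<theta> Q x *\<^sub>R ?y)) \<le> ennreal (B * ?P) * (ennreal (\<phi> 0 x) * indicator Q x)"
      by (simp only: mult.left_commute)
  qed
  also have "\<dots> = ennreal (B * ?P) * (\<integral>\<^sup>+x. ennreal (\<phi> 0 x) * indicator Q x \<partial>lebesgue)"
    by (rule nn_integral_cmult) (use \<phi>0 grid_lebesgue[OF Q] in \<open>intro borel_measurable_times_ennreal borel_measurable_indicator; auto\<close>)
  also have "\<dots> = ennreal (B * ?P) * ennreal (mass (\<phi> 0) Q)" by (simp only: nn_mass[OF \<phi>0 grid_lebesgue[OF Q]])
  also have "\<dots> = ennreal (B * ?P * mass (\<phi> 0) Q)"
    using mass_nonneg[of "\<phi> 0" Q, OF \<phi>0(2)] by (simp add: ennreal_mult'')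
  also have "B * ?P * mass (\<phi> 0) Q = B * form_term n \<phi> Q"
    unfolding form_term_def kx mass_eq measure_cube_at by simp
  finally show ?thesis .
qed

end

lemma sum_le_infsum_ennreal:
  fixes f :: "'i \<Rightarrow> ennreal"
  assumes "finite F" "F \<subseteq> S"
  shows "sum f F \<le> infsum f S"
  unfolding nonneg_infsum_complete[OF zero_le] by (rule SUP_upper) (use assms in auto)

context dyadic_system
begin

text \<open>The pairing is estimated with the norms inside. In the constant, the first 2 and the
  root of \<open>local_const\<close> stem from the local L^1 bound, the power n + 1 from the n
  averages and the dual function, and the last 2 from the coarse cubes.\<close>

lemma sparse_domination:
  fixes a :: "(real^'d) set \<Rightarrow> ('x::banach, 'y::banach) multop" and f :: "nat \<Rightarrow> real^'d \<Rightarrow> 'x"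
  assumes n: "1 \<le> n" and X: "\<And>m. m \<in> {1..n} \<Longrightarrow> subspace (X m)"
    and f: "\<And>m. m \<in> {1..n} \<Longrightarrow> controlled (X m) (f m) (\<phi> m)"
    and \<phi>0: "integrable lebesgue (\<phi> 0)" "\<And>x. 0 \<le> \<phi> 0 x"
    and K: "\<And>i x. i \<le> n \<Longrightarrow> x \<notin> K \<Longrightarrow> \<phi> i x = 0"
    and k0: "\<And>k x y. k \<le> k0 \<Longrightarrow> x \<in> K \<Longrightarrow> y \<in> K \<Longrightarrow> y \<in> cube_at \<omega> k x \<Longrightarrow> y \<in> cube_at \<omega> k0 x"
    and A: "1 \<le> A"
    and S: "S \<subseteq> dyadic_grid \<omega>" "\<And>x. cube_at \<omega> k0 x \<in> S"
    and par: "\<And>k x. k0 \<le> k \<Longrightarrow> \<exists>R\<in>S. cube_at \<omega> k x \<subseteq> R \<and>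
      (\<forall>Q\<in>dyadic_grid \<omega>. cube_at \<omega> k x \<subseteq> Q \<and> Q \<subseteq> R \<longrightarrow> (\<forall>i\<in>{0..n}. ave (\<phi> i) Q \<le> A * ave (\<phi> i) R))"
    and T: "\<And>k. k \<in> {1..<n} \<Longrightarrow> UMD_bound (T k) 2 (\<beta> k)"
    and Y: "UMD_bound (UNIV :: 'y set) 2 (\<beta> 0)"
    and cond: "UMD_subspace_condition (dyadic_grid \<omega>) n X T a"
    and fin: "finite {Q\<in>dyadic_grid \<omega>. a Q \<noteq> 0}"
    and \<theta>: "\<And>Q. Q \<in> dyadic_grid \<omega> \<Longrightarrow> cancellative (\<theta> Q)"
    and r: "0 < r" and B: "0 \<le> B" and BMO: "BMO_norm (dyadic_grid \<omega>) r a \<le> ennreal B"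
  shows "(\<integral>\<^sup>+x. ennreal (\<phi> 0 x) * ennreal (norm (paraproduct (dyadic_grid \<omega>) \<theta> n a f x)) \<partial>lebesgue) \<le>
    ennreal ((2 * (2 ^ CARD('d) * A) ^ (n + 1) * local_const n 2 r \<beta> powr (1 / 2) + 2) * B) * (\<Sum>\<^sub>\<infinity>Q\<in>S. ennreal (form_term n \<phi> Q))"
proof -
  let ?c = "2 * (2 ^ CARD('d) * A) ^ (n + 1) * local_const n 2 r \<beta> powr (1 / 2)"
  let ?S = "\<Sum>\<^sub>\<infinity>Q\<in>S. ennreal (form_term n \<phi> Q)"
  let ?Z = "{Q\<in>dyadic_grid \<omega>. a Q \<noteq> 0}"
  let ?y = "\<lambda>Q. multop_apply (a Q) (map (\<lambda>m. avg (f m) Q) [1..<n+1])"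
  \<comment> \<open>Z1 contains the cubes at or below the top level, which have stopping parents; Z2
    contains the larger ones.\<close>
  define Z1 where "Z1 = {Q\<in>?Z. \<forall>k x. Q = cube_at \<omega> k x \<longrightarrow> k0 \<le> k}"
  define Z2 where "Z2 = ?Z - Z1"
  have \<phi>: "integrable lebesgue (\<phi> i)" "\<And>x. 0 \<le> \<phi> i x" if "i \<le> n" for i
    using that \<phi>0 f[of i] by (cases "i = 0"; simp add: controlled_def)+
  have Z1: "finite Z1" "Z1 \<subseteq> dyadic_grid \<omega>" "levels_ge k0 Z1"
    by (rule finite_subset[OF _ fin]) (auto simp: Z1_def levels_ge_def)
  have Z2: "finite Z2" "Z2 \<subseteq> dyadic_grid \<omega>" using fin by (auto simp: Z2_def)
  have Z2': "\<exists>k x. Q = cube_at \<omega> k x \<and> k \<le> k0" if "Q \<in> Z2" for Q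
  proof -
    have "\<exists>k x. Q = cube_at \<omega> k x \<and> \<not> k0 \<le> k" using that unfolding Z1_def Z2_def by blast
    then show ?thesis using linear by blast
  qed
  obtain P where P: "\<And>Q. Q \<in> Z1 \<Longrightarrow> P Q \<in> S" "\<And>R. R \<in> P ` Z1 \<Longrightarrow> region_ok {0..n} \<phi> A R {Q\<in>Z1. P Q = R}"
    by (rule parent_decomposition[OF par S(1) Z1]) blast+
  let ?F = "\<lambda>R x. norm (\<Sum>Q\<in>{Q\<in>Z1. P Q = R}. haar (\<theta> Q) Q x *\<^sub>R ?y Q)"
  let ?H = "\<lambda>Q x. norm (haar (\<theta> Q) Q x *\<^sub>R ?y Q)"
  have pw: "norm (paraproduct (dyadic_grid \<omega>) \<theta> n a f x) \<le> (\<Sum>R\<in>P ` Z1. ?F R x) + (\<Sum>Q\<in>Z2. ?H Q x)" for x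
  proof -
    have Z: "?Z = Z1 \<union> Z2" "Z1 \<inter> Z2 = {}" by (auto simp: Z1_def Z2_def)
    have "paraproduct (dyadic_grid \<omega>) \<theta> n a f x = (\<Sum>Q\<in>Z1. haar (\<theta> Q) Q x *\<^sub>R ?y Q) + (\<Sum>Q\<in>Z2. haar (\<theta> Q) Q x *\<^sub>R ?y Q)"
      unfolding paraproduct_def Z(1) by (rule sum.union_disjoint[OF Z1(1) Z2(1) Z(2)])
    also have "(\<Sum>Q\<in>Z1. haar (\<theta> Q) Q x *\<^sub>R ?y Q) = (\<Sum>R\<in>P ` Z1. \<Sum>Q\<in>{Q\<in>Z1. P Q = R}. haar (\<theta> Q) Q x *\<^sub>R ?y Q)"
      by (rule sum.image_gen[OF Z1(1)])
    finally have e: "paraproduct (dyadic_grid \<omega>) \<theta> n a f x =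
        (\<Sum>R\<in>P ` Z1. \<Sum>Q\<in>{Q\<in>Z1. P Q = R}. haar (\<theta> Q) Q x *\<^sub>R ?y Q) + (\<Sum>Q\<in>Z2. haar (\<theta> Q) Q x *\<^sub>R ?y Q)" .
    show ?thesis unfolding e by (rule order_trans[OF norm_triangle_ineq add_mono[OF norm_sum norm_sum]])
  qed
  have mF: "?F R \<in> borel_measurable lebesgue" for R
    by (rule haar_sum_measurable) (use Z1 in auto)
  have mH: "?H Q \<in> borel_measurable lebesgue" if "Q \<in> Z2" for Q
    using haar_sum_measurable[of "{Q}" \<theta> ?y] that Z2 by auto
  have m0: "(\<lambda>x. ennreal (\<phi> 0 x)) \<in> borel_measurable lebesgue" using \<phi>0 by auto
  have "(\<integral>\<^sup>+x. ennreal (\<phi> 0 x) * ennreal (norm (paraproduct (dyadic_grid \<omega>) \<theta> n a f x)) \<partial>lebesgue) \<le>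
      (\<integral>\<^sup>+x. (\<Sum>R\<in>P ` Z1. ennreal (\<phi> 0 x) * ennreal (?F R x)) + (\<Sum>Q\<in>Z2. ennreal (\<phi> 0 x) * ennreal (?H Q x)) \<partial>lebesgue)"
  proof (rule nn_integral_mono)
    fix x
    have "ennreal (norm (paraproduct (dyadic_grid \<omega>) \<theta> n a f x)) \<le> ennreal ((\<Sum>R\<in>P ` Z1. ?F R x) + (\<Sum>Q\<in>Z2. ?H Q x))"
      by (rule ennreal_leI[OF pw])
    also have "\<dots> = (\<Sum>R\<in>P ` Z1. ennreal (?F R x)) + (\<Sum>Q\<in>Z2. ennreal (?H Q x))"
      by (subst ennreal_plus) (auto intro!: sum_nonneg)
    finally have "ennreal (\<phi> 0 x) * ennreal (norm (paraproduct (dyadic_grid \<omega>) \<theta> n a f x)) \<le>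
        ennreal (\<phi> 0 x) * ((\<Sum>R\<in>P ` Z1. ennreal (?F R x)) + (\<Sum>Q\<in>Z2. ennreal (?H Q x)))"
      by (rule mult_left_mono) simp
    then show "ennreal (\<phi> 0 x) * ennreal (norm (paraproduct (dyadic_grid \<omega>) \<theta> n a f x)) \<le>
        (\<Sum>R\<in>P ` Z1. ennreal (\<phi> 0 x) * ennreal (?F R x)) + (\<Sum>Q\<in>Z2. ennreal (\<phi> 0 x) * ennreal (?H Q x))"
      by (simp only: sum_distrib_left distrib_left)
  qed
  also have "\<dots> = (\<integral>\<^sup>+x. (\<Sum>R\<in>P ` Z1. ennreal (\<phi> 0 x) * ennreal (?F R x)) \<partial>lebesgue) +
      (\<integral>\<^sup>+x. (\<Sum>Q\<in>Z2. ennreal (\<phi> 0 x) * ennreal (?H Q x)) \<partial>lebesgue)"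
    by (rule nn_integral_add; rule borel_measurable_sum; rule borel_measurable_times_ennreal[OF m0]; rule measurable_compose[OF _ measurable_ennreal]; rule mF mH)
  also have "\<dots> = (\<Sum>R\<in>P ` Z1. \<integral>\<^sup>+x. ennreal (\<phi> 0 x) * ennreal (?F R x) \<partial>lebesgue) +
      (\<Sum>Q\<in>Z2. \<integral>\<^sup>+x. ennreal (\<phi> 0 x) * ennreal (?H Q x) \<partial>lebesgue)"
    by (subst (1 2) nn_integral_sum; (rule refl | rule borel_measurable_times_ennreal[OF m0], rule measurable_compose[OF _ measurable_ennreal], rule mF mH))
  also have "\<dots> \<le> (\<Sum>R\<in>P ` Z1. ennreal (?c * B) * ennreal (form_term n \<phi> R)) + (\<Sum>Q\<in>Z2. ennreal (B * form_term n \<phi> Q))"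
  proof (intro add_mono sum_mono)
    fix Q assume "Q \<in> Z2"
    then have "Q \<in> dyadic_grid \<omega>" using Z2 by blast
    show "(\<integral>\<^sup>+x. ennreal (\<phi> 0 x) * ennreal (?H Q x) \<partial>lebesgue) \<le> ennreal (B * form_term n \<phi> Q)"
      by (rule coarse_pairing[where X = X and f = f and \<phi> = \<phi> and r = r and a = a, OF f \<phi>0 \<open>Q \<in> dyadic_grid \<omega>\<close> r B BMO])
  next
    fix R assume R: "R \<in> P ` Z1"
    have ok: "region_ok {0..n} \<phi> A R {Q\<in>Z1. P Q = R}" by (rule P(2)[OF R])
    have I: "{1..n} \<subseteq> {0..n}" by auto
    let ?L = "local_const n 2 r \<beta> powr (1 / 2) * (B * (2 ^ CARD('d) * A) ^ n * (\<Prod>m=1..n. ave (\<phi> m) R))"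
    have a0: "0 \<le> ave (\<phi> 0) R" by (rule ave_nonneg[OF \<phi>0(2)])
    have L0: "0 \<le> ?L" by (rule region_Lp(1)[OF ok I n X f A T Y cond \<theta> r B BMO])
    have FL: "(\<integral>\<^sup>+x. ennreal (?F R x) \<partial>lebesgue) \<le> ennreal (2 * ?L * measure lebesgue R)"
      using region_Lp(3)[OF ok I n X f A T Y cond \<theta> r B BMO, where t = 1] L0 by simp
    have "(\<integral>\<^sup>+x. ennreal (\<phi> 0 x) * ennreal (?F R x) \<partial>lebesgue) \<le>
        ennreal (2 ^ CARD('d) * A * ave (\<phi> 0) R) * (\<integral>\<^sup>+x. ennreal (?F R x) \<partial>lebesgue)"
      by (rule region_pairing[OF ok _ \<phi>0 A]) simp
    also have "\<dots> \<le> ennreal (2 ^ CARD('d) * A * ave (\<phi> 0) R) * ennreal (2 * ?L * measure lebesgue R)"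
      by (rule mult_left_mono[OF FL]) simp
    also have "\<dots> = ennreal (2 ^ CARD('d) * A * ave (\<phi> 0) R * (2 * ?L * measure lebesgue R))"
      by (rule ennreal_mult[symmetric]) (use A a0 L0 in auto)
    also have "2 ^ CARD('d) * A * ave (\<phi> 0) R * (2 * ?L * measure lebesgue R) = ?c * B * form_term n \<phi> R"
      by (simp add: form_term_def mult_ac)
    also have "ennreal (?c * B * form_term n \<phi> R) = ennreal (?c * B) * ennreal (form_term n \<phi> R)"
      by (rule ennreal_mult) (use A B form_term_nonneg[of n \<phi>, OF \<phi>(2)] in auto)
    finally show "(\<integral>\<^sup>+x. ennreal (\<phi> 0 x) * ennreal (?F R x) \<partial>lebesgue) \<le> ennreal (?c * B) * ennreal (form_term n \<phi> R)" .
  qed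
  also have "\<dots> \<le> ennreal (?c * B) * ?S + ennreal (2 * B) * ?S"
  proof (rule add_mono)
    have "P ` Z1 \<subseteq> S" using P(1) by blast
    then show "(\<Sum>R\<in>P ` Z1. ennreal (?c * B) * ennreal (form_term n \<phi> R)) \<le> ennreal (?c * B) * ?S"
      unfolding sum_distrib_left[symmetric] by (intro mult_left_mono sum_le_infsum_ennreal) (use Z1 in auto)
    obtain TT where TT: "finite TT" "TT \<subseteq> range (cube_at \<omega> k0)" "(\<Sum>Q\<in>Z2. form_term n \<phi> Q) \<le> 2 * (\<Sum>T\<in>TT. form_term n \<phi> T)"
      by (rule sum_coarse_terms[OF n \<phi> K k0 Z2(1) Z2'])
    have ft: "0 \<le> form_term n \<phi> Q" for Q using form_term_nonneg[of n \<phi>, OF \<phi>(2)] .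
    have "(\<Sum>Q\<in>Z2. ennreal (B * form_term n \<phi> Q)) = ennreal (B * (\<Sum>Q\<in>Z2. form_term n \<phi> Q))"
      unfolding sum_distrib_left by (rule sum_ennreal) (use B ft in auto)
    also have "\<dots> \<le> ennreal (B * (2 * (\<Sum>T\<in>TT. form_term n \<phi> T)))"
      by (intro ennreal_leI mult_left_mono TT(3) B)
    also have "\<dots> = ennreal ((2 * B) * (\<Sum>T\<in>TT. form_term n \<phi> T))" by (simp only: mult_ac)
    also have "\<dots> = ennreal (2 * B) * ennreal (\<Sum>T\<in>TT. form_term n \<phi> T)"
      by (rule ennreal_mult) (use B ft in \<open>auto intro!: sum_nonneg\<close>)
    also have "ennreal (\<Sum>T\<in>TT. form_term n \<phi> T) = (\<Sum>T\<in>TT. ennreal (form_term n \<phi> T))"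
      by (rule sum_ennreal[symmetric]) (rule ft)
    also have "ennreal (2 * B) * (\<Sum>T\<in>TT. ennreal (form_term n \<phi> T)) \<le> ennreal (2 * B) * ?S"
      by (intro mult_left_mono sum_le_infsum_ennreal) (use TT S(2) in auto)
    finally show "(\<Sum>Q\<in>Z2. ennreal (B * form_term n \<phi> Q)) \<le> ennreal (2 * B) * ?S" .
  qed
  also have "\<dots> = ennreal ((?c + 2) * B) * ?S"
    unfolding distrib_right[symmetric] by (subst ennreal_plus[symmetric]) (use A B in \<open>auto simp: distrib_right\<close>)
  finally show ?thesis .
qed

end

section \<open>Carleson embedding and \<open>L\<^sup>q\<close> bounds\<close>

lemma sum_powr_le_geometric:
  fixes v :: real
  assumes "finite K" "1 < v" "\<And>k. k \<in> K \<Longrightarrow> k \<le> (k1 :: int)"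
  shows "(\<Sum>k\<in>K. v powr real_of_int k) \<le> v powr k1 / (1 - 1 / v)"
proof -
  have inj: "inj_on (\<lambda>k. nat (k1 - k)) K" 
  proof (rule inj_onI)
    fix k l assume "k \<in> K" "l \<in> K" "nat (k1 - k) = nat (k1 - l)"
    then show "k = l" using assms(3)[of k] assms(3)[of l] by linarith
  qed
  have "(\<Sum>k\<in>K. v powr real_of_int k) = (\<Sum>k\<in>K. v powr k1 * (1 / v) ^ nat (k1 - k))"
  proof (rule sum.cong[OF refl])
    fix k assume "k \<in> K"
    then have "k \<le> k1" by (rule assms(3))
    then have e: "real_of_int k = real_of_int k1 + - real (nat (k1 - k))" by simp
    have "v powr k = v powr k1 * v powr (- real (nat (k1 - k)))" by (subst e) (rule powr_add)
    also have "v powr (- real (nat (k1 - k))) = (1 / v) ^ nat (k1 - k)"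
      using assms(2) by (simp add: powr_minus powr_realpow power_one_over inverse_eq_divide)
    finally show "v powr k = v powr k1 * (1 / v) ^ nat (k1 - k)" .
  qed
  also have "\<dots> = v powr k1 * (\<Sum>j\<in>(\<lambda>k. nat (k1 - k)) ` K. (1 / v) ^ j)"
    unfolding sum_distrib_left[symmetric] sum.reindex[OF inj] by simp
  also have "\<dots> \<le> v powr k1 * (\<Sum>j. (1 / v) ^ j)"
    by (intro mult_left_mono sum_le_suminf) (use assms in \<open>auto intro!: summable_geometric\<close>)
  also have "(\<Sum>j. (1 / v) ^ j) = 1 / (1 - 1 / v)"
    by (rule suminf_geometric) (use assms in simp)
  finally show ?thesis by simp
qed

lemma superlevel_lebesgue:
  fixes \<phi> :: "'a::euclidean_space \<Rightarrow> real"
  assumes "integrable lebesgue \<phi>" shows "{x. t < \<phi> x} \<in> sets lebesgue"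
proof -
  have "\<phi> -` {t<..} \<inter> space lebesgue \<in> sets lebesgue"
    by (rule measurable_sets[OF borel_measurable_integrable[OF assms]]) simp
  moreover have "\<phi> -` {t<..} \<inter> space lebesgue = {x. t < \<phi> x}" by auto
  ultimately show ?thesis by simp
qed

text \<open>The numerator is \<open>2 powr (u + 1) * 2 powr (u - 1)\<close>: the weight of a layer
  and the index of the highest layer at a point. The denominator sums a geometric series of ratio
  \<open>2 powr (1 - u)\<close>.\<close>

definition carleson_const :: "real \<Rightarrow> real" where
  "carleson_const u = 2 powr (2 * u) / (1 - 1 / 2 powr (u - 1))"

context dyadic_system
begin

lemma finite_levels_ge:
  assumes "finite F" "F \<subseteq> dyadic_grid \<omega>"
  shows "\<exists>l. levels_ge l F"
proof -
  have "\<forall>Q\<in>F. \<exists>l. \<exists>x. Q = cube_at \<omega> l x" using assms(2) by (meson grid_cases subsetD)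
  then obtain kk where kk: "\<forall>Q\<in>F. \<exists>x. Q = cube_at \<omega> (kk Q) x" by (rule bchoice[THEN exE])
  have "Min (insert 0 (kk ` F)) \<le> l" if "cube_at \<omega> l x \<in> F" for l x
  proof -
    obtain z where "cube_at \<omega> l x = cube_at \<omega> (kk (cube_at \<omega> l x)) z" using kk \<open>cube_at \<omega> l x \<in> F\<close> by blast
    then have "l = kk (cube_at \<omega> l x)" by (rule cube_at_level_unique)
    then have "l \<in> kk ` F" using \<open>cube_at \<omega> l x \<in> F\<close> by blast
    then show ?thesis using assms(1) by (intro Min_le) auto
  qed
  then show ?thesis unfolding levels_ge_def by auto
qed

text \<open>Group the cubes by the dyadic size k of their average. On such a cube the part of \<phi>
  above \<open>2 powr (k - 1)\<close> still has average at least \<open>2 powr (k - 1)\<close>, so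
  the maximal inequality bounds the volume of the layer. Summed over k, the truncated functions form
  a geometric series at each point.\<close>

lemma carleson_embedding:
  assumes RR: "finite RR" "RR \<subseteq> dyadic_grid \<omega>" and E: "disjoint_family_on E RR"
      "\<And>R. R \<in> RR \<Longrightarrow> E R \<in> sets lebesgue" "\<And>R. R \<in> RR \<Longrightarrow> E R \<subseteq> R"
    and \<phi>: "integrable lebesgue \<phi>" "\<And>x. 0 \<le> \<phi> x" and u: "1 < u"
  shows "ennreal (\<Sum>R\<in>RR. measure lebesgue (E R) * ave \<phi> R powr u) \<le>
    ennreal (carleson_const u) * (\<integral>\<^sup>+x. ennreal (\<phi> x powr u) \<partial>lebesgue)"
proof -
  define lv where "lv R = \<lfloor>log 2 (ave \<phi> R)\<rfloor>" for R
  define Rp where "Rp = {R\<in>RR. 0 < ave \<phi> R}"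
  define FF where "FF k = {R\<in>Rp. lv R = k}" for k
  let ?U = "\<lambda>k. \<Union>(FF k)"
  have Rp: "finite Rp" using RR by (simp add: Rp_def)
  have FF: "finite (FF k)" "FF k \<subseteq> RR" "FF k \<subseteq> dyadic_grid \<omega>" for k using RR by (auto simp: FF_def Rp_def)
  have lv: "2 powr real_of_int (lv R) \<le> ave \<phi> R" "ave \<phi> R \<le> 2 powr (real_of_int (lv R) + 1)" if "R \<in> Rp" for R
  proof -
    have p: "0 < ave \<phi> R" using that by (simp add: Rp_def)
    have l: "real_of_int (lv R) \<le> log 2 (ave \<phi> R)" "log 2 (ave \<phi> R) \<le> real_of_int (lv R) + 1"
      unfolding lv_def by linarith+
    show "2 powr real_of_int (lv R) \<le> ave \<phi> R" using l(1) p by (simp add: le_log_iff)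
    show "ave \<phi> R \<le> 2 powr (real_of_int (lv R) + 1)" using l(2) p by (simp add: log_le_iff)
  qed
  have fin_em: "emeasure lebesgue R < \<infinity>" if "R \<in> dyadic_grid \<omega>" for R
    using that by (elim grid_cases) (simp add: emeasure_cube_at)
  have E_em: "emeasure lebesgue (E R) = ennreal (measure lebesgue (E R))" if "R \<in> RR" for R
  proof (rule emeasure_eq_ennreal_measure)
    have "emeasure lebesgue (E R) \<le> emeasure lebesgue R"
      by (rule emeasure_mono[OF E(3)[OF that] grid_lebesgue]) (use that RR in blast)
    then show "emeasure lebesgue (E R) \<noteq> \<top>" using fin_em[of R] that RR(2) by (auto simp: top_unique)
  qed
  have sumE: "ennreal (\<Sum>R\<in>FF k. measure lebesgue (E R)) \<le> emeasure lebesgue (?U k)" for k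
  proof -
    have "ennreal (\<Sum>R\<in>FF k. measure lebesgue (E R)) = (\<Sum>R\<in>FF k. emeasure lebesgue (E R))"
    proof (subst sum_ennreal[symmetric])
      show "(\<Sum>R\<in>FF k. ennreal (measure lebesgue (E R))) = (\<Sum>R\<in>FF k. emeasure lebesgue (E R))"
        using E_em FF(2)[of k] by (intro sum.cong refl) (metis subsetD)
    qed simp
    also have "\<dots> = emeasure lebesgue (\<Union>R\<in>FF k. E R)"
    proof (rule sum_emeasure)
      show "E ` FF k \<subseteq> sets lebesgue" by (rule image_subsetI) (rule E(2)[OF subsetD[OF FF(2)]])
      show "disjoint_family_on E (FF k)" by (rule disjoint_family_on_mono[OF FF(2) E(1)])
    qed (rule FF(1))
    also have "\<dots> \<le> emeasure lebesgue (?U k)"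
    proof (rule emeasure_mono[OF _ Union_grid_lebesgue[OF FF(3)]])
      have "E R \<subseteq> ?U k" if "R \<in> FF k" for R
        using order_trans[OF E(3)[OF subsetD[OF FF(2) that]] Union_upper[OF that]] .
      then show "(\<Union>R\<in>FF k. E R) \<subseteq> ?U k" by (rule UN_least)
    qed
    finally show ?thesis .
  qed
  define \<psi> where "\<psi> k x = \<phi> x * indicator {x. 2 powr (real_of_int k - 1) < \<phi> x} x" for k :: int and x
  have \<psi>0: "0 \<le> \<psi> k x" for k x unfolding \<psi>_def by (intro mult_nonneg_nonneg \<phi>(2)) simp
  have \<psi>s: "{x. 2 powr (real_of_int k - 1) < \<phi> x} \<in> sets lebesgue" for k :: int
    by (rule superlevel_lebesgue[OF \<phi>(1)])
  have \<psi>i: "integrable lebesgue (\<psi> k)" for k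
    unfolding \<psi>_def by (rule integrable_real_mult_indicator[OF \<psi>s \<phi>(1)])
  have layer: "ennreal (2 powr (real_of_int k - 1)) * emeasure lebesgue (?U k) \<le> (\<integral>\<^sup>+x. ennreal (\<psi> k x) \<partial>lebesgue)" for k
  proof -
    have "\<exists>l. levels_ge l (FF k)" by (rule finite_levels_ge[OF FF(1,3)])
    then obtain l where l: "levels_ge l (FF k)" ..
    have "2 powr (real_of_int k - 1) * measure lebesgue Q \<le> mass (\<psi> k) Q" if Q: "Q \<in> FF k" for Q
    proof -
      obtain j x0 where jx: "Q = cube_at \<omega> j x0" using Q FF(3) by (meson grid_cases subsetD)
      let ?t = "2 powr (real_of_int k - 1)"
      have Qs: "Q \<in> sets lebesgue" using jx by simp
      have ci: "set_integrable lebesgue Q (\<lambda>x. ?t)"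
        unfolding set_integrable_def by (simp add: jx emeasure_cube_at)
      have si: "set_integrable lebesgue Q (\<psi> k)"
        unfolding set_integrable_def using integrable_mult_indicator[OF Qs \<psi>i] by simp
      have "mass \<phi> Q \<le> (LINT x:Q|lebesgue. \<psi> k x + ?t)"
        unfolding mass_def set_lebesgue_integral_def
      proof (rule integral_mono)
        show "integrable lebesgue (\<lambda>x. indicator Q x *\<^sub>R \<phi> x)" by (rule integrable_mult_indicator[OF Qs \<phi>(1)])
        show "integrable lebesgue (\<lambda>x. indicator Q x *\<^sub>R (\<psi> k x + ?t))"
          using set_integral_add(1)[OF si ci] by (simp add: set_integrable_def)
        fix x
        have "\<phi> x \<le> \<psi> k x + ?t" by (auto simp: \<psi>_def indicator_def)
        then show "indicator Q x *\<^sub>R \<phi> x \<le> indicator Q x *\<^sub>R (\<psi> k x + ?t)" by (simp add: indicator_def)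
      qed
      also have "\<dots> = mass (\<psi> k) Q + (LINT x:Q|lebesgue. ?t)"
        unfolding mass_def by (rule set_integral_add(2)[OF si ci])
      also have "(LINT x:Q|lebesgue. ?t) = ?t * measure lebesgue Q"
        by (simp add: set_lebesgue_integral_def jx)
      finally have 1: "mass \<phi> Q \<le> mass (\<psi> k) Q + ?t * measure lebesgue Q" .
      have "2 powr real_of_int k \<le> ave \<phi> Q" using lv(1)[of Q] Q by (auto simp: FF_def)
      then have "2 powr real_of_int k * measure lebesgue Q \<le> ave \<phi> Q * measure lebesgue Q"
        by (rule mult_right_mono) simp
      then have "2 powr real_of_int k * measure lebesgue Q \<le> mass \<phi> Q" by (simp add: jx mass_eq measure_cube_at)
      moreover have "2 powr real_of_int k = 2 * ?t" by (simp add: powr_diff)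
      ultimately show ?thesis using 1 by simp
    qed
    then have "ennreal (2 powr (real_of_int k - 1)) * emeasure lebesgue (?U k) \<le> (\<integral>\<^sup>+x. ennreal (\<psi> k x) * indicator (?U k) x \<partial>lebesgue)"
      by (intro maximal_inequality[OF FF(3) l \<psi>i \<psi>0]) auto
    also have "\<dots> \<le> (\<integral>\<^sup>+x. ennreal (\<psi> k x) \<partial>lebesgue)"
      by (intro nn_integral_mono) (auto simp: indicator_def)
    finally show ?thesis .
  qed
  have level_sum: "(\<Sum>R\<in>FF k. measure lebesgue (E R) * ave \<phi> R powr u) \<le> 2 powr ((k + 1) * u) * (\<Sum>R\<in>FF k. measure lebesgue (E R))" for k :: int
    unfolding sum_distrib_left
  proof (rule sum_mono)
    fix R assume R: "R \<in> FF k"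
    then have "ave \<phi> R \<le> 2 powr (real_of_int k + 1)" using lv(2)[of R] by (auto simp: FF_def)
    then have "ave \<phi> R powr u \<le> (2 powr (real_of_int k + 1)) powr u"
      using u ave_nonneg[of \<phi> R, OF \<phi>(2)] by (intro powr_mono2) auto
    then have "measure lebesgue (E R) * ave \<phi> R powr u \<le> measure lebesgue (E R) * (2 powr (real_of_int k + 1)) powr u"
      by (rule mult_left_mono) simp
    then show "measure lebesgue (E R) * ave \<phi> R powr u \<le> 2 powr ((k + 1) * u) * measure lebesgue (E R)"
      by (simp add: powr_powr mult.commute)
  qed
  let ?K = "lv ` Rp"
  have "(\<Sum>R\<in>RR. measure lebesgue (E R) * ave \<phi> R powr u) = (\<Sum>R\<in>Rp. measure lebesgue (E R) * ave \<phi> R powr u)"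
  proof (rule sum.mono_neutral_right[OF RR(1)])
    show "\<forall>R\<in>RR - Rp. measure lebesgue (E R) * ave \<phi> R powr u = 0"
      using ave_nonneg[of \<phi>, OF \<phi>(2)] by (auto simp: Rp_def not_less intro: antisym)
  qed (simp add: Rp_def)
  also have "\<dots> = (\<Sum>k\<in>?K. \<Sum>R\<in>FF k. measure lebesgue (E R) * ave \<phi> R powr u)"
    unfolding FF_def by (rule sum.image_gen[OF Rp])
  also have "\<dots> \<le> (\<Sum>k\<in>?K. 2 powr ((k + 1) * u) * (\<Sum>R\<in>FF k. measure lebesgue (E R)))"
    by (intro sum_mono level_sum)
  finally have "ennreal (\<Sum>R\<in>RR. measure lebesgue (E R) * ave \<phi> R powr u) \<le>
      ennreal (\<Sum>k\<in>?K. 2 powr ((k + 1) * u) * (\<Sum>R\<in>FF k. measure lebesgue (E R)))" by (rule ennreal_leI)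
  also have "\<dots> = (\<Sum>k\<in>?K. ennreal (2 powr ((k + 1) * u) * (\<Sum>R\<in>FF k. measure lebesgue (E R))))"
    by (rule sum_ennreal[symmetric]) (auto intro!: mult_nonneg_nonneg sum_nonneg)
  also have "\<dots> \<le> (\<Sum>k\<in>?K. \<integral>\<^sup>+x. ennreal (2 powr ((k + 1) * u + (1 - k)) * \<psi> k x) \<partial>lebesgue)"
  proof (rule sum_mono)
    fix k
    let ?c = "2 powr ((real_of_int k + 1) * u + (1 - real_of_int k))" and ?t = "2 powr (real_of_int k - 1)"
    have c: "2 powr ((real_of_int k + 1) * u) = ?c * ?t" by (simp add: powr_add[symmetric])
    have "ennreal (2 powr ((k + 1) * u) * (\<Sum>R\<in>FF k. measure lebesgue (E R))) =
        ennreal (2 powr ((k + 1) * u)) * ennreal (\<Sum>R\<in>FF k. measure lebesgue (E R))"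
      by (rule ennreal_mult) (auto intro!: sum_nonneg)
    also have "\<dots> \<le> ennreal (2 powr ((k + 1) * u)) * emeasure lebesgue (?U k)"
      by (rule mult_left_mono[OF sumE]) simp
    also have "ennreal (2 powr ((k + 1) * u)) = ennreal ?c * ennreal ?t"
      by (subst ennreal_mult[symmetric]) (simp_all add: c)
    also have "\<dots> * emeasure lebesgue (?U k) \<le> ennreal ?c * (\<integral>\<^sup>+x. ennreal (\<psi> k x) \<partial>lebesgue)"
      unfolding mult.assoc by (rule mult_left_mono[OF layer]) simp
    also have "\<dots> = (\<integral>\<^sup>+x. ennreal ?c * ennreal (\<psi> k x) \<partial>lebesgue)"
      by (rule nn_integral_cmult[symmetric]) (use \<psi>i[of k] in auto)
    also have "\<dots> = (\<integral>\<^sup>+x. ennreal (?c * \<psi> k x) \<partial>lebesgue)"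
      by (intro nn_integral_cong ennreal_mult[symmetric] \<psi>0) simp
    finally show "ennreal (2 powr ((k + 1) * u) * (\<Sum>R\<in>FF k. measure lebesgue (E R))) \<le>
        (\<integral>\<^sup>+x. ennreal (2 powr ((k + 1) * u + (1 - k)) * \<psi> k x) \<partial>lebesgue)" by simp
  qed
  also have "\<dots> = (\<integral>\<^sup>+x. (\<Sum>k\<in>?K. ennreal (2 powr ((k + 1) * u + (1 - k)) * \<psi> k x)) \<partial>lebesgue)"
    by (rule nn_integral_sum[symmetric])
      (intro measurable_compose[OF _ measurable_ennreal] borel_measurable_times borel_measurable_const borel_measurable_integrable[OF \<psi>i])
  also have "\<dots> \<le> (\<integral>\<^sup>+x. ennreal (carleson_const u) * ennreal (\<phi> x powr u) \<partial>lebesgue)"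
  proof (rule nn_integral_mono)
    fix x
    let ?v = "2 powr (u - 1)"
    have v: "1 < ?v" using u by simp
    have cc: "0 \<le> carleson_const u" unfolding carleson_const_def using v by simp
    have "(\<Sum>k\<in>?K. 2 powr ((k + 1) * u + (1 - k)) * \<psi> k x) \<le> carleson_const u * \<phi> x powr u"
    proof (cases "\<phi> x = 0")
      case True
      then show ?thesis by (simp add: \<psi>_def)
    next
      case False
      then have p: "0 < \<phi> x" using \<phi>(2)[of x] by simp
      \<comment> \<open>Only layers with \<open>2 powr (k - 1) < \<phi> x\<close> contribute at x,
        so the powers of \<open>?v\<close> are summed downwards from k1.\<close>
      define k1 where "k1 = \<lfloor>log 2 (\<phi> x) + 1\<rfloor>"
      let ?K' = "{k\<in>?K. 2 powr (real_of_int k - 1) < \<phi> x}"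
      have k1: "k \<le> k1" if "k \<in> ?K'" for k
      proof -
        have "2 powr (real_of_int k - 1) < \<phi> x" using that by blast
        then have "real_of_int k - 1 < log 2 (\<phi> x)" using p by (simp add: less_log_iff)
        then show ?thesis unfolding k1_def le_floor_iff by simp
      qed
      have "(\<Sum>k\<in>?K. 2 powr ((k + 1) * u + (1 - k)) * \<psi> k x) = (\<Sum>k\<in>?K'. 2 powr ((k + 1) * u + (1 - k)) * \<phi> x)"
        using Rp by (intro sum.mono_neutral_cong_right) (auto simp: \<psi>_def)
      also have "\<dots> = 2 powr (u + 1) * \<phi> x * (\<Sum>k\<in>?K'. ?v powr k)"
        unfolding sum_distrib_left
      proof (rule sum.cong[OF refl])
        fix k :: int
        have "2 powr ((real_of_int k + 1) * u + (1 - real_of_int k)) = 2 powr (u + 1) * 2 powr ((u - 1) * k)"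
          unfolding powr_add[symmetric] by (simp add: algebra_simps)
        then show "2 powr ((k + 1) * u + (1 - k)) * \<phi> x = 2 powr (u + 1) * \<phi> x * ?v powr k"
          by (simp add: powr_powr)
      qed
      also have "\<dots> \<le> 2 powr (u + 1) * \<phi> x * (?v powr k1 / (1 - 1 / ?v))"
        by (intro mult_left_mono sum_powr_le_geometric k1 v) (use Rp p in auto)
      also have "\<dots> \<le> 2 powr (u + 1) * \<phi> x * ((2 powr (u - 1) * \<phi> x powr (u - 1)) / (1 - 1 / ?v))"
      proof (intro mult_left_mono divide_right_mono)
        have "real_of_int k1 \<le> log 2 (\<phi> x) + 1" unfolding k1_def by linarith
        then have "?v powr k1 \<le> ?v powr (log 2 (\<phi> x) + 1)" using v by (intro powr_mono) auto
        also have "\<dots> = ?v * (2 powr log 2 (\<phi> x)) powr (u - 1)"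
          by (simp add: powr_add powr_powr mult.commute)
        also have "\<dots> = 2 powr (u - 1) * \<phi> x powr (u - 1)" using p by simp
        finally show "?v powr k1 \<le> 2 powr (u - 1) * \<phi> x powr (u - 1)" .
      qed (use p v in auto)
      also have "\<dots> = (2 powr (u + 1) * 2 powr (u - 1)) * (\<phi> x powr 1 * \<phi> x powr (u - 1)) / (1 - 1 / ?v)"
        using p by simp
      also have "\<dots> = carleson_const u * \<phi> x powr u"
        unfolding powr_add[symmetric] carleson_const_def by simp
      finally show ?thesis .
    qed
    then have le: "ennreal (\<Sum>k\<in>?K. 2 powr ((k + 1) * u + (1 - k)) * \<psi> k x) \<le> ennreal (carleson_const u * \<phi> x powr u)"
      by (rule ennreal_leI)
    then show "(\<Sum>k\<in>?K. ennreal (2 powr ((k + 1) * u + (1 - k)) * \<psi> k x)) \<le> ennreal (carleson_const u) * ennreal (\<phi> x powr u)"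
    proof -
      have 1: "(\<Sum>k\<in>?K. ennreal (2 powr ((k + 1) * u + (1 - k)) * \<psi> k x)) = ennreal (\<Sum>k\<in>?K. 2 powr ((k + 1) * u + (1 - k)) * \<psi> k x)"
        by (rule sum_ennreal) (intro mult_nonneg_nonneg \<psi>0 powr_ge_zero)
      have 2: "ennreal (carleson_const u * \<phi> x powr u) = ennreal (carleson_const u) * ennreal (\<phi> x powr u)"
        by (rule ennreal_mult[OF cc powr_ge_zero])
      show ?thesis using le unfolding 1 2 .
    qed
  qed
  also have "\<dots> = ennreal (carleson_const u) * (\<integral>\<^sup>+x. ennreal (\<phi> x powr u) \<partial>lebesgue)"
  proof (rule nn_integral_cmult)
    have [measurable]: "\<phi> \<in> borel_measurable lebesgue" by (rule borel_measurable_integrable[OF \<phi>(1)])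
    show "(\<lambda>x. ennreal (\<phi> x powr u)) \<in> borel_measurable lebesgue" by measurable
  qed
  finally show ?thesis .
qed

end

section \<open>Elementary inequalities for powers\<close>

lemma mult_le_add_powr:
  fixes x y s :: real
  assumes "0 \<le> x" "0 \<le> y" "1 < s"
  shows "x * y \<le> x powr s + y powr (s / (s - 1))"
proof (cases "x = 0 \<or> y = 0")
  case True
  then show ?thesis by auto
next
  case False
  then have p: "0 < x" "0 < y" using assms by auto
  show ?thesis
  \<comment> \<open>Young's inequality up to constants: in each case one of the two terms alone
    dominates the product.\<close>
  proof (cases "y \<le> x powr (s - 1)")
    case True
    then have "x * y \<le> x powr 1 * x powr (s - 1)" using p by (simp add: mult_left_mono)
    also have "\<dots> = x powr s" unfolding powr_add[symmetric] by simp
    finally show ?thesis by (simp add: add_increasing2)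
  next
    case False
    then have "(x powr (s - 1)) powr (1 / (s - 1)) \<le> y powr (1 / (s - 1))"
      using p assms by (intro powr_mono2) auto
    then have "x \<le> y powr (1 / (s - 1))" using p assms by (simp add: powr_powr)
    then have "x * y \<le> y powr (1 / (s - 1)) * y powr 1" using p by (simp add: mult_right_mono)
    also have "\<dots> = y powr (1 / (s - 1) + 1)" by (rule powr_add[symmetric])
    also have "1 / (s - 1) + 1 = s / (s - 1)" using assms by (simp add: field_simps)
    finally show ?thesis by (simp add: add_increasing)
  qed
qed

text \<open>Write the power of the total as the sum of the \<open>h i * ?s powr (q - 1)\<close>;
  each \<open>h i\<close> is at most the total, and q - 1 is not positive.\<close>

lemma sum_powr_le_sum:
  fixes h :: "'i \<Rightarrow> real"
  assumes "finite F" "\<And>i. i \<in> F \<Longrightarrow> 0 \<le> h i" "0 < q" "q \<le> 1"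
  shows "(\<Sum>i\<in>F. h i) powr q \<le> (\<Sum>i\<in>F. h i powr q)"
proof (cases "(\<Sum>i\<in>F. h i) = 0")
  case True
  then show ?thesis by (simp add: sum_nonneg)
next
  case False
  let ?s = "\<Sum>i\<in>F. h i"
  have s: "0 < ?s" using False assms(2) by (simp add: less_le sum_nonneg)
  have "h i * ?s powr (q - 1) \<le> h i powr q" if i: "i \<in> F" for i
  proof (cases "h i = 0")
    case False
    then have h: "0 < h i" using assms(2)[OF i] by simp
    have "h i \<le> ?s" using assms i by (intro member_le_sum) auto
    then have "?s powr (q - 1) \<le> h i powr (q - 1)" using h assms by (intro powr_mono2') auto
    then have "h i * ?s powr (q - 1) \<le> h i powr 1 * h i powr (q - 1)" using h by (simp add: mult_left_mono)
    also have "\<dots> = h i powr q" unfolding powr_add[symmetric] by simp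
    finally show ?thesis .
  qed simp
  then have "(\<Sum>i\<in>F. h i * ?s powr (q - 1)) \<le> (\<Sum>i\<in>F. h i powr q)" by (rule sum_mono)
  moreover have "(\<Sum>i\<in>F. h i * ?s powr (q - 1)) = ?s powr 1 * ?s powr (q - 1)"
    using s by (simp add: sum_distrib_right)
  moreover have "?s powr 1 * ?s powr (q - 1) = ?s powr q" unfolding powr_add[symmetric] by simp
  ultimately show ?thesis by simp
qed

text \<open>A weak form of the inequality of weighted means: every factor is bounded by the
  corresponding power of the sum.\<close>

lemma prod_powr_le_sum:
  fixes x \<theta> :: "'i \<Rightarrow> real"
  assumes M: "finite M" "M \<noteq> {}" and x: "\<And>i. i \<in> M \<Longrightarrow> 0 \<le> x i" and \<theta>: "\<And>i. i \<in> M \<Longrightarrow> 0 < \<theta> i" "(\<Sum>i\<in>M. \<theta> i) = 1"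
  shows "(\<Prod>i\<in>M. x i powr \<theta> i) \<le> (\<Sum>i\<in>M. x i)"
proof (cases "(\<Sum>i\<in>M. x i) = 0")
  case True
  then have "\<And>i. i \<in> M \<Longrightarrow> x i = 0" using M x by (simp add: sum_nonneg_eq_0_iff)
  then have "(\<Prod>i\<in>M. x i powr \<theta> i) = (\<Prod>i\<in>M. 0)" by (intro prod.cong) auto
  also have "\<dots> = 0" using M by (simp add: card_gt_0_iff)
  finally show ?thesis using True by simp
next
  case False
  let ?s = "\<Sum>i\<in>M. x i"
  have s: "0 < ?s" using False x by (simp add: less_le sum_nonneg)
  have "(\<Prod>i\<in>M. x i powr \<theta> i) \<le> (\<Prod>i\<in>M. ?s powr \<theta> i)"
  proof (intro prod_mono conjI)
    fix i assume i: "i \<in> M"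
    have "x i \<le> ?s" using M x i by (intro member_le_sum) auto
    then show "x i powr \<theta> i \<le> ?s powr \<theta> i" using x[OF i] \<theta>(1)[OF i] by (intro powr_mono2) auto
  qed simp
  also have "\<dots> = ?s powr (\<Sum>i\<in>M. \<theta> i)" using s M by (simp add: powr_sum)
  finally show ?thesis using \<theta>(2) s by simp
qed

text \<open>For q > 1 the Carleson exponent is q' / s', with q' and s' conjugate to q and s. The 12
  reduces the Carleson term to half of the integral; absorbing it turns a factor 3 into 6.\<close>

definition Lq_const :: "real \<Rightarrow> real \<Rightarrow> real" where
  "Lq_const s q = (if q \<le> 1 then 2 else 6 * (12 * carleson_const (q / (q - 1) / (s / (s - 1)))) powr (q - 1))"

lemma carleson_const_pos: "1 < u \<Longrightarrow> 0 < carleson_const u"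
  unfolding carleson_const_def by (intro divide_pos_pos) auto

lemma Lq_const_nonneg: "0 \<le> Lq_const s q"
  unfolding Lq_const_def by auto

section \<open>Summation of the local pieces in L^q\<close>

context dyadic_system
begin

text \<open>The \<open>H R\<close> are the pieces and \<open>lam R\<close> their local sizes. For q
  > 1 the integral of F^q is bounded by the pairings of the \<open>H R\<close> with F^(q-1), and
  each of these by a multiple of \<open>lam R\<close> times the s'-mean of F^(q-1) over R. The
  Carleson embedding controls the means because q < s gives q' > s'. Its result can be absorbed, as
  F^q is integrable by hypothesis.\<close>

lemma Lq_sum_bound:
  fixes F :: "real^'d \<Rightarrow> real" and H :: "(real^'d) set \<Rightarrow> real^'d \<Rightarrow> real"
  assumes RR: "finite RR" "RR \<subseteq> dyadic_grid \<omega>" and E: "disjoint_family_on E RR"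
      "\<And>R. R \<in> RR \<Longrightarrow> E R \<in> sets lebesgue" "\<And>R. R \<in> RR \<Longrightarrow> E R \<subseteq> R"
      "\<And>R. R \<in> RR \<Longrightarrow> measure lebesgue R \<le> 2 * measure lebesgue (E R)"
    and F: "\<And>x. 0 \<le> F x" "\<And>x. F x \<le> (\<Sum>R\<in>RR. H R x)" "\<And>t. 0 < t \<Longrightarrow> integrable lebesgue (\<lambda>x. F x powr t)"
    and Hm [measurable]: "\<And>R. R \<in> RR \<Longrightarrow> H R \<in> borel_measurable lebesgue"
    and H: "\<And>R x. 0 \<le> H R x" "\<And>R x. R \<in> RR \<Longrightarrow> x \<notin> R \<Longrightarrow> H R x = 0"
      "\<And>R t. R \<in> RR \<Longrightarrow> 0 < t \<Longrightarrow> t \<le> s \<Longrightarrow> (\<integral>\<^sup>+x. ennreal (H R x powr t) \<partial>lebesgue) \<le> ennreal (2 * lam R powr t * measure lebesgue R)"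
    and lam: "\<And>R. R \<in> RR \<Longrightarrow> 0 \<le> lam R" and q: "0 < q" "q < s" and s: "1 < s"
  shows "(\<integral>\<^sup>+x. ennreal (F x powr q) \<partial>lebesgue) \<le> ennreal (Lq_const s q * (\<Sum>R\<in>RR. measure lebesgue R * lam R powr q))"
proof (cases "q \<le> 1")
  case True
  have "(\<integral>\<^sup>+x. ennreal (F x powr q) \<partial>lebesgue) \<le> (\<integral>\<^sup>+x. (\<Sum>R\<in>RR. ennreal (H R x powr q)) \<partial>lebesgue)"
  proof (rule nn_integral_mono)
    fix x
    have "F x powr q \<le> (\<Sum>R\<in>RR. H R x) powr q" using F q by (intro powr_mono2) auto
    also have "\<dots> \<le> (\<Sum>R\<in>RR. H R x powr q)" by (rule sum_powr_le_sum[OF RR(1) H(1) q(1) True])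
    finally show "ennreal (F x powr q) \<le> (\<Sum>R\<in>RR. ennreal (H R x powr q))"
      by (subst sum_ennreal) (auto intro: ennreal_leI)
  qed
  also have "\<dots> = (\<Sum>R\<in>RR. \<integral>\<^sup>+x. ennreal (H R x powr q) \<partial>lebesgue)"
    by (rule nn_integral_sum) measurable
  also have "\<dots> \<le> (\<Sum>R\<in>RR. ennreal (2 * lam R powr q * measure lebesgue R))"
    by (intro sum_mono H(3) q less_imp_le[OF q(2)])
  also have "\<dots> = ennreal (\<Sum>R\<in>RR. 2 * lam R powr q * measure lebesgue R)"
    by (rule sum_ennreal) simp
  finally show ?thesis using True by (simp add: Lq_const_def sum_distrib_left mult_ac)
next
  case False
  then have q1: "1 < q" by simp
  define q' where "q' = q / (q - 1)"
  define s' where "s' = s / (s - 1)"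
  define u where "u = q' / s'"
  have q': "1 < q'" using q1 by (simp add: q'_def field_simps)
  have s': "1 < s'" using s by (simp add: s'_def field_simps)
  have u: "1 < u" using q1 q s by (simp add: u_def q'_def s'_def field_simps)
  let ?C = "carleson_const u"
  have C: "0 < ?C" by (rule carleson_const_pos[OF u])
  \<comment> \<open>This is the power s' of \<open>F x powr (q - 1)\<close>, and its power u is
    \<open>F x powr q\<close>, which the Carleson embedding returns.\<close>
  define \<Psi> where "\<Psi> x = F x powr (q / u)" for x
  have qu: "0 < q / u" using q u by simp
  have \<Psi>0: "0 \<le> \<Psi> x" for x by (simp add: \<Psi>_def)
  have \<Psi>i: "integrable lebesgue \<Psi>" unfolding \<Psi>_def by (rule F(3)[OF qu])
  have \<Psi>u: "\<Psi> x powr u = F x powr q" for x using u by (simp add: \<Psi>_def powr_powr)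
  have eu: "(q - 1) * s' = q / u" using q1 s' by (simp add: u_def q'_def)
  have \<Psi>s: "(F x powr (q - 1)) powr s' = \<Psi> x" for x by (simp add: \<Psi>_def powr_powr eu)
  have Fq1 [measurable]: "(\<lambda>x. F x powr (q - 1)) \<in> borel_measurable lebesgue"
    by (rule borel_measurable_integrable[OF F(3)]) (use q1 in simp)
  define b where "b R = ave \<Psi> R powr (1 / s')" for R
  have b0: "0 \<le> b R" for R by (simp add: b_def)
  have aP: "0 \<le> ave \<Psi> R" for R by (rule ave_nonneg[OF \<Psi>0])
  have bs: "b R powr s' = ave \<Psi> R" for R using s' aP by (simp add: b_def powr_powr)
  have bq: "b R powr q' = ave \<Psi> R powr u" for R by (simp add: b_def powr_powr u_def)
  define X where "X = (LINT x|lebesgue. F x powr q)"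
  have X: "(\<integral>\<^sup>+x. ennreal (F x powr q) \<partial>lebesgue) = ennreal X" unfolding X_def
    by (rule nn_integral_eq_integral[OF F(3)[OF q(1)]]) simp
  have X0: "0 \<le> X" unfolding X_def by simp
  have mass: "mass \<Psi> R = ave \<Psi> R * measure lebesgue R" and ms: "0 < measure lebesgue R" if "R \<in> RR" for R
  proof -
    have "R \<in> dyadic_grid \<omega>" using that RR(2) by blast
    then obtain k x where "R = cube_at \<omega> k x" by (rule grid_cases)
    then show "mass \<Psi> R = ave \<Psi> R * measure lebesgue R" "0 < measure lebesgue R"
      by (simp_all add: mass_eq measure_cube_at)
  qed
  have piece: "(\<integral>\<^sup>+x. ennreal (H R x * F x powr (q - 1)) \<partial>lebesgue) \<le> ennreal (3 * (lam R * b R) * measure lebesgue R)"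
    if R: "R \<in> RR" for R
  proof -
    note [measurable] = Hm[OF R]
    have Rs [measurable]: "R \<in> sets lebesgue" by (rule grid_lebesgue) (use R RR in auto)
    have zero: "(\<integral>\<^sup>+x. ennreal (H R x * F x powr (q - 1)) \<partial>lebesgue) = 0" if "AE x in lebesgue. H R x * F x powr (q - 1) = 0"
      by (subst nn_integral_0_iff_AE) (use that in \<open>auto\<close>)
    \<comment> \<open>Young's inequality is applied after division by \<open>lam R\<close> and
      \<open>b R\<close>; if one of them is 0, the integrand vanishes almost everywhere.\<close>
    consider "lam R = 0" | "ave \<Psi> R = 0" | "0 < lam R" "0 < ave \<Psi> R"
      using lam[OF R] aP[of R] by linarith
    then show ?thesis
    proof cases
      case 1
      have "(\<integral>\<^sup>+x. ennreal (H R x powr s) \<partial>lebesgue) \<le> ennreal (2 * lam R powr s * measure lebesgue R)"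
        by (rule H(3)[OF R]) (use s in auto)
      then have "(\<integral>\<^sup>+x. ennreal (H R x powr s) \<partial>lebesgue) = 0" using 1 by simp
      then have "AE x in lebesgue. ennreal (H R x powr s) = 0" by (subst (asm) nn_integral_0_iff_AE) auto
      then have "AE x in lebesgue. H R x * F x powr (q - 1) = 0"
        by eventually_elim (auto simp: ennreal_eq_0_iff)
      then show ?thesis using zero by simp
    next
      case 2
      have "(\<integral>\<^sup>+x. ennreal (\<Psi> x) * indicator R x \<partial>lebesgue) = 0"
        unfolding nn_mass[OF \<Psi>i \<Psi>0 Rs] mass[OF R] 2 by simp
      then have "AE x in lebesgue. ennreal (\<Psi> x) * indicator R x = 0"
        by (subst (asm) nn_integral_0_iff_AE) (use \<Psi>i in auto)
      then have "AE x in lebesgue. H R x * F x powr (q - 1) = 0"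
      proof eventually_elim
        fix x assume x: "ennreal (\<Psi> x) * indicator R x = 0"
        show "H R x * F x powr (q - 1) = 0"
        proof (cases "x \<in> R")
          case True
          then have "\<Psi> x = 0" using x \<Psi>0[of x] by (simp add: ennreal_eq_0_iff)
          then show ?thesis by (simp add: \<Psi>_def)
        qed (simp add: H(2)[OF R])
      qed
      then show ?thesis using zero by simp
    next
      case 3
      have bp: "0 < b R" using 3 by (simp add: b_def)
      \<comment> \<open>Coefficients of Young's inequality for \<open>H R x / lam R\<close> and
        \<open>F x powr (q - 1) / b R\<close>, multiplied back by \<open>lam R * b R\<close>. The
        two terms integrate to 2 and 1 units, whence the factor 3.\<close>
      define c1 where "c1 = lam R * b R / lam R powr s"
      define c2 where "c2 = lam R * b R / b R powr s'"
      have c: "0 \<le> c1" "0 \<le> c2" using 3 bp by (auto simp: c1_def c2_def)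
      have pw: "H R x * F x powr (q - 1) \<le> c1 * H R x powr s + c2 * (\<Psi> x * indicator R x)" for x
      proof (cases "x \<in> R")
        case True
        have "(H R x / lam R) * (F x powr (q - 1) / b R) \<le> (H R x / lam R) powr s + (F x powr (q - 1) / b R) powr s'"
          unfolding s'_def by (rule mult_le_add_powr) (use 3 bp H(1) s in auto)
        also have "\<dots> = H R x powr s / lam R powr s + \<Psi> x / b R powr s'"
          using 3 bp H(1)[of R x] by (simp add: powr_divide \<Psi>s)
        finally have "(lam R * b R) * ((H R x / lam R) * (F x powr (q - 1) / b R)) \<le> (lam R * b R) * (H R x powr s / lam R powr s + \<Psi> x / b R powr s')"
          by (rule mult_left_mono) (use 3 bp in auto)
        then show ?thesis using True 3 bp by (simp add: distrib_left c1_def c2_def)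
      qed (use c \<Psi>0 H(1) H(2)[OF R] in \<open>simp add: \<close>)
      have "(\<integral>\<^sup>+x. ennreal (H R x * F x powr (q - 1)) \<partial>lebesgue) \<le>
          (\<integral>\<^sup>+x. ennreal c1 * ennreal (H R x powr s) + ennreal c2 * (ennreal (\<Psi> x) * indicator R x) \<partial>lebesgue)"
      proof (rule nn_integral_mono)
        fix x
        have "ennreal (H R x * F x powr (q - 1)) \<le> ennreal (c1 * H R x powr s + c2 * (\<Psi> x * indicator R x))"
          by (rule ennreal_leI[OF pw])
        also have "\<dots> = ennreal (c1 * H R x powr s) + ennreal (c2 * (\<Psi> x * indicator R x))"
          by (rule ennreal_plus) (intro mult_nonneg_nonneg c \<Psi>0 powr_ge_zero indicator_pos_le)+
        also have "\<dots> = ennreal c1 * ennreal (H R x powr s) + ennreal c2 * (ennreal (\<Psi> x) * indicator R x)"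
          by (cases "x \<in> R") (simp_all add: ennreal_mult[OF c(1) powr_ge_zero] ennreal_mult[OF c(2) \<Psi>0])
        finally show "ennreal (H R x * F x powr (q - 1)) \<le> ennreal c1 * ennreal (H R x powr s) + ennreal c2 * (ennreal (\<Psi> x) * indicator R x)" .
      qed
      also have "\<dots> = ennreal c1 * (\<integral>\<^sup>+x. ennreal (H R x powr s) \<partial>lebesgue) + ennreal c2 * (\<integral>\<^sup>+x. ennreal (\<Psi> x) * indicator R x \<partial>lebesgue)"
      proof -
        have [measurable]: "\<Psi> \<in> borel_measurable lebesgue" by (rule borel_measurable_integrable[OF \<Psi>i])
        have m1: "(\<lambda>x. ennreal (H R x powr s)) \<in> borel_measurable lebesgue" by measurable
        have m2: "(\<lambda>x. ennreal (\<Psi> x) * indicator R x) \<in> borel_measurable lebesgue" by measurable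
        show ?thesis unfolding nn_integral_cmult[OF m1, symmetric] nn_integral_cmult[OF m2, symmetric]
          by (rule nn_integral_add; rule borel_measurable_times_ennreal; rule borel_measurable_const m1 m2)
      qed
      also have "\<dots> \<le> ennreal c1 * ennreal (2 * lam R powr s * measure lebesgue R) + ennreal c2 * ennreal (mass \<Psi> R)"
        unfolding nn_mass[OF \<Psi>i \<Psi>0 Rs] by (intro add_mono mult_left_mono H(3)[OF R] order_refl) (use s in auto)
      also have "\<dots> = ennreal (c1 * (2 * lam R powr s * measure lebesgue R) + c2 * mass \<Psi> R)"
      proof -
        have m0: "0 \<le> mass \<Psi> R" by (rule mass_nonneg[OF \<Psi>0])
        have z: "0 \<le> 2 * lam R powr s * measure lebesgue R" by simp
        show ?thesis unfolding ennreal_mult[OF c(1) z, symmetric] ennreal_mult[OF c(2) m0, symmetric]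
          by (rule ennreal_plus[symmetric]) (intro mult_nonneg_nonneg c z m0)+
      qed
      also have "c1 * (2 * lam R powr s * measure lebesgue R) + c2 * mass \<Psi> R = 3 * (lam R * b R) * measure lebesgue R"
        unfolding mass[OF R] bs c1_def c2_def using 3 by simp
      finally show ?thesis .
    qed
  qed
  \<comment> \<open>The weight in Young's inequality, with \<open>K powr q' = 12 * ?C\<close>: the 3
    from the pieces, the 2 from sparseness and the Carleson constant then leave the coefficient 1/2
    for X.\<close>
  define K where "K = (12 * ?C) powr (1 / q')"
  have K: "0 < K" "K powr q' = 12 * ?C" "K powr q = (12 * ?C) powr (q - 1)"
    using C q' q1 by (simp_all add: K_def powr_powr q'_def)
  have "ennreal X \<le> (\<integral>\<^sup>+x. (\<Sum>R\<in>RR. ennreal (H R x * F x powr (q - 1))) \<partial>lebesgue)"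
    unfolding X[symmetric]
  proof (rule nn_integral_mono)
    fix x
    have "F x powr q = F x powr 1 * F x powr (q - 1)" unfolding powr_add[symmetric] by simp
    also have "\<dots> = F x * F x powr (q - 1)" using F(1)[of x] by simp
    also have "\<dots> \<le> (\<Sum>R\<in>RR. H R x) * F x powr (q - 1)" by (rule mult_right_mono[OF F(2)]) simp
    finally show "ennreal (F x powr q) \<le> (\<Sum>R\<in>RR. ennreal (H R x * F x powr (q - 1)))"
      unfolding sum_distrib_right using H(1) by (subst sum_ennreal) (auto intro: ennreal_leI)
  qed
  also have "\<dots> = (\<Sum>R\<in>RR. \<integral>\<^sup>+x. ennreal (H R x * F x powr (q - 1)) \<partial>lebesgue)"
    by (rule nn_integral_sum) measurable
  also have "\<dots> \<le> (\<Sum>R\<in>RR. ennreal (3 * (lam R * b R) * measure lebesgue R))"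
    by (rule sum_mono[OF piece])
  also have "\<dots> = ennreal (\<Sum>R\<in>RR. 3 * (lam R * b R) * measure lebesgue R)"
    by (rule sum_ennreal) (use lam b0 in auto)
  finally have "X \<le> (\<Sum>R\<in>RR. 3 * (lam R * b R) * measure lebesgue R)"
    by (subst (asm) ennreal_le_iff) (auto intro!: sum_nonneg mult_nonneg_nonneg lam b0)
  also have "\<dots> \<le> (\<Sum>R\<in>RR. 3 * K powr q * (measure lebesgue R * lam R powr q) + 3 / (12 * ?C) * (measure lebesgue R * ave \<Psi> R powr u))"
  proof (rule sum_mono)
    fix R assume R: "R \<in> RR"
    have "lam R * b R = (K * lam R) * (b R / K)" using K by simp
    also have "\<dots> \<le> (K * lam R) powr q + (b R / K) powr q'"
      unfolding q'_def by (rule mult_le_add_powr) (use K lam[OF R] b0 q1 in auto)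
    also have "\<dots> = K powr q * lam R powr q + ave \<Psi> R powr u / (12 * ?C)"
      using K lam[OF R] b0[of R] by (simp add: powr_mult powr_divide bq)
    finally have "(3 * measure lebesgue R) * (lam R * b R) \<le> (3 * measure lebesgue R) * (K powr q * lam R powr q + ave \<Psi> R powr u / (12 * ?C))"
      by (rule mult_left_mono) simp
    then show "3 * (lam R * b R) * measure lebesgue R \<le> 3 * K powr q * (measure lebesgue R * lam R powr q) + 3 / (12 * ?C) * (measure lebesgue R * ave \<Psi> R powr u)"
      by (simp add: algebra_simps)
  qed
  also have "\<dots> = 3 * K powr q * (\<Sum>R\<in>RR. measure lebesgue R * lam R powr q) + 3 / (12 * ?C) * (\<Sum>R\<in>RR. measure lebesgue R * ave \<Psi> R powr u)"
    by (simp only: sum.distrib sum_distrib_left)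
  also have "3 / (12 * ?C) * (\<Sum>R\<in>RR. measure lebesgue R * ave \<Psi> R powr u) \<le> 3 / (12 * ?C) * (2 * (?C * X))"
  proof (rule mult_left_mono)
    have "ennreal (\<Sum>R\<in>RR. measure lebesgue (E R) * ave \<Psi> R powr u) \<le> ennreal ?C * ennreal X"
      using carleson_embedding[OF RR E(1-3) \<Psi>i \<Psi>0 u] unfolding \<Psi>u X .
    also have "\<dots> = ennreal (?C * X)" by (rule ennreal_mult[symmetric]) (use C X0 in auto)
    finally have c: "(\<Sum>R\<in>RR. measure lebesgue (E R) * ave \<Psi> R powr u) \<le> ?C * X"
      by (subst (asm) ennreal_le_iff) (use C X0 in auto)
    have "(\<Sum>R\<in>RR. measure lebesgue R * ave \<Psi> R powr u) \<le> (\<Sum>R\<in>RR. (2 * measure lebesgue (E R)) * ave \<Psi> R powr u)"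
      by (intro sum_mono mult_right_mono E(4)) auto
    also have "\<dots> = 2 * (\<Sum>R\<in>RR. measure lebesgue (E R) * ave \<Psi> R powr u)"
      by (simp only: sum_distrib_left mult.assoc)
    finally show "(\<Sum>R\<in>RR. measure lebesgue R * ave \<Psi> R powr u) \<le> 2 * (?C * X)" using c by linarith
  qed (use C in simp)
  also have "3 / (12 * ?C) * (2 * (?C * X)) = X / 2" using C by (simp add: field_simps)
  finally have "X \<le> 3 * K powr q * (\<Sum>R\<in>RR. measure lebesgue R * lam R powr q) + X / 2" by simp
  then have "X \<le> Lq_const s q * (\<Sum>R\<in>RR. measure lebesgue R * lam R powr q)"
    using False unfolding Lq_const_def K(3) u_def q'_def s'_def by simp
  then show ?thesis unfolding X by (rule ennreal_leI)
qed

text \<open>M contains the indices with finite exponent; the other averages are bounded by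
  \<open>N m\<close> at once. After normalization by the \<open>N m\<close>, the product over M is
  at most the sum of the powers \<open>p m\<close>, as the \<open>q / p m\<close> add up to 1, and
  each power gives a Carleson sum.\<close>

lemma sparse_hoelder:
  assumes RR: "finite RR" "RR \<subseteq> dyadic_grid \<omega>" and E: "disjoint_family_on E RR"
      "\<And>R. R \<in> RR \<Longrightarrow> E R \<in> sets lebesgue" "\<And>R. R \<in> RR \<Longrightarrow> E R \<subseteq> R"
      "\<And>R. R \<in> RR \<Longrightarrow> measure lebesgue R \<le> 2 * measure lebesgue (E R)"
    and I: "finite I" "M \<subseteq> I" "M \<noteq> {}"
    and \<phi>: "\<And>m. m \<in> I \<Longrightarrow> integrable lebesgue (\<phi> m)" "\<And>m x. m \<in> I \<Longrightarrow> 0 \<le> \<phi> m x"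
    and N: "\<And>m. m \<in> I \<Longrightarrow> 0 \<le> N m"
    and M: "\<And>m. m \<in> M \<Longrightarrow> 1 < p m" "\<And>m. m \<in> M \<Longrightarrow> (\<integral>\<^sup>+x. ennreal (\<phi> m x powr p m) \<partial>lebesgue) = ennreal (N m powr p m)"
    and J: "\<And>m R. m \<in> I - M \<Longrightarrow> R \<in> RR \<Longrightarrow> ave (\<phi> m) R \<le> N m"
    and q: "0 < q" "(\<Sum>m\<in>M. q / p m) = 1"
  shows "(\<Sum>R\<in>RR. measure lebesgue R * (\<Prod>m\<in>I. ave (\<phi> m) R) powr q) \<le>
    2 * (\<Sum>m\<in>M. carleson_const (p m)) * (\<Prod>m\<in>I. N m) powr q"
proof -
  have finM: "finite M" using I finite_subset by blast
  have a0: "0 \<le> ave (\<phi> m) R" if "m \<in> I" for m R by (rule ave_nonneg[OF \<phi>(2)[OF that]])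
  have car: "(\<Sum>R\<in>RR. measure lebesgue (E R) * ave (\<phi> m) R powr p m) \<le> carleson_const (p m) * N m powr p m" if m: "m \<in> M" for m
  proof -
    have mI: "m \<in> I" using m I by blast
    have "ennreal (\<Sum>R\<in>RR. measure lebesgue (E R) * ave (\<phi> m) R powr p m) \<le> ennreal (carleson_const (p m)) * ennreal (N m powr p m)"
      using carleson_embedding[OF RR E(1-3) \<phi>[OF mI] M(1)[OF m]] unfolding M(2)[OF m] .
    also have "\<dots> = ennreal (carleson_const (p m) * N m powr p m)"
      by (rule ennreal_mult[symmetric]) (use carleson_const_pos[OF M(1)[OF m]] in auto)
    finally show ?thesis
      by (subst (asm) ennreal_le_iff) (use carleson_const_pos[OF M(1)[OF m]] in auto)
  qed
  have mE: "0 < measure lebesgue (E R)" if R: "R \<in> RR" for R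
  proof -
    have "R \<in> dyadic_grid \<omega>" using R RR(2) by blast
    then obtain k x where "R = cube_at \<omega> k x" by (rule grid_cases)
    then have "0 < measure lebesgue R" by (simp add: measure_cube_at)
    then show ?thesis using E(4)[OF R] by linarith
  qed
  have rhs: "0 \<le> 2 * (\<Sum>m\<in>M. carleson_const (p m)) * (\<Prod>m\<in>I. N m) powr q"
    using carleson_const_pos[OF M(1)] by (intro mult_nonneg_nonneg sum_nonneg) (auto intro: less_imp_le)
  show ?thesis
  \<comment> \<open>Normalization is impossible if a norm is 0; then the Carleson sum is 0, and
    since each \<open>E R\<close> has positive measure, all averages of this function
    vanish.\<close>
  proof (cases "\<exists>m\<in>M. N m = 0")
    case True
    then obtain m where m: "m \<in> M" "N m = 0" by blast
    have mI: "m \<in> I" using m I by blast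
    have "ave (\<phi> m) R = 0" if R: "R \<in> RR" for R
    proof -
      have "measure lebesgue (E R) * ave (\<phi> m) R powr p m \<le> (\<Sum>R\<in>RR. measure lebesgue (E R) * ave (\<phi> m) R powr p m)"
        using RR(1) R by (intro member_le_sum) auto
      also have "\<dots> \<le> 0" using car[OF m(1)] m(2) by simp
      finally have "ave (\<phi> m) R powr p m \<le> 0" using mE[OF R] by (simp add: mult_le_0_iff)
      then show ?thesis by simp
    qed
    then have "(\<Sum>R\<in>RR. measure lebesgue R * (\<Prod>m\<in>I. ave (\<phi> m) R) powr q) = 0"
      using mI I(1) by (intro sum.neutral ballI) (simp add: prod_zero_iff; blast)
    then show ?thesis using rhs by simp
  next
    case False
    have Np: "0 < N m" if "m \<in> M" for m
    proof -
      have "m \<in> I" "N m \<noteq> 0" using that I False by auto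
      then show ?thesis using N[of m] by simp
    qed
    let ?x = "\<lambda>R m. (ave (\<phi> m) R / N m) powr p m"
    have pr: "(\<Prod>m\<in>I. ave (\<phi> m) R) powr q \<le> (\<Prod>m\<in>I. N m) powr q * (\<Sum>m\<in>M. ?x R m)" if R: "R \<in> RR" for R
    proof -
      have s0: "0 \<le> (\<Sum>m\<in>M. ?x R m)" by (intro sum_nonneg) auto
      have "(\<Prod>m\<in>M. ave (\<phi> m) R) = (\<Prod>m\<in>M. N m * (ave (\<phi> m) R / N m))"
        using Np by (intro prod.cong refl) (simp add: less_imp_neq[symmetric] order_less_imp_not_eq2)
      also have "\<dots> powr q = (\<Prod>m\<in>M. N m) powr q * (\<Prod>m\<in>M. ave (\<phi> m) R / N m) powr q"
        unfolding prod.distrib by (rule powr_mult)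
      also have "(\<Prod>m\<in>M. ave (\<phi> m) R / N m) powr q = (\<Prod>m\<in>M. (ave (\<phi> m) R / N m) powr q)"
        by (rule prod_powr_distrib)
      also have "\<dots> = (\<Prod>m\<in>M. ?x R m powr (q / p m))"
        using M(1) by (intro prod.cong refl) (force simp: powr_powr)
      also have "\<dots> \<le> (\<Sum>m\<in>M. ?x R m)"
      proof (rule prod_powr_le_sum[OF finM I(3)])
        fix m assume "m \<in> M"
        then show "0 < q / p m" using q(1) M(1)[of m] by simp
      qed (use q(2) in simp_all)
      finally have 1: "(\<Prod>m\<in>M. ave (\<phi> m) R) powr q \<le> (\<Prod>m\<in>M. N m) powr q * (\<Sum>m\<in>M. ?x R m)"
        by (simp add: mult_left_mono)
      have 2: "(\<Prod>m\<in>I - M. ave (\<phi> m) R) powr q \<le> (\<Prod>m\<in>I - M. N m) powr q"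
        by (intro powr_mono2 prod_nonneg prod_mono conjI) (use q a0 J R in auto)
      have "(\<Prod>m\<in>I. ave (\<phi> m) R) powr q = (\<Prod>m\<in>I - M. ave (\<phi> m) R) powr q * (\<Prod>m\<in>M. ave (\<phi> m) R) powr q"
        unfolding prod.subset_diff[OF I(2,1)] by (rule powr_mult)
      also have "\<dots> \<le> (\<Prod>m\<in>I - M. N m) powr q * ((\<Prod>m\<in>M. N m) powr q * (\<Sum>m\<in>M. ?x R m))"
        by (intro mult_mono 1 2) auto
      also have "\<dots> = (\<Prod>m\<in>I. N m) powr q * (\<Sum>m\<in>M. ?x R m)"
      proof -
        have "(\<Prod>m\<in>I. N m) powr q = (\<Prod>m\<in>I - M. N m) powr q * (\<Prod>m\<in>M. N m) powr q"
          unfolding prod.subset_diff[OF I(2,1)] by (rule powr_mult)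
        then show ?thesis by simp
      qed
      finally show ?thesis .
    qed
    have "(\<Sum>R\<in>RR. measure lebesgue R * (\<Prod>m\<in>I. ave (\<phi> m) R) powr q) \<le>
        (\<Sum>R\<in>RR. (2 * measure lebesgue (E R)) * ((\<Prod>m\<in>I. N m) powr q * (\<Sum>m\<in>M. ?x R m)))"
      by (intro sum_mono mult_mono E(4) pr) auto
    also have "\<dots> = 2 * (\<Prod>m\<in>I. N m) powr q * (\<Sum>R\<in>RR. \<Sum>m\<in>M. measure lebesgue (E R) * ?x R m)"
      by (simp add: sum_distrib_left mult_ac)
    also have "(\<Sum>R\<in>RR. \<Sum>m\<in>M. measure lebesgue (E R) * ?x R m) = (\<Sum>m\<in>M. \<Sum>R\<in>RR. measure lebesgue (E R) * ?x R m)"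
      by (rule sum.swap)
    also have "2 * (\<Prod>m\<in>I. N m) powr q * \<dots> \<le> 2 * (\<Prod>m\<in>I. N m) powr q * (\<Sum>m\<in>M. carleson_const (p m))"
    proof (intro mult_left_mono sum_mono)
      fix m assume m: "m \<in> M"
      have mI: "m \<in> I" using m I by blast
      have "(\<Sum>R\<in>RR. measure lebesgue (E R) * ?x R m) = (\<Sum>R\<in>RR. measure lebesgue (E R) * ave (\<phi> m) R powr p m) / N m powr p m"
        unfolding sum_divide_distrib
        by (intro sum.cong refl) (use a0[OF mI] Np[OF m] in \<open>simp add: powr_divide less_imp_le\<close>)
      also have "\<dots> \<le> (carleson_const (p m) * N m powr p m) / N m powr p m"
        by (rule divide_right_mono[OF car[OF m]]) simp
      also have "\<dots> = carleson_const (p m)" using Np[OF m] by simp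
      finally show "(\<Sum>R\<in>RR. measure lebesgue (E R) * ?x R m) \<le> carleson_const (p m)" .
    qed simp
    finally show ?thesis by (simp add: mult_ac)
  qed
qed

end

section \<open>The L^q bound with an explicit constant\<close>

context dyadic_system
begin

text \<open>A finite Haar sum is simple and vanishes off finitely many cubes, and
  \<open>0 powr t = 0\<close>. This supplies the finite integral that \<open>Lq_sum_bound\<close>
  absorbs.\<close>

lemma haar_sum_powr_integrable:
  fixes y :: "(real^'d) set \<Rightarrow> 'b::real_normed_vector"
  assumes Z: "finite Z" "Z \<subseteq> dyadic_grid \<omega>"
  shows "integrable lebesgue (\<lambda>x. norm (\<Sum>Q\<in>Z. haar (\<theta> Q) Q x *\<^sub>R y Q) powr t)"
proof (rule integrableI_simple_bochner_integrable, rule Bochner_Integration.simple_bochner_integrable.intros)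
  let ?g = "\<lambda>x. norm (\<Sum>Q\<in>Z. haar (\<theta> Q) Q x *\<^sub>R y Q) powr t"
  show "simple_function lebesgue ?g" by (rule simple_function_compose1[OF haar_sum_simple[OF Z(2)]])
  have "{x \<in> space lebesgue. ?g x \<noteq> 0} \<subseteq> (\<Union>Q\<in>Z. Q)"
  proof
    fix x assume x: "x \<in> {x \<in> space lebesgue. ?g x \<noteq> 0}"
    show "x \<in> (\<Union>Q\<in>Z. Q)"
    proof (rule ccontr)
      assume "x \<notin> (\<Union>Q\<in>Z. Q)"
      then have "haar (\<theta> Q) Q x = 0" if "Q \<in> Z" for Q
        using that Z(2) haar_outside by (metis UN_I grid_cases subsetD)
      then have "(\<Sum>Q\<in>Z. haar (\<theta> Q) Q x *\<^sub>R y Q) = 0" by (intro sum.neutral) simp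
      then show False using x by simp
    qed
  qed
  then have "emeasure lebesgue {x \<in> space lebesgue. ?g x \<noteq> 0} \<le> emeasure lebesgue (\<Union>Q\<in>Z. Q)"
    by (rule emeasure_mono) (use Union_grid_lebesgue[OF Z(2)] in simp)
  also have "\<dots> \<le> (\<Sum>Q\<in>Z. emeasure lebesgue Q)"
    by (rule emeasure_subadditive_finite[OF Z(1)]) (use grid_lebesgue Z(2) in auto)
  also have "\<dots> < \<infinity>"
  proof -
    have "emeasure lebesgue Q = ennreal (measure lebesgue Q)" if Q: "Q \<in> Z" for Q
    proof -
      have "Q \<in> dyadic_grid \<omega>" using Q Z(2) by blast
      then obtain k x where "Q = cube_at \<omega> k x" by (rule grid_cases)
      then show ?thesis by (simp add: emeasure_cube_at measure_cube_at)
    qed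
    then have "(\<Sum>Q\<in>Z. emeasure lebesgue Q) = ennreal (\<Sum>Q\<in>Z. measure lebesgue Q)" by simp
    then show ?thesis by simp
  qed
  finally show "emeasure lebesgue {x \<in> space lebesgue. ?g x \<noteq> 0} \<noteq> \<infinity>" by simp
qed

text \<open>The stopping collection is built anew, from the \<phi> m with m from 1 to n and \<eta> =
  1/2. Its top level is chosen so that every cube of the paraproduct is at or below it; thus no
  coarse cubes occur.\<close>

lemma paraproduct_Lq:
  fixes a :: "(real^'d) set \<Rightarrow> ('x::banach, 'y::banach) multop" and f :: "nat \<Rightarrow> real^'d \<Rightarrow> 'x"
  assumes n: "1 \<le> n" and X: "\<And>m. m \<in> {1..n} \<Longrightarrow> subspace (X m)"
    and f: "\<And>m. m \<in> {1..n} \<Longrightarrow> controlled (X m) (f m) (\<phi> m)"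
    and T: "\<And>k. k \<in> {1..<n} \<Longrightarrow> UMD_bound (T k) s (\<beta> k)"
    and Y: "UMD_bound (UNIV :: 'y set) s (\<beta> 0)"
    and cond: "UMD_subspace_condition (dyadic_grid \<omega>) n X T a"
    and fin: "finite {Q\<in>dyadic_grid \<omega>. a Q \<noteq> 0}"
    and \<theta>: "\<And>Q. Q \<in> dyadic_grid \<omega> \<Longrightarrow> cancellative (\<theta> Q)"
    and r: "0 < r" and B: "0 \<le> B" and BMO: "BMO_norm (dyadic_grid \<omega>) r a \<le> ennreal B"
    and M: "M \<subseteq> {1..n}" "M \<noteq> {}" and N: "\<And>m. m \<in> {1..n} \<Longrightarrow> 0 \<le> N m"
    and p: "\<And>m. m \<in> M \<Longrightarrow> 1 < p m" "\<And>m. m \<in> M \<Longrightarrow> (\<integral>\<^sup>+x. ennreal (\<phi> m x powr p m) \<partial>lebesgue) = ennreal (N m powr p m)"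
    and J: "\<And>m R. m \<in> {1..n} - M \<Longrightarrow> R \<in> dyadic_grid \<omega> \<Longrightarrow> ave (\<phi> m) R \<le> N m"
    and q: "0 < q" "q < s" "(\<Sum>m\<in>M. q / p m) = 1"
  defines "c \<equiv> local_const n s r \<beta> powr (1 / s) * (2 ^ CARD('d) * (2 * (real n + 1))) ^ n"
  shows "(\<integral>\<^sup>+x. ennreal (norm (paraproduct (dyadic_grid \<omega>) \<theta> n a f x) powr q) \<partial>lebesgue) \<le>
    ennreal (Lq_const s q * (c powr q * (2 * (\<Sum>m\<in>M. carleson_const (p m)))) * (B * (\<Prod>m=1..n. N m)) powr q)"
proof -
  \<comment> \<open>Makes n / A less than 1/2, the portion that stopping children may cover for
    \<eta> = 1/2.\<close>
  let ?A = "2 * (real n + 1)"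
  let ?Z = "{Q\<in>dyadic_grid \<omega>. a Q \<noteq> 0}"
  let ?y = "\<lambda>Q. multop_apply (a Q) (map (\<lambda>m. avg (f m) Q) [1..<n+1])"
  have Z: "?Z \<subseteq> dyadic_grid \<omega>" by blast
  have s: "1 < s" using Y by (simp add: UMD_bound_def)
  have A: "1 \<le> ?A" by simp
  have \<phi>: "integrable lebesgue (\<phi> m)" "\<And>x. 0 \<le> \<phi> m x" if "m \<in> {1..n}" for m
    using f[OF that] by (auto simp: controlled_def)
  obtain k0 where k0: "levels_ge k0 ?Z" using finite_levels_ge[OF fin Z] ..
  have key: "real (card {1..n}) / ?A < 1 - 1 / 2" by (simp add: field_simps)
  obtain S where S: "S \<subseteq> dyadic_grid \<omega>" "sparse_collection (1 / 2) S"
    and par: "\<And>k x. k0 \<le> k \<Longrightarrow> \<exists>R\<in>S. cube_at \<omega> k x \<subseteq> R \<and>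
      (\<forall>Q\<in>dyadic_grid \<omega>. cube_at \<omega> k x \<subseteq> Q \<and> Q \<subseteq> R \<longrightarrow> (\<forall>i\<in>{1..n}. ave (\<phi> i) Q \<le> ?A * ave (\<phi> i) R))"
  proof (rule sparse_stopping[OF finite_atLeastAtMost A key \<phi>, where ?k0.0 = k0])
    fix S
    assume "S \<subseteq> dyadic_grid \<omega>" "sparse_collection (1 / 2) S"
      "\<And>k x. k0 \<le> k \<Longrightarrow> \<exists>R\<in>S. cube_at \<omega> k x \<subseteq> R \<and>
        (\<forall>Q\<in>dyadic_grid \<omega>. cube_at \<omega> k x \<subseteq> Q \<and> Q \<subseteq> R \<longrightarrow> (\<forall>i\<in>{1..n}. ave (\<phi> i) Q \<le> ?A * ave (\<phi> i) R))"
    then show thesis by (rule that)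
  qed
  obtain P where P: "\<And>Q. Q \<in> ?Z \<Longrightarrow> P Q \<in> S" "\<And>R. R \<in> P ` ?Z \<Longrightarrow> region_ok {1..n} \<phi> ?A R {Q\<in>?Z. P Q = R}"
  proof (rule parent_decomposition[OF par S(1) fin Z k0])
    fix P
    assume "\<And>Q. Q \<in> ?Z \<Longrightarrow> P Q \<in> S" "\<And>R. R \<in> P ` ?Z \<Longrightarrow> region_ok {1..n} \<phi> ?A R {Q\<in>?Z. P Q = R}"
    then show thesis by (rule that)
  qed
  obtain E where E: "disjoint_family_on E S" "\<And>Q. Q \<in> S \<Longrightarrow> E Q \<in> sets lebesgue" "\<And>Q. Q \<in> S \<Longrightarrow> E Q \<subseteq> Q"
    "\<And>Q. Q \<in> S \<Longrightarrow> 1 / 2 * measure lebesgue Q < measure lebesgue (E Q)"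
    using S(2) unfolding sparse_collection_def by blast
  let ?RR = "P ` ?Z"
  have RS: "?RR \<subseteq> S" using P(1) by blast
  have RR: "finite ?RR" "?RR \<subseteq> dyadic_grid \<omega>" using fin RS S(1) by auto
  have E': "disjoint_family_on E ?RR" "\<And>R. R \<in> ?RR \<Longrightarrow> E R \<in> sets lebesgue" "\<And>R. R \<in> ?RR \<Longrightarrow> E R \<subseteq> R"
      "\<And>R. R \<in> ?RR \<Longrightarrow> measure lebesgue R \<le> 2 * measure lebesgue (E R)"
  proof -
    show "disjoint_family_on E ?RR" by (rule disjoint_family_on_mono[OF RS E(1)])
    fix R assume "R \<in> ?RR"
    then have R: "R \<in> S" by (rule subsetD[OF RS])
    show "E R \<in> sets lebesgue" "E R \<subseteq> R" by (rule E(2)[OF R], rule E(3)[OF R])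
    show "measure lebesgue R \<le> 2 * measure lebesgue (E R)" using E(4)[OF R] by linarith
  qed
  let ?H = "\<lambda>R x. norm (\<Sum>Q\<in>{Q\<in>?Z. P Q = R}. haar (\<theta> Q) Q x *\<^sub>R ?y Q)"
  let ?F = "\<lambda>x. norm (paraproduct (dyadic_grid \<omega>) \<theta> n a f x)"
  let ?lam = "\<lambda>R. local_const n s r \<beta> powr (1 / s) * (B * (2 ^ CARD('d) * ?A) ^ n * (\<Prod>m=1..n. ave (\<phi> m) R))"
  have region: "0 \<le> ?lam R" "\<And>t. 0 < t \<Longrightarrow> t \<le> s \<Longrightarrow> (\<integral>\<^sup>+x. ennreal (?H R x powr t) \<partial>lebesgue) \<le> ennreal (2 * ?lam R powr t * measure lebesgue R)"
    "\<And>x. x \<notin> R \<Longrightarrow> ?H R x = 0" if R: "R \<in> ?RR" for R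
  proof -
    note reg = region_Lp[OF P(2)[OF R] order_refl n X f A T Y cond \<theta> r B BMO]
    show "0 \<le> ?lam R" by (rule reg(1))
    show "(\<integral>\<^sup>+x. ennreal (?H R x powr t) \<partial>lebesgue) \<le> ennreal (2 * ?lam R powr t * measure lebesgue R)" if "0 < t" "t \<le> s" for t
      by (rule reg(3); (assumption | rule that))
    show "?H R x = 0" if "x \<notin> R" for x by (rule reg(4); (assumption | rule that))
  qed
  have FH: "?F x \<le> (\<Sum>R\<in>?RR. ?H R x)" for x
  proof -
    have e: "paraproduct (dyadic_grid \<omega>) \<theta> n a f x = (\<Sum>R\<in>?RR. \<Sum>Q\<in>{Q\<in>?Z. P Q = R}. haar (\<theta> Q) Q x *\<^sub>R ?y Q)"
      unfolding paraproduct_def by (rule sum.image_gen[OF fin])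
    show ?thesis unfolding e by (rule norm_sum)
  qed
  have "(\<integral>\<^sup>+x. ennreal (?F x powr q) \<partial>lebesgue) \<le> ennreal (Lq_const s q * (\<Sum>R\<in>?RR. measure lebesgue R * ?lam R powr q))"
  proof (rule Lq_sum_bound[where H = ?H, OF RR E' _ FH _ _ _ _ _ _ q(1,2) s])
    show "integrable lebesgue (\<lambda>x. ?F x powr t)" for t
      unfolding paraproduct_def by (rule haar_sum_powr_integrable[OF fin Z])
    show "?H R \<in> borel_measurable lebesgue" for R
      by (rule haar_sum_measurable) blast
    show "?H R x = 0" if "R \<in> ?RR" "x \<notin> R" for R x by (rule region(3)[OF that])
    show "(\<integral>\<^sup>+x. ennreal (?H R x powr t) \<partial>lebesgue) \<le> ennreal (2 * ?lam R powr t * measure lebesgue R)"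
      if "R \<in> ?RR" "0 < t" "t \<le> s" for R t by (rule region(2)[OF that])
    show "0 \<le> ?lam R" if "R \<in> ?RR" for R by (rule region(1)[OF that])
  qed simp_all
  also have "\<dots> \<le> ennreal (Lq_const s q * (c powr q * (2 * (\<Sum>m\<in>M. carleson_const (p m)))) * (B * (\<Prod>m=1..n. N m)) powr q)"
  proof (rule ennreal_leI)
    have lamq: "?lam R powr q = (c powr q * B powr q) * (\<Prod>m=1..n. ave (\<phi> m) R) powr q" for R
      by (simp add: c_def powr_mult mult_ac)
    have "(\<Sum>R\<in>?RR. measure lebesgue R * ?lam R powr q) = (c powr q * B powr q) * (\<Sum>R\<in>?RR. measure lebesgue R * (\<Prod>m=1..n. ave (\<phi> m) R) powr q)"
      unfolding lamq sum_distrib_left by (rule sum.cong[OF refl]) (simp only: mult_ac)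
    also have "\<dots> \<le> (c powr q * B powr q) * (2 * (\<Sum>m\<in>M. carleson_const (p m)) * (\<Prod>m=1..n. N m) powr q)"
    proof (rule mult_left_mono)
      show "(\<Sum>R\<in>?RR. measure lebesgue R * (\<Prod>m=1..n. ave (\<phi> m) R) powr q) \<le> 2 * (\<Sum>m\<in>M. carleson_const (p m)) * (\<Prod>m=1..n. N m) powr q"
        by (rule sparse_hoelder[where p = p and M = M and I = "{1..n}", OF RR E' finite_atLeastAtMost M \<phi> N p _ q(1,3)])
          (use J RR(2) in \<open>auto simp only: subset_iff\<close>)
    qed simp
    finally have "Lq_const s q * (\<Sum>R\<in>?RR. measure lebesgue R * ?lam R powr q) \<le>
        Lq_const s q * ((c powr q * B powr q) * (2 * (\<Sum>m\<in>M. carleson_const (p m)) * (\<Prod>m=1..n. N m) powr q))"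
      by (rule mult_left_mono) (rule Lq_const_nonneg)
    also have "\<dots> = Lq_const s q * (c powr q * (2 * (\<Sum>m\<in>M. carleson_const (p m)))) * (B * (\<Prod>m=1..n. N m)) powr q"
      by (simp add: powr_mult mult_ac)
    finally show "Lq_const s q * (\<Sum>R\<in>?RR. measure lebesgue R * ?lam R powr q) \<le>
        Lq_const s q * (c powr q * (2 * (\<Sum>m\<in>M. carleson_const (p m)))) * (B * (\<Prod>m=1..n. N m)) powr q" .
  qed
  finally show ?thesis .
qed

end

section \<open>The bounds for the paraproduct\<close>

lemma Linfc_controlled:
  fixes f :: "real^'d \<Rightarrow> 'a::banach"
  assumes "subspace X" "closed X" "Linfc X f"
  shows "\<exists>\<phi> K. controlled X f \<phi> \<and> compact K \<and> (\<forall>x. x \<notin> K \<longrightarrow> \<phi> x = 0) \<and>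
    (AE x in lebesgue. norm (f x) = \<phi> x) \<and> (\<exists>B. \<forall>x. \<phi> x \<le> B)"
  using Linfc_integrals[OF assms] unfolding controlled_def by blast

lemma Linfc_controlled_family:
  fixes f :: "'i \<Rightarrow> real^'d \<Rightarrow> 'a::banach"
  assumes X: "\<And>m. m \<in> I \<Longrightarrow> subspace (X m) \<and> closed (X m)" and f: "\<And>m. m \<in> I \<Longrightarrow> Linfc (X m) (f m)"
  obtains \<phi> K where "\<And>m. m \<in> I \<Longrightarrow> controlled (X m) (f m) (\<phi> m) \<and> compact (K m) \<and> (\<forall>x. x \<notin> K m \<longrightarrow> \<phi> m x = 0) \<and>
    (AE x in lebesgue. norm (f m x) = \<phi> m x) \<and> (\<exists>B. \<forall>x. \<phi> m x \<le> B)"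
proof -
  let ?P = "\<lambda>m \<phi> K. controlled (X m) (f m) \<phi> \<and> compact K \<and> (\<forall>x. x \<notin> K \<longrightarrow> \<phi> x = 0) \<and>
    (AE x in lebesgue. norm (f m x) = \<phi> x) \<and> (\<exists>B. \<forall>x. \<phi> x \<le> B)"
  have "\<forall>m\<in>I. \<exists>\<phi> K. ?P m \<phi> K"
  proof
    fix m assume "m \<in> I"
    from Linfc_controlled[OF conjunct1[OF X[OF this]] conjunct2[OF X[OF this]] f[OF this]]
    show "\<exists>\<phi> K. ?P m \<phi> K" .
  qed
  from bchoice[OF this] obtain \<phi> where "\<forall>m\<in>I. \<exists>K. ?P m (\<phi> m) K" ..
  from bchoice[OF this] obtain K where K: "\<forall>m\<in>I. ?P m (\<phi> m) (K m)" ..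
  show thesis by (rule that) (rule bspec[OF K])
qed

lemma controlled_powr_integrable:
  assumes \<phi>: "controlled X f \<phi>" and K: "compact K" "\<forall>x. x \<notin> K \<longrightarrow> \<phi> x = 0" and B: "\<forall>x. \<phi> x \<le> B" and p: "0 < p"
  shows "(\<integral>\<^sup>+x. ennreal (\<phi> x powr p) \<partial>lebesgue) < \<infinity>"
proof -
  have 0: "0 \<le> \<phi> x" for x using \<phi> by (simp add: controlled_def)
  have Ks: "K \<in> sets lebesgue" "emeasure lebesgue K < \<infinity>"
    using lmeasurable_compact[OF K(1)] by (auto simp: fmeasurable_def)
  have "(\<integral>\<^sup>+x. ennreal (\<phi> x powr p) \<partial>lebesgue) \<le> (\<integral>\<^sup>+x. ennreal (B powr p) * indicator K x \<partial>lebesgue)"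
  proof (rule nn_integral_mono)
    fix x
    have "\<phi> x powr p \<le> B powr p" using 0 B p by (intro powr_mono2) auto
    then show "ennreal (\<phi> x powr p) \<le> ennreal (B powr p) * indicator K x"
      using K(2) by (cases "x \<in> K") (auto intro: ennreal_leI)
  qed
  also have "\<dots> = ennreal (B powr p) * emeasure lebesgue K" by (rule nn_integral_cmult_indicator[OF Ks(1)])
  also have "\<dots> < \<infinity>" using Ks(2) by (simp add: ennreal_mult_less_top)
  finally show ?thesis .
qed

context dyadic_system
begin

lemma norm_avg_eq:
  assumes \<phi>: "integrable lebesgue \<phi>" "\<And>x. 0 \<le> \<phi> x" and ae: "AE x in lebesgue. norm (f x) = \<phi> x"
    and Q: "Q \<in> dyadic_grid \<omega>"
  shows "norm_avg f Q = ennreal (ave \<phi> Q)"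
proof -
  obtain k x where kx: "Q = cube_at \<omega> k x" using Q by (rule grid_cases)
  have "(\<integral>\<^sup>+x. ennreal (norm (f x)) * indicator Q x \<partial>lebesgue) = (\<integral>\<^sup>+x. ennreal (\<phi> x) * indicator Q x \<partial>lebesgue)"
    by (rule nn_integral_cong_AE) (use ae in eventually_elim, simp)
  also have "\<dots> = ennreal (mass \<phi> Q)" by (rule nn_mass[OF \<phi> grid_lebesgue[OF Q]])
  finally show ?thesis
    unfolding norm_avg_def ave_def kx emeasure_cube_at measure_cube_at
    using mass_nonneg[of \<phi>, OF \<phi>(2)] by (simp add: divide_ennreal)
qed

lemma ave_le_of_AE:
  assumes \<phi>: "integrable lebesgue \<phi>" and ae: "AE x in lebesgue. \<phi> x \<le> N" and Q: "Q \<in> dyadic_grid \<omega>"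
  shows "ave \<phi> Q \<le> N"
proof -
  obtain k x where kx: "Q = cube_at \<omega> k x" using Q by (rule grid_cases)
  have "mass \<phi> Q \<le> (LINT x|lebesgue. indicator Q x *\<^sub>R N)"
    unfolding mass_def set_lebesgue_integral_def
  proof (rule integral_mono_AE)
    show "integrable lebesgue (\<lambda>x. indicator Q x *\<^sub>R \<phi> x)"
      by (rule integrable_mult_indicator[OF grid_lebesgue[OF Q] \<phi>])
    show "integrable lebesgue (\<lambda>x. indicator Q x *\<^sub>R N)" by (simp add: kx emeasure_cube_at)
    show "AE x in lebesgue. indicator Q x *\<^sub>R \<phi> x \<le> indicator Q x *\<^sub>R N"
      using ae by eventually_elim (simp add: indicator_def)
  qed
  also have "\<dots> = N * cube_vol TYPE('d) k" by (simp add: kx measure_cube_at)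
  finally show ?thesis unfolding ave_def kx measure_cube_at by (simp add: pos_divide_le_eq)
qed

end

text \<open>The choice by \<open>SOME\<close> makes the constants depend on the spaces and the
  exponent alone. Index 0 stands for Y, as in \<open>multilinear_stein\<close>.\<close>

definition umd_const :: "real \<Rightarrow> (nat \<Rightarrow> ('x::banach, 'y::banach) multop set) \<Rightarrow> nat \<Rightarrow> real" where
  "umd_const s T k = (if k = 0 then SOME \<beta>. UMD_bound (UNIV :: 'y set) s \<beta> else SOME \<beta>. UMD_bound (T k) s \<beta>)"

lemma umd_const_bound:
  fixes T :: "nat \<Rightarrow> ('x::banach, 'y::banach) multop set"
  assumes s: "1 < s" and Y: "UMD_space (UNIV :: 'y set)" and cond: "UMD_subspace_condition D n X T a"
  shows "UMD_bound (UNIV :: 'y set) s (umd_const s T 0)"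
    and "k \<in> {1..<n} \<Longrightarrow> UMD_bound (T k) s (umd_const s T k)"
proof -
  show "UMD_bound (UNIV :: 'y set) s (umd_const s T 0)"
    using someI_ex[OF UMD_space_imp_bound[OF Y s]] by (simp add: umd_const_def)
  show "UMD_bound (T k) s (umd_const s T k)" if k: "k \<in> {1..<n}"
  proof -
    have "k \<in> {1..n}" "k \<noteq> 0" using k by auto
    then have "UMD_space (T k)" using cond unfolding UMD_subspace_condition_def by blast
    from someI_ex[OF UMD_space_imp_bound[OF this s]] show ?thesis using \<open>k \<noteq> 0\<close> by (simp add: umd_const_def)
  qed
qed

text \<open>\<open>(real n + 2) / (1 - \<eta>)\<close> is the stopping threshold: with n + 1
  functions the stopping children cover at most the fraction (n + 1) / (n + 2) of 1 -
  \<eta>.\<close>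

definition sparse_const :: "nat \<Rightarrow> nat \<Rightarrow> real \<Rightarrow> (nat \<Rightarrow> ('x::banach, 'y::banach) multop set) \<Rightarrow> real \<Rightarrow> real" where
  "sparse_const d n \<eta> T r =
    2 * (2 ^ d * ((real n + 2) / (1 - \<eta>))) ^ (n + 1) * local_const n 2 r (umd_const 2 T) powr (1 / 2) + 2"

text \<open>The collection is fixed before T, a, \<theta> and r appear: its construction uses the
  grid, the functions and \<eta>.\<close>

lemma (in dyadic_system) sparse_form_bound:
  fixes f :: "nat \<Rightarrow> real^'d \<Rightarrow> 'x::banach" and g :: "real^'d \<Rightarrow> ('y::banach \<Rightarrow>\<^sub>L real)"
  assumes n: "1 \<le> n" and X: "\<And>m. m \<in> {1..n} \<Longrightarrow> subspace (X m) \<and> closed (X m)"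
    and Y: "UMD_space (UNIV :: 'y set)" and \<eta>: "0 < \<eta>" "\<eta> < 1"
    and f: "\<And>m. m \<in> {1..n} \<Longrightarrow> Linfc (X m) (f m)" and g: "Linfc UNIV g"
  shows "\<exists>S \<subseteq> dyadic_grid \<omega>. sparse_collection \<eta> S \<and>
    (\<forall>(T :: nat \<Rightarrow> ('x, 'y) multop set) a \<theta> r.
      UMD_subspace_condition (dyadic_grid \<omega>) n X T a \<and>
      finite {Q \<in> dyadic_grid \<omega>. a Q \<noteq> 0} \<and>
      (\<forall>Q\<in>dyadic_grid \<omega>. cancellative (\<theta> Q)) \<and> 0 < r \<longrightarrow>
      ennreal \<bar>\<integral>x. blinfun_apply (g x) (paraproduct (dyadic_grid \<omega>) \<theta> n a f x) \<partial>lebesgue\<bar>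
        \<le> ennreal (sparse_const CARD('d) n \<eta> T r) * BMO_norm (dyadic_grid \<omega>) r a *
          (\<Sum>\<^sub>\<infinity>Q\<in>S. emeasure lebesgue Q * (\<Prod>m=1..n. norm_avg (f m) Q) * norm_avg g Q))"
proof -
  obtain \<phi>f Kf where F: "\<And>m. m \<in> {1..n} \<Longrightarrow> controlled (X m) (f m) (\<phi>f m) \<and> compact (Kf m) \<and> (\<forall>x. x \<notin> Kf m \<longrightarrow> \<phi>f m x = 0) \<and>
    (AE x in lebesgue. norm (f m x) = \<phi>f m x) \<and> (\<exists>B. \<forall>x. \<phi>f m x \<le> B)"
    by (rule Linfc_controlled_family[where I = "{1..n}" and X = X and f = f, OF X f]; (assumption | blast))
  obtain \<phi>g Kg where G: "controlled UNIV g \<phi>g" "compact Kg" "\<forall>x. x \<notin> Kg \<longrightarrow> \<phi>g x = 0" "AE x in lebesgue. norm (g x) = \<phi>g x"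
    using Linfc_controlled[OF subspace_UNIV closed_UNIV g] by blast
  \<comment> \<open>The dual function takes index 0, so that one stopping construction treats all n
    + 1 functions.\<close>
  define \<phi> where "\<phi> i = (if i = 0 then \<phi>g else \<phi>f i)" for i :: nat
  define K where "K = Kg \<union> (\<Union>m\<in>{1..n}. Kf m)"
  have K: "compact K" unfolding K_def using F G(2) by (intro compact_Un compact_UN) auto
  have \<phi>f: "controlled (X m) (f m) (\<phi> m)" "AE x in lebesgue. norm (f m x) = \<phi> m x" if "m \<in> {1..n}" for m
    using F[OF that] that by (auto simp: \<phi>_def)
  have \<phi>: "integrable lebesgue (\<phi> i)" "\<And>x. 0 \<le> \<phi> i x" if "i \<le> n" for i
    using that \<phi>f(1)[of i] G(1) by (cases "i = 0"; simp add: controlled_def \<phi>_def)+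
  have \<phi>K: "\<phi> i x = 0" if "i \<le> n" "x \<notin> K" for i x
  proof (cases "i = 0")
    case True
    then show ?thesis using G(3) that(2) by (simp add: \<phi>_def K_def)
  next
    case False
    then have i: "i \<in> {1..n}" using that(1) by simp
    then have "x \<notin> Kf i" using that(2) unfolding K_def by blast
    then show ?thesis using F[OF i] False by (simp add: \<phi>_def)
  qed
  obtain k0 where k0: "\<And>k x y. k \<le> k0 \<Longrightarrow> x \<in> K \<Longrightarrow> y \<in> K \<Longrightarrow> y \<in> cube_at \<omega> k x \<Longrightarrow> y \<in> cube_at \<omega> k0 x"
    by (rule coarse_level[OF K]) blast
  let ?A = "(real n + 2) / (1 - \<eta>)"
  have A: "1 \<le> ?A" using \<eta> by (simp add: field_simps)
  have key: "real (card {0..n}) / ?A < 1 - \<eta>" using \<eta> by (simp add: field_simps)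
  have \<phi>I: "integrable lebesgue (\<phi> i)" "\<And>x. 0 \<le> \<phi> i x" if "i \<in> {0..n}" for i using \<phi> that by auto
  obtain S where S: "S \<subseteq> dyadic_grid \<omega>" "sparse_collection \<eta> S" "\<And>x. cube_at \<omega> k0 x \<in> S"
    and par: "\<And>k x. k0 \<le> k \<Longrightarrow> \<exists>R\<in>S. cube_at \<omega> k x \<subseteq> R \<and>
      (\<forall>Q\<in>dyadic_grid \<omega>. cube_at \<omega> k x \<subseteq> Q \<and> Q \<subseteq> R \<longrightarrow> (\<forall>i\<in>{0..n}. ave (\<phi> i) Q \<le> ?A * ave (\<phi> i) R))"
  proof (rule sparse_stopping[OF finite_atLeastAtMost A key \<phi>I, where ?k0.0 = k0])
    fix S
    assume "S \<subseteq> dyadic_grid \<omega>" "sparse_collection \<eta> S" "\<And>x. cube_at \<omega> k0 x \<in> S"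
      "\<And>k x. k0 \<le> k \<Longrightarrow> \<exists>R\<in>S. cube_at \<omega> k x \<subseteq> R \<and>
        (\<forall>Q\<in>dyadic_grid \<omega>. cube_at \<omega> k x \<subseteq> Q \<and> Q \<subseteq> R \<longrightarrow> (\<forall>i\<in>{0..n}. ave (\<phi> i) Q \<le> ?A * ave (\<phi> i) R))"
    then show thesis by (rule that)
  qed
  have terms: "(\<Sum>\<^sub>\<infinity>Q\<in>S. emeasure lebesgue Q * (\<Prod>m=1..n. norm_avg (f m) Q) * norm_avg g Q) = (\<Sum>\<^sub>\<infinity>Q\<in>S. ennreal (form_term n \<phi> Q))"
  proof (rule infsum_cong)
    fix Q assume "Q \<in> S"
    then have Q: "Q \<in> dyadic_grid \<omega>" using S(1) by blast
    obtain k x where kx: "Q = cube_at \<omega> k x" using Q by (rule grid_cases)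
    have em: "emeasure lebesgue Q = ennreal (measure lebesgue Q)" by (simp add: kx emeasure_cube_at measure_cube_at)
    have av: "0 \<le> ave (\<phi> i) Q" if "i \<le> n" for i by (rule ave_nonneg[OF \<phi>(2)[OF that]])
    have P0: "0 \<le> (\<Prod>m=1..n. ave (\<phi> m) Q)" by (intro prod_nonneg) (use av in auto)
    have gQ: "norm_avg g Q = ennreal (ave (\<phi> 0) Q)"
      by (rule norm_avg_eq[OF \<phi>[OF le0] _ Q]) (use G(4) in \<open>simp add: \<phi>_def\<close>)
    have "(\<Prod>m=1..n. norm_avg (f m) Q) = (\<Prod>m=1..n. ennreal (ave (\<phi> m) Q))"
      by (rule prod.cong[OF refl], rule norm_avg_eq[OF \<phi> _ Q]) (use \<phi>f(2) in auto)
    also have "\<dots> = ennreal (\<Prod>m=1..n. ave (\<phi> m) Q)" by (rule prod_ennreal) (use av in auto)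
    finally show "emeasure lebesgue Q * (\<Prod>m=1..n. norm_avg (f m) Q) * norm_avg g Q = ennreal (form_term n \<phi> Q)"
      unfolding em gQ form_term_def ennreal_mult[OF mult_nonneg_nonneg[OF measure_nonneg P0] av[OF le0]] ennreal_mult[OF measure_nonneg P0]
      by (simp only:)
  qed
  show ?thesis
  proof (intro exI conjI allI impI)
    show "S \<subseteq> dyadic_grid \<omega>" "sparse_collection \<eta> S" by (rule S)+
    fix T :: "nat \<Rightarrow> ('x, 'y) multop set" and a :: "(real^'d) set \<Rightarrow> ('x, 'y) multop" and \<theta> :: "(real^'d) set \<Rightarrow> 'd \<Rightarrow> bool" and r :: real
    assume "UMD_subspace_condition (dyadic_grid \<omega>) n X T a \<and>
      finite {Q \<in> dyadic_grid \<omega>. a Q \<noteq> 0} \<and>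
      (\<forall>Q\<in>dyadic_grid \<omega>. cancellative (\<theta> Q)) \<and> 0 < r"
    then have cond: "UMD_subspace_condition (dyadic_grid \<omega>) n X T a" and fin: "finite {Q \<in> dyadic_grid \<omega>. a Q \<noteq> 0}"
      and \<theta>: "\<And>Q. Q \<in> dyadic_grid \<omega> \<Longrightarrow> cancellative (\<theta> Q)" and r: "0 < r" by auto
    define B where "B = enn2real (BMO_norm (dyadic_grid \<omega>) r a)"
    have BMO: "BMO_norm (dyadic_grid \<omega>) r a = ennreal B" and B: "0 \<le> B"
      using BMO_norm_finite[OF fin r] by (simp_all add: B_def)
    let ?\<pi> = "paraproduct (dyadic_grid \<omega>) \<theta> n a f"
    let ?h = "\<lambda>x. blinfun_apply (g x) (?\<pi> x)"
    have two: "(1::real) < 2" by simp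
    have dom: "(\<integral>\<^sup>+x. ennreal (\<phi> 0 x) * ennreal (norm (?\<pi> x)) \<partial>lebesgue) \<le>
        ennreal (sparse_const CARD('d) n \<eta> T r * B) * (\<Sum>\<^sub>\<infinity>Q\<in>S. ennreal (form_term n \<phi> Q))"
      unfolding sparse_const_def
      by (rule sparse_domination[where X = X, OF n _ \<phi>f(1) \<phi>[OF le0] \<phi>K k0 A S(1,3) par umd_const_bound(2)[OF two Y cond] umd_const_bound(1)[OF two Y cond] cond fin \<theta> r B])
        (use X BMO in auto)
    have "ennreal \<bar>\<integral>x. ?h x \<partial>lebesgue\<bar> \<le> (\<integral>\<^sup>+x. ennreal (norm (?h x)) \<partial>lebesgue)"
    \<comment> \<open>If the pairing is not integrable, its integral is 0 by convention.\<close>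
    proof (cases "integrable lebesgue ?h")
      case True
      from integral_norm_bound_ennreal[OF this] show ?thesis by simp
    qed (simp add: not_integrable_integral_eq)
    also have "\<dots> \<le> (\<integral>\<^sup>+x. ennreal (\<phi> 0 x) * ennreal (norm (?\<pi> x)) \<partial>lebesgue)"
    proof (rule nn_integral_mono_AE)
      show "AE x in lebesgue. ennreal (norm (?h x)) \<le> ennreal (\<phi> 0 x) * ennreal (norm (?\<pi> x))"
        using G(4)
      proof eventually_elim
        fix x assume x: "norm (g x) = \<phi>g x"
        have "norm (?h x) \<le> norm (g x) * norm (?\<pi> x)" by (rule norm_blinfun)
        then have "norm (?h x) \<le> \<phi> 0 x * norm (?\<pi> x)" using x by (simp add: \<phi>_def)
        then have "ennreal (norm (?h x)) \<le> ennreal (\<phi> 0 x * norm (?\<pi> x))" by (rule ennreal_leI)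
        then show "ennreal (norm (?h x)) \<le> ennreal (\<phi> 0 x) * ennreal (norm (?\<pi> x))"
          using \<phi>(2)[OF le0] by (simp add: ennreal_mult)
      qed
    qed
    also note dom
    also have "ennreal (sparse_const CARD('d) n \<eta> T r * B) = ennreal (sparse_const CARD('d) n \<eta> T r) * ennreal B"
      by (rule ennreal_mult[OF _ B]) (use \<eta> in \<open>simp add: sparse_const_def\<close>)
    finally show "ennreal \<bar>\<integral>x. ?h x \<partial>lebesgue\<bar>
        \<le> ennreal (sparse_const CARD('d) n \<eta> T r) * BMO_norm (dyadic_grid \<omega>) r a *
          (\<Sum>\<^sub>\<infinity>Q\<in>S. emeasure lebesgue Q * (\<Prod>m=1..n. norm_avg (f m) Q) * norm_avg g Q)"
      unfolding BMO terms .
  qed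
qed

text \<open>The exponent s = \<open>max q 1 + 1\<close> is above 1, as UMD requires, and above q, as
  the summation of the pieces requires.\<close>

definition Lq_bound_const ::
    "nat \<Rightarrow> nat \<Rightarrow> (nat \<Rightarrow> ('x::banach, 'y::banach) multop set) \<Rightarrow> real \<Rightarrow> (nat \<Rightarrow> ennreal) \<Rightarrow> real \<Rightarrow> real" where
  "Lq_bound_const d n T r p q = (let s = max q 1 + 1 in
    Lq_const s q * ((local_const n s r (umd_const s T) powr (1 / s) * (2 ^ d * (2 * (real n + 1))) ^ n) powr q *
      (2 * (\<Sum>m\<in>{m\<in>{1..n}. p m \<noteq> \<infinity>}. carleson_const (enn2real (p m)))))) powr (1 / q)"

lemma (in dyadic_system) paraproduct_Lp_bound:
  fixes f :: "nat \<Rightarrow> real^'d \<Rightarrow> 'x::banach" and T :: "nat \<Rightarrow> ('x, 'y::banach) multop set"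
  assumes n: "1 \<le> n" and X: "\<And>m. m \<in> {1..n} \<Longrightarrow> subspace (X m) \<and> closed (X m)"
    and Y: "UMD_space (UNIV :: 'y set)" and f: "\<And>m. m \<in> {1..n} \<Longrightarrow> Linfc (X m) (f m)"
    and cond: "UMD_subspace_condition (dyadic_grid \<omega>) n X T a" and fin: "finite {Q \<in> dyadic_grid \<omega>. a Q \<noteq> 0}"
    and \<theta>: "\<And>Q. Q \<in> dyadic_grid \<omega> \<Longrightarrow> cancellative (\<theta> Q)" and r: "0 < r"
    and p: "\<And>m. m \<in> {1..n} \<Longrightarrow> 1 < p m" and q: "0 < q" "(\<Sum>m=1..n. inverse (p m)) = inverse (ennreal q)"
  shows "Lp_norm lebesgue (ennreal q) (paraproduct (dyadic_grid \<omega>) \<theta> n a f)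
      \<le> ennreal (Lq_bound_const CARD('d) n T r p q) * BMO_norm (dyadic_grid \<omega>) r a * (\<Prod>m=1..n. Lp_norm lebesgue (p m) (f m))"
proof -
  \<comment> \<open>The indices with finite exponent; the other functions enter through their
    essential suprema.\<close>
  define M where "M = {m\<in>{1..n}. p m \<noteq> \<infinity>}"
  define P where "P m = enn2real (p m)" for m
  define s where "s = max q 1 + 1"
  have s: "1 < s" "q < s" using q by (auto simp: s_def)
  have M: "M \<subseteq> {1..n}" "finite M" by (auto simp: M_def)
  have pP: "p m = ennreal (P m)" "1 < P m" if "m \<in> M" for m
  proof -
    have fin: "p m \<noteq> top" and m: "m \<in> {1..n}" using that by (auto simp: M_def)
    show e: "p m = ennreal (P m)" using fin by (simp add: P_def less_top)
    have "ennreal 1 < ennreal (P m)" using p[OF m] e by simp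
    then show "1 < P m" by (simp add: ennreal_less_iff)
  qed
  have inv: "(\<Sum>m\<in>M. inverse (P m)) = inverse q"
  proof -
    have "(\<Sum>m=1..n. inverse (p m)) = (\<Sum>m\<in>M. inverse (p m))"
      by (rule sum.mono_neutral_right) (auto simp: M_def)
    also have "\<dots> = (\<Sum>m\<in>M. ennreal (inverse (P m)))"
    proof (rule sum.cong[OF refl])
      fix m assume m: "m \<in> M"
      show "inverse (p m) = ennreal (inverse (P m))"
        unfolding pP(1)[OF m] by (rule inverse_ennreal) (use pP(2)[OF m] in simp)
    qed
    also have "\<dots> = ennreal (\<Sum>m\<in>M. inverse (P m))"
      by (rule sum_ennreal) (use pP(2) in \<open>force intro: less_imp_le\<close>)
    finally have "ennreal (\<Sum>m\<in>M. inverse (P m)) = ennreal (inverse q)"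
      using q by (simp add: inverse_ennreal)
    then show ?thesis
      by (subst (asm) ennreal_inj) (use pP(2) q(1) in \<open>force intro!: sum_nonneg intro: less_imp_le\<close>)+
  qed
  \<comment> \<open>1 / q is positive, so not all exponents are infinite.\<close>
  have M0: "M \<noteq> {}" using inv q(1) by auto
  have qP: "(\<Sum>m\<in>M. q / P m) = 1"
    using inv q(1) by (simp add: divide_inverse sum_distrib_left[symmetric])
  obtain \<phi> K where F: "\<And>m. m \<in> {1..n} \<Longrightarrow> controlled (X m) (f m) (\<phi> m) \<and> compact (K m) \<and> (\<forall>x. x \<notin> K m \<longrightarrow> \<phi> m x = 0) \<and>
    (AE x in lebesgue. norm (f m x) = \<phi> m x) \<and> (\<exists>B. \<forall>x. \<phi> m x \<le> B)"
    by (rule Linfc_controlled_family[where I = "{1..n}" and X = X and f = f, OF X f]; (assumption | blast))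
  have fc: "controlled (X m) (f m) (\<phi> m)" "AE x in lebesgue. norm (f m x) = \<phi> m x" if "m \<in> {1..n}" for m
    using F[OF that] by blast+
  have \<phi>: "integrable lebesgue (\<phi> m)" "\<And>x. 0 \<le> \<phi> m x" if "m \<in> {1..n}" for m
    using fc(1)[OF that] by (auto simp: controlled_def)
  define N where "N m = enn2real (Lp_norm lebesgue (p m) (f m))" for m
  have N0: "0 \<le> N m" for m by (simp add: N_def)
  have NM: "Lp_norm lebesgue (p m) (f m) = ennreal (N m)" "(\<integral>\<^sup>+x. ennreal (\<phi> m x powr P m) \<partial>lebesgue) = ennreal (N m powr P m)"
    if m: "m \<in> M" for m
  proof -
    have mn: "m \<in> {1..n}" using m M by blast
    have P0: "0 < P m" using pP(2)[OF m] by simp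
    obtain B where B: "\<forall>x. \<phi> m x \<le> B" using F[OF mn] by blast
    define I where "I = enn2real (\<integral>\<^sup>+x. ennreal (\<phi> m x powr P m) \<partial>lebesgue)"
    have I: "(\<integral>\<^sup>+x. ennreal (\<phi> m x powr P m) \<partial>lebesgue) = ennreal I"
      using controlled_powr_integrable[of "X m" "f m" "\<phi> m" "K m" B "P m"] F[OF mn] B P0 by (simp add: I_def)
    have I0: "0 \<le> I" by (simp add: I_def)
    have "(\<integral>\<^sup>+x. ennreal (norm (f m x) powr P m) \<partial>lebesgue) = (\<integral>\<^sup>+x. ennreal (\<phi> m x powr P m) \<partial>lebesgue)"
      by (rule nn_integral_cong_AE) (use fc(2)[OF mn] in eventually_elim, simp)
    then have "Lp_norm lebesgue (p m) (f m) = ennreal (I powr (1 / P m))"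
      using I I0 P0 unfolding Lp_norm_def pP(1)[OF m] by (simp add: ennreal_pow_def less_imp_le)
    moreover from this have NI: "N m = I powr (1 / P m)" by (simp add: N_def)
    ultimately show "Lp_norm lebesgue (p m) (f m) = ennreal (N m)" by simp
    show "(\<integral>\<^sup>+x. ennreal (\<phi> m x powr P m) \<partial>lebesgue) = ennreal (N m powr P m)"
      unfolding I NI using P0 I0 by (simp add: powr_powr)
  qed
  have NJ: "Lp_norm lebesgue (p m) (f m) = ennreal (N m)" "AE x in lebesgue. \<phi> m x \<le> N m"
    if m: "m \<in> {1..n} - M" for m
  proof -
    have mn: "m \<in> {1..n}" and pm: "p m = \<infinity>" using m by (auto simp: M_def)
    obtain B where B: "\<forall>x. \<phi> m x \<le> B" using F[OF mn] by blast
    have ae: "AE x in lebesgue. \<phi> m x = norm (f m x)" using fc(2)[OF mn] by eventually_elim simp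
    have "(\<lambda>x. norm (f m x)) \<in> borel_measurable lebesgue"
      by (rule borel_measurable_AE[OF borel_measurable_integrable[OF \<phi>(1)[OF mn]] ae])
    then have fm: "(\<lambda>x. ennreal (norm (f m x))) \<in> borel_measurable lebesgue" by simp
    have L: "Lp_norm lebesgue (p m) (f m) = esssup lebesgue (\<lambda>x. ennreal (norm (f m x)))"
      by (simp add: Lp_norm_def pm)
    have "esssup lebesgue (\<lambda>x. ennreal (norm (f m x))) \<le> ennreal B"
    proof (rule esssup_I[OF fm])
      show "AE x in lebesgue. ennreal (norm (f m x)) \<le> ennreal B"
        using ae by eventually_elim (metis B ennreal_leI)
    qed
    also have "\<dots> < top" by simp
    finally show e: "Lp_norm lebesgue (p m) (f m) = ennreal (N m)" unfolding N_def L by simp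
    show "AE x in lebesgue. \<phi> m x \<le> N m"
      using esssup_AE[where M = lebesgue and f = "\<lambda>x. ennreal (norm (f m x))"] ae
    proof eventually_elim
      fix x assume "ennreal (norm (f m x)) \<le> esssup lebesgue (\<lambda>x. ennreal (norm (f m x)))" "\<phi> m x = norm (f m x)"
      then have "ennreal (\<phi> m x) \<le> ennreal (N m)" using e L by simp
      then show "\<phi> m x \<le> N m" using N0 by (simp add: ennreal_le_iff)
    qed
  qed
  have Lpf: "(\<Prod>m=1..n. Lp_norm lebesgue (p m) (f m)) = ennreal (\<Prod>m=1..n. N m)"
  proof -
    have "(\<Prod>m=1..n. Lp_norm lebesgue (p m) (f m)) = (\<Prod>m=1..n. ennreal (N m))"
      by (rule prod.cong[OF refl]) (use NM(1) NJ(1) in blast)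
    then show ?thesis by (simp add: prod_ennreal N0)
  qed
  define B where "B = enn2real (BMO_norm (dyadic_grid \<omega>) r a)"
  have BMO: "BMO_norm (dyadic_grid \<omega>) r a = ennreal B" and B: "0 \<le> B"
    using BMO_norm_finite[OF fin r] by (simp_all add: B_def)
  let ?\<pi> = "paraproduct (dyadic_grid \<omega>) \<theta> n a f"
  define D where "D = Lq_const s q * ((local_const n s r (umd_const s T) powr (1 / s) * (2 ^ CARD('d) * (2 * (real n + 1))) ^ n) powr q *
      (2 * (\<Sum>m\<in>M. carleson_const (P m))))"
  have D0: "0 \<le> D"
    unfolding D_def using carleson_const_pos[OF pP(2)]
    by (intro mult_nonneg_nonneg Lq_const_nonneg sum_nonneg) (auto intro: less_imp_le)
  have C: "Lq_bound_const CARD('d) n T r p q = D powr (1 / q)"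
    by (simp add: Lq_bound_const_def D_def s_def M_def P_def Let_def)
  have PN: "0 \<le> (\<Prod>m=1..n. N m)" by (intro prod_nonneg) (simp add: N0)
  have main: "(\<integral>\<^sup>+x. ennreal (norm (?\<pi> x) powr q) \<partial>lebesgue) \<le> ennreal (D * (B * (\<Prod>m=1..n. N m)) powr q)"
    unfolding D_def
    by (rule paraproduct_Lq[where X = X and M = M and \<phi> = \<phi>, OF n _ fc(1) umd_const_bound(2)[OF s(1) Y cond] umd_const_bound(1)[OF s(1) Y cond] cond fin \<theta> r B _ M(1) M0 N0 pP(2) NM(2) _ q(1) s(2) qP])
      (use X BMO ave_le_of_AE[OF \<phi>(1) NJ(2)] in auto)
  obtain I where I: "(\<integral>\<^sup>+x. ennreal (norm (?\<pi> x) powr q) \<partial>lebesgue) = ennreal I" "0 \<le> I" "I \<le> D * (B * (\<Prod>m=1..n. N m)) powr q"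
  proof (cases "\<integral>\<^sup>+x. ennreal (norm (?\<pi> x) powr q) \<partial>lebesgue")
    case (real I)
    have "I \<le> D * (B * (\<Prod>m=1..n. N m)) powr q"
      using main D0 unfolding real(2) by (subst (asm) ennreal_le_iff) auto
    then show thesis by (rule that[OF real(2,1)])
  qed (use main in \<open>simp add: top_unique\<close>)
  have "I powr (1 / q) \<le> (D * (B * (\<Prod>m=1..n. N m)) powr q) powr (1 / q)"
    using I q by (intro powr_mono2) auto
  also have "\<dots> = D powr (1 / q) * (B * (\<Prod>m=1..n. N m))"
    unfolding powr_mult[of D] powr_powr using q B PN by simp
  finally have le: "I powr (1 / q) \<le> D powr (1 / q) * (B * (\<Prod>m=1..n. N m))" .
  have "Lp_norm lebesgue (ennreal q) ?\<pi> = ennreal (I powr (1 / q))"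
    using I q unfolding Lp_norm_def by (simp add: ennreal_pow_def less_imp_le)
  also have "\<dots> \<le> ennreal (D powr (1 / q) * (B * (\<Prod>m=1..n. N m)))" by (rule ennreal_leI[OF le])
  also have "\<dots> = ennreal (D powr (1 / q)) * ennreal B * ennreal (\<Prod>m=1..n. N m)"
    using B PN by (simp add: ennreal_mult mult.assoc)
  finally show ?thesis unfolding C BMO Lpf .
qed

theorem theorem5p3:
  fixes n :: nat and X :: "nat \<Rightarrow> 'x::banach set"
  assumes "n \<ge> 2"
    and "\<forall>m\<in>{1..n}. subspace (X m) \<and> closed (X m)"
    and "UMD_space (UNIV :: 'y::banach set)"
  shows "(\<exists>C :: real \<Rightarrow> (nat \<Rightarrow> ('x, 'y) multop set) \<Rightarrow> real \<Rightarrow> real.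
      \<forall>(\<omega> :: int \<Rightarrow> real^'d) \<in> dyadic_shifts. \<forall>\<eta>\<in>{0<..<1}.
      \<forall>(f :: nat \<Rightarrow> real^'d \<Rightarrow> 'x) (g :: real^'d \<Rightarrow> ('y \<Rightarrow>\<^sub>L real)).
        (\<forall>m\<in>{1..n}. Linfc (X m) (f m)) \<and> Linfc UNIV g \<longrightarrow>
        (\<exists>S \<subseteq> dyadic_grid \<omega>. sparse_collection \<eta> S \<and>
          (\<forall>T a \<theta> r.
            UMD_subspace_condition (dyadic_grid \<omega>) n X T a \<and>
            finite {Q \<in> dyadic_grid \<omega>. a Q \<noteq> 0} \<and>
            (\<forall>Q\<in>dyadic_grid \<omega>. cancellative (\<theta> Q)) \<and> 0 < r \<longrightarrow>
            ennreal \<bar>\<integral>x. blinfun_apply (g x) (paraproduct (dyadic_grid \<omega>) \<theta> n a f x) \<partial>lebesgue\<bar>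
              \<le> ennreal (C \<eta> T r) * BMO_norm (dyadic_grid \<omega>) r a *
                (\<Sum>\<^sub>\<infinity>Q\<in>S. emeasure lebesgue Q * (\<Prod>m=1..n. norm_avg (f m) Q) * norm_avg g Q))))
    \<and>
    (\<exists>C :: (nat \<Rightarrow> ('x, 'y) multop set) \<Rightarrow> real \<Rightarrow> (nat \<Rightarrow> ennreal) \<Rightarrow> real \<Rightarrow> real.
      \<forall>(\<omega> :: int \<Rightarrow> real^'d) \<in> dyadic_shifts.
      \<forall>(f :: nat \<Rightarrow> real^'d \<Rightarrow> 'x) T a \<theta> r p q.
        (\<forall>m\<in>{1..n}. Linfc (X m) (f m)) \<and>
        UMD_subspace_condition (dyadic_grid \<omega>) n X T a \<and>
        finite {Q \<in> dyadic_grid \<omega>. a Q \<noteq> 0} \<and>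
        (\<forall>Q\<in>dyadic_grid \<omega>. cancellative (\<theta> Q)) \<and> 0 < r \<and>
        (\<forall>m\<in>{1..n}. 1 < p m) \<and> 1 / real n < q \<and>
        (\<Sum>m=1..n. inverse (p m)) = inverse (ennreal q) \<longrightarrow>
        Lp_norm lebesgue (ennreal q) (paraproduct (dyadic_grid \<omega>) \<theta> n a f)
          \<le> ennreal (C T r p q) * BMO_norm (dyadic_grid \<omega>) r a *
            (\<Prod>m=1..n. Lp_norm lebesgue (p m) (f m)))"
proof (rule conjI, goal_cases)
  have n: "1 \<le> n" using assms(1) by simp
  have X: "subspace (X m) \<and> closed (X m)" if "m \<in> {1..n}" for m using assms(2) that by (rule bspec)
  {
    case 1
    show ?case
    \<comment> \<open>As a function of \<eta>, T and r the constant is named before the grid, the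
      functions and the coefficients.\<close>
    proof (rule exI[of _ "sparse_const CARD('d) n"], intro ballI allI impI, goal_cases)
      case (1 \<omega> \<eta> f g)
      then interpret dyadic_system \<omega> by unfold_locales
      show ?case by (rule sparse_form_bound[OF n _ assms(3)]) (use 1 X in auto)
    qed
  next
    case 2
    show ?case
    proof (rule exI[of _ "Lq_bound_const CARD('d) n"], intro ballI allI impI, elim conjE, goal_cases)
      case (1 \<omega> f T a \<theta> r p q)
      then interpret dyadic_system \<omega> by unfold_locales
      have "0 < q" by (rule le_less_trans[OF _ \<open>1 / real n < q\<close>]) simp
      then show ?case by (intro paraproduct_Lp_bound[OF n _ assms(3)]) (use 1 X in auto)
    qed
  }
qed

end
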